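(* Let $q>q_0$, let $h\in\mathbb R$, $h\ne0$, be a constant, and let $v\in W^{2,1}_{q,loc}(\mathbb R^N\times(0,\infty))$ be a strong (a.e.) solution of $$-\partial_t v-\Delta v+h|Dv|^\gamma=0\qquad\text{on }\mathbb R^N\times(0,\infty).$$ Suppose that for some $0<\alpha<1$, $$\sup_{(x,t)\ne(x',t')\in\mathbb R^N\times(0,\infty)}\frac{|v(x,t)-v(x',t')|}{|x-x'|^\alpha+|t-t'|^{\alpha/2}}<\infty.$$ Then $v$ is constant on $\mathbb R^N\times(0,\infty)$.
   Context: $N\ge1$, $\gamma>2$, $q_0=(N+2)\frac{\gamma-1}{\gamma}$. $Dv,\Delta v$ are derivatives in $x$. $W^{2,1}_{q,loc}$ is the local version of the parabolic Sobolev space $W^{2,1}_q(X)$ of measurable $v$ with $\partial_t^rD_x^\beta v\in L^q(X)$ for all $|\beta|+2r\le2$; $v$ is identified with its continuous representative. *)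

theory Defs
  imports "HOL-Analysis.Analysis"
begin

text \<open>Iterated directional derivative of \<open>f\<close> along the directions in the list. For smooth \<open>f\<close> the
  order of the directions is irrelevant, so multi-indices are represented by lists of directions,
  the order of the multi-index being the length of the list.\<close>

fun iter_deriv :: "'a::euclidean_space list \<Rightarrow> ('a \<Rightarrow> real) \<Rightarrow> 'a \<Rightarrow> real" where
  "iter_deriv [] f = f"
| "iter_deriv (e # es) f = (\<lambda>z. frechet_derivative (iter_deriv es f) (at z) e)"

definition smooth :: "('a::euclidean_space \<Rightarrow> real) \<Rightarrow> bool" where
  "smooth f \<longleftrightarrow> (\<forall>es. iter_deriv es f differentiable_on UNIV)"

definition test_function :: "'a::euclidean_space set \<Rightarrow> ('a \<Rightarrow> real) \<Rightarrow> bool" where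
  "test_function X \<phi> \<longleftrightarrow>
     smooth \<phi> \<and> compact (closure {z. \<phi> z \<noteq> 0}) \<and> closure {z. \<phi> z \<noteq> 0} \<subseteq> X"

definition locally_integrable :: "'a::euclidean_space set \<Rightarrow> ('a \<Rightarrow> real) \<Rightarrow> bool" where
  "locally_integrable X f \<longleftrightarrow> (\<forall>K. compact K \<and> K \<subseteq> X \<longrightarrow> integrable (lebesgue_on K) f)"

text \<open>\<open>w\<close> is the weak (distributional) derivative of \<open>u\<close> in the open set \<open>X\<close> along the directions
  \<open>es\<close>. It is determined up to null sets; the values of \<open>u\<close> and \<open>w\<close> outside \<open>X\<close> play no role.\<close>

definition has_weak_deriv ::
    "'a::euclidean_space set \<Rightarrow> 'a list \<Rightarrow> ('a \<Rightarrow> real) \<Rightarrow> ('a \<Rightarrow> real) \<Rightarrow> bool" where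
  "has_weak_deriv X es u w \<longleftrightarrow>
     locally_integrable X u \<and> locally_integrable X w \<and>
     (\<forall>\<phi>. test_function X \<phi> \<longrightarrow>
        (LINT z|lebesgue_on X. u z * iter_deriv es \<phi> z)
          = (- 1) ^ length es * (LINT z|lebesgue_on X. w z * \<phi> z))"

definition Lq :: "real \<Rightarrow> 'a::euclidean_space set \<Rightarrow> ('a \<Rightarrow> real) set" where
  "Lq q X = {f \<in> borel_measurable (lebesgue_on X). integrable (lebesgue_on X) (\<lambda>z. \<bar>f z\<bar> powr q)}"

text \<open>Points of space-time are pairs \<open>(x, t)\<close>.\<close>

definition t_dir :: "(real^'n) \<times> real" where
  "t_dir = (0, 1)"

definition x_dir :: "'n \<Rightarrow> (real^'n) \<times> real" where
  "x_dir i = (axis i 1, 0)"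

definition W21 :: "real \<Rightarrow> ((real^'n) \<times> real) set \<Rightarrow> ((real^'n) \<times> real \<Rightarrow> real) set" where
  "W21 q X = {v. \<forall>r \<beta>. length \<beta> + 2 * r \<le> 2 \<longrightarrow>
     (\<exists>w \<in> Lq q X. has_weak_deriv X (replicate r t_dir @ map x_dir \<beta>) v w)}"

definition W21_loc :: "real \<Rightarrow> ((real^'n) \<times> real) set \<Rightarrow> ((real^'n) \<times> real \<Rightarrow> real) set" where
  "W21_loc q X =
     {v. \<forall>Y. open Y \<and> compact (closure Y) \<and> closure Y \<subseteq> X \<longrightarrow> v \<in> W21 q Y}"

definition half_spacetime :: "((real^'n) \<times> real) set" where
  "half_spacetime = UNIV \<times> {0<..}"

text \<open>Strong (almost everywhere) solution of \<open>- \<partial>\<^sub>t v - \<Delta> v + h |Dv|\<^sup>\<gamma> = 0\<close>; the \<open>i\<close>-th component of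
  \<open>D2 z\<close> is the pure second derivative of \<open>v\<close> in \<open>x\<^sub>i\<close>.\<close>

definition strong_HJ_solution ::
    "((real^'n) \<times> real) set \<Rightarrow> real \<Rightarrow> real \<Rightarrow> ((real^'n) \<times> real \<Rightarrow> real) \<Rightarrow> bool" where
  "strong_HJ_solution X h \<gamma> v \<longleftrightarrow>
     (\<exists>(vt :: (real^'n) \<times> real \<Rightarrow> real) (Dv :: (real^'n) \<times> real \<Rightarrow> real^'n)
        (D2 :: (real^'n) \<times> real \<Rightarrow> real^'n).
        has_weak_deriv X [t_dir] v vt \<and>
        (\<forall>i. has_weak_deriv X [x_dir i] v (\<lambda>z. Dv z $ i)) \<and>
        (\<forall>i. has_weak_deriv X [x_dir i, x_dir i] v (\<lambda>z. D2 z $ i)) \<and>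
        (AE z in lebesgue_on X.
           - vt z - (\<Sum>i\<in>UNIV. D2 z $ i) + h * norm (Dv z) powr \<gamma> = 0))"

definition holder_quotient ::
    "real \<Rightarrow> ((real^'n) \<times> real \<Rightarrow> real) \<Rightarrow> (real^'n) \<times> real \<Rightarrow> (real^'n) \<times> real \<Rightarrow> real" where
  "holder_quotient \<alpha> v = (\<lambda>(x, t) (x', t').
     \<bar>v (x, t) - v (x', t')\<bar> / (norm (x - x') powr \<alpha> + \<bar>t - t'\<bar> powr (\<alpha> / 2)))"

end

theory Submission
  imports Defs
begin

text \<open>The heart of the matter is the one-sided bound \<open>v (x0 + e, t0) \<le> v (x0, t0)\<close> for every
  shift \<open>e\<close>. Used with \<open>e\<close> and \<open>- e\<close> it makes \<open>v\<close>
  independent of \<open>x\<close>; then \<open>Dv = 0\<close> almost everywhere, the equation gives that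
  \<open>v\<close> has no time derivative either, and \<open>v\<close> is constant. Passing from
  \<open>v\<close> to \<open>- v\<close> if necessary, one may take \<open>h > 0\<close>.

  To prove the bound, look at a long time window from \<open>t0\<close> to \<open>t0 + T\<close> and slide
  the solution in space: \<open>W (x, t) = v (x + (1 - (t - t0) / T) e, t)\<close> starts as the shifted
  solution and ends as \<open>v\<close> itself, and solves the equation with an additional drift of size
  \<open>|e| / T\<close>. Compare \<open>W - c0\<close>, where \<open>c0 = v (x0, t0)\<close>, with
  \<open>(1 + 3 \<kappa>) (v - c0) + P\<close>, where \<open>P\<close> is the barrier
  \<open>A sqrt (R^2 + |x - x0|^2) + B (t0 + T - t)\<close> and \<open>R^2 = T\<close>. By convexity of
  \<open>|p|^\<gamma>\<close> the factor \<open>1 + 3 \<kappa>\<close> leaves the amount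
  \<open>h (\<kappa> / 2) |p|^\<gamma>\<close> to spare, and this absorbs the drift at the price
  \<open>(|e| / T) (2 |e| / (T h \<kappa>))^(1 / (\<gamma> - 1))\<close>, which is part of
  \<open>B\<close>. The Hoelder bound on \<open>v\<close>, of order \<open>\<alpha> < 1\<close>, lets
  \<open>P\<close> dominate at the final time and on the lateral boundary as soon as
  \<open>A = 6 \<kappa> C R^(\<alpha> - 1)\<close>. At the point \<open>(x0, t0)\<close> the maximum
  principle then reads \<open>v (x0 + e, t0) - v (x0, t0) \<le> A R + B T\<close>. With
  \<open>\<kappa> = T^(- \<theta>)\<close> and \<open>\<theta> < 1\<close> close enough to
  \<open>1\<close>, every term on the right tends to \<open>0\<close> as \<open>T\<close> grows; see
  \<open>comparison\<close>, \<open>shift_estimate\<close> and \<open>solution_shift_le\<close>.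

  The difficulty is that \<open>v\<close> is not twice differentiable, so that the maximum principle
  cannot be applied to it directly. Mollify: \<open>U = corr (moll \<epsilon>) v\<close> solves
  \<open>- U\<^sub>t - Laplace U + h F = 0\<close>, where \<open>F\<close> is the mollification of
  \<open>|Dv|^\<gamma>\<close>. Jensen's inequality gives \<open>F \<ge> |DU|^\<gamma>\<close>, which is
  the right sign for one of the two copies of \<open>U\<close> in the comparison and the wrong sign for
  the other. The wrong copy costs the error \<open>h (F - |DU|^\<gamma>)\<close>. The equation, together
  with the Sobolev regularity of \<open>v\<close>, puts \<open>|Dv|^\<gamma>\<close> into
  \<open>L^q\<close> locally, hence the error tends to \<open>0\<close> in \<open>L^q\<close> on compact
  sets (\<open>moll_error_small\<close>), but not uniformly.

  An error \<open>g\<close> that is small in \<open>L^q\<close> only is absorbed by a corrector: a small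
  function \<open>\<psi> \<ge> 0\<close> with
  \<open>- \<psi>\<^sub>t - Laplace \<psi> \<ge> K |D\<psi>|^\<gamma> + g - \<sigma>\<close>, which is
  added to the barrier (\<open>smooth_corrector\<close>). It is a heat potential of a function
  \<open>F\<close> that solves \<open>F = K (|D\<Gamma>| * F)^\<gamma> + g\<close>,
  \<open>\<Gamma>\<close> being the heat kernel. By Young's inequality the right-hand side maps small
  balls of \<open>L^q\<close> into themselves when \<open>|D\<Gamma>|\<close> lies in \<open>L^a\<close>
  with \<open>1 / a = 1 + 1 / (\<gamma> q) - 1 / q\<close>. Since \<open>|D\<Gamma>|\<close> lies
  locally in \<open>L^a\<close> exactly for \<open>a < (N + 2) / (N + 1)\<close>, this is the condition
  \<open>q > q0\<close>. Because \<open>\<gamma> > 2\<close>, it also implies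
  \<open>q > (N + 2) / 2\<close>, so that \<open>\<Gamma>\<close> belongs to the dual space of
  \<open>L^q\<close> locally and the corrector is uniformly small (\<open>young_convolution\<close>,
  \<open>holder_small\<close>, \<open>subcritical_exponents\<close>).\<close>

section \<open>A smooth compactly supported mollifier\<close>

text \<open>The negative powers of \<open>r\<close> are included because they appear on differentiation; with them,
  derivatives of the family are linear combinations of its members.\<close>
definition exp_recip :: "nat \<Rightarrow> real \<Rightarrow> real" where
  "exp_recip m r = (if r > 0 then exp (- (1 / r)) / r ^ m else 0)"

lemma exp_recip_nonneg: "exp_recip m r \<ge> 0"
  by (simp add: exp_recip_def)

text \<open>Substituting \<open>1 / r\<close> turns the claim into the fact that the exponential outgrows every
  power.\<close>
lemma exp_recip_tendsto_0: "((\<lambda>r. exp_recip m r) \<longlongrightarrow> 0) (at_right 0)"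
proof -
  have "((\<lambda>x::real. x ^ m / exp x) \<longlongrightarrow> 0) at_top"
    by (rule tendsto_power_div_exp_0)
  then have "((\<lambda>r::real. (inverse r) ^ m / exp (inverse r)) \<longlongrightarrow> 0) (at_right 0)"
    by (rule filterlim_compose[OF _ filterlim_inverse_at_top_right])
  moreover have "\<forall>\<^sub>F r in at_right (0::real). (inverse r) ^ m / exp (inverse r) = exp_recip m r"
    unfolding eventually_at_right_field
    by (intro exI[of _ 1]) (auto simp: exp_recip_def exp_minus field_simps)
  ultimately show ?thesis
    by (simp add: tendsto_cong)
qed

text \<open>Only the point \<open>0\<close> is delicate: there the difference quotient of order \<open>m\<close> is
  the function of order \<open>m + 1\<close>, which tends to \<open>0\<close> from the right and
  vanishes on the left.\<close>
lemma exp_recip_has_derivative: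
  "(exp_recip m has_real_derivative (exp_recip (m + 2) r - m * exp_recip (m + 1) r)) (at r)"
proof (cases r "0::real" rule: linorder_cases)
  case less
  have "((\<lambda>r::real. 0::real) has_real_derivative 0) (at r)" by simp
  moreover have "\<forall>\<^sub>F x in nhds r. exp_recip m x = 0"
    using less by (intro eventually_nhds_in_open[of "{..<0}", THEN eventually_mono])
      (auto simp: exp_recip_def)
  ultimately show ?thesis
    using less by (subst DERIV_cong_ev[OF refl _ refl, where g="\<lambda>_. 0"]) (auto simp: exp_recip_def)
next
  case greater
  have "((\<lambda>r. exp (- (1 / r)) / r ^ m) has_real_derivative (exp_recip (m + 2) r - m * exp_recip (m + 1) r)) (at r)"
  proof -
    have "((\<lambda>r. exp (- (1 / r)) / r ^ m) has_real_derivative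
        (exp (- (1 / r)) * (1 / r\<^sup>2) * r ^ m - exp (- (1 / r)) * (m * r ^ (m - 1))) / (r ^ m * r ^ m)) (at r)"
      using greater by (auto intro!: derivative_eq_intros simp: power2_eq_square)
    also have "(exp (- (1 / r)) * (1 / r\<^sup>2) * r ^ m - exp (- (1 / r)) * (m * r ^ (m - 1))) / (r ^ m * r ^ m) =
        exp_recip (m + 2) r - m * exp_recip (m + 1) r"
      using greater by (cases m) (auto simp: exp_recip_def divide_simps power2_eq_square algebra_simps)
    finally show ?thesis .
  qed
  moreover have "\<forall>\<^sub>F x in nhds r. exp_recip m x = exp (- (1 / x)) / x ^ m"
    using greater by (intro eventually_nhds_in_open[of "{0<..}", THEN eventually_mono])
      (auto simp: exp_recip_def)
  ultimately show ?thesis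
    by (subst DERIV_cong_ev[OF refl _ refl, where g="\<lambda>r. exp (- (1 / r)) / r ^ m"])
next
  case equal
  have "((\<lambda>h. (exp_recip m (0 + h) - exp_recip m 0) / h) \<longlongrightarrow> 0) (at 0)"
    unfolding filterlim_split_at_real[of _ _ 0] filterlim_at_split
  proof
    have "\<forall>\<^sub>F h in at_right (0::real). exp_recip (m + 1) h = (exp_recip m (0 + h) - exp_recip m 0) / h"
      unfolding eventually_at_right_field
      by (intro exI[of _ 1]) (auto simp: exp_recip_def field_simps)
    then show "((\<lambda>h. (exp_recip m (0 + h) - exp_recip m 0) / h) \<longlongrightarrow> 0) (at_right 0)"
      using exp_recip_tendsto_0[of "m + 1"] by (simp add: tendsto_cong)
    have "\<forall>\<^sub>F h in at_left (0::real). (exp_recip m (0 + h) - exp_recip m 0) / h = 0"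
      unfolding eventually_at_left_field
      by (intro exI[of _ "-1"]) (auto simp: exp_recip_def)
    then show "((\<lambda>h. (exp_recip m (0 + h) - exp_recip m 0) / h) \<longlongrightarrow> 0) (at_left 0)"
      by (rule tendsto_eventually)
  qed
  then show ?thesis
    using equal unfolding DERIV_def by (simp add: exp_recip_def)
qed

text \<open>An algebra of functions that contains the bump and is closed under differentiation. Its members are
  therefore infinitely differentiable, and no higher derivative ever has to be computed.\<close>
inductive bump_alg :: "real \<Rightarrow> ('a::euclidean_space \<Rightarrow> real) \<Rightarrow> bool" for r where
  base: "bump_alg r (\<lambda>z. exp_recip m (r - z \<bullet> z))"
| const: "bump_alg r (\<lambda>z. c)"
| lin: "bump_alg r (\<lambda>z. z \<bullet> e)"
| add: "bump_alg r f \<Longrightarrow> bump_alg r g \<Longrightarrow> bump_alg r (\<lambda>z. f z + g z)"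
| mult: "bump_alg r f \<Longrightarrow> bump_alg r g \<Longrightarrow> bump_alg r (\<lambda>z. f z * g z)"

lemma bump_alg_deriv:
  assumes "bump_alg r f"
  shows "\<exists>f'. (\<forall>z. (f has_derivative f' z) (at z)) \<and> (\<forall>e. bump_alg r (\<lambda>z. f' z e))"
  using assms
proof induction
  case (base m)
  let ?f' = "\<lambda>z e. (exp_recip (m + 2) (r - z \<bullet> z) - m * exp_recip (m + 1) (r - z \<bullet> z)) * (- 2 * (z \<bullet> e))"
  have "((\<lambda>z. exp_recip m (r - z \<bullet> z)) has_derivative ?f' z) (at z)" for z :: 'a
  proof -
    have "((\<lambda>z. r - z \<bullet> z) has_derivative (\<lambda>e. - 2 * (z \<bullet> e))) (at z)"
      by (auto intro!: derivative_eq_intros simp: inner_commute)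
    from has_derivative_compose[OF this exp_recip_has_derivative[unfolded has_field_derivative_def]]
    show ?thesis by simp
  qed
  moreover have "bump_alg r (\<lambda>z. ?f' z e)" for e :: 'a
  proof -
    have "bump_alg r (\<lambda>z. (exp_recip (m + 2) (r - z \<bullet> z) + (- real m) * exp_recip (m + 1) (r - z \<bullet> z)) * ((- 2) * (z \<bullet> e)))"
      by (intro bump_alg.intros)
    then show ?thesis by simp
  qed
  ultimately show ?case by (intro exI[of _ ?f']) auto
next
  case (const c)
  show ?case by (rule exI[of _ "\<lambda>_ _. 0"]) (auto intro: bump_alg.intros)
next
  case (lin e)
  show ?case
    by (rule exI[of _ "\<lambda>_ d. d \<bullet> e"]) (auto intro!: bump_alg.intros derivative_eq_intros)
next
  case (add f g)
  then obtain f' g' where *: "\<forall>z. (f has_derivative f' z) (at z)" "\<forall>e. bump_alg r (\<lambda>z. f' z e)"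
    "\<forall>z. (g has_derivative g' z) (at z)" "\<forall>e. bump_alg r (\<lambda>z. g' z e)" by blast
  then show ?case
    by (intro exI[of _ "\<lambda>z e. f' z e + g' z e"]) (auto intro!: bump_alg.intros has_derivative_add)
next
  case (mult f g)
  then obtain f' g' where *: "\<forall>z. (f has_derivative f' z) (at z)" "\<forall>e. bump_alg r (\<lambda>z. f' z e)"
    "\<forall>z. (g has_derivative g' z) (at z)" "\<forall>e. bump_alg r (\<lambda>z. g' z e)" by blast
  then show ?case using mult.hyps
    by (intro exI[of _ "\<lambda>z e. f z * g' z e + f' z e * g z"])
       (auto intro!: bump_alg.intros has_derivative_mult)
qed

lemma bump_alg_has_derivative:
  assumes "bump_alg r f"
  shows "(f has_derivative frechet_derivative f (at z)) (at z)"
    and "bump_alg r (\<lambda>z. frechet_derivative f (at z) e)"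
proof -
  obtain f' where f': "\<And>z. (f has_derivative f' z) (at z)" "\<And>e. bump_alg r (\<lambda>z. f' z e)"
    using bump_alg_deriv[OF assms] by blast
  have eq: "frechet_derivative f (at z) = f' z" for z
    using f'(1) by (rule frechet_derivative_at[symmetric])
  show "(f has_derivative frechet_derivative f (at z)) (at z)"
    and "bump_alg r (\<lambda>z. frechet_derivative f (at z) e)"
    using f' by (auto simp: eq)
qed

lemma bump_alg_continuous: "bump_alg r f \<Longrightarrow> continuous_on S f"
  by (meson bump_alg_has_derivative(1) has_derivative_continuous continuous_at_imp_continuous_on)

lemma frechet_derivative_shift:
  assumes "(f has_derivative f') (at (z - c))"
  shows "frechet_derivative (\<lambda>z. f (z - c)) (at z) = f'"
proof -
  have "((\<lambda>z. z - c) has_derivative (\<lambda>h. h)) (at z)"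
    by (auto intro!: derivative_eq_intros)
  from has_derivative_compose[OF this, of f] assms
  show ?thesis by (intro frechet_derivative_at[symmetric]) simp
qed

lemma iter_deriv_bump_alg:
  fixes f :: "'a::euclidean_space \<Rightarrow> real"
  assumes "bump_alg r f"
  shows "bump_alg r (iter_deriv es f)"
    and "iter_deriv es (\<lambda>z. f (z - c)) = (\<lambda>z. iter_deriv es f (z - c))"
proof -
  show *: "bump_alg r (iter_deriv es f)" for es
  proof (induction es)
    case Nil then show ?case using assms by simp
  next
    case (Cons e es) then show ?case by (simp add: bump_alg_has_derivative(2))
  qed
  show "iter_deriv es (\<lambda>z. f (z - c)) = (\<lambda>z. iter_deriv es f (z - c))"
  proof (induction es)
    case Nil then show ?case by simp
  next
    case (Cons e es)
    have "frechet_derivative (\<lambda>z. iter_deriv es f (z - c)) (at z) =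
       frechet_derivative (iter_deriv es f) (at (z - c))" for z
      by (rule frechet_derivative_shift[OF bump_alg_has_derivative(1)[OF *]])
    then show ?case by (simp add: Cons)
  qed
qed

lemma smooth_bump_alg_shift:
  assumes "bump_alg r f" shows "smooth (\<lambda>z. f (z - c))"
  unfolding smooth_def iter_deriv_bump_alg(2)[OF assms]
proof
  fix es
  let ?g = "iter_deriv es f"
  have "(?g \<circ> (\<lambda>z. z - c)) differentiable (at z)" for z
    using bump_alg_has_derivative(1)[OF iter_deriv_bump_alg(1)[OF assms, of es], of "z - c"]
    by (intro differentiable_chain_at) (auto simp: differentiable_def intro!: derivative_eq_intros exI)
  then show "(\<lambda>z. ?g (z - c)) differentiable_on UNIV"
    by (simp add: differentiable_on_def o_def)
qed

definition bump :: "real \<Rightarrow> 'a::euclidean_space \<Rightarrow> real" where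
  "bump \<epsilon> z = exp_recip 0 (\<epsilon>\<^sup>2 - z \<bullet> z)"

definition moll :: "real \<Rightarrow> 'a::euclidean_space \<Rightarrow> real" where
  "moll \<epsilon> z = inverse (LINT y|lborel. bump \<epsilon> (y::'a)) * bump \<epsilon> z"

text \<open>Support in a closed ball around the origin. Translations are always written explicitly, so that a
  support with another centre is never needed.\<close>
definition vanishes_off :: "real \<Rightarrow> ('a::real_normed_vector \<Rightarrow> real) \<Rightarrow> bool" where
  "vanishes_off \<epsilon> f \<longleftrightarrow> (\<forall>z. norm z > \<epsilon> \<longrightarrow> f z = 0)"

lemma bump_eq_0: assumes "\<epsilon> > 0" "norm z \<ge> \<epsilon>" shows "bump \<epsilon> z = 0"
proof -
  have "\<epsilon>\<^sup>2 \<le> (norm z)\<^sup>2" using assms by (intro power_mono) auto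
  then show ?thesis by (auto simp: bump_def exp_recip_def power2_norm_eq_inner)
qed

lemma bump_alg_bump: "bump_alg (\<epsilon>\<^sup>2) (bump \<epsilon>)"
  unfolding bump_def[abs_def] by (rule bump_alg.base)

lemma bump_alg_moll: "bump_alg (\<epsilon>\<^sup>2) (moll \<epsilon>)"
  unfolding moll_def[abs_def] by (intro bump_alg.mult bump_alg.const bump_alg_bump)

lemma continuous_vanishes_off:
  fixes f :: "'a::euclidean_space \<Rightarrow> real"
  assumes "continuous_on UNIV f" "vanishes_off \<epsilon> f"
  shows "integrable lborel f" "bounded (range f)" "f \<in> borel_measurable borel"
proof -
  have i: "integrable lborel (\<lambda>x. indicator (cball 0 \<epsilon>) x *\<^sub>R f x)"
    using assms(1) by (intro borel_integrable_compact) (auto intro: continuous_on_subset)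
  have e: "indicator (cball 0 \<epsilon>) x *\<^sub>R f x = f x" for x
    using assms(2) by (auto simp: indicator_def vanishes_off_def)
  show "integrable lborel f" using i unfolding e .
  show "f \<in> borel_measurable borel" using assms(1) by (rule borel_measurable_continuous_onI)
  have "bounded (f ` cball 0 \<epsilon>)"
    using assms(1) by (intro compact_imp_bounded compact_continuous_image) (auto intro: continuous_on_subset)
  then have "bounded (insert 0 (f ` cball 0 \<epsilon>))" by simp
  then show "bounded (range f)"
    by (rule bounded_subset) (use assms(2) in \<open>force simp: vanishes_off_def\<close>)
qed

lemma vanishes_off_bump: "\<epsilon> > 0 \<Longrightarrow> vanishes_off \<epsilon> (bump \<epsilon>)"
  by (simp add: vanishes_off_def bump_eq_0)

lemma vanishes_off_moll: "\<epsilon> > 0 \<Longrightarrow> vanishes_off \<epsilon> (moll \<epsilon>)"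
  by (simp add: vanishes_off_def moll_def bump_eq_0)

text \<open>A continuous non-negative function with vanishing integral vanishes almost everywhere, whereas the bump
  is positive on a ball.\<close>
lemma integral_bump_pos:
  assumes "\<epsilon> > 0" shows "(LINT y|lborel. bump \<epsilon> (y::'a::euclidean_space)) > 0"
proof -
  let ?f = "bump \<epsilon> :: 'a \<Rightarrow> real"
  have cont: "continuous_on UNIV ?f" by (rule bump_alg_continuous[OF bump_alg_bump])
  have int: "integrable lborel ?f" using continuous_vanishes_off(1)[OF cont vanishes_off_bump[OF assms]] .
  have nn: "?f y \<ge> 0" for y by (simp add: bump_def exp_recip_nonneg)
  have "(LINT y|lborel. ?f y) \<noteq> 0"
  proof
    assume "(LINT y|lborel. ?f y) = 0"
    then have "AE y in lborel. ?f y = 0"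
      using integral_nonneg_eq_0_iff_AE[OF int] nn by auto
    then have "emeasure lborel {y. ?f y \<noteq> 0} = 0"
      using AE_iff_measurable[of "{y. ?f y \<noteq> 0}" lborel "\<lambda>y. ?f y = 0"]
        borel_open[OF open_Collect_neq[OF cont continuous_on_const[of UNIV 0]]] by auto
    moreover have "ball 0 \<epsilon> \<subseteq> {y. ?f y \<noteq> 0}"
    proof
      fix y :: 'a assume "y \<in> ball 0 \<epsilon>"
      then have "(norm y)\<^sup>2 < \<epsilon>\<^sup>2" by (intro power_strict_mono) auto
      then show "y \<in> {y. ?f y \<noteq> 0}" by (simp add: bump_def exp_recip_def power2_norm_eq_inner)
    qed
    moreover have "{y. ?f y \<noteq> 0} \<in> sets lborel"
      using borel_open[OF open_Collect_neq[OF cont continuous_on_const[of UNIV 0]]] by simp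
    ultimately have "emeasure lborel (ball (0::'a) \<epsilon>) \<le> 0"
      by (metis emeasure_mono)
    then have "measure lborel (ball (0::'a) \<epsilon>) = 0"
      by (simp add: measure_def)
    then show False using assms content_ball_pos[of \<epsilon> "0::'a"] by simp
  qed
  moreover have "(LINT y|lborel. ?f y) \<ge> 0" using nn by simp
  ultimately show ?thesis by simp
qed

lemma moll_nonneg: "\<epsilon> > 0 \<Longrightarrow> moll \<epsilon> z \<ge> 0"
  using integral_bump_pos[of \<epsilon>, where 'a='a] by (simp add: moll_def bump_def exp_recip_nonneg)

lemma moll_basic:
  assumes "\<epsilon> > 0"
  shows "continuous_on UNIV (moll \<epsilon> :: 'a::euclidean_space \<Rightarrow> real)"
    "integrable lborel (moll \<epsilon> :: 'a \<Rightarrow> real)" "bounded (range (moll \<epsilon> :: 'a \<Rightarrow> real))"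
    "(moll \<epsilon> :: 'a \<Rightarrow> real) \<in> borel_measurable borel"
    "(LINT z|lborel. moll \<epsilon> (z::'a)) = 1"
proof -
  show c: "continuous_on UNIV (moll \<epsilon> :: 'a \<Rightarrow> real)"
    by (rule bump_alg_continuous[OF bump_alg_moll])
  show "integrable lborel (moll \<epsilon> :: 'a \<Rightarrow> real)" "bounded (range (moll \<epsilon> :: 'a \<Rightarrow> real))"
    "(moll \<epsilon> :: 'a \<Rightarrow> real) \<in> borel_measurable borel"
    using continuous_vanishes_off[OF c vanishes_off_moll[OF assms]] by auto
  show "(LINT z|lborel. moll \<epsilon> (z::'a)) = 1"
    using integral_bump_pos[OF assms, where 'a='a] by (simp add: moll_def)
qed

lemma vanishes_off_deriv:
  fixes f :: "'a::euclidean_space \<Rightarrow> real"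
  assumes "vanishes_off \<epsilon> f"
  shows "vanishes_off \<epsilon> (\<lambda>z. frechet_derivative f (at z) e)"
  unfolding vanishes_off_def
proof (intro allI impI)
  fix z :: 'a assume z: "\<epsilon> < norm z"
  have "((\<lambda>_. 0) has_derivative (\<lambda>_. 0)) (at z)" by simp
  then have "(f has_derivative (\<lambda>_. 0)) (at z)"
  proof (rule has_derivative_transform_within_open)
    show "open {z::'a. \<epsilon> < norm z}" by (intro open_Collect_less continuous_intros)
  qed (use z assms in \<open>auto simp: vanishes_off_def\<close>)
  from frechet_derivative_at[OF this] show "frechet_derivative f (at z) e = 0" by metis
qed

lemma vanishes_off_iter_deriv:
  fixes f :: "'a::euclidean_space \<Rightarrow> real"
  shows "vanishes_off \<epsilon> f \<Longrightarrow> vanishes_off \<epsilon> (iter_deriv es f)"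
proof (induction es)
  case (Cons e es) then show ?case using vanishes_off_deriv[of \<epsilon> "iter_deriv es f" e] by simp
qed simp

definition mollD :: "real \<Rightarrow> 'a::euclidean_space list \<Rightarrow> 'a \<Rightarrow> real" where
  "mollD \<epsilon> es = iter_deriv es (moll \<epsilon>)"

lemma mollD_basic:
  fixes es :: "'a::euclidean_space list"
  assumes "\<epsilon> > 0"
  shows "continuous_on UNIV (mollD \<epsilon> es)" "vanishes_off \<epsilon> (mollD \<epsilon> es)"
    "integrable lborel (mollD \<epsilon> es)" "bounded (range (mollD \<epsilon> es))"
    "mollD \<epsilon> es \<in> borel_measurable borel"
proof -
  show 1: "continuous_on UNIV (mollD \<epsilon> es)" "vanishes_off \<epsilon> (mollD \<epsilon> es)"
    unfolding mollD_def
    by (auto intro!: bump_alg_continuous iter_deriv_bump_alg(1) bump_alg_moll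
        vanishes_off_iter_deriv vanishes_off_moll assms)
  show "integrable lborel (mollD \<epsilon> es)" "bounded (range (mollD \<epsilon> es))"
    "mollD \<epsilon> es \<in> borel_measurable borel"
    using continuous_vanishes_off[OF 1] by auto
qed

lemma mollD_Nil: "mollD \<epsilon> [] = moll \<epsilon>" by (simp add: mollD_def)

lemma mollD_deriv:
  "(mollD \<epsilon> es has_derivative (\<lambda>e. mollD \<epsilon> (e # es) z)) (at z)"
  using bump_alg_has_derivative(1)[OF iter_deriv_bump_alg(1)[OF bump_alg_moll[of \<epsilon>], of es], of z]
  by (simp add: mollD_def)

text \<open>This is how weak derivatives come into contact with mollification: the shifted mollifier is an
  admissible test function as long as its support stays inside the domain.\<close>
lemma test_function_moll:
  assumes "\<epsilon> > 0" "cball z \<epsilon> \<subseteq> X"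
  shows "test_function X (\<lambda>y. moll \<epsilon> (y - z))"
  unfolding test_function_def
proof (intro conjI)
  show "smooth (\<lambda>y. moll \<epsilon> (y - z))" by (rule smooth_bump_alg_shift[OF bump_alg_moll])
  have "{y. moll \<epsilon> (y - z) \<noteq> 0} \<subseteq> cball z \<epsilon>"
    using vanishes_off_moll[OF assms(1), where 'a='a]
    by (force simp: vanishes_off_def dist_norm norm_minus_commute)
  then have c: "closure {y. moll \<epsilon> (y - z) \<noteq> 0} \<subseteq> cball z \<epsilon>"
    by (rule closure_minimal) auto
  then show "closure {y. moll \<epsilon> (y - z) \<noteq> 0} \<subseteq> X" using assms(2) by blast
  show "compact (closure {y. moll \<epsilon> (y - z) \<noteq> 0})"
    using c by (meson bounded_cball bounded_subset closed_closure compact_eq_bounded_closed)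
qed

lemma iter_deriv_moll_shift: "iter_deriv es (\<lambda>y. moll \<epsilon> (y - z)) = (\<lambda>y. mollD \<epsilon> es (y - z))"
  unfolding mollD_def by (rule iter_deriv_bump_alg(2)[OF bump_alg_moll])

section \<open>Correlations and their derivatives\<close>

lemma cball_borel [measurable]: "cball (z::'a::euclidean_space) r \<in> sets borel"
  by (simp add: borel_closed)

lemma lborel_integral_shift:
  fixes f :: "'a::euclidean_space \<Rightarrow> 'b::{banach, second_countable_topology}"
  assumes "f \<in> borel_measurable borel"
  shows "(LINT y|lborel. f (z + y)) = (LINT y|lborel. f y)"
proof -
  have "(LINT y|lborel. f y) = integral\<^sup>L (distr lborel borel ((+) z)) f"
    by (simp add: lborel_distr_plus)
  also have "\<dots> = (LINT y|lborel. f (z + y))"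
    using assms by (subst integral_distr) auto
  finally show ?thesis by simp
qed

lemma lborel_integrable_shift:
  fixes f :: "'a::euclidean_space \<Rightarrow> 'b::{banach, second_countable_topology}"
  assumes "integrable lborel f"
  shows "integrable lborel (\<lambda>y. f (z + y))"
proof -
  have "integrable (distr lborel borel ((+) z)) f"
    using assms by (simp add: lborel_distr_plus)
  then show ?thesis
    by (subst (asm) integrable_distr_eq) (use borel_measurable_integrable[OF assms] in auto)
qed

lemma lborel_nn_integral_shift:
  fixes f :: "'a::euclidean_space \<Rightarrow> ennreal"
  assumes "f \<in> borel_measurable borel"
  shows "(\<integral>\<^sup>+ y. f (z + y) \<partial>lborel) = (\<integral>\<^sup>+ y. f y \<partial>lborel)"
proof -
  have "(\<integral>\<^sup>+ y. f y \<partial>lborel) = integral\<^sup>N (distr lborel borel ((+) z)) f"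
    by (simp add: lborel_distr_plus)
  also have "\<dots> = (\<integral>\<^sup>+ y. f (z + y) \<partial>lborel)"
    using assms by (subst nn_integral_distr) auto
  finally show ?thesis by simp
qed

text \<open>Reduces differentiability to sequences, to which dominated convergence applies.\<close>
lemma DERIV_seqI:
  fixes f :: "real \<Rightarrow> real"
  assumes "\<delta> > 0"
    and "\<And>s. (\<And>n. s n \<noteq> 0) \<Longrightarrow> (\<And>n. \<bar>s n\<bar> < \<delta>) \<Longrightarrow> s \<longlonglongrightarrow> 0 \<Longrightarrow> (\<lambda>n. (f (s n) - f 0) / s n) \<longlonglongrightarrow> D"
  shows "(f has_real_derivative D) (at 0)"
proof -
  have "((\<lambda>h. (f (0 + h) - f 0) / h) \<longlongrightarrow> D) (at 0)"
  proof (subst LIMSEQ_SEQ_conv[symmetric], intro allI impI)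
    fix s :: "nat \<Rightarrow> real" assume s: "(\<forall>n. s n \<noteq> 0) \<and> s \<longlonglongrightarrow> 0"
    then have "\<forall>\<^sub>F n in sequentially. dist (s n) 0 < \<delta>"
      using assms(1) tendstoD by blast
    then obtain N where N: "\<And>n. n \<ge> N \<Longrightarrow> \<bar>s n\<bar> < \<delta>"
      unfolding eventually_sequentially by auto
    have "(\<lambda>n. (f (s (n + N)) - f 0) / s (n + N)) \<longlonglongrightarrow> D"
      using s N by (intro assms(2)) (auto intro: LIMSEQ_ignore_initial_segment)
    then show "(\<lambda>n. (f (0 + s n) - f 0) / s n) \<longlonglongrightarrow> D"
      using LIMSEQ_offset[of "\<lambda>n. (f (s n) - f 0) / s n" N] by simp
  qed
  then show ?thesis by (simp add: DERIV_def)
qed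

lemma mean_value_bound:
  fixes f :: "real \<Rightarrow> real"
  assumes "\<And>t. \<bar>t\<bar> < \<delta> \<Longrightarrow> (f has_real_derivative f' t) (at t)"
    and "\<And>t. \<bar>t\<bar> < \<delta> \<Longrightarrow> \<bar>f' t\<bar> \<le> B" and "\<bar>h\<bar> < \<delta>"
  shows "\<bar>f h - f 0\<bar> \<le> B * \<bar>h\<bar>"
proof -
  have "norm (f h - f 0) \<le> B * norm (h - 0)"
    by (rule field_differentiable_bound[of "{-\<delta><..<\<delta>}" f f'])
      (use assms in \<open>auto intro: has_field_derivative_at_within\<close>)
  then show ?thesis by simp
qed

text \<open>By the mean value theorem the difference quotients of \<Phi> are bounded by the bound \<open>B\<close>
  on its derivative, so they are dominated by \<open>B * \<bar>w\<bar>\<close>. The weight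
  \<open>w\<close> is kept separate from the differentiable factor because it is only integrable, like a
  singular kernel or a Sobolev function.\<close>
lemma diff_under_integral:
  fixes \<Phi> \<Phi>' :: "'y \<Rightarrow> real \<Rightarrow> real"
  assumes w: "integrable M w" and \<delta>: "\<delta> > 0"
    and D: "\<And>y h. y \<in> space M \<Longrightarrow> \<bar>h\<bar> < \<delta> \<Longrightarrow> (\<Phi> y has_real_derivative \<Phi>' y h) (at h)"
    and B: "\<And>y h. y \<in> space M \<Longrightarrow> \<bar>h\<bar> < \<delta> \<Longrightarrow> \<bar>\<Phi>' y h\<bar> \<le> B"
    and int: "\<And>h. \<bar>h\<bar> < \<delta> \<Longrightarrow> integrable M (\<lambda>y. w y * \<Phi> y h)"
    and meas: "(\<lambda>y. w y * \<Phi>' y 0) \<in> borel_measurable M"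
  shows "((\<lambda>h. LINT y|M. w y * \<Phi> y h) has_real_derivative (LINT y|M. w y * \<Phi>' y 0)) (at 0)"
proof (rule DERIV_seqI[OF \<delta>])
  fix s :: "nat \<Rightarrow> real" assume s: "\<And>n. s n \<noteq> 0" "\<And>n. \<bar>s n\<bar> < \<delta>" "s \<longlonglongrightarrow> 0"
  let ?q = "\<lambda>n y. w y * ((\<Phi> y (s n) - \<Phi> y 0) / s n)"
  have int': "integrable M (?q n)" for n
  proof -
    have "integrable M (\<lambda>y. (w y * \<Phi> y (s n) - w y * \<Phi> y 0) / s n)"
      using int[of "s n"] int[of 0] s(2) \<delta> by auto
    then show ?thesis by (simp add: algebra_simps)
  qed
  have "(\<lambda>n. LINT y|M. ?q n y) \<longlonglongrightarrow> (LINT y|M. w y * \<Phi>' y 0)"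
  proof (rule integral_dominated_convergence[where w="\<lambda>y. B * \<bar>w y\<bar>"])
    show "integrable M (\<lambda>y. B * \<bar>w y\<bar>)" using w by auto
    show "AE y in M. (\<lambda>n. ?q n y) \<longlonglongrightarrow> w y * \<Phi>' y 0"
    proof (intro AE_I2 tendsto_mult_left)
      fix y assume "y \<in> space M"
      then have "((\<lambda>h. (\<Phi> y (0 + h) - \<Phi> y 0) / h) \<longlongrightarrow> \<Phi>' y 0) (at 0)"
        using D[of y 0] \<delta> by (simp add: DERIV_def)
      then have "(\<lambda>h. (\<Phi> y h - \<Phi> y 0) / h) \<midarrow>0\<rightarrow> \<Phi>' y 0" by simp
      from this[folded LIMSEQ_SEQ_conv, rule_format, of s] s
      show "(\<lambda>n. (\<Phi> y (s n) - \<Phi> y 0) / s n) \<longlonglongrightarrow> \<Phi>' y 0" by simp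
    qed
    fix n show "AE y in M. norm (?q n y) \<le> B * \<bar>w y\<bar>"
    proof (rule AE_I2)
      fix y assume y: "y \<in> space M"
      have "\<bar>\<Phi> y (s n) - \<Phi> y 0\<bar> \<le> B * \<bar>s n\<bar>"
        by (rule mean_value_bound[OF D[OF y] B[OF y] s(2)])
      then have "\<bar>\<Phi> y (s n) - \<Phi> y 0\<bar> / \<bar>s n\<bar> \<le> B"
        using s(1)[of n] by (simp add: field_simps)
      then show "norm (?q n y) \<le> B * \<bar>w y\<bar>"
        using mult_right_mono[of "\<bar>\<Phi> y (s n) - \<Phi> y 0\<bar> / \<bar>s n\<bar>" B "\<bar>w y\<bar>"] by (simp add: abs_mult ac_simps)
    qed
  qed (use int' meas in auto)
  moreover have "(LINT y|M. ?q n y) = ((LINT y|M. w y * \<Phi> y (s n)) - (LINT y|M. w y * \<Phi> y 0)) / s n" for n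
  proof -
    have "(LINT y|M. ?q n y) = (LINT y|M. (w y * \<Phi> y (s n) - w y * \<Phi> y 0) / s n)"
      by (simp add: algebra_simps)
    also have "\<dots> = (LINT y|M. w y * \<Phi> y (s n) - w y * \<Phi> y 0) / s n" by simp
    also have "\<dots> = ((LINT y|M. w y * \<Phi> y (s n)) - (LINT y|M. w y * \<Phi> y 0)) / s n"
      using int[of "s n"] int[of 0] s(2) \<delta> by (subst Bochner_Integration.integral_diff) auto
    finally show ?thesis .
  qed
  then have "(\<lambda>n. LINT y|M. ?q n y) = (\<lambda>n. ((LINT y|M. w y * \<Phi> y (s n)) - (LINT y|M. w y * \<Phi> y 0)) / s n)"
    by (rule ext)
  ultimately show "(\<lambda>n. ((LINT y|M. w y * \<Phi> y (s n)) - (LINT y|M. w y * \<Phi> y 0)) / s n)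
      \<longlonglongrightarrow> (LINT y|M. w y * \<Phi>' y 0)"
    by simp
qed

lemma cont_under_integral:
  fixes \<Phi> :: "'y \<Rightarrow> 'a::metric_space \<Rightarrow> real"
  assumes w: "integrable M w"
    and c: "\<And>y. y \<in> space M \<Longrightarrow> isCont (\<Phi> y) z"
    and B: "\<And>y z'. y \<in> space M \<Longrightarrow> \<bar>\<Phi> y z'\<bar> \<le> B"
    and m: "\<And>z'. (\<lambda>y. w y * \<Phi> y z') \<in> borel_measurable M"
  shows "isCont (\<lambda>z'. LINT y|M. w y * \<Phi> y z') z"
  unfolding continuous_at_sequentially
proof (intro allI impI)
  fix x :: "nat \<Rightarrow> 'a" assume x: "x \<longlonglongrightarrow> z"
  show "((\<lambda>z'. LINT y|M. w y * \<Phi> y z') \<circ> x) \<longlonglongrightarrow> (LINT y|M. w y * \<Phi> y z)"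
    unfolding o_def
  proof (rule integral_dominated_convergence[where w="\<lambda>y. B * \<bar>w y\<bar>"])
    show "integrable M (\<lambda>y. B * \<bar>w y\<bar>)" using w by auto
    show "AE y in M. (\<lambda>n. w y * \<Phi> y (x n)) \<longlonglongrightarrow> w y * \<Phi> y z"
      using c x by (intro AE_I2 tendsto_mult_left) (auto simp: continuous_at_sequentially o_def)
    fix n show "AE y in M. norm (w y * \<Phi> y (x n)) \<le> B * \<bar>w y\<bar>"
      using mult_right_mono[OF B abs_ge_zero] by (intro AE_I2) (simp add: abs_mult mult.commute)
  qed (use m in auto)
qed

text \<open>Derivative along a line. The heat operator and the maximum principle involve derivatives in fixed
  directions only, and these pass through integrals without any appeal to joint differentiability.\<close>
definition has_line_deriv :: "('a::real_normed_vector \<Rightarrow> real) \<Rightarrow> 'a \<Rightarrow> real \<Rightarrow> 'a \<Rightarrow> bool" where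
  "has_line_deriv f e D z \<longleftrightarrow> ((\<lambda>h. f (z + h *\<^sub>R e)) has_real_derivative D) (at 0)"

lemma has_line_deriv_along:
  assumes "has_line_deriv f e D (z + h *\<^sub>R e)"
  shows "((\<lambda>h. f (z + h *\<^sub>R e)) has_real_derivative D) (at h)"
proof -
  have "((\<lambda>k. f (z + (k + h) *\<^sub>R e)) has_real_derivative D) (at 0)"
    using assms by (simp add: has_line_deriv_def algebra_simps)
  then show ?thesis using DERIV_shift[of "\<lambda>h. f (z + h *\<^sub>R e)" D 0 h] by simp
qed

lemma has_derivative_imp_has_line_deriv:
  assumes "(f has_derivative f') (at z)" shows "has_line_deriv f e (f' e) z"
proof -
  interpret bounded_linear f' using assms by (rule has_derivative_bounded_linear)
  have "((\<lambda>h::real. z + h *\<^sub>R e) has_derivative (\<lambda>h. h *\<^sub>R e)) (at 0)"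
    by (auto intro!: derivative_eq_intros)
  from has_derivative_compose[OF this, of f f'] assms
  have "((\<lambda>h. f (z + h *\<^sub>R e)) has_derivative (\<lambda>h. f' (h *\<^sub>R e))) (at 0)" by simp
  then show ?thesis
    by (simp add: has_line_deriv_def has_field_derivative_def scaleR mult_commute_abs)
qed

text \<open>The correlation of a kernel with a function, that is, the convolution with the reflected kernel. With
  this convention one notion covers both mollification, where the kernel is even, and the potentials of
  the backward heat operator, in which the value at a point is determined by the future.\<close>
definition corr :: "('a::euclidean_space \<Rightarrow> real) \<Rightarrow> ('a \<Rightarrow> real) \<Rightarrow> 'a \<Rightarrow> real" where
  "corr \<kappa> F z = (LINT y|lborel. \<kappa> y * F (z + y))"

lemma corr_shift:
  assumes "\<kappa> \<in> borel_measurable borel" "F \<in> borel_measurable borel"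
  shows "corr \<kappa> F z = (LINT y|lborel. F y * \<kappa> (y - z))"
  unfolding corr_def using assms
  by (subst lborel_integral_shift[of "\<lambda>y. F y * \<kappa> (y - z)" z, symmetric]) (simp_all add: mult.commute)

lemma integrable_bounded_mult:
  assumes "integrable M w" "\<phi> \<in> borel_measurable M" "\<And>y. \<bar>\<phi> y\<bar> \<le> (B::real)"
  shows "integrable M (\<lambda>y. w y * \<phi> y)"
proof (rule Bochner_Integration.integrable_bound[of _ "\<lambda>y. B * w y"])
  show "integrable M (\<lambda>y. B * w y)" using assms by auto
  show "AE x in M. norm (w x * \<phi> x) \<le> norm (B * w x)"
  proof (rule AE_I2)
    fix x have "\<bar>\<phi> x\<bar> \<le> \<bar>B\<bar>" using assms(3)[of x] by linarith
    then show "norm (w x * \<phi> x) \<le> norm (B * w x)"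
      using mult_left_mono[of "\<bar>\<phi> x\<bar>" "\<bar>B\<bar>" "\<bar>w x\<bar>"] by (simp add: abs_mult mult.commute)
  qed
qed (use assms in auto)

text \<open>The derivative falls on the regular factor, so an integrable kernel suffices. This is the case of heat
  potentials.\<close>
lemma corr_ld_right:
  fixes \<kappa> \<phi> \<phi>' :: "'a::euclidean_space \<Rightarrow> real"
  assumes \<kappa>: "integrable lborel \<kappa>"
    and \<phi>: "\<phi> \<in> borel_measurable borel" "\<And>z. \<bar>\<phi> z\<bar> \<le> B0"
    and \<phi>': "\<phi>' \<in> borel_measurable borel" "\<And>z. \<bar>\<phi>' z\<bar> \<le> B"
    and D: "\<And>z. has_line_deriv \<phi> e (\<phi>' z) z"
  shows "has_line_deriv (corr \<kappa> \<phi>) e (corr \<kappa> \<phi>' z) z"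
proof -
  have [measurable]: "\<kappa> \<in> borel_measurable borel" using \<kappa> by (simp add: borel_measurable_integrable)
  note [measurable] = \<phi>(1) \<phi>'(1)
  have "((\<lambda>h. LINT y|lborel. \<kappa> y * \<phi> (z + y + h *\<^sub>R e)) has_real_derivative
     (LINT y|lborel. \<kappa> y * \<phi>' (z + y + 0 *\<^sub>R e))) (at 0)"
  proof (rule diff_under_integral[where \<delta>=1 and B=B, OF \<kappa>])
    show "((\<lambda>h. \<phi> (z + y + h *\<^sub>R e)) has_real_derivative \<phi>' (z + y + h *\<^sub>R e)) (at h)" for y h
      by (rule has_line_deriv_along[OF D])
    show "integrable lborel (\<lambda>y. \<kappa> y * \<phi> (z + y + h *\<^sub>R e))" for h
      by (rule integrable_bounded_mult[OF \<kappa> _ \<phi>(2)]) measurable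
  qed (use \<phi>'(2) in auto)
  then show ?thesis by (simp add: has_line_deriv_def corr_def algebra_simps)
qed

lemma corr_moll_local:
  fixes F :: "'a::euclidean_space \<Rightarrow> real"
  assumes \<epsilon>: "\<epsilon> > 0" and F: "F \<in> borel_measurable borel" and S: "cball z \<epsilon> \<subseteq> S"
  shows "corr (mollD \<epsilon> es) F z = (LINT y|lborel. (indicator S y * F y) * mollD \<epsilon> es (y - z))"
proof -
  have "F y * mollD \<epsilon> es (y - z) = (indicator S y * F y) * mollD \<epsilon> es (y - z)" for y
  proof (cases "y \<in> S")
    case False
    then have "y \<notin> cball z \<epsilon>" using S by blast
    then have "norm (y - z) > \<epsilon>" by (simp add: dist_norm norm_minus_commute)
    then show ?thesis using mollD_basic(2)[OF \<epsilon>, of es] by (simp add: vanishes_off_def)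
  qed simp
  then show ?thesis
    unfolding corr_shift[OF mollD_basic(5)[OF \<epsilon>, of es] F, of z]
    by (intro Bochner_Integration.integral_cong refl)
qed

lemma mollD_bound: assumes "\<epsilon> > 0" shows "\<exists>B\<ge>0. \<forall>z::'a::euclidean_space. \<bar>mollD \<epsilon> es z\<bar> \<le> B"
proof -
  obtain B where B: "\<And>z::'a. \<bar>mollD \<epsilon> es z\<bar> \<le> B"
    using mollD_basic(4)[OF assms, of es] unfolding bounded_iff by auto
  moreover have "B \<ge> 0" using B[of 0] by linarith
  ultimately show ?thesis by blast
qed

text \<open>The derivative falls on the mollifier, so integrability of \<open>F\<close> near the point suffices. The
  new sign comes from the shift of the mollifier to \<open>z\<close>.\<close>
lemma corr_moll_ld:
  fixes F :: "'a::euclidean_space \<Rightarrow> real"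
  assumes \<epsilon>: "\<epsilon> > 0" and r: "r > \<epsilon>" and F: "F \<in> borel_measurable borel"
    and i: "integrable lborel (\<lambda>y. indicator (cball z r) y * F y)"
  shows "has_line_deriv (corr (mollD \<epsilon> es) F) e (- corr (mollD \<epsilon> (e # es)) F z) z"
proof -
  define \<delta> where "\<delta> = (r - \<epsilon>) / (1 + norm e)"
  have \<delta>: "\<delta> > 0" using r add_pos_nonneg[of 1 "norm e"] by (simp add: \<delta>_def)
  have sub: "cball (z + h *\<^sub>R e) \<epsilon> \<subseteq> cball z r" if "\<bar>h\<bar> < \<delta>" for h
  proof -
    have "\<bar>h\<bar> * norm e \<le> \<bar>h\<bar> * (1 + norm e)" by (simp add: mult_left_mono)
    also have "\<dots> \<le> \<delta> * (1 + norm e)" using that by (intro mult_right_mono) auto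
    also have "\<dots> = r - \<epsilon>" using add_pos_nonneg[of 1 "norm e"] by (simp add: \<delta>_def)
    finally show ?thesis by (subst cball_subset_cball_iff) (auto simp: dist_norm)
  qed
  note [measurable] = F mollD_basic(5)[OF \<epsilon>]
  obtain B0 B where B: "\<And>y. \<bar>mollD \<epsilon> es (y::'a)\<bar> \<le> B0" "\<And>y. \<bar>mollD \<epsilon> (e # es) y\<bar> \<le> B"
    using mollD_bound[OF \<epsilon>, of es] mollD_bound[OF \<epsilon>, of "e # es"] by blast
  let ?w = "\<lambda>y. indicator (cball z r) y * F y"
  let ?I = "\<lambda>h. LINT y|lborel. ?w y * mollD \<epsilon> es (y - z - h *\<^sub>R e)"
  have "(?I has_real_derivative
     (LINT y|lborel. ?w y * (- mollD \<epsilon> (e # es) (y - z - 0 *\<^sub>R e)))) (at 0)"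
  proof (rule diff_under_integral[where B=B, OF i \<delta>])
    show "((\<lambda>h. mollD \<epsilon> es (y - z - h *\<^sub>R e)) has_real_derivative - mollD \<epsilon> (e # es) (y - z - h *\<^sub>R e)) (at h)" for y h
    proof -
      have "((\<lambda>k. mollD \<epsilon> es ((y - z) + k *\<^sub>R e)) has_real_derivative mollD \<epsilon> (e # es) (y - z + (- h) *\<^sub>R e)) (at (- h))"
        by (rule has_line_deriv_along[OF has_derivative_imp_has_line_deriv[OF mollD_deriv]])
      then have "((\<lambda>k. mollD \<epsilon> es ((y - z) + (- k) *\<^sub>R e)) has_real_derivative
          mollD \<epsilon> (e # es) (y - z + (- h) *\<^sub>R e) * (-1)) (at h)"
        by (rule DERIV_chain2) (auto intro!: derivative_eq_intros)
      then show ?thesis by simp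
    qed
    show "integrable lborel (\<lambda>y. ?w y * mollD \<epsilon> es (y - z - h *\<^sub>R e))" for h
      by (rule integrable_bounded_mult[OF i _ B(1)]) measurable
    show "(\<lambda>y. ?w y * (- mollD \<epsilon> (e # es) (y - z - 0 *\<^sub>R e))) \<in> borel_measurable lborel"
      by (intro borel_measurable_times borel_measurable_integrable[OF i]) measurable
  qed (use B in auto)
  then have 1: "(?I has_real_derivative - corr (mollD \<epsilon> (e # es)) F z) (at 0)"
    using corr_moll_local[OF \<epsilon> F sub[of 0], of "e # es"] \<delta> by simp
  have "\<forall>\<^sub>F h in nhds 0. corr (mollD \<epsilon> es) F (z + h *\<^sub>R e) = ?I h"
  proof (rule eventually_mono[OF eventually_nhds_in_open[of "{-\<delta><..<\<delta>}"]])
    fix h assume "h \<in> {-\<delta><..<\<delta>}"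
    then show "corr (mollD \<epsilon> es) F (z + h *\<^sub>R e) = ?I h"
      using corr_moll_local[OF \<epsilon> F sub[of h], of es] by (simp add: algebra_simps abs_less_iff)
  qed (use \<delta> in auto)
  then show ?thesis
    unfolding has_line_deriv_def using 1 by (subst DERIV_cong_ev[OF refl _ refl]) auto
qed

lemma corr_moll_isCont:
  fixes F :: "'a::euclidean_space \<Rightarrow> real"
  assumes \<epsilon>: "\<epsilon> > 0" and r: "r > \<epsilon>" and F: "F \<in> borel_measurable borel"
    and i: "integrable lborel (\<lambda>y. indicator (cball z r) y * F y)"
  shows "isCont (corr (mollD \<epsilon> es) F) z"
proof -
  note [measurable] = F mollD_basic(5)[OF \<epsilon>]
  obtain B where B: "\<And>y. \<bar>mollD \<epsilon> es (y::'a)\<bar> \<le> B"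
    using mollD_bound[OF \<epsilon>, of es] by blast
  let ?w = "\<lambda>y. indicator (cball z r) y * F y"
  have 1: "isCont (\<lambda>z'. LINT y|lborel. ?w y * mollD \<epsilon> es (y - z')) z"
  proof (rule cont_under_integral[OF i])
    show "isCont (\<lambda>z'. mollD \<epsilon> es (y - z')) z" for y
    proof (rule isCont_o2[where f="\<lambda>z'. y - z'"])
      show "isCont (mollD \<epsilon> es) (y - z)"
        using mollD_basic(1)[OF \<epsilon>, of es] by (simp add: continuous_on_eq_continuous_at)
    qed (intro continuous_intros)
    show "(\<lambda>y. ?w y * mollD \<epsilon> es (y - z')) \<in> borel_measurable lborel" for z'
      by measurable
  qed (use B in auto)
  have "\<forall>\<^sub>F z' in nhds z. corr (mollD \<epsilon> es) F z' = (LINT y|lborel. ?w y * mollD \<epsilon> es (y - z'))"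
  proof (rule eventually_mono[OF eventually_nhds_in_open[of "ball z (r - \<epsilon>)"]])
    fix z' assume "z' \<in> ball z (r - \<epsilon>)"
    then have "cball z' \<epsilon> \<subseteq> cball z r" by (subst cball_subset_cball_iff) (auto simp: dist_commute)
    from corr_moll_local[OF \<epsilon> F this]
    show "corr (mollD \<epsilon> es) F z' = (LINT y|lborel. ?w y * mollD \<epsilon> es (y - z'))" .
  qed (use r in auto)
  from isCont_cong[OF this] 1 show ?thesis by blast
qed

text \<open>Fubini's theorem and the commutativity of addition.\<close>
lemma corr_swap:
  fixes \<kappa> \<rho> F :: "'a::euclidean_space \<Rightarrow> real"
  assumes \<kappa>: "integrable lborel \<kappa>" and \<rho>: "integrable lborel \<rho>"
    and F: "F \<in> borel_measurable borel" "\<And>z. \<bar>F z\<bar> \<le> B"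
  shows "corr \<kappa> (corr \<rho> F) z = corr \<rho> (corr \<kappa> F) z"
proof -
  have [measurable]: "\<kappa> \<in> borel_measurable borel" "\<rho> \<in> borel_measurable borel"
    using \<kappa> \<rho> by (simp_all add: borel_measurable_integrable)
  note [measurable] = F(1)
  have i: "integrable lborel (\<lambda>y'. c * (w y' * F (a + y')))" if "integrable lborel w" for c a and w :: "'a \<Rightarrow> real"
    using that by (intro integrable_mult_right integrable_bounded_mult[OF _ _ F(2)]) auto
  let ?f = "\<lambda>(y, y'). \<kappa> y * (\<rho> y' * F (z + y + y'))"
  have int: "integrable (lborel \<Otimes>\<^sub>M lborel) ?f"
  proof (rule lborel_pair.Fubini_integrable)
    show "AE y in lborel. integrable lborel (\<lambda>y'. ?f (y, y'))"
      using i[OF \<rho>] by auto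
    show "integrable lborel (\<lambda>y. LINT y'|lborel. norm (?f (y, y')))"
    proof (rule Bochner_Integration.integrable_bound)
      show "integrable lborel (\<lambda>y. (LINT y'|lborel. \<bar>\<rho> y'\<bar> * B) * \<bar>\<kappa> y\<bar>)" using \<kappa> by auto
      have B: "\<bar>B\<bar> = B" using F(2)[of 0] by linarith
      have le: "(LINT y'|lborel. norm (?f (y, y'))) \<le> (LINT y'|lborel. \<bar>\<rho> y'\<bar> * B) * \<bar>\<kappa> y\<bar>" for y
      proof -
        have "(LINT y'|lborel. norm (?f (y, y'))) \<le> (LINT y'|lborel. (\<bar>\<rho> y'\<bar> * B) * \<bar>\<kappa> y\<bar>)"
        proof (rule integral_mono)
          show "integrable lborel (\<lambda>y'. norm (?f (y, y')))"
            using integrable_norm[OF i[OF \<rho>, of "\<kappa> y" "z + y"]] by simp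
          show "integrable lborel (\<lambda>y'. (\<bar>\<rho> y'\<bar> * B) * \<bar>\<kappa> y\<bar>)" using \<rho> by auto
          show "norm (?f (y, y')) \<le> (\<bar>\<rho> y'\<bar> * B) * \<bar>\<kappa> y\<bar>" for y'
            using mult_left_mono[OF F(2)[of "z + y + y'"], of "\<bar>\<kappa> y\<bar> * \<bar>\<rho> y'\<bar>"]
            by (simp add: abs_mult ac_simps)
        qed
        then show ?thesis by simp
      qed
      show "AE y in lborel. norm (LINT y'|lborel. norm (?f (y, y'))) \<le> norm ((LINT y'|lborel. \<bar>\<rho> y'\<bar> * B) * \<bar>\<kappa> y\<bar>)"
      proof (rule AE_I2)
        fix y
        have "(LINT y'|lborel. norm (?f (y, y'))) \<ge> 0" by simp
        with le[of y] show "norm (LINT y'|lborel. norm (?f (y, y'))) \<le> norm ((LINT y'|lborel. \<bar>\<rho> y'\<bar> * B) * \<bar>\<kappa> y\<bar>)"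
          unfolding real_norm_def by linarith
      qed
    qed measurable
  qed measurable
  have "corr \<kappa> (corr \<rho> F) z = (LINT y|lborel. LINT y'|lborel. ?f (y, y'))"
    by (simp add: corr_def)
  also have "\<dots> = (LINT y'|lborel. LINT y|lborel. ?f (y, y'))"
    using lborel_pair.Fubini_integral[OF int] by simp
  also have "\<dots> = (LINT y'|lborel. \<rho> y' * corr \<kappa> F (z + y'))"
  proof (rule Bochner_Integration.integral_cong[OF refl])
    fix y'
    show "(LINT y|lborel. ?f (y, y')) = \<rho> y' * corr \<kappa> F (z + y')"
      unfolding corr_def integral_mult_right_zero[symmetric]
      by (intro Bochner_Integration.integral_cong refl) (simp add: ac_simps)
  qed
  also have "\<dots> = corr \<rho> (corr \<kappa> F) z"
    by (simp add: corr_def)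
  finally show ?thesis .
qed

section \<open>Convexity of powers\<close>

text \<open>The graph of a convex function lies above its tangent at \<open>m\<close>.\<close>
lemma powr_tangent:
  fixes a m s :: real
  assumes "s \<ge> 1" "a \<ge> 0" "m > 0"
  shows "m powr s + s * m powr (s - 1) * (a - m) \<le> a powr s"
proof (cases "a = 0")
  case True
  have "m powr (s - 1) * m = m powr s"
    using assms(3) by (simp add: powr_diff)
  then show ?thesis using True assms
    by (simp add: algebra_simps)
next
  case False
  then have a: "a > 0" using assms by simp
  have "((\<lambda>x. x powr s) has_real_derivative (s * m powr (s - 1))) (at m within {0<..})"
    using assms by (auto intro!: derivative_eq_intros simp: has_field_derivative_at_within powr_diff field_simps)
  from convex_on_imp_above_tangent[OF powr_convex[OF assms(1)] _ _ _ this, of a] a assms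
  have "a powr s - m powr s \<ge> s * m powr (s - 1) * (a - m)"
    by (simp add: convex_connected interior_open)
  then show ?thesis by simp
qed

lemma powr_mult_split:
  fixes a \<theta> s :: real assumes "\<theta> > 0" "a \<ge> 0"
  shows "\<theta> * (a / \<theta>) powr s = \<theta> powr (1 - s) * a powr s"
  using assms by (simp add: powr_divide powr_diff)

text \<open>Jensen's inequality for the two points \<open>a / \<theta>\<close> and \<open>b / \<eta>\<close> with
  weights \<open>\<theta>\<close> and \<open>\<eta>\<close>. Unlike the usual bound with the factor
  \<open>2 powr s\<close>, the factor in front of \<open>a powr s\<close> may be taken as close to
  \<open>1\<close> as desired. Both the commutator estimate and the comparison argument live on this.\<close>
lemma powr_split2:
  fixes a b \<theta> s :: real
  assumes s: "s \<ge> 1" and ab: "a \<ge> 0" "b \<ge> 0" and \<theta>: "0 < \<theta>" "0 < \<eta>" "\<theta> + \<eta> = 1"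
  shows "(a + b) powr s \<le> \<theta> powr (1 - s) * a powr s + \<eta> powr (1 - s) * b powr s"
proof (cases "a + b = 0")
  case True
  then show ?thesis using ab by simp
next
  case False
  define m where "m = a + b"
  have m: "m > 0" using False ab by (simp add: m_def)
  have "\<theta> * (m powr s + s * m powr (s - 1) * (a / \<theta> - m)) + \<eta> * (m powr s + s * m powr (s - 1) * (b / \<eta> - m))
      \<le> \<theta> * (a / \<theta>) powr s + \<eta> * (b / \<eta>) powr s"
    using ab \<theta> m s by (intro add_mono mult_left_mono powr_tangent) auto
  also have "\<theta> * (m powr s + s * m powr (s - 1) * (a / \<theta> - m)) + \<eta> * (m powr s + s * m powr (s - 1) * (b / \<eta> - m))
      = (\<theta> + \<eta>) * m powr s + s * m powr (s - 1) * (a + b - (\<theta> + \<eta>) * m)"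
  proof -
    have eq: "\<theta> * (a / \<theta> - m) = a - \<theta> * m" "\<eta> * (b / \<eta> - m) = b - \<eta> * m"
      using \<theta> by (simp_all add: field_simps)
    have gen: "\<theta> * (p + k * x) + \<eta> * (p + k * y) = (\<theta> + \<eta>) * p + k * (\<theta> * x + \<eta> * y)" for p k x y :: real
      by (simp add: algebra_simps)
    show ?thesis unfolding gen eq by (simp add: algebra_simps)
  qed
  finally show ?thesis
    using \<theta> ab by (simp add: powr_mult_split m_def)
qed

lemma powr_split_half:
  fixes a b s :: real
  assumes "s \<ge> 1" "a \<ge> 0" "b \<ge> 0"
  shows "(a + b) powr s \<le> 2 powr s * (a powr s + b powr s)"
proof -
  have "(a + b) powr s \<le> (1/2) powr (1 - s) * a powr s + (1/2) powr (1 - s) * b powr s"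
    by (rule powr_split2[OF assms]) auto
  also have "(1/2::real) powr (1 - s) = 2 powr (s - 1)"
    by (simp add: powr_divide powr_minus_divide powr_diff)
  also have "2 powr (s - 1) * a powr s + 2 powr (s - 1) * b powr s = 2 powr (s - 1) * (a powr s + b powr s)"
    by (simp add: algebra_simps)
  also have "\<dots> \<le> 2 powr s * (a powr s + b powr s)"
    by (intro mult_right_mono powr_mono) auto
  finally show ?thesis .
qed

text \<open>The tangent inequality at the mean, integrated against the probability density \<rho>.\<close>
lemma jensen_powr:
  fixes \<rho> Y :: "'a \<Rightarrow> real"
  assumes s: "s \<ge> 1" and \<rho>: "integrable M \<rho>" "\<And>y. \<rho> y \<ge> 0" "(LINT y|M. \<rho> y) = 1"
    and Y: "\<And>y. Y y \<ge> 0" "integrable M (\<lambda>y. \<rho> y * Y y)" "integrable M (\<lambda>y. \<rho> y * Y y powr s)"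
  shows "(LINT y|M. \<rho> y * Y y) powr s \<le> (LINT y|M. \<rho> y * Y y powr s)"
proof -
  define m where "m = (LINT y|M. \<rho> y * Y y)"
  have "m \<ge> 0" unfolding m_def using \<rho> Y by simp
  show ?thesis
  proof (cases "m = 0")
    case True
    then show ?thesis using \<rho> Y by (simp add: m_def)
  next
    case False
    then have m: "m > 0" using \<open>m \<ge> 0\<close> by simp
    let ?c = "s * m powr (s - 1)"
    have i: "integrable M (\<lambda>y. (m powr s - ?c * m) * \<rho> y + ?c * (\<rho> y * Y y))"
      using \<rho> Y by auto
    have "(m powr s - ?c * m) * 1 + ?c * m =
       (LINT y|M. (m powr s - ?c * m) * \<rho> y + ?c * (\<rho> y * Y y))"
      using \<rho> Y by (subst Bochner_Integration.integral_add) (auto simp: m_def)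
    also have "\<dots> \<le> (LINT y|M. \<rho> y * Y y powr s)"
    proof (rule integral_mono[OF i Y(3)])
      fix y
      have "\<rho> y * (m powr s + ?c * (Y y - m)) \<le> \<rho> y * Y y powr s"
        using powr_tangent[OF s Y(1) m] \<rho>(2) by (intro mult_left_mono) auto
      then show "(m powr s - ?c * m) * \<rho> y + ?c * (\<rho> y * Y y) \<le> \<rho> y * Y y powr s"
        by (simp add: algebra_simps)
    qed
    finally show ?thesis by (simp add: m_def)
  qed
qed

section \<open>Weak derivatives and mollification\<close>

text \<open>Exhaust the open set by compact sets and pass to the limit.\<close>
lemma locally_integrable_measurable:
  fixes X :: "'a::euclidean_space set"
  assumes X: "open X" and w: "locally_integrable X w"
  shows "(\<lambda>z. indicator X z * w z) \<in> borel_measurable lebesgue"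
proof -
  obtain C where C: "\<And>n::nat. compact (C n)" "\<And>n. C n \<subseteq> X" "\<And>n. C n \<subseteq> interior (C (Suc n))"
    "\<Union>(range C) = X"
    using open_Union_compact_subsets[OF X] by metis
  have inc: "C m \<subseteq> C n" if "m \<le> n" for m n
    using that C(3) interior_subset by (meson lift_Suc_mono_le order_trans)
  show ?thesis
  proof (rule borel_measurable_LIMSEQ_real)
    fix n
    have "integrable (lebesgue_on (C n)) w" using w C by (auto simp: locally_integrable_def)
    then have "w \<in> borel_measurable (lebesgue_on (C n))" by (rule borel_measurable_integrable)
    moreover have "C n \<in> sets lebesgue" using C(1) by (intro sets_completionI_sets) (auto intro: borel_compact)
    ultimately have "(\<lambda>x. indicator (C n) x *\<^sub>R w x) \<in> borel_measurable lebesgue"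
      by (subst (asm) borel_measurable_restrict_space_iff) auto
    then show "(\<lambda>z. indicator (C n) z * w z) \<in> borel_measurable lebesgue" by simp
  next
    fix z
    show "(\<lambda>n. indicator (C n) z * w z) \<longlonglongrightarrow> indicator X z * w z"
    proof (cases "z \<in> X")
      case True
      then obtain m where m: "z \<in> C m" using C(4) by blast
      have "\<forall>\<^sub>F n in sequentially. indicator (C n) z * w z = indicator X z * w z"
        by (rule eventually_mono[OF eventually_ge_at_top[of m]]) (use inc m True in \<open>auto simp: indicator_def\<close>)
      then show ?thesis by (rule tendsto_eventually)
    next
      case False
      then have "z \<notin> C n" for n using C(2) by blast
      with False show ?thesis by simp
    qed
  qed
qed

text \<open>Local integrability for Borel functions with respect to \<open>lborel\<close>. Translations and Fubini's
  theorem are available for this measure, but not for the Lebesgue measurable functions of the weak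
  derivatives, which are therefore replaced by representatives.\<close>
definition loc_int :: "'a::euclidean_space set \<Rightarrow> ('a \<Rightarrow> real) \<Rightarrow> bool" where
  "loc_int X F \<longleftrightarrow> F \<in> borel_measurable borel \<and>
     (\<forall>K. compact K \<and> K \<subseteq> X \<longrightarrow> integrable lborel (\<lambda>y. indicator K y * F y))"

definition borel_rep :: "'a::euclidean_space set \<Rightarrow> ('a \<Rightarrow> real) \<Rightarrow> ('a \<Rightarrow> real) \<Rightarrow> bool" where
  "borel_rep X w w' \<longleftrightarrow> loc_int X w' \<and> (AE z in lebesgue. z \<in> X \<longrightarrow> w z = w' z)"

lemma integral_lebesgue_on_eq:
  fixes X :: "'a::euclidean_space set"
  assumes X: "X \<in> sets borel" and f: "AE z in lebesgue. z \<in> X \<longrightarrow> f z = (g z :: real)"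
    and g: "g \<in> borel_measurable borel" and m: "(\<lambda>z. indicator X z * f z) \<in> borel_measurable lebesgue"
  shows "(LINT z|lebesgue_on X. f z) = (LINT z|lborel. indicator X z * g z)"
    and "integrable (lebesgue_on X) f \<longleftrightarrow> integrable lborel (\<lambda>z. indicator X z * g z)"
proof -
  have X': "X \<in> sets lebesgue" "X \<inter> space lebesgue \<in> sets lebesgue" using X by auto
  have gm: "(\<lambda>z. indicator X z * g z) \<in> borel_measurable lborel" using X g by measurable
  then have gm': "(\<lambda>z. indicator X z * g z) \<in> borel_measurable lebesgue" by (rule measurable_completion)
  have ae: "AE z in lebesgue. indicator X z * f z = indicator X z * g z"
    using f by eventually_elim (auto simp: indicator_def)
  have "(LINT z|lebesgue_on X. f z) = (LINT z|lebesgue. indicator X z * f z)"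
    by (subst integral_restrict_space[OF X'(2)]) simp
  also have "\<dots> = (LINT z|lebesgue. indicator X z * g z)"
    by (rule integral_cong_AE[OF m gm' ae])
  also have "\<dots> = (LINT z|lborel. indicator X z * g z)" by (rule integral_completion[OF gm])
  finally show "(LINT z|lebesgue_on X. f z) = (LINT z|lborel. indicator X z * g z)" .
  have "integrable (lebesgue_on X) f \<longleftrightarrow> integrable lebesgue (\<lambda>z. indicator X z * f z)"
    by (subst integrable_restrict_space[OF X'(2)]) simp
  also have "\<dots> \<longleftrightarrow> integrable lebesgue (\<lambda>z. indicator X z * g z)"
    by (rule integrable_cong_AE[OF m gm' ae])
  also have "\<dots> \<longleftrightarrow> integrable lborel (\<lambda>z. indicator X z * g z)" by (rule integrable_completion[OF gm])
  finally show "integrable (lebesgue_on X) f \<longleftrightarrow> integrable lborel (\<lambda>z. indicator X z * g z)" .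
qed

lemma AE_eq_measurable:
  fixes X :: "'a::euclidean_space set"
  assumes "AE z in lebesgue. z \<in> X \<longrightarrow> f z = (g z :: real)" "X \<in> sets borel" "g \<in> borel_measurable borel"
  shows "(\<lambda>z. indicator X z * f z) \<in> borel_measurable lebesgue"
proof -
  have "(\<lambda>z. indicator X z * g z) \<in> borel_measurable lborel" using assms by measurable
  then have m: "(\<lambda>z. indicator X z * g z) \<in> borel_measurable lebesgue" by (rule measurable_completion)
  show ?thesis
  proof (rule measurableI)
    fix A :: "real set" assume A: "A \<in> sets borel"
    show "(\<lambda>z. indicator X z * f z) -` A \<inter> space lebesgue \<in> sets lebesgue"
    proof (rule completion.in_sets_AE)
      show "(\<lambda>z. indicator X z * g z) -` A \<inter> space lebesgue \<in> sets lebesgue"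
        by (rule measurable_sets[OF m A])
      show "AE x in lebesgue. (x \<in> (\<lambda>z. indicator X z * g z) -` A \<inter> space lebesgue) =
         (x \<in> (\<lambda>z. indicator X z * f z) -` A \<inter> space lebesgue)"
        using assms(1) by eventually_elim (auto simp: indicator_def)
    qed auto
  qed auto
qed

text \<open>Lebesgue measurable functions agree almost everywhere with Borel functions.\<close>
lemma borel_rep_exists:
  fixes X :: "'a::euclidean_space set"
  assumes X: "open X" and w: "locally_integrable X w"
  shows "\<exists>w'. borel_rep X w w' \<and> (\<forall>z. z \<notin> X \<longrightarrow> w' z = 0)"
proof -
  have m: "(\<lambda>z. indicator X z * w z) \<in> borel_measurable lebesgue"
    by (rule locally_integrable_measurable[OF X w])
  obtain g where g: "g \<in> borel_measurable lborel" "AE z in lborel. indicator X z * w z = g z"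
    using completion_ex_borel_measurable_real[OF m] by blast
  define w' where "w' z = indicator X z * g z" for z
  have w'm: "w' \<in> borel_measurable borel" unfolding w'_def[abs_def] using g(1) borel_open[OF X] by (intro borel_measurable_times) auto
  have ae: "AE z in lebesgue. z \<in> X \<longrightarrow> w z = w' z"
    using AE_completion[OF g(2)] by eventually_elim (auto simp: w'_def)
  have "integrable lborel (\<lambda>y. indicator K y * w' y)" if K: "compact K" "K \<subseteq> X" for K
  proof -
    have K': "K \<in> sets borel" using K by (auto intro: borel_compact)
    have aeK: "AE z in lebesgue. z \<in> K \<longrightarrow> w z = w' z" using ae K by (auto elim: eventually_mono)
    show ?thesis
      using integral_lebesgue_on_eq(2)[OF K' aeK w'm AE_eq_measurable[OF aeK K' w'm]] w K
      by (auto simp: locally_integrable_def)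
  qed
  with w'm ae show ?thesis
    unfolding borel_rep_def loc_int_def by (intro exI[of _ w']) (auto simp: w'_def)
qed

text \<open>The definition of the weak derivative, read with the shifted mollifier as test function. The relation
  between \<open>u\<close> and its weak derivatives is used in this form only.\<close>
lemma weak_deriv_corr:
  fixes X :: "'a::euclidean_space set"
  assumes X: "open X" and wd: "has_weak_deriv X es u w"
    and u: "borel_rep X u u'" and w: "borel_rep X w w'" and \<epsilon>: "\<epsilon> > 0" "cball z \<epsilon> \<subseteq> X"
  shows "corr (mollD \<epsilon> es) u' z = (- 1) ^ length es * corr (moll \<epsilon>) w' z"
proof -
  have Xb: "X \<in> sets borel" using X by simp
  have *: "(LINT y|lebesgue_on X. f y * mollD \<epsilon> ds (y - z)) = corr (mollD \<epsilon> ds) f' z"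
    if "borel_rep X f f'" for f f' ds
  proof -
    have f': "f' \<in> borel_measurable borel" "AE y in lebesgue. y \<in> X \<longrightarrow> f y = f' y"
      using that by (auto simp: borel_rep_def loc_int_def)
    note [measurable] = f'(1) mollD_basic(5)[OF \<epsilon>(1), of ds]
    have 1: "(\<lambda>y. f' y * mollD \<epsilon> ds (y - z)) \<in> borel_measurable borel" by measurable
    have 2: "AE y in lebesgue. y \<in> X \<longrightarrow> f y * mollD \<epsilon> ds (y - z) = f' y * mollD \<epsilon> ds (y - z)"
      using f'(2) by (auto elim: eventually_mono)
    show ?thesis
      using integral_lebesgue_on_eq(1)[OF Xb 2 1 AE_eq_measurable[OF 2 Xb 1]]
        corr_moll_local[OF \<epsilon>(1) f'(1) \<epsilon>(2), of ds] by (simp add: mult.assoc)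
  qed
  have "(LINT y|lebesgue_on X. u y * iter_deriv es (\<lambda>y. moll \<epsilon> (y - z)) y)
      = (- 1) ^ length es * (LINT y|lebesgue_on X. w y * moll \<epsilon> (y - z))"
    using wd test_function_moll[OF \<epsilon>] by (simp add: has_weak_deriv_def)
  then show ?thesis
    using *[OF u, of es] *[OF w, of "[]"] by (simp add: iter_deriv_moll_shift mollD_Nil)
qed

section \<open>Continuity of translations in Lebesgue spaces\<close>

text \<open>Measurable functions are almost everywhere limits of continuous functions; truncation at the levels
  \<open>- M\<close> and \<open>M\<close> keeps the bound.\<close>
lemma continuous_bounded_approx:
  fixes f :: "'a::euclidean_space \<Rightarrow> real"
  assumes f: "f \<in> borel_measurable borel" "\<And>x. \<bar>f x\<bar> \<le> M"
  shows "\<exists>g. (\<forall>n::nat. continuous_on UNIV (g n)) \<and> (\<forall>n x. \<bar>g n x\<bar> \<le> M) \<and>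
     (AE x in lborel. (\<lambda>n. g n x) \<longlonglongrightarrow> f x)"
proof -
  have M: "M \<ge> 0" using f(2)[of 0] by linarith
  have "f \<in> borel_measurable lborel" using f(1) by simp
  then have "f \<in> borel_measurable (lebesgue_on UNIV)"
    by (metis lebesgue_on_UNIV_eq measurable_completion)
  then have "f measurable_on UNIV" by (intro lebesgue_measurable_imp_measurable_on) auto
  then obtain N g where N: "negligible N" and g: "\<And>n::nat. continuous_on UNIV (g n)"
    and lim: "\<And>x. x \<notin> N \<Longrightarrow> (\<lambda>n. g n x) \<longlonglongrightarrow> f x"
    unfolding measurable_on_def by auto
  let ?h = "\<lambda>n x. max (- M) (min M (g n x))"
  have "AE x in lebesgue. x \<notin> N"
    using N by (simp add: AE_not_in negligible_iff_null_sets)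
  then have "AE x in lborel. x \<notin> N" by (simp add: AE_completion_iff)
  then have "AE x in lborel. (\<lambda>n. ?h n x) \<longlonglongrightarrow> f x"
  proof eventually_elim
    case (elim x)
    have "(\<lambda>n. ?h n x) \<longlonglongrightarrow> max (- M) (min M (f x))"
      by (intro tendsto_intros lim elim)
    moreover have "max (- M) (min M (f x)) = f x" using f(2)[of x] by (auto simp: max_def min_def)
    ultimately show ?case by simp
  qed
  moreover have "continuous_on UNIV (?h n)" for n by (intro continuous_intros g)
  moreover have "\<bar>?h n x\<bar> \<le> M" for n x using M by (auto simp: max_def min_def)
  ultimately show ?thesis by (intro exI[of _ ?h]) auto
qed

text \<open>Uniform continuity settles the case of a continuous function on a large ball, and \<open>f\<close> is
  close to such a function in the mean by dominated convergence.\<close>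
lemma L1_translation_bounded:
  fixes f :: "'a::euclidean_space \<Rightarrow> real"
  assumes f: "f \<in> borel_measurable borel" "\<And>x. \<bar>f x\<bar> \<le> M" "\<And>x. norm x > R \<Longrightarrow> f x = 0" and e: "e > 0"
  shows "\<exists>\<delta>>0. \<forall>y. norm y < \<delta> \<longrightarrow> (LINT z|lborel. \<bar>f (z + y) - f z\<bar>) \<le> e"
proof -
  obtain g where g: "\<And>n::nat. continuous_on UNIV (g n)" "\<And>n x. \<bar>g n x\<bar> \<le> M"
     and lim: "AE x in lborel. (\<lambda>n. g n x) \<longlonglongrightarrow> f x"
    using continuous_bounded_approx[OF f(1,2)] by blast
  have gm [measurable]: "g n \<in> borel_measurable borel" for n
    by (rule borel_measurable_continuous_onI[OF g(1)])
  note [measurable] = f(1)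
  define K where "K = cball (0::'a) (R + 2)"
  have Km [measurable]: "K \<in> sets borel" by (simp add: K_def)
  have Ki: "integrable lborel (indicator K :: 'a \<Rightarrow> real)"
    unfolding K_def by (intro integrable_real_indicator emeasure_lborel_cball_finite) simp
  let ?d = "\<lambda>n z. indicator K z * \<bar>f z - g n z\<bar>"
  have fg: "\<bar>\<bar>f z - g n z\<bar>\<bar> \<le> 2 * M" for n z
    using f(2)[of z] g(2)[of n z] by linarith
  have di: "integrable lborel (?d n)" for n
    by (rule integrable_bounded_mult[OF Ki _ fg]) measurable
  have "(\<lambda>n. LINT z|lborel. ?d n z) \<longlonglongrightarrow> (LINT z|(lborel::'a measure). 0)"
  proof (rule integral_dominated_convergence[where w="\<lambda>z. indicator K z * (2 * M)"])
    show "integrable lborel (\<lambda>z. indicator K z * (2 * M))" using Ki by simp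
    show "AE z in lborel. (\<lambda>n. ?d n z) \<longlonglongrightarrow> 0"
      using lim
    proof eventually_elim
      case (elim z)
      have "(\<lambda>n. indicator K z * \<bar>f z - g n z\<bar>) \<longlonglongrightarrow> indicator K z * \<bar>f z - f z\<bar>"
        by (intro tendsto_intros elim)
      then show ?case by simp
    qed
    show "AE z in lborel. norm (?d n z) \<le> indicator K z * (2 * M)" for n
    proof (rule AE_I2)
      fix z show "norm (?d n z) \<le> indicator K z * (2 * M)"
        using f(2)[of z] g(2)[of n z] by (auto simp: indicator_def)
    qed
  qed (use di in \<open>auto dest: borel_measurable_integrable\<close>)
  then have "\<forall>\<^sub>F n in sequentially. dist (LINT z|lborel. ?d n z) 0 < e / 3"
    using e by (intro tendstoD) auto
  then obtain n where n: "\<bar>LINT z|lborel. ?d n z\<bar> < e / 3"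
    by (auto simp: eventually_sequentially)
  define V where "V = (LINT z|lborel. indicator K (z::'a) :: real)"
  have V: "V \<ge> 0" unfolding V_def by simp
  define \<eta> where "\<eta> = e / 3 / (V + 1)"
  have \<eta>: "\<eta> > 0" "\<eta> * V \<le> e / 3" using e V by (auto simp: \<eta>_def field_simps)
  have "uniformly_continuous_on K (g n)"
    by (rule compact_uniformly_continuous) (use g(1) in \<open>auto simp: K_def intro: continuous_on_subset\<close>)
  then obtain \<delta> where \<delta>: "\<delta> > 0" "\<And>x x'. x \<in> K \<Longrightarrow> x' \<in> K \<Longrightarrow> dist x' x < \<delta> \<Longrightarrow> dist (g n x') (g n x) < \<eta>"
    unfolding uniformly_continuous_on_def using \<eta>(1) by meson
  show ?thesis
  proof (intro exI[of _ "min \<delta> 1"] conjI allI impI)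
    show "0 < min \<delta> 1" using \<delta> by simp
    fix y :: 'a assume y: "norm y < min \<delta> 1"
    \<comment> \<open>Triangle inequality through the continuous approximation \<open>g n\<close>, whose values at
      \<open>z\<close> and \<open>z + y\<close> differ by at most \<eta>.\<close>
    let ?b = "\<lambda>z. ?d n (y + z) + (indicator K z * \<eta> + ?d n z)"
    have bi: "integrable lborel ?b"
      by (intro Bochner_Integration.integrable_add di lborel_integrable_shift[OF di]) (use Ki in auto)
    have le: "\<bar>f (z + y) - f z\<bar> \<le> ?b z" for z
    proof (cases "norm z \<le> R + 1")
      case True
      have "norm (z + y) \<le> R + 2" using True y norm_triangle_ineq[of z y] by linarith
      then have z: "z \<in> K" "z + y \<in> K" using True by (auto simp: K_def)
      have "dist (g n (z + y)) (g n z) < \<eta>" using z y by (intro \<delta>(2)) (auto simp: dist_norm)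
      then show ?thesis using z by (simp add: dist_real_def add.commute[of y z])
    next
      case False
      have "norm z \<le> norm (z + y) + norm y" using norm_triangle_ineq4[of "z + y" y] by simp
      then have "f z = 0" "f (z + y) = 0" using False y f(3) by (auto intro!: f(3))
      then show ?thesis using \<eta> by simp
    qed
    have "(LINT z|lborel. \<bar>f (z + y) - f z\<bar>) \<le> (LINT z|lborel. ?b z)"
    proof (rule integral_mono)
      show "integrable lborel (\<lambda>z. \<bar>f (z + y) - f z\<bar>)"
      proof (rule Bochner_Integration.integrable_bound[OF bi])
        show "AE z in lborel. norm \<bar>f (z + y) - f z\<bar> \<le> norm (?b z)"
          using le by (intro AE_I2) (metis abs_ge_self abs_idempotent order_trans real_norm_def)
      qed measurable
    qed (use bi le in auto)
    also have "\<dots> = (LINT z|lborel. ?d n (y + z)) + (V * \<eta> + (LINT z|lborel. ?d n z))"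
      using di lborel_integrable_shift[OF di, of y] Ki
      by (subst Bochner_Integration.integral_add | simp add: V_def)+
    also have "(LINT z|lborel. ?d n (y + z)) = (LINT z|lborel. ?d n z)"
      using lborel_integral_shift[of "?d n" y] by simp
    also have "\<dots> + (V * \<eta> + (LINT z|lborel. ?d n z)) \<le> e"
      using n \<eta>(2) by (simp add: mult.commute abs_less_iff)
    finally show "(LINT z|lborel. \<bar>f (z + y) - f z\<bar>) \<le> e" .
  qed
qed

lemma powr_split3:
  fixes a b c p :: real
  assumes "p \<ge> 1" "a \<ge> 0" "b \<ge> 0" "c \<ge> 0"
  shows "(a + b + c) powr p \<le> 2 powr p * 2 powr p * (a powr p + b powr p + c powr p)"
proof -
  have 1: "1 \<le> 2 powr p" using assms by (simp add: ge_one_powr_ge_zero)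
  have "(a + b + c) powr p \<le> 2 powr p * ((a + b) powr p + c powr p)"
    using assms by (intro powr_split_half) auto
  also have "\<dots> \<le> 2 powr p * (2 powr p * (a powr p + b powr p) + 2 powr p * c powr p)"
    using assms 1 mult_right_mono[OF 1, of "c powr p"]
    by (intro mult_left_mono add_mono powr_split_half) auto
  finally show ?thesis by (simp add: algebra_simps)
qed

text \<open>Truncate \<open>f\<close> in size and support. For the truncated function the \<open>p\<close>-th power
  of a difference is at most a constant times the difference, which reduces the claim to
  \<open>p = 1\<close>.\<close>
lemma Lp_translation:
  fixes f :: "'a::euclidean_space \<Rightarrow> real"
  assumes p: "p \<ge> 1" and f: "f \<in> borel_measurable borel" "integrable lborel (\<lambda>z. \<bar>f z\<bar> powr p)" and e: "e > 0"
  shows "\<exists>\<delta>>0. \<forall>y. norm y < \<delta> \<longrightarrow> (\<integral>\<^sup>+ z. ennreal (\<bar>f (z + y) - f z\<bar> powr p) \<partial>lborel) \<le> ennreal e"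
proof -
  note [measurable] = f(1)
  define F where "F n z = (if \<bar>f z\<bar> \<le> real n \<and> norm z \<le> real n then f z else 0)" for n :: nat and z
  have [measurable]: "F n \<in> borel_measurable borel" for n unfolding F_def by measurable
  define c where "c = (2::real) powr p * 2 powr p"
  have c: "c > 0" by (simp add: c_def)
  let ?d = "\<lambda>n z. \<bar>f z - F n z\<bar> powr p"
  have "(\<lambda>n. LINT z|lborel. ?d n z) \<longlonglongrightarrow> (LINT z|(lborel::'a measure). (0::real))"
  proof (rule integral_dominated_convergence[where w="\<lambda>z. \<bar>f z\<bar> powr p"])
    show "AE z in lborel. (\<lambda>n. ?d n z) \<longlonglongrightarrow> 0"
    proof (rule AE_I2)
      fix z
      obtain m :: nat where m: "max \<bar>f z\<bar> (norm z) \<le> real m" using real_arch_simple by blast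
      have "\<forall>\<^sub>F n in sequentially. ?d n z = 0"
        by (rule eventually_mono[OF eventually_ge_at_top[of m]]) (use m in \<open>auto simp: F_def\<close>)
      then show "(\<lambda>n. ?d n z) \<longlonglongrightarrow> 0" by (rule tendsto_eventually)
    qed
    show "AE z in lborel. norm (?d n z) \<le> \<bar>f z\<bar> powr p" for n by (auto simp: F_def)
  qed (use f(2) in auto)
  then have "\<forall>\<^sub>F n in sequentially. dist (LINT z|lborel. ?d n z) 0 < e / (3 * c)"
    using e c by (intro tendstoD) auto
  then obtain n where n: "\<bar>LINT z|lborel. ?d n z\<bar> < e / (3 * c)"
    by (auto simp: eventually_sequentially)
  have di: "integrable lborel (?d n)"
    by (rule Bochner_Integration.integrable_bound[OF f(2)]) (auto simp: F_def)
  have dn: "(\<integral>\<^sup>+ z. ennreal (?d n z) \<partial>lborel) \<le> ennreal (e / (3 * c))"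
    using n by (subst nn_integral_eq_integral[OF di]) (auto intro!: ennreal_leI)
  define M where "M = 2 * real n"
  \<comment> \<open>The truncated function has differences of size at most \<open>M\<close>, and
    \<open>M powr (p - 1)\<close> is the factor lost in the reduction to the first power; adding
    \<open>1\<close> avoids a division by zero.\<close>
  define e' where "e' = e / (3 * c) / (M powr (p - 1) + 1)"
  have "M powr (p - 1) + 1 > 0" using powr_ge_zero[of M "p - 1"] by linarith
  then have e': "e' > 0" using e c by (simp add: e'_def)
  have "M powr (p - 1) * e' = e / (3 * c) * (M powr (p - 1) / (M powr (p - 1) + 1))"
    by (simp add: e'_def)
  also have "\<dots> \<le> e / (3 * c) * 1"
    using e c by (intro mult_left_mono) (auto simp: divide_le_eq_1 add_nonneg_pos)
  finally have Me: "M powr (p - 1) * e' \<le> e / (3 * c)" by simp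
  have "\<bar>F n z\<bar> \<le> real n" "norm z > real n \<Longrightarrow> F n z = 0" for z by (auto simp: F_def)
  then obtain \<delta> where \<delta>: "\<delta> > 0" "\<And>y. norm y < \<delta> \<Longrightarrow> (LINT z|lborel. \<bar>F n (z + y) - F n z\<bar>) \<le> e'"
    using L1_translation_bounded[of "F n" "real n" "real n" e'] e' \<open>F n \<in> borel_measurable borel\<close> by blast
  have Fi: "integrable lborel (F n)"
  proof (rule Bochner_Integration.integrable_bound)
    show "integrable lborel (\<lambda>z. indicator (cball (0::'a) n) z * real n)"
      by (intro integrable_mult_left integrable_real_indicator emeasure_lborel_cball_finite) simp
  qed (auto simp: F_def indicator_def)
  show ?thesis
  proof (intro exI[of _ \<delta>] conjI allI impI \<delta>(1))
    fix y :: 'a assume y: "norm y < \<delta>"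
    have Fyi: "integrable lborel (\<lambda>z. \<bar>F n (z + y) - F n z\<bar>)"
      using lborel_integrable_shift[OF Fi, of y] Fi by (auto simp: add.commute)
    have pt: "\<bar>f (z + y) - f z\<bar> powr p \<le> c * (?d n (y + z) + M powr (p - 1) * \<bar>F n (z + y) - F n z\<bar> + ?d n z)" for z
    proof -
      have "\<bar>f (z + y) - f z\<bar> powr p \<le> (\<bar>f (y + z) - F n (y + z)\<bar> + \<bar>F n (z + y) - F n z\<bar> + \<bar>f z - F n z\<bar>) powr p"
        using p by (intro powr_mono2) (auto simp: add.commute)
      also have "\<dots> \<le> c * (?d n (y + z) + \<bar>F n (z + y) - F n z\<bar> powr p + ?d n z)"
        unfolding c_def using p by (intro powr_split3) auto
      also have "\<bar>F n (z + y) - F n z\<bar> powr p \<le> M powr (p - 1) * \<bar>F n (z + y) - F n z\<bar>"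
      proof (cases "F n (z + y) - F n z = 0")
        case False
        have "\<bar>F n (z + y) - F n z\<bar> \<le> M" by (auto simp: F_def M_def)
        then have "\<bar>F n (z + y) - F n z\<bar> powr (p - 1) \<le> M powr (p - 1)"
          using p by (intro powr_mono2) auto
        then have "\<bar>F n (z + y) - F n z\<bar> powr (p - 1) * \<bar>F n (z + y) - F n z\<bar> \<le> M powr (p - 1) * \<bar>F n (z + y) - F n z\<bar>"
          by (intro mult_right_mono) auto
        then show ?thesis using False by (simp add: powr_diff)
      qed (use p in simp)
      finally show ?thesis using c by (simp add: mult_left_mono)
    qed
    have "(\<integral>\<^sup>+ z. ennreal (\<bar>f (z + y) - f z\<bar> powr p) \<partial>lborel) \<le>
        (\<integral>\<^sup>+ z. ennreal c * (ennreal (?d n (y + z)) + ennreal (M powr (p - 1)) * ennreal \<bar>F n (z + y) - F n z\<bar> + ennreal (?d n z)) \<partial>lborel)"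
      using pt c by (intro nn_integral_mono)
        (auto simp: ennreal_mult[symmetric] ennreal_plus[symmetric] simp del: ennreal_plus intro!: ennreal_leI)
    also have "\<dots> = ennreal c * ((\<integral>\<^sup>+ z. ennreal (?d n (y + z)) \<partial>lborel) + ennreal (M powr (p - 1)) * (\<integral>\<^sup>+ z. ennreal \<bar>F n (z + y) - F n z\<bar> \<partial>lborel) + (\<integral>\<^sup>+ z. ennreal (?d n z) \<partial>lborel))"
      by (simp add: nn_integral_cmult nn_integral_add)
    also have "(\<integral>\<^sup>+ z. ennreal (?d n (y + z)) \<partial>lborel) = (\<integral>\<^sup>+ z. ennreal (?d n z) \<partial>lborel)"
      by (rule lborel_nn_integral_shift[of "\<lambda>z. ennreal (?d n z)"]) measurable
    also have "(\<integral>\<^sup>+ z. ennreal \<bar>F n (z + y) - F n z\<bar> \<partial>lborel) = ennreal (LINT z|lborel. \<bar>F n (z + y) - F n z\<bar>)"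
      by (rule nn_integral_eq_integral[OF Fyi]) auto
    also have "ennreal c * ((\<integral>\<^sup>+ z. ennreal (?d n z) \<partial>lborel) + ennreal (M powr (p - 1)) * ennreal (LINT z|lborel. \<bar>F n (z + y) - F n z\<bar>) + (\<integral>\<^sup>+ z. ennreal (?d n z) \<partial>lborel))
       \<le> ennreal c * (ennreal (e / (3 * c)) + ennreal (M powr (p - 1)) * ennreal e' + ennreal (e / (3 * c)))"
      using \<delta>(2)[OF y] by (intro mult_left_mono add_mono dn) (auto intro!: ennreal_leI)
    also have "\<dots> = ennreal (c * (e / (3 * c) + M powr (p - 1) * e' + e / (3 * c)))"
      using c e e' by (simp add: ennreal_mult[symmetric] ennreal_plus[symmetric] del: ennreal_plus)
    also have "\<dots> \<le> ennreal (c * (e / (3 * c) + e / (3 * c) + e / (3 * c)))"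
      using Me c by (intro ennreal_leI mult_left_mono add_mono) auto
    also have "c * (e / (3 * c) + e / (3 * c) + e / (3 * c)) = e" using c by (simp add: field_simps)
    finally show "(\<integral>\<^sup>+ z. ennreal (\<bar>f (z + y) - f z\<bar> powr p) \<partial>lborel) \<le> ennreal e" .
  qed
qed

lemma norm_powr_le_sum:
  fixes v :: "'b::euclidean_space"
  assumes p: "p \<ge> 1"
  shows "norm v powr p \<le> real DIM('b) powr p * (\<Sum>b\<in>Basis. \<bar>v \<bullet> b\<bar> powr p)"
proof -
  define m where "m = (MAX b\<in>Basis. \<bar>v \<bullet> b\<bar>)"
  have m: "\<bar>v \<bullet> b\<bar> \<le> m" if "b \<in> Basis" for b using that by (simp add: m_def)
  have "m \<in> (\<lambda>b. \<bar>v \<bullet> b\<bar>) ` Basis" unfolding m_def by (intro Max_in) auto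
  then obtain b0 where b0: "b0 \<in> Basis" "m = \<bar>v \<bullet> b0\<bar>" by auto
  have "norm v \<le> (\<Sum>b\<in>Basis. \<bar>v \<bullet> b\<bar>)" by (rule norm_le_l1)
  also have "\<dots> \<le> real DIM('b) * m" using sum_bounded_above[of Basis "\<lambda>b. \<bar>v \<bullet> b\<bar>" m] m by simp
  finally have "norm v powr p \<le> (real DIM('b) * m) powr p" using p by (intro powr_mono2) auto
  also have "\<dots> = real DIM('b) powr p * m powr p" using b0 by (simp add: powr_mult)
  also have "m powr p \<le> (\<Sum>b\<in>Basis. \<bar>v \<bullet> b\<bar> powr p)"
    unfolding b0(2) using b0(1) by (intro member_le_sum) auto
  finally show ?thesis by (simp add: mult_left_mono)
qed

text \<open>Componentwise, since all norms on a Euclidean space are equivalent.\<close>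
lemma Lp_translation_vec:
  fixes f :: "'a::euclidean_space \<Rightarrow> 'b::euclidean_space"
  assumes p: "p \<ge> 1" and f: "f \<in> borel_measurable borel" "integrable lborel (\<lambda>z. norm (f z) powr p)" and e: "e > 0"
  shows "\<exists>\<delta>>0. \<forall>y. norm y < \<delta> \<longrightarrow> (\<integral>\<^sup>+ z. ennreal (norm (f (z + y) - f z) powr p) \<partial>lborel) \<le> ennreal e"
proof -
  note [measurable] = f(1)
  define N where "N = real DIM('b)"
  have N: "N > 0" by (simp add: N_def)
  define e' where "e' = e / (N powr p * N)"
  have e': "e' > 0" using e N by (simp add: e'_def)
  let ?P = "\<lambda>b \<delta>. \<delta> > 0 \<and> (\<forall>y. norm y < \<delta> \<longrightarrow> (\<integral>\<^sup>+ z. ennreal (\<bar>f (z + y) \<bullet> b - f z \<bullet> b\<bar> powr p) \<partial>lborel) \<le> ennreal e')"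
  have "\<exists>\<delta>. ?P b \<delta>" if "b \<in> Basis" for b
  proof (rule Lp_translation[OF p _ _ e'])
    show "(\<lambda>z. f z \<bullet> b) \<in> borel_measurable borel" by measurable
    show "integrable lborel (\<lambda>z. \<bar>f z \<bullet> b\<bar> powr p)"
      by (rule Bochner_Integration.integrable_bound[OF f(2)])
         (use Basis_le_norm[OF that] p in \<open>auto intro!: powr_mono2\<close>)
  qed
  then obtain \<delta> where "\<forall>b\<in>Basis. ?P b (\<delta> b)"
    using bchoice[of Basis ?P] by blast
  then have \<delta>: "\<And>b. b \<in> Basis \<Longrightarrow> \<delta> b > 0"
    "\<And>b y. b \<in> Basis \<Longrightarrow> norm y < \<delta> b \<Longrightarrow> (\<integral>\<^sup>+ z. ennreal (\<bar>f (z + y) \<bullet> b - f z \<bullet> b\<bar> powr p) \<partial>lborel) \<le> ennreal e'"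
    by blast+
  show ?thesis
  proof (intro exI[of _ "Min (\<delta> ` Basis)"] conjI allI impI)
    show "0 < Min (\<delta> ` Basis)" using \<delta>(1) by (subst Min_gr_iff) auto
    fix y :: 'a assume "norm y < Min (\<delta> ` Basis)"
    then have y: "norm y < \<delta> b" if "b \<in> Basis" for b using that by (subst (asm) Min_gr_iff) auto
    have "(\<integral>\<^sup>+ z. ennreal (norm (f (z + y) - f z) powr p) \<partial>lborel) \<le>
      (\<integral>\<^sup>+ z. ennreal (N powr p) * (\<Sum>b\<in>Basis. ennreal (\<bar>f (z + y) \<bullet> b - f z \<bullet> b\<bar> powr p)) \<partial>lborel)"
    proof (rule nn_integral_mono)
      fix z
      have "norm (f (z + y) - f z) powr p \<le> N powr p * (\<Sum>b\<in>Basis. \<bar>f (z + y) \<bullet> b - f z \<bullet> b\<bar> powr p)"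
        using norm_powr_le_sum[OF p, of "f (z + y) - f z"] by (simp add: N_def inner_diff_left)
      then have "ennreal (norm (f (z + y) - f z) powr p) \<le> ennreal (N powr p * (\<Sum>b\<in>Basis. \<bar>f (z + y) \<bullet> b - f z \<bullet> b\<bar> powr p))"
        by (rule ennreal_leI)
      then show "ennreal (norm (f (z + y) - f z) powr p) \<le> ennreal (N powr p) * (\<Sum>b\<in>Basis. ennreal (\<bar>f (z + y) \<bullet> b - f z \<bullet> b\<bar> powr p))"
        by (simp add: ennreal_mult sum_nonneg)
    qed
    also have "\<dots> = ennreal (N powr p) * (\<Sum>b\<in>Basis. \<integral>\<^sup>+ z. ennreal (\<bar>f (z + y) \<bullet> b - f z \<bullet> b\<bar> powr p) \<partial>lborel)"
    proof -
      have m: "(\<lambda>z. ennreal (\<bar>f (z + y) \<bullet> b - f z \<bullet> b\<bar> powr p)) \<in> borel_measurable lborel" for b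
        by measurable
      show ?thesis
        unfolding nn_integral_cmult[OF borel_measurable_sum[OF m]] nn_integral_sum[OF m] by (rule refl)
    qed
    also have "\<dots> \<le> ennreal (N powr p) * (\<Sum>b\<in>(Basis::'b set). ennreal e')"
      using \<delta>(2) y by (intro mult_left_mono sum_mono) auto
    also have "\<dots> = ennreal e"
    proof -
      have "N powr p * (N * e') = e" using N by (simp add: e'_def)
      moreover have "(\<Sum>b\<in>(Basis::'b set). ennreal e') = ennreal (N * e')"
        using e' N by (simp add: ennreal_of_nat_eq_real_of_nat N_def ennreal_mult)
      ultimately show ?thesis using e' N by (simp add: ennreal_mult[symmetric])
    qed
    finally show "(\<integral>\<^sup>+ z. ennreal (norm (f (z + y) - f z) powr p) \<partial>lborel) \<le> ennreal e" .
  qed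
qed

section \<open>Mollification errors in Lebesgue spaces\<close>

text \<open>Average the continuity of translations over the support of the mollifier, after exchanging the two
  integrals.\<close>
lemma moll_osc:
  fixes f :: "'a::euclidean_space \<Rightarrow> 'b::euclidean_space"
  assumes p: "p \<ge> 1" and f: "f \<in> borel_measurable borel" "integrable lborel (\<lambda>z. norm (f z) powr p)" and e: "e > 0"
  shows "\<exists>\<delta>>0. \<forall>\<epsilon>. 0 < \<epsilon> \<and> \<epsilon> < \<delta> \<longrightarrow>
    (\<integral>\<^sup>+ z. \<integral>\<^sup>+ y. ennreal (moll \<epsilon> y * norm (f (z + y) - f z) powr p) \<partial>lborel \<partial>lborel) \<le> ennreal e"
proof -
  obtain \<delta> where \<delta>: "\<delta> > 0" "\<And>y. norm y < \<delta> \<Longrightarrow> (\<integral>\<^sup>+ z. ennreal (norm (f (z + y) - f z) powr p) \<partial>lborel) \<le> ennreal e"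
    using Lp_translation_vec[OF p f e] by blast
  show ?thesis
  proof (intro exI[of _ \<delta>] conjI allI impI \<delta>(1))
    fix \<epsilon> assume \<epsilon>: "0 < \<epsilon> \<and> \<epsilon> < \<delta>"
    then have \<epsilon>0: "\<epsilon> > 0" by simp
    note [measurable] = f(1) moll_basic(4)[OF \<epsilon>0]
    have "(\<integral>\<^sup>+ z. \<integral>\<^sup>+ y. ennreal (moll \<epsilon> y * norm (f (z + y) - f z) powr p) \<partial>lborel \<partial>lborel)
       = (\<integral>\<^sup>+ y. \<integral>\<^sup>+ z. ennreal (moll \<epsilon> y * norm (f (z + y) - f z) powr p) \<partial>lborel \<partial>lborel)"
      by (rule lborel_pair.Fubini'[of "\<lambda>y z. ennreal (moll \<epsilon> y * norm (f (z + y) - f z) powr p)"]) measurable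
    also have "\<dots> = (\<integral>\<^sup>+ y. ennreal (moll \<epsilon> y) * (\<integral>\<^sup>+ z. ennreal (norm (f (z + y) - f z) powr p) \<partial>lborel) \<partial>lborel)"
    proof (intro nn_integral_cong)
      fix y :: 'a
      have "(\<lambda>z. ennreal (norm (f (z + y) - f z) powr p)) \<in> borel_measurable lborel" by measurable
      from nn_integral_cmult[OF this, of "ennreal (moll \<epsilon> y)"]
      show "(\<integral>\<^sup>+ z. ennreal (moll \<epsilon> y * norm (f (z + y) - f z) powr p) \<partial>lborel) =
          ennreal (moll \<epsilon> y) * (\<integral>\<^sup>+ z. ennreal (norm (f (z + y) - f z) powr p) \<partial>lborel)"
        by (simp add: ennreal_mult moll_nonneg[OF \<epsilon>0])
    qed
    also have "\<dots> \<le> (\<integral>\<^sup>+ y. ennreal (moll \<epsilon> (y::'a)) * ennreal e \<partial>lborel)"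
    proof (intro nn_integral_mono)
      fix y :: 'a
      show "ennreal (moll \<epsilon> y) * (\<integral>\<^sup>+ z. ennreal (norm (f (z + y) - f z) powr p) \<partial>lborel) \<le> ennreal (moll \<epsilon> y) * ennreal e"
      proof (cases "norm y > \<epsilon>")
        case True
        then show ?thesis using vanishes_off_moll[OF \<epsilon>0, where 'a='a] by (simp add: vanishes_off_def)
      next
        case False
        then show ?thesis using \<epsilon> by (intro mult_left_mono \<delta>(2)) auto
      qed
    qed
    also have "\<dots> = ennreal e"
    proof -
      have "(\<integral>\<^sup>+ y. ennreal (moll \<epsilon> (y::'a)) \<partial>lborel) = 1"
        using nn_integral_eq_integral[OF moll_basic(2)[OF \<epsilon>0, where 'a='a]]
          moll_nonneg[OF \<epsilon>0, where 'a='a] moll_basic(5)[OF \<epsilon>0, where 'a='a] by simp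
      then show ?thesis by (subst nn_integral_multc) auto
    qed
    finally show "(\<integral>\<^sup>+ z. \<integral>\<^sup>+ y. ennreal (moll \<epsilon> y * norm (f (z + y) - f z) powr p) \<partial>lborel \<partial>lborel) \<le> ennreal e" .
  qed
qed

lemma loc_int_cut:
  assumes "loc_int X w" "compact K" "K \<subseteq> X"
  shows "integrable lborel (\<lambda>y. indicator K y * w y)" "w \<in> borel_measurable borel"
  using assms by (auto simp: loc_int_def)

lemma compact_nhd:
  fixes K :: "'a::euclidean_space set"
  assumes "compact K" "open X" "K \<subseteq> X"
  shows "\<exists>r>0. \<exists>K'. compact K' \<and> K' \<subseteq> X \<and> (\<forall>z\<in>K. cball z r \<subseteq> K')"
proof -
  obtain r where r: "r > 0" "(\<Union>x\<in>K. cball x r) \<subseteq> X"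
    using compact_subset_open_imp_cball_epsilon_subset[OF assms] by blast
  let ?K = "{x + y | x y. x \<in> K \<and> y \<in> cball 0 r}"
  have "compact ?K" using assms(1) by (intro compact_sums) auto
  moreover have "?K \<subseteq> X"
  proof
    fix z assume "z \<in> ?K"
    then obtain x y where "z = x + y" "x \<in> K" "norm y \<le> r" by auto
    then have "z \<in> cball x r" "x \<in> K" by (auto simp: dist_norm)
    then show "z \<in> X" using r(2) by blast
  qed
  moreover have "cball z r \<subseteq> ?K" if "z \<in> K" for z
  proof
    fix x assume "x \<in> cball z r"
    then have "x = z + (x - z) \<and> z \<in> K \<and> x - z \<in> cball 0 r"
      using that by (auto simp: dist_norm norm_minus_commute)
    then show "x \<in> ?K" by blast
  qed
  ultimately show ?thesis using r(1) by (intro exI[of _ r] exI[of _ ?K] conjI ballI)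
qed

lemma corr_moll_cong:
  fixes F :: "'a::euclidean_space \<Rightarrow> real"
  assumes "\<epsilon> > 0" "\<And>y. y \<in> cball z \<epsilon> \<Longrightarrow> F y = F' y"
  shows "corr (moll \<epsilon>) F z = corr (moll \<epsilon>) F' z"
  unfolding corr_def
proof (intro Bochner_Integration.integral_cong refl)
  fix y :: 'a
  show "moll \<epsilon> y * F (z + y) = moll \<epsilon> y * F' (z + y)"
  proof (cases "norm y > \<epsilon>")
    case True then show ?thesis using vanishes_off_moll[OF assms(1), where 'a='a] by (simp add: vanishes_off_def)
  next
    case False then show ?thesis using assms(2)[of "z + y"] by (simp add: dist_norm)
  qed
qed

lemma moll_bounded: assumes "\<epsilon> > 0" obtains B where "\<And>y::'a::euclidean_space. \<bar>moll \<epsilon> y\<bar> \<le> B"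
  using mollD_bound[OF assms, of "[] :: 'a list"] by (auto simp: mollD_Nil)

lemma integrable_moll_mult:
  fixes F :: "'a::euclidean_space \<Rightarrow> real"
  assumes "\<epsilon> > 0" "integrable lborel F"
  shows "integrable lborel (\<lambda>y. moll \<epsilon> y * F (z + y))"
proof -
  obtain B where B: "\<And>y::'a. \<bar>moll \<epsilon> y\<bar> \<le> B" using moll_bounded[OF assms(1)] by blast
  have "integrable lborel (\<lambda>y. F (z + y) * moll \<epsilon> y)"
    by (rule integrable_bounded_mult[OF lborel_integrable_shift[OF assms(2)] _ B])
       (use moll_basic(4)[OF assms(1)] in simp)
  then show ?thesis by (simp add: mult.commute)
qed

text \<open>The mean value of \<open>w (z + y) - w z\<close> under the mollifier is \<open>- w z\<close>, and its
  integral over a compact set tends to zero. This gives uniqueness of weak derivatives without density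
  of test functions.\<close>
lemma ae_zero_of_moll_zero:
  fixes w :: "'a::euclidean_space \<Rightarrow> real"
  assumes X: "open X" and w: "loc_int X w"
    and z: "\<And>z \<epsilon>. \<epsilon> > 0 \<Longrightarrow> cball z \<epsilon> \<subseteq> X \<Longrightarrow> corr (moll \<epsilon>) w z = 0"
  shows "AE z in lborel. z \<in> X \<longrightarrow> w z = 0"
proof -
  have wm [measurable]: "w \<in> borel_measurable borel" using w by (simp add: loc_int_def)
  have comp: "AE z in lborel. z \<in> K \<longrightarrow> w z = 0" if K: "compact K" "K \<subseteq> X" for K
  proof -
    obtain r K' where r: "r > 0" and K': "compact K'" "K' \<subseteq> X" "\<And>z. z \<in> K \<Longrightarrow> cball z r \<subseteq> K'"
      using compact_nhd[OF K(1) X K(2)] by blast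
    have [measurable]: "K \<in> sets borel" "K' \<in> sets borel" using K(1) K'(1) by (auto intro: borel_compact)
    define f where "f y = indicator K' y * w y" for y
    have fi: "integrable lborel f" unfolding f_def[abs_def] by (rule loc_int_cut(1)[OF w K'(1,2)])
    have fm [measurable]: "f \<in> borel_measurable borel" unfolding f_def[abs_def] by measurable
    have fi': "integrable lborel (\<lambda>z. norm (f z) powr 1)" using fi by (simp add: powr_one)
    have "(\<integral>\<^sup>+ z. ennreal (indicator K z * \<bar>w z\<bar>) \<partial>lborel) \<le> 0"
    proof (rule ennreal_le_epsilon)
      fix e :: real assume "0 < e"
      obtain \<delta> where \<delta>: "\<delta> > 0" "\<And>\<epsilon>. 0 < \<epsilon> \<Longrightarrow> \<epsilon> < \<delta> \<Longrightarrow>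
        (\<integral>\<^sup>+ z. \<integral>\<^sup>+ y. ennreal (moll \<epsilon> y * norm (f (z + y) - f z) powr 1) \<partial>lborel \<partial>lborel) \<le> ennreal e"
        using moll_osc[OF order_refl fm fi' \<open>0 < e\<close>] by blast
      define \<epsilon> where "\<epsilon> = min (\<delta> / 2) r"
      have \<epsilon>: "0 < \<epsilon>" "\<epsilon> < \<delta>" "\<epsilon> \<le> r" using \<delta>(1) r by (auto simp: \<epsilon>_def)
      have "(\<integral>\<^sup>+ z. ennreal (indicator K z * \<bar>w z\<bar>) \<partial>lborel) \<le>
         (\<integral>\<^sup>+ z. \<integral>\<^sup>+ y. ennreal (moll \<epsilon> y * norm (f (z + y) - f z) powr 1) \<partial>lborel \<partial>lborel)"
      proof (rule nn_integral_mono)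
        fix z :: 'a
        show "ennreal (indicator K z * \<bar>w z\<bar>) \<le> (\<integral>\<^sup>+ y. ennreal (moll \<epsilon> y * norm (f (z + y) - f z) powr 1) \<partial>lborel)"
        proof (cases "z \<in> K")
          case True
          have sub: "cball z \<epsilon> \<subseteq> K'" using K'(3)[OF True] \<epsilon>(3) by (auto simp: subset_eq)
          then have "corr (moll \<epsilon>) f z = corr (moll \<epsilon>) w z"
            by (intro corr_moll_cong \<epsilon>(1)) (auto simp: f_def subset_eq)
          also have "\<dots> = 0" using sub K'(2) by (intro z \<epsilon>(1)) auto
          finally have 0: "corr (moll \<epsilon>) f z = 0" .
          have fz: "f z = w z" using sub \<epsilon>(1) by (auto simp: f_def subset_eq)
          have i1: "integrable lborel (\<lambda>y. moll \<epsilon> y * f (z + y))" by (rule integrable_moll_mult[OF \<epsilon>(1) fi])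
          have i2: "integrable lborel (\<lambda>y. moll \<epsilon> (y::'a) * f z)" using moll_basic(2)[OF \<epsilon>(1)] by auto
          have i: "integrable lborel (\<lambda>y. moll \<epsilon> y * (f (z + y) - f z))"
            using Bochner_Integration.integrable_diff[OF i1 i2] by (simp add: algebra_simps)
          have "(LINT y|lborel. moll \<epsilon> y * (f (z + y) - f z)) = corr (moll \<epsilon>) f z - (LINT y|lborel. moll \<epsilon> (y::'a) * f z)"
            unfolding corr_def Bochner_Integration.integral_diff[OF i1 i2, symmetric] by (simp add: algebra_simps)
          also have "\<dots> = - w z" using 0 fz moll_basic(5)[OF \<epsilon>(1), where 'a='a] by simp
          finally have "ennreal \<bar>w z\<bar> = ennreal (norm (LINT y|lborel. moll \<epsilon> y * (f (z + y) - f z)))" by simp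
          also have "\<dots> \<le> (\<integral>\<^sup>+ y. ennreal (norm (moll \<epsilon> y * (f (z + y) - f z))) \<partial>lborel)"
            by (rule integral_norm_bound_ennreal[OF i])
          also have "\<dots> = (\<integral>\<^sup>+ y. ennreal (moll \<epsilon> y * norm (f (z + y) - f z) powr 1) \<partial>lborel)"
            using moll_nonneg[OF \<epsilon>(1), where 'a='a] by (intro nn_integral_cong) (simp add: abs_mult)
          finally show ?thesis using True by simp
        qed simp
      qed
      also have "\<dots> \<le> ennreal e" by (rule \<delta>(2)[OF \<epsilon>(1,2)])
      finally show "(\<integral>\<^sup>+ z. ennreal (indicator K z * \<bar>w z\<bar>) \<partial>lborel) \<le> 0 + ennreal e" by simp
    qed
    then have "(\<integral>\<^sup>+ z. ennreal (indicator K z * \<bar>w z\<bar>) \<partial>lborel) = 0" by simp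
    then have "AE z in lborel. ennreal (indicator K z * \<bar>w z\<bar>) = 0"
      by (subst (asm) nn_integral_0_iff_AE) measurable
    then show ?thesis by eventually_elim (auto simp: indicator_def split: if_splits)
  qed
  obtain C where C: "\<And>n::nat. compact (C n)" "\<And>n. C n \<subseteq> X" "\<Union>(range C) = X"
    using open_Union_compact_subsets[OF X] by metis
  have "AE z in lborel. \<forall>n. z \<in> C n \<longrightarrow> w z = 0"
    unfolding AE_all_countable using comp[OF C(1,2)] by blast
  then show ?thesis by eventually_elim (use C(3) in blast)
qed

section \<open>Mollification of nonlinear functions of the gradient\<close>

lemma powr_le_one_add: 
  fixes x s p :: real assumes "0 \<le> x" "0 \<le> s" "s \<le> p" shows "x powr s \<le> 1 + x powr p"
proof (cases "x \<le> 1")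
  case True
  then have "x powr s \<le> 1" using assms powr_le1 by auto
  then show ?thesis using powr_ge_zero[of x p] by linarith
next
  case False
  then have "x powr s \<le> x powr p" using assms by (intro powr_mono) auto
  then show ?thesis by simp
qed

lemma moll_osc_integrable:
  fixes f :: "'a::euclidean_space \<Rightarrow> 'b::euclidean_space"
  assumes p: "p \<ge> 1" and f: "f \<in> borel_measurable borel" "integrable lborel (\<lambda>z. norm (f z) powr p)"
    and \<epsilon>: "\<epsilon> > 0" and s: "0 \<le> s" "s \<le> p"
  shows "integrable lborel (\<lambda>y. moll \<epsilon> y * norm (f (z + y) - c) powr s)"
proof -
  note [measurable] = f(1) moll_basic(4)[OF \<epsilon>]
  let ?b = "\<lambda>y. moll \<epsilon> (y::'a) * (1 + 2 powr p * norm c powr p) + 2 powr p * (moll \<epsilon> y * norm (f (z + y)) powr p)"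
  have bi: "integrable lborel ?b"
    using moll_basic(2)[OF \<epsilon>, where 'a='a] integrable_moll_mult[OF \<epsilon> f(2), of z]
    by (intro Bochner_Integration.integrable_add integrable_mult_left integrable_mult_right)
  show ?thesis
  proof (rule Bochner_Integration.integrable_bound[OF bi])
    show "AE y in lborel. norm (moll \<epsilon> y * norm (f (z + y) - c) powr s) \<le> norm (?b y)"
    proof (rule AE_I2)
      fix y :: 'a
      have "norm (f (z + y) - c) powr s \<le> 1 + norm (f (z + y) - c) powr p"
        using s by (intro powr_le_one_add) auto
      also have "norm (f (z + y) - c) powr p \<le> (norm (f (z + y)) + norm c) powr p"
        using p by (intro powr_mono2 norm_triangle_ineq4) auto
      also have "\<dots> \<le> 2 powr p * (norm (f (z + y)) powr p + norm c powr p)"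
        using p by (intro powr_split_half) auto
      finally have "moll \<epsilon> y * norm (f (z + y) - c) powr s \<le> moll \<epsilon> y * (1 + 2 powr p * (norm (f (z + y)) powr p + norm c powr p))"
        using moll_nonneg[OF \<epsilon>] by (intro mult_left_mono) auto
      also have "\<dots> = ?b y" by (simp add: algebra_simps)
      finally show "norm (moll \<epsilon> y * norm (f (z + y) - c) powr s) \<le> norm (?b y)"
        using moll_nonneg[OF \<epsilon>, of y] by (simp add: abs_mult)
    qed
  qed measurable
qed

definition vcorr :: "('a::euclidean_space \<Rightarrow> real) \<Rightarrow> ('a \<Rightarrow> 'b::euclidean_space) \<Rightarrow> 'a \<Rightarrow> 'b" where
  "vcorr \<rho> f z = (LINT y|lborel. \<rho> y *\<^sub>R f (z + y))"

context
  fixes f :: "'a::euclidean_space \<Rightarrow> 'b::euclidean_space" and p \<epsilon> :: real and z :: 'a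
  assumes p: "p \<ge> 1" and f: "f \<in> borel_measurable borel" "integrable lborel (\<lambda>z. norm (f z) powr p)"
    and \<epsilon>: "\<epsilon> > 0"
begin

lemma moll_osc_int: "0 \<le> s \<Longrightarrow> s \<le> p \<Longrightarrow> integrable lborel (\<lambda>y. moll \<epsilon> y * norm (f (z + y) - c) powr s)"
  by (rule moll_osc_integrable[OF p f \<epsilon>])

lemma vcorr_integrable: "integrable lborel (\<lambda>y. moll \<epsilon> y *\<^sub>R f (z + y))"
proof (rule Bochner_Integration.integrable_bound[OF moll_osc_int[of 1 0]])
  note [measurable] = f(1) moll_basic(4)[OF \<epsilon>]
  show "(\<lambda>y. moll \<epsilon> y *\<^sub>R f (z + y)) \<in> borel_measurable lborel" by measurable
qed (use p in auto)

lemma norm_vcorr_diff: 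
  "norm (vcorr (moll \<epsilon>) f z - c) \<le> (LINT y|lborel. moll \<epsilon> y * norm (f (z + y) - c))"
proof -
  have i: "integrable lborel (\<lambda>y. moll \<epsilon> (y::'a) *\<^sub>R c)" using moll_basic(2)[OF \<epsilon>] by auto
  have "vcorr (moll \<epsilon>) f z - c = (LINT y|lborel. moll \<epsilon> y *\<^sub>R f (z + y)) - (LINT y|lborel. moll \<epsilon> (y::'a) *\<^sub>R c)"
    using moll_basic(2,5)[OF \<epsilon>, where 'a='a] by (simp add: vcorr_def)
  also have "\<dots> = (LINT y|lborel. moll \<epsilon> y *\<^sub>R (f (z + y) - c))"
    unfolding Bochner_Integration.integral_diff[OF vcorr_integrable i, symmetric] by (simp add: algebra_simps)
  finally have "norm (vcorr (moll \<epsilon>) f z - c) \<le> (LINT y|lborel. norm (moll \<epsilon> y *\<^sub>R (f (z + y) - c)))"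
    using integral_norm_bound[of lborel "\<lambda>y. moll \<epsilon> y *\<^sub>R (f (z + y) - c)"] by (simp del: norm_scaleR)
  also have "\<dots> = (LINT y|lborel. moll \<epsilon> y * norm (f (z + y) - c))"
    using moll_nonneg[OF \<epsilon>, where 'a='a] by simp
  finally show ?thesis .
qed

text \<open>Jensen's inequality again. For \<open>c = 0\<close> it says that the mollified gradient does not exceed
  the mollification of its power, so that mollified solutions are subsolutions.\<close>
lemma norm_vcorr_diff_powr:
  assumes s: "1 \<le> s" "s \<le> p"
  shows "norm (vcorr (moll \<epsilon>) f z - c) powr s \<le> (LINT y|lborel. moll \<epsilon> y * norm (f (z + y) - c) powr s)"
proof -
  have "norm (vcorr (moll \<epsilon>) f z - c) powr s \<le> (LINT y|lborel. moll \<epsilon> y * norm (f (z + y) - c)) powr s"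
    using s by (intro powr_mono2 norm_vcorr_diff) auto
  also have "\<dots> \<le> (LINT y|lborel. moll \<epsilon> y * norm (f (z + y) - c) powr s)"
  proof (rule jensen_powr[OF s(1) moll_basic(2)[OF \<epsilon>] moll_nonneg[OF \<epsilon>] moll_basic(5)[OF \<epsilon>]])
    show "integrable lborel (\<lambda>y. moll \<epsilon> y * norm (f (z + y) - c))"
      using moll_osc_int[of 1 c] p by simp
    show "integrable lborel (\<lambda>y. moll \<epsilon> y * norm (f (z + y) - c) powr s)"
      using s by (intro moll_osc_int) auto
  qed simp
  finally show ?thesis .
qed

text \<open>Let \<open>m\<close> be the mean of \<open>f\<close> under the mollifier centred at \<open>z\<close>.
  Since \<open>\<bar>f\<bar>\<close> is at most \<open>\<bar>m\<bar> + \<bar>f - m\<bar>\<close>, the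
  convexity bound with weights \<open>\<theta>\<close> and \<open>\<eta>\<close> controls the error by a
  small multiple of \<open>\<bar>m\<bar> powr \<gamma>\<close> and a possibly large multiple of the
  oscillation. The oscillation around \<open>m\<close> is then compared with that around the value
  \<open>f z\<close>.\<close>
lemma moll_error_pointwise:
  assumes g: "\<gamma> \<ge> 1" "q \<ge> 1" "p = \<gamma> * q" and \<theta>: "0 < \<theta>" "0 < \<eta>" "\<theta> + \<eta> = 1"
  defines "r \<equiv> (LINT y|lborel. moll \<epsilon> y * norm (f (z + y)) powr \<gamma>) - norm (vcorr (moll \<epsilon>) f z) powr \<gamma>"
  shows "0 \<le> r"
    "r powr q \<le> 2 powr q * (\<theta> powr (1 - \<gamma>) - 1) powr q * (LINT y|lborel. moll \<epsilon> y * norm (f (z + y)) powr p)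
      + 2 powr q * \<eta> powr (q * (1 - \<gamma>)) * 2 powr p * 2 * (LINT y|lborel. moll \<epsilon> y * norm (f (z + y) - f z) powr p)"
proof -
  have gp: "\<gamma> \<le> p" using g mult_left_mono[of 1 q \<gamma>] by simp
  show r0: "0 \<le> r" using norm_vcorr_diff_powr[OF g(1) gp, of 0] by (simp add: r_def)
  define m where "m = vcorr (moll \<epsilon>) f z"
  define D where "D = (LINT y|lborel. moll \<epsilon> y * norm (f (z + y) - m) powr \<gamma>)"
  define A where "A = (LINT y|lborel. moll \<epsilon> y * norm (f (z + y)) powr p)"
  define W where "W = (LINT y|lborel. moll \<epsilon> y * norm (f (z + y) - f z) powr p)"
  have D0: "D \<ge> 0" unfolding D_def using moll_nonneg[OF \<epsilon>, where 'a='a] by simp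
  have i: "integrable lborel (\<lambda>y. moll \<epsilon> y * norm (f (z + y) - c) powr \<gamma>)"
     "integrable lborel (\<lambda>y. moll \<epsilon> y * norm (f (z + y) - c) powr p)" for c
    using g gp p by (auto intro!: moll_osc_int)
  have m1: "integrable lborel (moll \<epsilon> :: 'a \<Rightarrow> real)" "(LINT y|lborel. moll \<epsilon> (y::'a)) = 1"
    using moll_basic(2,5)[OF \<epsilon>, where 'a='a] by auto
  have "(LINT y|lborel. moll \<epsilon> y * norm (f (z + y)) powr \<gamma>) \<le>
     (LINT y|lborel. \<theta> powr (1 - \<gamma>) * norm m powr \<gamma> * moll \<epsilon> y + \<eta> powr (1 - \<gamma>) * (moll \<epsilon> y * norm (f (z + y) - m) powr \<gamma>))"
  proof (rule integral_mono)
    fix y :: 'a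
    have "norm (f (z + y)) powr \<gamma> \<le> (norm m + norm (f (z + y) - m)) powr \<gamma>"
      using g norm_triangle_ineq[of m "f (z + y) - m"] by (intro powr_mono2) auto
    also have "\<dots> \<le> \<theta> powr (1 - \<gamma>) * norm m powr \<gamma> + \<eta> powr (1 - \<gamma>) * norm (f (z + y) - m) powr \<gamma>"
      by (rule powr_split2[OF g(1) _ _ \<theta>]) auto
    finally have "moll \<epsilon> y * norm (f (z + y)) powr \<gamma> \<le> moll \<epsilon> y * (\<theta> powr (1 - \<gamma>) * norm m powr \<gamma> + \<eta> powr (1 - \<gamma>) * norm (f (z + y) - m) powr \<gamma>)"
      using moll_nonneg[OF \<epsilon>] by (intro mult_left_mono) auto
    then show "moll \<epsilon> y * norm (f (z + y)) powr \<gamma> \<le> \<theta> powr (1 - \<gamma>) * norm m powr \<gamma> * moll \<epsilon> y + \<eta> powr (1 - \<gamma>) * (moll \<epsilon> y * norm (f (z + y) - m) powr \<gamma>)"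
      by (simp add: algebra_simps)
  next
    show "integrable lborel (\<lambda>y. moll \<epsilon> y * norm (f (z + y)) powr \<gamma>)" using i(1)[of 0] by simp
    show "integrable lborel (\<lambda>y. \<theta> powr (1 - \<gamma>) * norm m powr \<gamma> * moll \<epsilon> y + \<eta> powr (1 - \<gamma>) * (moll \<epsilon> y * norm (f (z + y) - m) powr \<gamma>))"
      using i(1)[of m] m1 by auto
  qed
  also have "\<dots> = \<theta> powr (1 - \<gamma>) * norm m powr \<gamma> + \<eta> powr (1 - \<gamma>) * D"
    using i(1)[of m] m1 by (subst Bochner_Integration.integral_add) (auto simp: D_def)
  finally have r1: "r \<le> (\<theta> powr (1 - \<gamma>) - 1) * norm m powr \<gamma> + \<eta> powr (1 - \<gamma>) * D"
    by (simp add: r_def m_def algebra_simps)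
  have \<theta>1: "\<theta> powr (1 - \<gamma>) - 1 \<ge> 0"
  proof -
    have "\<theta> powr 0 \<le> \<theta> powr (1 - \<gamma>)" using \<theta> g by (intro powr_mono') auto
    then show ?thesis using \<theta> by simp
  qed
  have mp: "norm m powr p \<le> A"
    using norm_vcorr_diff_powr[OF p order_refl, of 0] by (simp add: m_def A_def)
  have "D powr q \<le> (LINT y|lborel. moll \<epsilon> y * (norm (f (z + y) - m) powr \<gamma>) powr q)"
    unfolding D_def
    by (rule jensen_powr[OF g(2) moll_basic(2)[OF \<epsilon>] moll_nonneg[OF \<epsilon>] moll_basic(5)[OF \<epsilon>]])
       (use i in \<open>auto simp: powr_powr g(3)[symmetric]\<close>)
  also have "\<dots> = (LINT y|lborel. moll \<epsilon> y * norm (f (z + y) - m) powr p)" by (simp add: powr_powr g(3))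
  also have "\<dots> \<le> (LINT y|lborel. 2 powr p * (moll \<epsilon> y * norm (f (z + y) - f z) powr p) + 2 powr p * norm (m - f z) powr p * moll \<epsilon> y)"
  proof (rule integral_mono)
    fix y :: 'a
    have "norm (f (z + y) - m) powr p \<le> (norm (f (z + y) - f z) + norm (m - f z)) powr p"
      using p norm_triangle_ineq4[of "f (z + y) - f z" "m - f z"] by (intro powr_mono2) auto
    also have "\<dots> \<le> 2 powr p * (norm (f (z + y) - f z) powr p + norm (m - f z) powr p)"
      using p by (intro powr_split_half) auto
    finally have "moll \<epsilon> y * norm (f (z + y) - m) powr p \<le> moll \<epsilon> y * (2 powr p * (norm (f (z + y) - f z) powr p + norm (m - f z) powr p))"
      using moll_nonneg[OF \<epsilon>] by (intro mult_left_mono) auto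
    then show "moll \<epsilon> y * norm (f (z + y) - m) powr p \<le> 2 powr p * (moll \<epsilon> y * norm (f (z + y) - f z) powr p) + 2 powr p * norm (m - f z) powr p * moll \<epsilon> y"
      by (simp add: algebra_simps)
  qed (use i(2)[of m] i(2)[of "f z"] m1 in auto)
  also have "\<dots> = 2 powr p * W + 2 powr p * norm (m - f z) powr p"
    using i(2)[of "f z"] m1 by (subst Bochner_Integration.integral_add) (auto simp: W_def)
  also have "\<dots> \<le> 2 powr p * W + 2 powr p * W"
    using norm_vcorr_diff_powr[OF p order_refl, of "f z"] by (intro add_left_mono mult_left_mono) (auto simp: m_def W_def)
  finally have Dq: "D powr q \<le> 2 powr p * 2 * W" by (simp add: ac_simps)
  have "r powr q \<le> ((\<theta> powr (1 - \<gamma>) - 1) * norm m powr \<gamma> + \<eta> powr (1 - \<gamma>) * D) powr q"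
    using r0 r1 g by (intro powr_mono2) auto
  also have "\<dots> \<le> 2 powr q * (((\<theta> powr (1 - \<gamma>) - 1) * norm m powr \<gamma>) powr q + (\<eta> powr (1 - \<gamma>) * D) powr q)"
    using g \<theta>1 D0 by (intro powr_split_half) auto
  also have "((\<theta> powr (1 - \<gamma>) - 1) * norm m powr \<gamma>) powr q = (\<theta> powr (1 - \<gamma>) - 1) powr q * norm m powr p"
    using \<theta>1 by (simp add: powr_mult powr_powr g(3))
  also have "(\<eta> powr (1 - \<gamma>) * D) powr q = \<eta> powr (q * (1 - \<gamma>)) * D powr q"
    using D0 by (simp add: powr_mult powr_powr mult.commute)
  also have "2 powr q * ((\<theta> powr (1 - \<gamma>) - 1) powr q * norm m powr p + \<eta> powr (q * (1 - \<gamma>)) * D powr q)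
    \<le> 2 powr q * ((\<theta> powr (1 - \<gamma>) - 1) powr q * A + \<eta> powr (q * (1 - \<gamma>)) * (2 powr p * 2 * W))"
    by (intro mult_left_mono add_mono mp Dq) auto
  finally show "r powr q \<le> 2 powr q * (\<theta> powr (1 - \<gamma>) - 1) powr q * (LINT y|lborel. moll \<epsilon> y * norm (f (z + y)) powr p)
      + 2 powr q * \<eta> powr (q * (1 - \<gamma>)) * 2 powr p * 2 * (LINT y|lborel. moll \<epsilon> y * norm (f (z + y) - f z) powr p)"
    by (simp add: A_def W_def algebra_simps)
qed

end

text \<open>In the pointwise estimate first choose \<theta> so close to \<open>1\<close> that the term with the full
  norm of \<open>f\<close> is small, and only then the mollification radius, which makes the oscillation
  small.\<close>
lemma moll_error_small:
  fixes f :: "'a::euclidean_space \<Rightarrow> 'b::euclidean_space"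
  assumes g: "\<gamma> \<ge> 1" "q \<ge> 1" and f: "f \<in> borel_measurable borel" "integrable lborel (\<lambda>z. norm (f z) powr (\<gamma> * q))"
    and e: "e > 0"
  shows "\<exists>\<delta>>0. \<forall>\<epsilon>. 0 < \<epsilon> \<and> \<epsilon> < \<delta> \<longrightarrow>
    (\<integral>\<^sup>+ z. ennreal ((corr (moll \<epsilon>) (\<lambda>z. norm (f z) powr \<gamma>) z - norm (vcorr (moll \<epsilon>) f z) powr \<gamma>) powr q) \<partial>lborel) \<le> ennreal e"
proof -
  define p where "p = \<gamma> * q"
  have p: "p \<ge> 1" using g mult_mono[of 1 \<gamma> 1 q] by (simp add: p_def)
  note f' = f[folded p_def]
  note [measurable] = f(1)
  define I where "I = (LINT z|lborel. norm (f z) powr p)"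
  have I: "I \<ge> 0" by (simp add: I_def)
  have one: "1 \<le> y powr (1 - \<gamma>)" if "0 < y" "y < 1" for y :: real
    using powr_mono'[of "1 - \<gamma>" 0 y] that g by simp
  have "((\<lambda>\<theta>. 2 powr q * (\<theta> powr (1 - \<gamma>) - 1) powr q * I) \<longlongrightarrow> 2 powr q * (1 powr (1 - \<gamma>) - 1) powr q * I) (at_left 1)"
    using g by (intro tendsto_intros tendsto_powr2) (auto simp: eventually_at_left_field intro!: exI[of _ 0] one)
  then have "\<forall>\<^sub>F \<theta> in at_left 1. 2 powr q * (\<theta> powr (1 - \<gamma>) - 1) powr q * I < e / 2"
    using g e by (intro order_tendstoD(2)[where y = "2 powr q * (1 powr (1 - \<gamma>) - 1) powr q * I"]) auto
  then obtain b where b: "b < 1" "\<And>\<theta>. b < \<theta> \<Longrightarrow> \<theta> < 1 \<Longrightarrow> 2 powr q * (\<theta> powr (1 - \<gamma>) - 1) powr q * I < e / 2"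
    unfolding eventually_at_left_field by blast
  \<comment> \<open>Any value between \<open>max b 0\<close> and \<open>1\<close> will do.\<close>
  define \<theta> where "\<theta> = (max b 0 + 1) / 2"
  have \<theta>: "0 < \<theta>" "\<theta> < 1" "b < \<theta>" using b(1) by (auto simp: \<theta>_def max_def)
  define c1 where "c1 = 2 powr q * (\<theta> powr (1 - \<gamma>) - 1) powr q"
  define c2 where "c2 = 2 powr q * (1 - \<theta>) powr (q * (1 - \<gamma>)) * 2 powr p * 2"
  have c1: "c1 \<ge> 0" "c1 * I \<le> e / 2" using b(2)[OF \<theta>(3,2)] by (auto simp: c1_def)
  have c2: "c2 > 0" using \<theta> by (simp add: c2_def)
  define e' where "e' = e / (2 * c2)"
  have e': "e' > 0" using e c2 by (simp add: e'_def)
  obtain \<delta> where \<delta>: "\<delta> > 0" "\<And>\<epsilon>. 0 < \<epsilon> \<Longrightarrow> \<epsilon> < \<delta> \<Longrightarrow>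
    (\<integral>\<^sup>+ z. \<integral>\<^sup>+ y. ennreal (moll \<epsilon> y * norm (f (z + y) - f z) powr p) \<partial>lborel \<partial>lborel) \<le> ennreal e'"
    using moll_osc[OF p f' e'] by blast
  show ?thesis
  proof (intro exI[of _ \<delta>] conjI allI impI \<delta>(1))
    fix \<epsilon> assume \<epsilon>: "0 < \<epsilon> \<and> \<epsilon> < \<delta>"
    then have \<epsilon>0: "\<epsilon> > 0" by simp
    note [measurable] = moll_basic(4)[OF \<epsilon>0]
    note mn = moll_nonneg[OF \<epsilon>0, where 'a='a]
    let ?A = "\<lambda>z. \<integral>\<^sup>+ y. ennreal (moll \<epsilon> y * norm (f (z + y)) powr p) \<partial>lborel"
    let ?W = "\<lambda>z. \<integral>\<^sup>+ y. ennreal (moll \<epsilon> y * norm (f (z + y) - f z) powr p) \<partial>lborel"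
    have "(\<integral>\<^sup>+ z. ennreal ((corr (moll \<epsilon>) (\<lambda>z. norm (f z) powr \<gamma>) z - norm (vcorr (moll \<epsilon>) f z) powr \<gamma>) powr q) \<partial>lborel)
      \<le> (\<integral>\<^sup>+ z. ennreal c1 * ?A z + ennreal c2 * ?W z \<partial>lborel)"
    proof (rule nn_integral_mono)
      fix z :: 'a
      have A: "?A z = ennreal (LINT y|lborel. moll \<epsilon> y * norm (f (z + y)) powr p)"
        by (rule nn_integral_eq_integral) (use moll_osc_integrable[OF p f' \<epsilon>0, of p z 0] p mn in auto)
      have W: "?W z = ennreal (LINT y|lborel. moll \<epsilon> y * norm (f (z + y) - f z) powr p)"
        by (rule nn_integral_eq_integral) (use moll_osc_integrable[OF p f' \<epsilon>0, of p z "f z"] p mn in auto)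
      have nn: "0 \<le> (LINT y|lborel. moll \<epsilon> y * norm (f (z + y)) powr p)"
         "0 \<le> (LINT y|lborel. moll \<epsilon> y * norm (f (z + y) - f z) powr p)"
        using mn by simp_all
      show "ennreal ((corr (moll \<epsilon>) (\<lambda>z. norm (f z) powr \<gamma>) z - norm (vcorr (moll \<epsilon>) f z) powr \<gamma>) powr q)
         \<le> ennreal c1 * ?A z + ennreal c2 * ?W z"
        unfolding A W using c1(1) c2 nn
          moll_error_pointwise(2)[OF p f' \<epsilon>0 g p_def \<theta>(1), of "1 - \<theta>" z] \<theta>
        by (simp add: ennreal_mult[symmetric] ennreal_plus[symmetric] corr_def c1_def[symmetric] c2_def[symmetric]
            del: ennreal_plus)
    qed
    also have "\<dots> = ennreal c1 * (\<integral>\<^sup>+ z. ?A z \<partial>lborel) + ennreal c2 * (\<integral>\<^sup>+ z. ?W z \<partial>lborel)"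
      by (subst nn_integral_add, measurable, subst (1 2) nn_integral_cmult, measurable)
    also have "(\<integral>\<^sup>+ z. ?A z \<partial>lborel) = ennreal I"
    proof -
      have "(\<integral>\<^sup>+ z. ?A z \<partial>lborel) = (\<integral>\<^sup>+ y. \<integral>\<^sup>+ z. ennreal (moll \<epsilon> y * norm (f (z + y)) powr p) \<partial>lborel \<partial>lborel)"
        by (rule lborel_pair.Fubini'[of "\<lambda>y z. ennreal (moll \<epsilon> y * norm (f (z + y)) powr p)"]) measurable
      also have "\<dots> = (\<integral>\<^sup>+ y. ennreal (moll \<epsilon> (y::'a)) * ennreal I \<partial>lborel)"
      proof (intro nn_integral_cong)
        fix y :: 'a
        have "(\<lambda>z. ennreal (norm (f (z + y)) powr p)) \<in> borel_measurable lborel" by measurable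
        from nn_integral_cmult[OF this, of "ennreal (moll \<epsilon> y)"]
        have "(\<integral>\<^sup>+ z. ennreal (moll \<epsilon> y * norm (f (z + y)) powr p) \<partial>lborel)
           = ennreal (moll \<epsilon> y) * (\<integral>\<^sup>+ z. ennreal (norm (f (y + z)) powr p) \<partial>lborel)"
          by (simp add: ennreal_mult mn add.commute)
        also have "(\<integral>\<^sup>+ z. ennreal (norm (f (y + z)) powr p) \<partial>lborel) = (\<integral>\<^sup>+ z. ennreal (norm (f z) powr p) \<partial>lborel)"
          by (rule lborel_nn_integral_shift[of "\<lambda>z. ennreal (norm (f z) powr p)"]) measurable
        also have "\<dots> = ennreal I" unfolding I_def by (rule nn_integral_eq_integral[OF f'(2)]) simp
        finally show "(\<integral>\<^sup>+ z. ennreal (moll \<epsilon> y * norm (f (z + y)) powr p) \<partial>lborel) = ennreal (moll \<epsilon> y) * ennreal I" .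
      qed
      also have "\<dots> = (\<integral>\<^sup>+ y. ennreal (moll \<epsilon> (y::'a)) \<partial>lborel) * ennreal I"
        by (rule nn_integral_multc) measurable
      also have "(\<integral>\<^sup>+ y. ennreal (moll \<epsilon> (y::'a)) \<partial>lborel) = 1"
        using nn_integral_eq_integral[OF moll_basic(2)[OF \<epsilon>0, where 'a='a]] mn
          moll_basic(5)[OF \<epsilon>0, where 'a='a] by simp
      finally show ?thesis by simp
    qed
    also have "ennreal c1 * ennreal I + ennreal c2 * (\<integral>\<^sup>+ z. ?W z \<partial>lborel) \<le> ennreal c1 * ennreal I + ennreal c2 * ennreal e'"
      using \<epsilon> by (intro add_left_mono mult_left_mono \<delta>(2)) auto
    also have "\<dots> = ennreal (c1 * I + c2 * e')"
      using c1 c2 e' I by (simp add: ennreal_mult[symmetric] ennreal_plus[symmetric] del: ennreal_plus)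
    also have "\<dots> \<le> ennreal e"
      using c1(2) c2 by (intro ennreal_leI) (simp add: e'_def)
    finally show "(\<integral>\<^sup>+ z. ennreal ((corr (moll \<epsilon>) (\<lambda>z. norm (f z) powr \<gamma>) z - norm (vcorr (moll \<epsilon>) f z) powr \<gamma>) powr q) \<partial>lborel) \<le> ennreal e" .
  qed
qed

section \<open>Integrability of the heat kernel and its gradient\<close>

text \<open>Comparison with an exponential: \<open>2 * \<bar>t\<bar> - 1 \<le> t\<^sup>2\<close>.\<close>
lemma nn_integral_gaussian_1:
  assumes c: "c > (0::real)"
  shows "(\<integral>\<^sup>+ t. ennreal (exp (- c * t\<^sup>2)) \<partial>lborel) < \<infinity>"
proof -
  let ?g = "\<lambda>t::real. ennreal (exp (- (2 * c) * t)) * indicator {0..} t"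
  have g: "(\<integral>\<^sup>+ t. ?g t \<partial>lborel) = ennreal (exp (- (2 * c) * 0) / (2 * c))"
    by (rule nn_integral_has_integral_lebesgue'[OF _ has_integral_exp_minus_to_infinity]) (use c in auto)
  have g': "(\<integral>\<^sup>+ t. ?g (- t) \<partial>lborel) = (\<integral>\<^sup>+ t. ?g t \<partial>lborel)"
    using nn_integral_real_affine[of ?g "-1" 0] by simp
  have "(\<integral>\<^sup>+ t. ennreal (exp (- c * t\<^sup>2)) \<partial>lborel) \<le> (\<integral>\<^sup>+ t. ennreal (exp c) * (?g t + ?g (- t)) \<partial>lborel)"
  proof (intro nn_integral_mono)
    fix t :: real
    have "0 \<le> (\<bar>t\<bar> - 1)\<^sup>2" by simp
    then have "2 * \<bar>t\<bar> - 1 \<le> t\<^sup>2" by (simp add: power2_diff)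
    then have "c * (2 * \<bar>t\<bar> - 1) \<le> c * t\<^sup>2" using c by (intro mult_left_mono) auto
    then have "exp (- c * t\<^sup>2) \<le> exp (c - 2 * c * \<bar>t\<bar>)" by (simp add: algebra_simps)
    also have "\<dots> = exp c * exp (- (2 * c * \<bar>t\<bar>))" by (simp add: exp_diff exp_minus field_simps)
    finally have "ennreal (exp (- c * t\<^sup>2)) \<le> ennreal (exp c) * ennreal (exp (- (2 * c * \<bar>t\<bar>)))"
      by (simp add: ennreal_mult[symmetric] ennreal_leI)
    also have "ennreal (exp (- (2 * c * \<bar>t\<bar>))) \<le> ?g t + ?g (- t)"
      by (cases "t \<ge> 0") (auto simp: indicator_def)
    finally show "ennreal (exp (- c * t\<^sup>2)) \<le> ennreal (exp c) * (?g t + ?g (- t))"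
      by (simp add: mult_left_mono)
  qed
  also have "\<dots> = ennreal (exp c) * ((\<integral>\<^sup>+ t. ?g t \<partial>lborel) + (\<integral>\<^sup>+ t. ?g (- t) \<partial>lborel))"
    by (subst nn_integral_cmult, measurable, subst nn_integral_add) (auto intro!: borel_measurable_times)
  also have "\<dots> < \<infinity>" unfolding g' g by (simp add: ennreal_mult_less_top)
  finally show ?thesis .
qed

lemma nn_integral_gaussian:
  assumes c: "c > (0::real)"
  shows "(\<integral>\<^sup>+ x. ennreal (exp (- c * (x \<bullet> x))) \<partial>(lborel::'a::euclidean_space measure)) < \<infinity>"
proof -
  have "(\<integral>\<^sup>+ x. ennreal (exp (- c * (x \<bullet> x))) \<partial>(lborel::'a measure)) =
     (\<integral>\<^sup>+ x. (\<Prod>b\<in>Basis. ennreal (exp (- c * (x \<bullet> b)\<^sup>2))) \<partial>(lborel::'a measure))"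
  proof (intro nn_integral_cong)
    fix x :: 'a
    have "- c * (x \<bullet> x) = (\<Sum>b\<in>Basis. - c * (x \<bullet> b)\<^sup>2)"
      unfolding euclidean_inner[of x x] by (simp add: sum_distrib_left power2_eq_square sum_negf)
    then have "exp (- c * (x \<bullet> x)) = (\<Prod>b\<in>Basis. exp (- c * (x \<bullet> b)\<^sup>2))" by (simp add: exp_sum)
    then show "ennreal (exp (- c * (x \<bullet> x))) = (\<Prod>b\<in>Basis. ennreal (exp (- c * (x \<bullet> b)\<^sup>2)))"
      by (simp add: prod_ennreal)
  qed
  also have "\<dots> = (\<Prod>b\<in>(Basis::'a set). (\<integral>\<^sup>+ t. ennreal (exp (- c * t\<^sup>2)) \<partial>lborel))"
    by (rule nn_integral_lborel_prod) auto
  also have "\<dots> < \<infinity>"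
    using nn_integral_gaussian_1[OF c] by (simp add: power_less_top_ennreal)
  finally show ?thesis .
qed

lemma integrable_gaussian:
  assumes c: "c > (0::real)"
  shows "integrable lborel (\<lambda>x::'a::euclidean_space. exp (- c * (x \<bullet> x)))"
  using nn_integral_gaussian[OF c, where 'a='a] by (intro integrableI_bounded) auto

lemma nn_integral_scale:
  fixes f :: "'a::euclidean_space \<Rightarrow> ennreal"
  assumes [measurable]: "f \<in> borel_measurable borel" and c: "c > 0"
  shows "(\<integral>\<^sup>+ x. f x \<partial>lborel) = ennreal (c ^ DIM('a)) * (\<integral>\<^sup>+ x. f (c *\<^sub>R x) \<partial>lborel)"
  using c by (subst lborel_affine[of c 0])
    (simp_all add: nn_integral_density nn_integral_distr nn_integral_cmult)

lemma integral_scale: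
  fixes f :: "'a::euclidean_space \<Rightarrow> real"
  assumes [measurable]: "f \<in> borel_measurable borel" and c: "c > 0"
  shows "(LINT x|lborel. f x) = c ^ DIM('a) * (LINT x|lborel. f (c *\<^sub>R x))"
  using c by (subst lborel_affine[of c 0])
    (simp_all add: integral_density integral_distr)

text \<open>Integrating the Gaussian in space at time \<open>s\<close> gives a constant times \<open>s\<close> to
  the power \<open>DIM('a) / 2 - \<beta> * a\<close>, and the hypothesis on \<open>a\<close> says that
  this power is integrable at \<open>s = 0\<close>.\<close>
lemma kernel_Lp:
  fixes \<kappa> :: "'a::euclidean_space \<times> real \<Rightarrow> real"
  assumes m: "\<kappa> \<in> borel_measurable borel"
    and b: "\<And>x s. \<bar>\<kappa> (x, s)\<bar> \<le> (if 0 < s \<and> s < S then C * s powr (- \<beta>) * exp (- (x \<bullet> x) / (8 * s)) else 0)"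
    and a: "a > 0" "\<beta> * a - DIM('a) / 2 < 1" and C: "C \<ge> 0" and S: "S > 0"
  shows "integrable lborel (\<lambda>z. \<bar>\<kappa> z\<bar> powr a)"
proof (rule integrableI_bounded)
  note [measurable] = m
  show "(\<lambda>z. \<bar>\<kappa> z\<bar> powr a) \<in> borel_measurable lborel" by measurable
  define d where "d = real DIM('a) / 2 - \<beta> * a"
  define V where "V = (\<integral>\<^sup>+ x. ennreal (exp (- (a / 8) * (x \<bullet> x))) \<partial>(lborel::'a measure))"
  have V: "V < \<infinity>" unfolding V_def using a by (intro nn_integral_gaussian) auto
  let ?b = "\<lambda>(x::'a, s::real). (if 0 < s \<and> s < S then C * s powr (- \<beta>) * exp (- (x \<bullet> x) / (8 * s)) else 0) powr a"
  have [measurable]: "?b \<in> borel_measurable (borel \<Otimes>\<^sub>M borel)" by measurable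
  have slice: "(\<integral>\<^sup>+ x. ennreal (?b (x, s)) \<partial>lborel) = ennreal (C powr a) * V * (ennreal (s powr d) * indicator {0<..<S} s)" for s
  proof (cases "0 < s \<and> s < S")
    case True
    then have s: "0 < s" "s < S" by auto
    have e: "exp (- (x \<bullet> x) / (8 * s)) powr a = exp (- (a / 8 / s) * (x \<bullet> x))" for x :: 'a
      by (simp add: powr_def)
    have e': "exp (- (x \<bullet> x / (8 * s))) powr a = exp (- (a * (x \<bullet> x) / (8 * s)))" for x :: 'a
      by (simp add: powr_def)
    have "(\<integral>\<^sup>+ x. ennreal (?b (x, s)) \<partial>lborel) = (\<integral>\<^sup>+ x. ennreal (C powr a * s powr (- \<beta> * a)) * ennreal (exp (- (a / 8 / s) * (x \<bullet> x))) \<partial>(lborel::'a measure))"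
      using s C by (intro nn_integral_cong) (auto simp: powr_mult powr_powr e' ennreal_mult[symmetric])
    also have "\<dots> = ennreal (C powr a * s powr (- \<beta> * a)) * (\<integral>\<^sup>+ x. ennreal (exp (- (a / 8 / s) * (x \<bullet> x))) \<partial>(lborel::'a measure))"
      by (rule nn_integral_cmult) measurable
    also have "(\<integral>\<^sup>+ x. ennreal (exp (- (a / 8 / s) * (x \<bullet> x))) \<partial>(lborel::'a measure)) = ennreal (sqrt s ^ DIM('a)) * V"
    proof -
      have k: "- (a / 8 / s) * ((sqrt s *\<^sub>R x) \<bullet> (sqrt s *\<^sub>R x)) = - (a / 8) * (x \<bullet> x)" for x :: 'a
      proof -
        have "(sqrt s *\<^sub>R x) \<bullet> (sqrt s *\<^sub>R x) = (sqrt s * sqrt s) * (x \<bullet> x)" by simp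
        also have "sqrt s * sqrt s = s" using s by simp
        finally have "(sqrt s *\<^sub>R x) \<bullet> (sqrt s *\<^sub>R x) = s * (x \<bullet> x)" .
        then show ?thesis using s by (simp del: inner_scaleR_left inner_scaleR_right)
      qed
      have "(\<lambda>x::'a. ennreal (exp (- (a / 8 / s) * (x \<bullet> x)))) \<in> borel_measurable borel" by measurable
      from nn_integral_scale[OF this, of "sqrt s"] show ?thesis
        unfolding V_def k using s by simp
    qed
    also have "sqrt s ^ DIM('a) = s powr (real DIM('a) / 2)"
      using s by (simp add: powr_half_sqrt[symmetric] powr_powr powr_realpow[symmetric])
    also have "ennreal (C powr a * s powr (- \<beta> * a)) * (ennreal (s powr (real DIM('a) / 2)) * V) =
       ennreal (C powr a) * V * (ennreal (s powr (- \<beta> * a) * s powr (real DIM('a) / 2)))"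
      by (simp add: ennreal_mult ac_simps)
    also have "s powr (- \<beta> * a) * s powr (real DIM('a) / 2) = s powr d"
      by (simp add: powr_add[symmetric] d_def)
    finally show ?thesis using True by simp
  qed auto
  have "(\<integral>\<^sup>+ z. ennreal (norm (\<bar>\<kappa> z\<bar> powr a)) \<partial>lborel) \<le> (\<integral>\<^sup>+ z. ennreal (?b z) \<partial>lborel)"
  proof (intro nn_integral_mono ennreal_leI)
    fix z :: "'a \<times> real"
    obtain x s where z: "z = (x, s)" by (cases z)
    show "norm (\<bar>\<kappa> z\<bar> powr a) \<le> ?b z"
      unfolding z using b[of x s] a by (auto intro!: powr_mono2 simp del: abs_le_zero_iff split: if_splits)
  qed
  also have "\<dots> = (\<integral>\<^sup>+ z. ennreal (?b z) \<partial>(lborel \<Otimes>\<^sub>M lborel))" by (simp add: lborel_prod)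
  also have "\<dots> = (\<integral>\<^sup>+ s. \<integral>\<^sup>+ x. ennreal (?b (x, s)) \<partial>lborel \<partial>lborel)"
    by (rule lborel_pair.nn_integral_snd[symmetric]) measurable
  also have "\<dots> = (\<integral>\<^sup>+ s. ennreal (C powr a) * V * (ennreal (s powr d) * indicator {0<..<S} s) \<partial>lborel)"
    by (simp only: slice)
  also have "\<dots> \<le> (\<integral>\<^sup>+ s. ennreal (C powr a) * V * (ennreal (s powr d) * indicator {0..S} s) \<partial>lborel)"
    by (intro nn_integral_mono mult_left_mono) (auto simp: indicator_def)
  also have "\<dots> = ennreal (C powr a) * V * (\<integral>\<^sup>+ s. ennreal (s powr d) * indicator {0..S} s \<partial>lborel)"
    by (rule nn_integral_cmult) measurable
  also have "(\<integral>\<^sup>+ s. ennreal (s powr d) * indicator {0..S} s \<partial>lborel) = ennreal (S powr (d + 1) / (d + 1))"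
    using a S by (intro nn_integral_has_integral_lebesgue' has_integral_powr_from_0) (auto simp: d_def)
  also have "ennreal (C powr a) * V * ennreal (S powr (d + 1) / (d + 1)) < \<infinity>"
    using V by (simp add: ennreal_mult_less_top)
  finally show "(\<integral>\<^sup>+ z. ennreal (norm (\<bar>\<kappa> z\<bar> powr a)) \<partial>lborel) < \<infinity>" .
qed

text \<open>The Gaussian kernel without the factor \<open>(4 * pi) powr (- DIM('a) / 2)\<close>;
  \<open>heat_const\<close> accounts for the missing normalisation.\<close>
definition heat_kernel :: "'a::euclidean_space \<Rightarrow> real \<Rightarrow> real" where
  "heat_kernel x s = s powr (- (DIM('a) / 2)) * exp (- (x \<bullet> x) / (4 * s))"

text \<open>Cutting the kernel off at time \<open>S\<close> makes it integrable over space-time. On functions that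
  vanish after a time span less than \<open>S\<close> the cut-off is not felt.\<close>
definition heat :: "real \<Rightarrow> 'a::euclidean_space \<times> real \<Rightarrow> real" where
  "heat S = (\<lambda>(x, s). if 0 < s \<and> s < S then heat_kernel x s else 0)"

text \<open>The negative spatial derivative of the kernel in direction \<open>b\<close>; the sign is that of the
  integration by parts in \<open>heat_first\<close>.\<close>
definition heat_grad :: "real \<Rightarrow> 'a::euclidean_space \<Rightarrow> 'a \<times> real \<Rightarrow> real" where
  "heat_grad S b = (\<lambda>(x, s). if 0 < s \<and> s < S then (x \<bullet> b) / (2 * s) * heat_kernel x s else 0)"

text \<open>A non-negative kernel that dominates the length of the spatial gradient.\<close>
definition heat_abs_grad :: "real \<Rightarrow> 'a::euclidean_space \<times> real \<Rightarrow> real" where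
  "heat_abs_grad S z = (\<Sum>b\<in>Basis. \<bar>heat_grad S b z\<bar>)"

lemma heat_kernel_nonneg: "heat_kernel x s \<ge> 0" by (simp add: heat_kernel_def)

lemma heat_measurable [measurable]:
  "heat S \<in> borel_measurable (borel :: ('a::euclidean_space \<times> real) measure)"
  "heat_grad S b \<in> borel_measurable (borel :: ('a::euclidean_space \<times> real) measure)"
  "heat_abs_grad S \<in> borel_measurable (borel :: ('a::euclidean_space \<times> real) measure)"
proof -
  show 1: "heat S \<in> borel_measurable (borel :: ('a::euclidean_space \<times> real) measure)"
    unfolding heat_def heat_kernel_def borel_prod[symmetric] by measurable
  show 2: "heat_grad S b \<in> borel_measurable (borel :: ('a::euclidean_space \<times> real) measure)" for b
    unfolding heat_grad_def heat_kernel_def borel_prod[symmetric] by measurable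
  show "heat_abs_grad S \<in> borel_measurable (borel :: ('a::euclidean_space \<times> real) measure)"
    unfolding heat_abs_grad_def[abs_def] using 2 by (intro borel_measurable_sum borel_measurable_abs) auto
qed

lemma heat_nonneg: "heat S z \<ge> 0" by (auto simp: heat_def heat_kernel_nonneg split: prod.split)
lemma heat_abs_grad_nonneg: "heat_abs_grad S z \<ge> 0" by (simp add: heat_abs_grad_def sum_nonneg)

lemma heat_bound:
  "\<bar>heat S (x::'a::euclidean_space, s)\<bar> \<le> (if 0 < s \<and> s < S then 1 * s powr (- (DIM('a) / 2)) * exp (- (x \<bullet> x) / (8 * s)) else 0)"
  by (auto simp: heat_def heat_kernel_def abs_mult field_simps intro!: mult_left_mono)

text \<open>The factor \<open>\<bar>x\<bar> / s\<close> costs one half power of \<open>s\<close>, at the price of a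
  wider Gaussian.\<close>
lemma heat_grad_bound:
  assumes b: "b \<in> Basis"
  shows "\<bar>heat_grad S b (x::'a::euclidean_space, s)\<bar> \<le> (if 0 < s \<and> s < S then 1 * s powr (- ((DIM('a) + 1) / 2)) * exp (- (x \<bullet> x) / (8 * s)) else 0)"
proof (cases "0 < s \<and> s < S")
  case True
  then have s: "s > 0" by simp
  define t where "t = norm x / sqrt s"
  have t2: "t\<^sup>2 = (x \<bullet> x) / s" using s by (simp add: t_def power_divide power2_norm_eq_inner)
  have "0 \<le> (t / 2 - 1)\<^sup>2" by simp
  then have "t \<le> 2 * (1 + t\<^sup>2 / 8)" by (simp add: power2_eq_square algebra_simps)
  also have "\<dots> \<le> 2 * exp (t\<^sup>2 / 8)" using exp_ge_add_one_self[of "t\<^sup>2 / 8"] by (intro mult_left_mono) auto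
  finally have t: "t / 2 \<le> exp ((x \<bullet> x) / (8 * s))" by (simp add: t2 mult.commute)
  have "\<bar>x \<bullet> b\<bar> \<le> norm x" using b by (rule Basis_le_norm)
  then have "\<bar>x \<bullet> b\<bar> / (2 * s) \<le> norm x / (2 * s)" using s by (intro divide_right_mono) auto
  also have "\<dots> = s powr (-1/2) * (t / 2)"
    using s by (simp add: t_def powr_minus_divide powr_half_sqrt)
  also have "\<dots> \<le> s powr (-1/2) * exp ((x \<bullet> x) / (8 * s))" using t by (intro mult_left_mono) auto
  finally have "\<bar>x \<bullet> b\<bar> / (2 * s) * heat_kernel x s \<le> s powr (-1/2) * exp ((x \<bullet> x) / (8 * s)) * heat_kernel x s"
    by (intro mult_right_mono heat_kernel_nonneg)
  also have "\<dots> = (s powr (-1/2) * s powr (- (DIM('a) / 2))) * (exp ((x \<bullet> x) / (8 * s)) * exp (- (x \<bullet> x) / (4 * s)))"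
    by (simp add: heat_kernel_def)
  also have "exp ((x \<bullet> x) / (8 * s)) * exp (- (x \<bullet> x) / (4 * s)) = exp (- (x \<bullet> x) / (8 * s))"
    using s by (simp add: exp_add[symmetric] field_simps)
  also have "s powr (-1/2) * s powr (- (DIM('a) / 2)) = s powr (- ((DIM('a) + 1) / 2))"
  proof -
    have "- 1 / 2 + - (real DIM('a) / 2) = - (real (DIM('a) + 1) / 2)" by (simp add: field_simps)
    then show ?thesis by (simp only: powr_add[symmetric])
  qed
  finally show ?thesis using True heat_kernel_nonneg[of x s] by (simp add: heat_grad_def abs_mult)
qed (auto simp: heat_grad_def)

lemma heat_abs_grad_bound:
  "\<bar>heat_abs_grad S (x::'a::euclidean_space, s)\<bar> \<le> (if 0 < s \<and> s < S then real DIM('a) * s powr (- ((DIM('a) + 1) / 2)) * exp (- (x \<bullet> x) / (8 * s)) else 0)"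
proof -
  have "\<bar>heat_abs_grad S (x, s)\<bar> = (\<Sum>b\<in>Basis. \<bar>heat_grad S b (x, s)\<bar>)" by (simp add: heat_abs_grad_def sum_nonneg)
  also have "\<dots> \<le> real DIM('a) * (if 0 < s \<and> s < S then 1 * s powr (- ((DIM('a) + 1) / 2)) * exp (- (x \<bullet> x) / (8 * s)) else 0)"
    by (rule sum_bounded_above) (rule heat_grad_bound)
  finally show ?thesis by (simp split: if_splits)
qed

text \<open>With \<open>N = DIM('a)\<close> the ranges of exponents are \<open>a < (N + 2) / N\<close> for the
  kernel and \<open>a < (N + 2) / (N + 1)\<close> for its gradient.\<close>
lemma heat_Lp:
  fixes S a :: real
  assumes "S > 0" "a > 0"
  shows "DIM('a) / 2 * a - DIM('a) / 2 < 1 \<Longrightarrow> integrable lborel (\<lambda>z::'a::euclidean_space \<times> real. \<bar>heat S z\<bar> powr a)"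
    and "(DIM('a) + 1) / 2 * a - DIM('a) / 2 < 1 \<Longrightarrow> integrable lborel (\<lambda>z::'a::euclidean_space \<times> real. \<bar>heat_abs_grad S z\<bar> powr a)"
    and "b \<in> Basis \<Longrightarrow> (DIM('a) + 1) / 2 * a - DIM('a) / 2 < 1 \<Longrightarrow> integrable lborel (\<lambda>z::'a::euclidean_space \<times> real. \<bar>heat_grad S b z\<bar> powr a)"
proof -
  show "integrable lborel (\<lambda>z::'a \<times> real. \<bar>heat S z\<bar> powr a)" if "DIM('a) / 2 * a - DIM('a) / 2 < 1"
    by (rule kernel_Lp[OF heat_measurable(1) heat_bound assms(2) that]) (use assms in auto)
  show "integrable lborel (\<lambda>z::'a \<times> real. \<bar>heat_abs_grad S z\<bar> powr a)" if "(DIM('a) + 1) / 2 * a - DIM('a) / 2 < 1"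
    by (rule kernel_Lp[OF heat_measurable(3) heat_abs_grad_bound assms(2) that]) (use assms in auto)
  show "integrable lborel (\<lambda>z::'a \<times> real. \<bar>heat_grad S b z\<bar> powr a)"
    if "b \<in> Basis" "(DIM('a) + 1) / 2 * a - DIM('a) / 2 < 1"
    by (rule kernel_Lp[OF heat_measurable(2) heat_grad_bound[OF that(1)] assms(2) that(2)]) (use assms in auto)
qed

lemma heat_integrable:
  assumes "S > 0"
  shows "integrable lborel (heat S :: 'a::euclidean_space \<times> real \<Rightarrow> real)"
    "integrable lborel (heat_abs_grad S :: 'a::euclidean_space \<times> real \<Rightarrow> real)"
    "b \<in> Basis \<Longrightarrow> integrable lborel (heat_grad S b :: 'a::euclidean_space \<times> real \<Rightarrow> real)"
proof -
  have *: "integrable lborel f" if "f \<in> borel_measurable borel" "integrable lborel (\<lambda>z. \<bar>f z\<bar> powr 1)"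
    for f :: "'a \<times> real \<Rightarrow> real"
    using that integrable_norm_iff[of f lborel] by (simp add: powr_one)
  show "integrable lborel (heat S :: 'a \<times> real \<Rightarrow> real)"
    by (rule *[OF heat_measurable(1) heat_Lp(1)[OF assms]]) auto
  show "integrable lborel (heat_abs_grad S :: 'a \<times> real \<Rightarrow> real)"
    by (rule *[OF heat_measurable(3) heat_Lp(2)[OF assms]]) (auto simp: field_simps)
  show "integrable lborel (heat_grad S b :: 'a \<times> real \<Rightarrow> real)" if "b \<in> Basis"
    by (rule *[OF heat_measurable(2) heat_Lp(3)[OF assms _ that]]) (auto simp: field_simps)
qed

section \<open>Heat potentials of smooth functions\<close>

text \<open>The integral of a translated function does not depend on the translation; differentiate.\<close>
lemma integral_line_deriv_zero:
  fixes f f' :: "'a::euclidean_space \<Rightarrow> real"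
  assumes f: "f \<in> borel_measurable borel" "\<And>x. \<bar>f x\<bar> \<le> B" "\<And>x. norm x > R \<Longrightarrow> f x = 0"
    and f': "f' \<in> borel_measurable borel" "\<And>x. \<bar>f' x\<bar> \<le> B'" "\<And>x. norm x > R \<Longrightarrow> f' x = 0"
    and D: "\<And>x. has_line_deriv f e (f' x) x"
  shows "(LINT x|lborel. f' x) = 0"
proof -
  note [measurable] = f(1) f'(1)
  let ?w = "indicator (cball (0::'a) (R + norm e)) :: 'a \<Rightarrow> real"
  have w: "integrable lborel ?w"
    by (intro integrable_real_indicator emeasure_lborel_cball_finite) simp
  have wf: "?w x * f (x + h *\<^sub>R e) = f (x + h *\<^sub>R e)" if "\<bar>h\<bar> < 1" for x h
  proof (cases "x \<in> cball 0 (R + norm e)")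
    case False
    have "\<bar>h\<bar> * norm e \<le> 1 * norm e" using that by (intro mult_right_mono) auto
    moreover have "norm x \<le> norm (x + h *\<^sub>R e) + norm (h *\<^sub>R e)"
      using norm_triangle_ineq4[of "x + h *\<^sub>R e" "h *\<^sub>R e"] by simp
    ultimately have "norm (x + h *\<^sub>R e) > R" using False by simp
    then show ?thesis using f(3) by simp
  qed simp
  have wf': "?w x * f' x = f' x" for x
  proof (cases "x \<in> cball 0 (R + norm e)")
    case False
    then have "norm x > R + norm e" by simp
    then have "norm x > R" using norm_ge_zero[of e] by linarith
    then show ?thesis using f'(3) by simp
  qed simp
  have "((\<lambda>h. LINT x|lborel. ?w x * f (x + h *\<^sub>R e)) has_real_derivative (LINT x|lborel. ?w x * f' (x + 0 *\<^sub>R e))) (at 0)"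
  proof (rule diff_under_integral[where \<delta>=1 and B=B', OF w])
    show "((\<lambda>h. f (x + h *\<^sub>R e)) has_real_derivative f' (x + h *\<^sub>R e)) (at h)" for x h
      by (rule has_line_deriv_along[OF D])
    show "integrable lborel (\<lambda>x. ?w x * f (x + h *\<^sub>R e))" for h
      by (rule integrable_bounded_mult[OF w _ f(2)]) measurable
  qed (use f'(2) in auto)
  moreover have "\<forall>\<^sub>F h in nhds 0. (LINT x|lborel. ?w x * f (x + h *\<^sub>R e)) = (LINT x|lborel. f x)"
  proof (rule eventually_mono[OF eventually_nhds_in_open[of "{-1<..<1}"]])
    fix h :: real assume "h \<in> {-1<..<1}"
    then have h: "\<bar>h\<bar> < 1" by auto
    show "(LINT x|lborel. ?w x * f (x + h *\<^sub>R e)) = (LINT x|lborel. f x)"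
      unfolding wf[OF h] using lborel_integral_shift[OF f(1), of "h *\<^sub>R e"] by (simp add: add.commute)
  qed auto
  ultimately have "((\<lambda>h. LINT x|lborel. f x) has_real_derivative (LINT x|lborel. ?w x * f' (x + 0 *\<^sub>R e))) (at 0)"
    using DERIV_cong_ev[OF refl _ refl, of "\<lambda>h. LINT x|lborel. ?w x * f (x + h *\<^sub>R e)" "\<lambda>h. LINT x|lborel. f x" 0] by simp
  then have "(LINT x|lborel. ?w x * f' (x + 0 *\<^sub>R e)) = 0"
    by (rule DERIV_unique) simp
  then show ?thesis using wf' by simp
qed

lemma has_line_deriv_mult:
  assumes "has_line_deriv f e D z" "has_line_deriv g e E z"
  shows "has_line_deriv (\<lambda>z. f z * g z) e (D * g z + f z * E) z"
  using DERIV_mult[OF assms[unfolded has_line_deriv_def]] by (simp add: has_line_deriv_def algebra_simps)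

lemma has_line_deriv_inner_self:
  fixes b :: "'a::euclidean_space"
  shows "has_line_deriv (\<lambda>x. x \<bullet> x) b (2 * (x \<bullet> b)) x"
proof -
  have "(x + h *\<^sub>R b) \<bullet> (x + h *\<^sub>R b) = x \<bullet> x + (2 * (x \<bullet> b)) * h + (b \<bullet> b) * h\<^sup>2" for h
    by (simp add: inner_add_left inner_add_right inner_commute[of b x] power2_eq_square algebra_simps)
  then show ?thesis
    unfolding has_line_deriv_def by (auto intro!: derivative_eq_intros)
qed

lemma has_line_deriv_inner:
  fixes b :: "'a::euclidean_space"
  shows "has_line_deriv (\<lambda>x. x \<bullet> c) b (b \<bullet> c) x"
  unfolding has_line_deriv_def by (auto intro!: derivative_eq_intros simp: inner_add_left)

lemma has_line_deriv_heat_kernel: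
  fixes b x :: "'a::euclidean_space"
  assumes s: "s > 0"
  shows "has_line_deriv (\<lambda>x. heat_kernel x s) b (- (x \<bullet> b) / (2 * s) * heat_kernel x s) x"
proof -
  note 1 = has_line_deriv_inner_self[of b x, unfolded has_line_deriv_def]
  show ?thesis unfolding has_line_deriv_def heat_kernel_def
    using s by (auto intro!: derivative_eq_intros 1)
qed

lemma heat_kernel_DERIV_s:
  fixes x :: "'a::euclidean_space"
  assumes s: "s > 0"
  shows "((\<lambda>s. heat_kernel x s) has_real_derivative ((x \<bullet> x) / (4 * s\<^sup>2) - DIM('a) / (2 * s)) * heat_kernel x s) (at s)"
proof -
  have "s powr (- (real DIM('a) / 2) - 1) = s powr (- (real DIM('a) / 2)) / s"
    using s by (simp add: powr_diff)
  then show ?thesis unfolding heat_kernel_def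
    using s by (auto intro!: derivative_eq_intros simp: field_simps power2_eq_square)
qed

lemma has_line_deriv_slice:
  assumes "has_line_deriv \<phi> (b, 0) D (z + (x, s))"
  shows "has_line_deriv (\<lambda>x. \<phi> (z + (x, s))) b D x"
  using assms by (simp add: has_line_deriv_def add.assoc)

lemma heat_kernel_continuous: "s > 0 \<Longrightarrow> continuous_on UNIV (\<lambda>x::'a::euclidean_space. heat_kernel x s)"
  unfolding heat_kernel_def by (intro continuous_intros) auto

lemma heat_kernel_measurable_slice [measurable]: "(\<lambda>x::'a::euclidean_space. heat_kernel x s) \<in> borel_measurable borel"
  unfolding heat_kernel_def by measurable

definition heat_const :: "'a::euclidean_space itself \<Rightarrow> real" where
  "heat_const _ = (LINT y|lborel. exp (- (1/4) * ((y::'a) \<bullet> y)))"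

context
  fixes \<phi> \<phi>t :: "'a::euclidean_space \<times> real \<Rightarrow> real" and \<phi>1 \<phi>2 :: "'a \<Rightarrow> 'a \<times> real \<Rightarrow> real" and R :: real
  assumes c: "continuous_on UNIV \<phi>" "continuous_on UNIV \<phi>t"
      "\<And>b. b \<in> Basis \<Longrightarrow> continuous_on UNIV (\<phi>1 b)" "\<And>b. b \<in> Basis \<Longrightarrow> continuous_on UNIV (\<phi>2 b)"
    and v: "vanishes_off R \<phi>" "vanishes_off R \<phi>t"
      "\<And>b. b \<in> Basis \<Longrightarrow> vanishes_off R (\<phi>1 b)" "\<And>b. b \<in> Basis \<Longrightarrow> vanishes_off R (\<phi>2 b)"
    and ld: "\<And>z. has_line_deriv \<phi> (0, 1) (\<phi>t z) z"
      "\<And>z b. b \<in> Basis \<Longrightarrow> has_line_deriv \<phi> (b, 0) (\<phi>1 b z) z"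
      "\<And>z b. b \<in> Basis \<Longrightarrow> has_line_deriv (\<phi>1 b) (b, 0) (\<phi>2 b z) z"
begin

lemma slice_props:
  fixes \<psi> :: "'a \<times> real \<Rightarrow> real"
  assumes "continuous_on UNIV \<psi>" "vanishes_off R \<psi>"
  shows "continuous_on UNIV (\<lambda>x. \<psi> (z + (x, s)))"
    "norm x > R + norm z + \<bar>s\<bar> \<Longrightarrow> \<psi> (z + (x, s)) = 0"
proof -
  show "continuous_on UNIV (\<lambda>x. \<psi> (z + (x, s)))"
    by (intro continuous_on_compose2[OF assms(1)] continuous_intros) auto
  assume x: "norm x > R + norm z + \<bar>s\<bar>"
  have "norm x \<le> norm (x, s)" using norm_fst_le[of x s] by simp
  also have "\<dots> \<le> norm (z + (x, s)) + norm z" using norm_triangle_ineq4[of "z + (x, s)" z] by simp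
  finally have "norm (z + (x, s)) > R" using x by linarith
  then show "\<psi> (z + (x, s)) = 0" using assms(2) unfolding vanishes_off_def by blast
qed

lemma slice_ibp:
  fixes \<psi> \<psi>' :: "'a \<times> real \<Rightarrow> real"
  assumes s: "s > 0"
    and a: "continuous_on UNIV a" "continuous_on UNIV a'" "\<And>x. has_line_deriv a b (a' x) x"
    and \<psi>: "continuous_on UNIV \<psi>" "continuous_on UNIV \<psi>'" "vanishes_off R \<psi>" "vanishes_off R \<psi>'"
      "\<And>z. has_line_deriv \<psi> (b, 0) (\<psi>' z) z"
  shows "(LINT x|lborel. a x * \<psi>' (z + (x, s))) = - (LINT x|lborel. a' x * \<psi> (z + (x, s)))"
proof -
  define R' where "R' = R + norm z + \<bar>s\<bar>"
  note p = slice_props[OF \<psi>(1,3), of z s] slice_props[OF \<psi>(2,4), of z s]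
  have 1: "continuous_on UNIV (\<lambda>x. a x * \<psi>' (z + (x, s)))" "vanishes_off R' (\<lambda>x. a x * \<psi>' (z + (x, s)))"
    using p a by (auto intro!: continuous_intros simp: vanishes_off_def R'_def)
  have 2: "continuous_on UNIV (\<lambda>x. a' x * \<psi> (z + (x, s)))" "vanishes_off R' (\<lambda>x. a' x * \<psi> (z + (x, s)))"
    using p a by (auto intro!: continuous_intros simp: vanishes_off_def R'_def)
  have 3: "continuous_on UNIV (\<lambda>x. a x * \<psi> (z + (x, s)))" "vanishes_off R' (\<lambda>x. a x * \<psi> (z + (x, s)))"
    using p a by (auto intro!: continuous_intros simp: vanishes_off_def R'_def)
  let ?f' = "\<lambda>x. a' x * \<psi> (z + (x, s)) + a x * \<psi>' (z + (x, s))"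
  have 4: "continuous_on UNIV ?f'" "vanishes_off R' ?f'"
    using 1 2 by (auto intro!: continuous_intros simp: vanishes_off_def)
  obtain B where B: "\<And>x. \<bar>a x * \<psi> (z + (x, s))\<bar> \<le> B"
    using continuous_vanishes_off(2)[OF 3] by (auto simp: bounded_iff)
  obtain B' where B': "\<And>x. \<bar>?f' x\<bar> \<le> B'"
    using continuous_vanishes_off(2)[OF 4] by (auto simp: bounded_iff)
  have "(LINT x|lborel. ?f' x) = 0"
  proof (rule integral_line_deriv_zero)
    show "has_line_deriv (\<lambda>x. a x * \<psi> (z + (x, s))) b (?f' x) x" for x
      by (intro has_line_deriv_mult a has_line_deriv_slice \<psi>)
    show "R' < norm x \<Longrightarrow> a x * \<psi> (z + (x, s)) = 0" for x using 3(2) by (simp add: vanishes_off_def)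
    show "R' < norm x \<Longrightarrow> ?f' x = 0" for x using 4(2) by (simp add: vanishes_off_def)
  qed (use B B' continuous_vanishes_off(3)[OF 3] continuous_vanishes_off(3)[OF 4] in auto)
  moreover have "(LINT x|lborel. ?f' x) = (LINT x|lborel. a' x * \<psi> (z + (x, s))) + (LINT x|lborel. a x * \<psi>' (z + (x, s)))"
    by (intro Bochner_Integration.integral_add continuous_vanishes_off(1)[OF 2] continuous_vanishes_off(1)[OF 1])
  ultimately show ?thesis by linarith
qed

lemma slice_first:
  assumes s: "s > 0" and b: "b \<in> Basis"
  shows "(LINT x|lborel. heat_kernel x s * \<phi>1 b (z + (x, s))) = (LINT x|lborel. (x \<bullet> b) / (2 * s) * heat_kernel x s * \<phi> (z + (x, s)))"
proof -
  have "(LINT x|lborel. heat_kernel x s * \<phi>1 b (z + (x, s))) = - (LINT x|lborel. (- (x \<bullet> b) / (2 * s) * heat_kernel x s) * \<phi> (z + (x, s)))"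
    by (rule slice_ibp[OF s heat_kernel_continuous[OF s] _ has_line_deriv_heat_kernel[OF s] c(1) c(3)[OF b] v(1) v(3)[OF b] ld(2)[OF b]])
       (intro continuous_intros heat_kernel_continuous s; use s in auto)
  then show ?thesis by simp
qed

lemma slice_second:
  assumes s: "s > 0" and b: "b \<in> Basis"
  shows "(LINT x|lborel. heat_kernel x s * \<phi>2 b (z + (x, s))) = (LINT x|lborel. ((x \<bullet> b)\<^sup>2 / (4 * s\<^sup>2) - 1 / (2 * s)) * heat_kernel x s * \<phi> (z + (x, s)))"
proof -
  let ?a = "\<lambda>x. (x \<bullet> b) / (2 * s) * heat_kernel x s"
  let ?a' = "\<lambda>x. (1 / (2 * s) - (x \<bullet> b)\<^sup>2 / (4 * s\<^sup>2)) * heat_kernel x s"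
  have "(LINT x|lborel. heat_kernel x s * \<phi>2 b (z + (x, s))) = - (LINT x|lborel. (- (x \<bullet> b) / (2 * s) * heat_kernel x s) * \<phi>1 b (z + (x, s)))"
    by (rule slice_ibp[OF s heat_kernel_continuous[OF s] _ has_line_deriv_heat_kernel[OF s] c(3)[OF b] c(4)[OF b] v(3)[OF b] v(4)[OF b] ld(3)[OF b]])
       (intro continuous_intros heat_kernel_continuous s; use s in auto)
  also have "\<dots> = (LINT x|lborel. ?a x * \<phi>1 b (z + (x, s)))" by simp
  also have "\<dots> = - (LINT x|lborel. ?a' x * \<phi> (z + (x, s)))"
  proof (rule slice_ibp[OF s _ _ _ c(1) c(3)[OF b] v(1) v(3)[OF b] ld(2)[OF b]])
    show "continuous_on UNIV ?a" "continuous_on UNIV ?a'"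
      by (intro continuous_intros heat_kernel_continuous s; use s in auto)+
    show "has_line_deriv ?a b (?a' x) x" for x
    proof -
      have "has_line_deriv (\<lambda>x. (1 / (2 * s)) * ((x \<bullet> b) * heat_kernel x s)) b (0 * ((x \<bullet> b) * heat_kernel x s) + (1 / (2 * s)) * ((b \<bullet> b) * heat_kernel x s + (x \<bullet> b) * (- (x \<bullet> b) / (2 * s) * heat_kernel x s))) x"
        by (intro has_line_deriv_mult has_line_deriv_inner has_line_deriv_heat_kernel s) (simp add: has_line_deriv_def)
      then show ?thesis using b s by (simp add: field_simps power2_eq_square)
    qed
  qed
  also have "\<dots> = (LINT x|lborel. - (?a' x * \<phi> (z + (x, s))))" by simp
  finally show ?thesis by (simp add: algebra_simps)
qed

lemma slice_integrable:
  fixes \<psi> :: "'a \<times> real \<Rightarrow> real"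
  assumes s: "s > 0" and a: "continuous_on UNIV (a :: 'a \<Rightarrow> real)" and \<psi>: "continuous_on UNIV \<psi>" "vanishes_off R \<psi>"
  shows "integrable lborel (\<lambda>x. a x * \<psi> (z + (x, s)))"
  by (rule continuous_vanishes_off(1)[where \<epsilon>="R + norm z + \<bar>s\<bar>"])
     (use slice_props[OF \<psi>, of z s] a in \<open>auto intro!: continuous_intros simp: vanishes_off_def\<close>)

text \<open>Two integrations by parts move the Laplacian onto the kernel.\<close>
lemma slice_laplace:
  assumes s: "s > 0"
  shows "(LINT x|lborel. heat_kernel x s * (\<Sum>b\<in>Basis. \<phi>2 b (z + (x, s)))) =
    (LINT x|lborel. ((x \<bullet> x) / (4 * s\<^sup>2) - DIM('a) / (2 * s)) * heat_kernel x s * \<phi> (z + (x, s)))"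
proof -
  have "(LINT x|lborel. heat_kernel x s * (\<Sum>b\<in>Basis. \<phi>2 b (z + (x, s)))) = (\<Sum>b\<in>Basis. LINT x|lborel. heat_kernel x s * \<phi>2 b (z + (x, s)))"
    unfolding sum_distrib_left
    by (intro Bochner_Integration.integral_sum slice_integrable heat_kernel_continuous s c v) auto
  also have "\<dots> = (\<Sum>b\<in>(Basis::'a set). LINT x|lborel. ((x \<bullet> b)\<^sup>2 / (4 * s\<^sup>2) - 1 / (2 * s)) * heat_kernel x s * \<phi> (z + (x, s)))"
    by (intro sum.cong refl slice_second s)
  also have "\<dots> = (LINT x|lborel. (\<Sum>b\<in>(Basis::'a set). ((x \<bullet> b)\<^sup>2 / (4 * s\<^sup>2) - 1 / (2 * s)) * heat_kernel x s * \<phi> (z + (x, s))))"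
    by (intro Bochner_Integration.integral_sum[symmetric] slice_integrable s c v continuous_intros heat_kernel_continuous) (use s in auto)
  also have "(\<lambda>x. \<Sum>b\<in>(Basis::'a set). ((x \<bullet> b)\<^sup>2 / (4 * s\<^sup>2) - 1 / (2 * s)) * heat_kernel x s * \<phi> (z + (x, s))) =
     (\<lambda>x. ((x \<bullet> x) / (4 * s\<^sup>2) - DIM('a) / (2 * s)) * heat_kernel x s * \<phi> (z + (x, s)))"
  proof
    fix x :: 'a
    have "(\<Sum>b\<in>(Basis::'a set). (x \<bullet> b)\<^sup>2 / (4 * s\<^sup>2) - 1 / (2 * s)) = (x \<bullet> x) / (4 * s\<^sup>2) - DIM('a) / (2 * s)"
      unfolding euclidean_inner[of x x] by (simp add: sum_subtractf sum_divide_distrib[symmetric] power2_eq_square)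
    then show "(\<Sum>b\<in>(Basis::'a set). ((x \<bullet> b)\<^sup>2 / (4 * s\<^sup>2) - 1 / (2 * s)) * heat_kernel x s * \<phi> (z + (x, s))) =
      ((x \<bullet> x) / (4 * s\<^sup>2) - DIM('a) / (2 * s)) * heat_kernel x s * \<phi> (z + (x, s))"
      by (simp only: sum_distrib_right[symmetric])
  qed
  finally show ?thesis .
qed

text \<open>The mean of \<phi> under the heat kernel at time distance \<open>s\<close>, written after the
  substitution \<open>x = sqrt s * y\<close>. In this form the limit \<open>s = 0\<close> causes no
  singularity.\<close>
definition "heat_mean z s = (LINT y|lborel. exp (- (1/4) * ((y::'a) \<bullet> y)) * \<phi> (z + (sqrt s *\<^sub>R y, s)))"
definition "heat_mean' z s = (LINT x|lborel. heat_kernel x s * (\<phi>t (z + (x, s)) + (\<Sum>b\<in>Basis. \<phi>2 b (z + (x, s)))))"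

lemma heat_mean_0: "heat_mean z 0 = heat_const TYPE('a) * \<phi> z"
  by (simp add: heat_mean_def heat_const_def zero_prod_def[symmetric])

lemma heat_mean_large: "R < snd z + s \<Longrightarrow> heat_mean z s = 0"
proof -
  assume s: "R < snd z + s"
  have "\<phi> (z + (x, s)) = 0" for x
  proof -
    have "R < norm (z + (x, s))"
    proof -
      have "R < \<bar>snd (z + (x, s))\<bar>" using s by simp
      also have "\<dots> \<le> norm (z + (x, s))"
        using norm_snd_le[of "snd (z + (x, s))" "fst (z + (x, s))"]
        unfolding prod.collapse by (simp only: real_norm_def)
      finally show ?thesis .
    qed
    then show ?thesis using v(1) unfolding vanishes_off_def by blast
  qed
  then show ?thesis by (simp add: heat_mean_def)
qed

lemma heat_mean_pos:
  assumes s: "s > 0" shows "heat_mean z s = (LINT x|lborel. heat_kernel x s * \<phi> (z + (x, s)))"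
proof -
  have "continuous_on UNIV (\<lambda>x. heat_kernel x s * \<phi> (z + (x, s)))"
    using slice_props(1)[OF c(1) v(1)] heat_kernel_continuous[OF s] by (intro continuous_intros)
  then have m: "(\<lambda>x. heat_kernel x s * \<phi> (z + (x, s))) \<in> borel_measurable borel"
    by (rule borel_measurable_continuous_onI)
  have e: "sqrt s ^ DIM('a) * (heat_kernel (sqrt s *\<^sub>R y) s * q) = exp (- (1/4) * (y \<bullet> y)) * q" for y :: 'a and q
  proof -
    have "sqrt s ^ DIM('a) = s powr (real DIM('a) / 2)"
      using s by (simp add: powr_half_sqrt[symmetric] powr_powr powr_realpow[symmetric])
    then have p: "sqrt s ^ DIM('a) * s powr (- (real DIM('a) / 2)) = 1"
      using s by (simp add: powr_add[symmetric])
    have "(sqrt s *\<^sub>R y) \<bullet> (sqrt s *\<^sub>R y) = (sqrt s * sqrt s) * (y \<bullet> y)" by simp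
    also have "sqrt s * sqrt s = s" using s by simp
    finally have "(sqrt s *\<^sub>R y) \<bullet> (sqrt s *\<^sub>R y) = s * (y \<bullet> y)" .
    then have "- ((sqrt s *\<^sub>R y) \<bullet> (sqrt s *\<^sub>R y)) / (4 * s) = - (1/4) * (y \<bullet> y)"
      using s by (simp del: inner_scaleR_left inner_scaleR_right)
    then have "sqrt s ^ DIM('a) * (heat_kernel (sqrt s *\<^sub>R y) s * q) = (sqrt s ^ DIM('a) * s powr (- (real DIM('a) / 2))) * (exp (- (1/4) * (y \<bullet> y)) * q)"
      by (simp add: heat_kernel_def)
    then show ?thesis unfolding p by simp
  qed
  have "(LINT x|lborel. heat_kernel x s * \<phi> (z + (x, s))) = sqrt s ^ DIM('a) * (LINT y|lborel. heat_kernel (sqrt s *\<^sub>R y) s * \<phi> (z + (sqrt s *\<^sub>R y, s)))"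
    using s by (intro integral_scale[OF m]) auto
  also have "\<dots> = heat_mean z s"
    unfolding heat_mean_def integral_mult_right_zero[symmetric] e ..
  finally show ?thesis by simp
qed

lemma heat_mean_continuous: "continuous_on {0..} (heat_mean z)"
proof -
  obtain B where B: "\<And>x. \<bar>\<phi> x\<bar> \<le> B"
    using continuous_vanishes_off(2)[OF c(1) v(1)] by (auto simp: bounded_iff)
  have m: "\<phi> \<in> borel_measurable borel" by (rule continuous_vanishes_off(3)[OF c(1) v(1)])
  have "isCont (heat_mean z) s" for s
    unfolding heat_mean_def
  proof (rule cont_under_integral)
    show "integrable lborel (\<lambda>y::'a. exp (- (1/4) * (y \<bullet> y)))" by (rule integrable_gaussian) simp
    show "isCont (\<lambda>s. \<phi> (z + (sqrt s *\<^sub>R y, s))) s" for y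
    proof (rule isCont_o2[where f="\<lambda>s. z + (sqrt s *\<^sub>R y, s)"])
      show "isCont (\<lambda>s. z + (sqrt s *\<^sub>R y, s)) s" by (intro continuous_intros)
      show "isCont \<phi> (z + (sqrt s *\<^sub>R y, s))" using c(1) continuous_on_eq_continuous_at[OF open_UNIV] by blast
    qed
    show "(\<lambda>y::'a. exp (- (1/4) * (y \<bullet> y)) * \<phi> (z + (sqrt s *\<^sub>R y, s))) \<in> borel_measurable lborel" for s
      using m by measurable
    show "\<bar>\<phi> (z + (sqrt s *\<^sub>R y, s))\<bar> \<le> B" for y s by (rule B)
  qed
  then show ?thesis by (simp add: continuous_at_imp_continuous_on)
qed

text \<open>The time derivative of the kernel equals its Laplacian, which is moved onto \<phi>.\<close>
lemma heat_mean_DERIV: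
  assumes s: "s > 0"
  shows "(heat_mean z has_real_derivative heat_mean' z s) (at s)"
proof -
  define R' where "R' = R + norm z + 2 * s"
  let ?w = "indicator (cball (0::'a) R') :: 'a \<Rightarrow> real"
  have w: "integrable lborel ?w"
    by (intro integrable_real_indicator emeasure_lborel_cball_finite) simp
  let ?H = "\<lambda>x s. ((x \<bullet> x) / (4 * s\<^sup>2) - DIM('a) / (2 * s)) * heat_kernel x s"
  \<comment> \<open>For times near \<open>s\<close> the integrand vanishes off a fixed ball, so the indicator of this ball
    serves as the integrable weight, and the singularity of the kernel at time zero is kept away.\<close>
  let ?\<Phi> = "\<lambda>x h. if x \<in> cball 0 R' then heat_kernel x (s + h) * \<phi> (z + (x, s + h)) else 0"
  let ?\<Phi>' = "\<lambda>x h. if x \<in> cball 0 R' then ?H x (s + h) * \<phi> (z + (x, s + h)) + heat_kernel x (s + h) * \<phi>t (z + (x, s + h)) else 0"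
  have off: "\<psi> (z + (x, s + h)) = 0" if "x \<notin> cball 0 R'" "\<bar>h\<bar> < s / 2" "vanishes_off R \<psi>" "continuous_on UNIV \<psi>" for x h \<psi>
  proof (rule slice_props(2)[OF that(4,3)])
    show "R + norm z + \<bar>s + h\<bar> < norm x" using that(1,2) s by (auto simp: R'_def)
  qed
  have cont: "continuous_on (cball 0 R' \<times> {- (s/2)..s/2}) (\<lambda>(x, h). ?H x (s + h) * \<phi> (z + (x, s + h)) + heat_kernel x (s + h) * \<phi>t (z + (x, s + h)))"
    unfolding heat_kernel_def split_def
    by (intro continuous_intros continuous_on_compose2[OF c(1)] continuous_on_compose2[OF c(2)]) (use s in auto)
  have "compact (cball (0::'a) R' \<times> {- (s/2)..s/2})" by (intro compact_Times) auto
  then obtain B where B: "\<And>x h. x \<in> cball 0 R' \<Longrightarrow> \<bar>h\<bar> \<le> s/2 \<Longrightarrow> \<bar>?H x (s + h) * \<phi> (z + (x, s + h)) + heat_kernel x (s + h) * \<phi>t (z + (x, s + h))\<bar> \<le> B"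
    using compact_imp_bounded[OF compact_continuous_image[OF cont]] unfolding bounded_iff by (force simp: abs_le_iff)
  have m: "\<phi> \<in> borel_measurable borel" "\<phi>t \<in> borel_measurable borel"
    by (rule continuous_vanishes_off(3)[OF c(1) v(1)], rule continuous_vanishes_off(3)[OF c(2) v(2)])
  note [measurable] = m
  have D: "((\<lambda>h. LINT x|lborel. ?w x * ?\<Phi> x h) has_real_derivative (LINT x|lborel. ?w x * ?\<Phi>' x 0)) (at 0)"
  proof (rule diff_under_integral[where \<delta>="s/2" and B="max B 0" and \<Phi>="?\<Phi>" and \<Phi>'="?\<Phi>'", OF w])
    show "s / 2 > 0" using s by simp
    fix x h assume h: "\<bar>h\<bar> < s / 2"
    show "(?\<Phi> x has_real_derivative ?\<Phi>' x h) (at h)"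
    proof (cases "x \<in> cball 0 R'")
      case True
      have sh: "s + h > 0" using h s by auto
      have 1: "((\<lambda>h. heat_kernel x (s + h)) has_real_derivative ?H x (s + h)) (at h)"
        using heat_kernel_DERIV_s[OF sh, of x] DERIV_shift[of "heat_kernel x" "?H x (s + h)" h s] by (simp add: add.commute)
      have 2: "((\<lambda>h. \<phi> (z + (x, s + h))) has_real_derivative \<phi>t (z + (x, s + h))) (at h)"
        using has_line_deriv_along[OF ld(1), of "z + (x, s)" h] by (simp add: add.assoc)
      show ?thesis using DERIV_mult[OF 1 2] True by (simp add: algebra_simps)
    qed simp
    show "\<bar>?\<Phi>' x h\<bar> \<le> max B 0" using B[of x h] h by auto
  next
    fix h assume h: "\<bar>h\<bar> < s / 2"
    have sh: "s + h > 0" using h s by auto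
    have "integrable lborel (\<lambda>x. heat_kernel x (s + h) * \<phi> (z + (x, s + h)))"
      by (rule slice_integrable[OF sh heat_kernel_continuous[OF sh] c(1) v(1)])
    moreover have "?w x * ?\<Phi> x h = heat_kernel x (s + h) * \<phi> (z + (x, s + h))" for x
      using off[OF _ h v(1) c(1), of x] by (auto simp: indicator_def)
    ultimately show "integrable lborel (\<lambda>x. ?w x * ?\<Phi> x h)" by (simp only:)
  next
    show "(\<lambda>x. ?w x * ?\<Phi>' x 0) \<in> borel_measurable lborel" by measurable
  qed
  have ev: "\<forall>\<^sub>F h in nhds 0. (LINT x|lborel. ?w x * ?\<Phi> x h) = heat_mean z (h + s)"
  proof (rule eventually_mono[OF eventually_nhds_in_open[of "{-(s/2)<..<s/2}"]])
    fix h assume "h \<in> {-(s/2)<..<s/2}"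
    then have h: "\<bar>h\<bar> < s / 2" by auto
    then have sh: "s + h > 0" using s by auto
    have "?w x * ?\<Phi> x h = heat_kernel x (s + h) * \<phi> (z + (x, s + h))" for x
      using off[OF _ h v(1) c(1), of x] by (auto simp: indicator_def)
    then show "(LINT x|lborel. ?w x * ?\<Phi> x h) = heat_mean z (h + s)"
      using heat_mean_pos[OF sh, of z] by (simp only: add.commute)
  qed (use s in auto)
  have "((\<lambda>h. heat_mean z (h + s)) has_real_derivative (LINT x|lborel. ?w x * ?\<Phi>' x 0)) (at 0)"
    using DERIV_cong_ev[OF refl ev refl] D by blast
  then have 1: "(heat_mean z has_real_derivative (LINT x|lborel. ?w x * ?\<Phi>' x 0)) (at s)"
    using DERIV_shift[of "heat_mean z" _ 0 s] by simp
  have "(LINT x|lborel. ?w x * ?\<Phi>' x 0) = (LINT x|lborel. ?H x s * \<phi> (z + (x, s)) + heat_kernel x s * \<phi>t (z + (x, s)))"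
    using off[of _ 0, OF _ _ v(1) c(1)] off[of _ 0, OF _ _ v(2) c(2)] s
    by (intro Bochner_Integration.integral_cong refl) (auto simp: indicator_def)
  also have "\<dots> = (LINT x|lborel. ?H x s * \<phi> (z + (x, s))) + (LINT x|lborel. heat_kernel x s * \<phi>t (z + (x, s)))"
    by (intro Bochner_Integration.integral_add slice_integrable s c v heat_kernel_continuous continuous_intros) (use s in auto)
  also have "(LINT x|lborel. ?H x s * \<phi> (z + (x, s))) = (LINT x|lborel. heat_kernel x s * (\<Sum>b\<in>Basis. \<phi>2 b (z + (x, s))))"
    by (rule slice_laplace[OF s, symmetric])
  also have "\<dots> + (LINT x|lborel. heat_kernel x s * \<phi>t (z + (x, s))) = heat_mean' z s"
  proof -
    have "integrable lborel (\<lambda>x. heat_kernel x s * (\<Sum>b\<in>Basis. \<phi>2 b (z + (x, s))))"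
      unfolding sum_distrib_left
      by (intro Bochner_Integration.integrable_sum slice_integrable heat_kernel_continuous s c v) auto
    moreover have "integrable lborel (\<lambda>x. heat_kernel x s * \<phi>t (z + (x, s)))"
      by (intro slice_integrable heat_kernel_continuous s c v)
    ultimately show ?thesis
      unfolding heat_mean'_def distrib_left by (subst Bochner_Integration.integral_add) auto
  qed
  finally show ?thesis using 1 by simp
qed

lemma corr_slices:
  fixes \<psi> :: "'a \<times> real \<Rightarrow> real"
  assumes \<kappa>: "integrable lborel \<kappa>" and \<psi>: "continuous_on UNIV \<psi>" "vanishes_off R \<psi>"
  shows "corr \<kappa> \<psi> z = (LINT s|lborel. LINT x|lborel. \<kappa> (x, s) * \<psi> (z + (x, s)))"
    "integrable lborel (\<lambda>s. LINT x|lborel. \<kappa> (x, s) * \<psi> (z + (x, s)))"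
proof -
  obtain B where B: "\<And>x. \<bar>\<psi> x\<bar> \<le> B"
    using continuous_vanishes_off(2)[OF \<psi>] by (auto simp: bounded_iff)
  have [measurable]: "\<psi> \<in> borel_measurable borel" by (rule continuous_vanishes_off(3)[OF \<psi>])
  have "integrable lborel (\<lambda>y. \<kappa> y * \<psi> (z + y))"
    by (rule integrable_bounded_mult[OF \<kappa> _ B]) measurable
  then have i: "integrable (lborel \<Otimes>\<^sub>M lborel) (\<lambda>(x, s). \<kappa> (x, s) * \<psi> (z + (x, s)))"
    by (simp add: lborel_prod split_def)
  show "integrable lborel (\<lambda>s. LINT x|lborel. \<kappa> (x, s) * \<psi> (z + (x, s)))"
    by (rule lborel_pair.integrable_snd[OF i])
  show "corr \<kappa> \<psi> z = (LINT s|lborel. LINT x|lborel. \<kappa> (x, s) * \<psi> (z + (x, s)))"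
    using lborel_pair.integral_snd[OF i] by (simp add: lborel_prod split_def corr_def)
qed

lemma heat_first:
  assumes S: "S > 0" and b: "b \<in> Basis"
  shows "corr (heat S) (\<phi>1 b) z = corr (heat_grad S b) \<phi> z"
  unfolding corr_slices(1)[OF heat_integrable(1)[OF S] c(3)[OF b] v(3)[OF b]]
    corr_slices(1)[OF heat_integrable(3)[OF S b] c(1) v(1)]
proof (rule Bochner_Integration.integral_cong[OF refl])
  fix s
  show "(LINT x|lborel. heat S (x, s) * \<phi>1 b (z + (x, s))) = (LINT x|lborel. heat_grad S b (x, s) * \<phi> (z + (x, s)))"
    using slice_first[OF _ b, of s z] by (cases "0 < s \<and> s < S") (auto simp: heat_def heat_grad_def)
qed

text \<open>The heat potential inverts the backward heat operator. Integrating the time derivative of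
  \<open>heat_mean\<close> from \<open>0\<close> to \<open>S\<close> leaves the value at
  \<open>0\<close>, a multiple of \<phi>, since the value at \<open>S\<close> lies beyond the support of
  \<phi>.\<close>
lemma heat_identity:
  assumes S: "S > 0" and z: "R < snd z + S"
  shows "corr (heat S) \<phi>t z + (\<Sum>b\<in>Basis. corr (heat S) (\<phi>2 b) z) = - heat_const TYPE('a) * \<phi> z"
proof -
  let ?\<psi> = "\<lambda>z. \<phi>t z + (\<Sum>b\<in>Basis. \<phi>2 b z)"
  have \<psi>: "continuous_on UNIV ?\<psi>" "vanishes_off R ?\<psi>"
    using c v by (auto intro!: continuous_intros simp: vanishes_off_def)
  note hi = heat_integrable(1)[OF S, where 'a='a]
  have int: "integrable lborel (\<lambda>y. heat S y * \<eta> (z + y))" if \<eta>: "continuous_on UNIV \<eta>" "vanishes_off R \<eta>" for \<eta> :: "'a \<times> real \<Rightarrow> real"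
  proof -
    obtain B where B: "\<And>x. \<bar>\<eta> x\<bar> \<le> B"
      using continuous_vanishes_off(2)[OF \<eta>] by (auto simp: bounded_iff)
    have [measurable]: "\<eta> \<in> borel_measurable borel" by (rule continuous_vanishes_off(3)[OF \<eta>])
    show ?thesis by (rule integrable_bounded_mult[OF hi _ B]) measurable
  qed
  have "corr (heat S) ?\<psi> z = corr (heat S) \<phi>t z + (\<Sum>b\<in>Basis. corr (heat S) (\<phi>2 b) z)"
    unfolding corr_def distrib_left sum_distrib_left
    by (subst Bochner_Integration.integral_add)
       (auto intro!: int c v Bochner_Integration.integrable_sum Bochner_Integration.integral_sum)
  moreover have "corr (heat S) ?\<psi> z = - heat_const TYPE('a) * \<phi> z"
  proof -
    let ?g = "\<lambda>s. LINT x|lborel. heat S (x, s) * ?\<psi> (z + (x, s))"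
    have g: "?g s = (if 0 < s \<and> s < S then heat_mean' z s else 0)" for s
    proof (cases "0 < s \<and> s < S")
      case False
      then have "heat S (x, s) = 0" for x :: 'a by (auto simp: heat_def)
      then show ?thesis using False by (simp only: mult_zero_left integral_zero if_False)
    qed (simp add: heat_def heat_mean'_def)
    have "(?g has_integral (LINT s|lborel. ?g s)) UNIV"
      by (rule has_integral_integral_lborel[OF corr_slices(2)[OF hi \<psi>]])
    moreover have "(heat_mean' z has_integral (heat_mean z S - heat_mean z 0)) {0..S}"
    proof (rule fundamental_theorem_of_calculus_interior)
      show "continuous_on {0..S} (heat_mean z)" by (rule continuous_on_subset[OF heat_mean_continuous]) auto
      show "(heat_mean z has_vector_derivative heat_mean' z s) (at s)" if "s \<in> {0<..<S}" for s
        using heat_mean_DERIV[of s z] that by (simp add: has_real_derivative_iff_has_vector_derivative)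
    qed (use S in auto)
    then have "(?g has_integral (heat_mean z S - heat_mean z 0)) {0..S}"
      by (rule has_integral_spike_finite[rotated 2, of _ _ _ "{0, S}"]) (auto simp: g)
    then have "(?g has_integral (heat_mean z S - heat_mean z 0)) UNIV"
      by (rule has_integral_on_superset) (auto simp: g)
    ultimately have "(LINT s|lborel. ?g s) = heat_mean z S - heat_mean z 0" by (rule has_integral_unique)
    then show ?thesis
      using corr_slices(1)[OF hi \<psi>, of z] heat_mean_0[of z] heat_mean_large[OF z] by simp
  qed
  ultimately show ?thesis by simp
qed

end

section \<open>Convolution inequalities\<close>

lemma powr_mult3_le:
  fixes u v w :: real
  assumes "u \<ge> 0" "v \<ge> 0" "w \<ge> 0" "\<theta>1 \<ge> 0" "\<theta>2 \<ge> 0" "\<theta>3 \<ge> 0" "\<theta>1 + \<theta>2 + \<theta>3 = 1"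
  shows "u powr \<theta>1 * v powr \<theta>2 * w powr \<theta>3 \<le> u + v + w"
proof -
  define M where "M = max u (max v w)"
  have M: "u \<le> M" "v \<le> M" "w \<le> M" "M \<ge> 0" "M \<le> u + v + w" using assms by (auto simp: M_def max_def)
  have "u powr \<theta>1 * v powr \<theta>2 * w powr \<theta>3 \<le> M powr \<theta>1 * M powr \<theta>2 * M powr \<theta>3"
    using assms M by (intro mult_mono powr_mono2) auto
  also have "\<dots> = M powr (\<theta>1 + \<theta>2 + \<theta>3)" by (simp add: powr_add)
  also have "\<dots> = M" using M assms by simp
  finally show ?thesis using M by linarith
qed

lemma conv_power_nn_integral:
  fixes \<kappa> \<phi> :: "'b::euclidean_space \<Rightarrow> real"
  assumes [measurable]: "\<kappa> \<in> borel_measurable borel" "\<phi> \<in> borel_measurable borel"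
    and nn: "\<And>y. \<kappa> y \<ge> 0" "\<And>y. \<phi> y \<ge> 0"
  shows "(\<integral>\<^sup>+ z. \<integral>\<^sup>+ y. ennreal (\<kappa> y * \<phi> (z + y)) \<partial>lborel \<partial>lborel) =
     (\<integral>\<^sup>+ y. ennreal (\<kappa> y) \<partial>lborel) * (\<integral>\<^sup>+ z. ennreal (\<phi> z) \<partial>lborel)"
proof -
  have "(\<integral>\<^sup>+ z. \<integral>\<^sup>+ y. ennreal (\<kappa> y * \<phi> (z + y)) \<partial>lborel \<partial>lborel) =
    (\<integral>\<^sup>+ y. \<integral>\<^sup>+ z. ennreal (\<kappa> y * \<phi> (z + y)) \<partial>lborel \<partial>lborel)"
    by (rule lborel_pair.Fubini'[of "\<lambda>y z. ennreal (\<kappa> y * \<phi> (z + y))"]) measurable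
  also have "\<dots> = (\<integral>\<^sup>+ y. ennreal (\<kappa> y) * (\<integral>\<^sup>+ z. ennreal (\<phi> z) \<partial>lborel) \<partial>lborel)"
  proof (rule nn_integral_cong)
    fix y :: 'b
    have "(\<lambda>z. ennreal (\<phi> (z + y))) \<in> borel_measurable lborel" by measurable
    from nn_integral_cmult[OF this, of "ennreal (\<kappa> y)"]
    have "(\<integral>\<^sup>+ z. ennreal (\<kappa> y * \<phi> (z + y)) \<partial>lborel) = ennreal (\<kappa> y) * (\<integral>\<^sup>+ z. ennreal (\<phi> (y + z)) \<partial>lborel)"
      by (simp add: ennreal_mult nn add.commute)
    also have "(\<integral>\<^sup>+ z. ennreal (\<phi> (y + z)) \<partial>lborel) = (\<integral>\<^sup>+ z. ennreal (\<phi> z) \<partial>lborel)"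
      by (rule lborel_nn_integral_shift[of "\<lambda>z. ennreal (\<phi> z)"]) measurable
    finally show "(\<integral>\<^sup>+ z. ennreal (\<kappa> y * \<phi> (z + y)) \<partial>lborel) = ennreal (\<kappa> y) * (\<integral>\<^sup>+ z. ennreal (\<phi> z) \<partial>lborel)" .
  qed
  also have "\<dots> = (\<integral>\<^sup>+ y. ennreal (\<kappa> y) \<partial>lborel) * (\<integral>\<^sup>+ z. ennreal (\<phi> z) \<partial>lborel)"
    by (rule nn_integral_multc) measurable
  finally show ?thesis .
qed

text \<open>Young's inequality with exponents \<open>a\<close> for the kernel, \<open>q\<close> for the function and
  \<open>\<gamma> * q\<close> for the result, over a set \<open>Q\<close> of finite measure. Homogeneity
  reduces it to functions of norm at most one. For these the integrand is split as a product of three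
  powers of \<open>\<kappa> powr a * f powr q\<close>, \<open>\<kappa> powr a\<close> and
  \<open>f powr q\<close>, and such a product is at most the sum. Dividing the first of them by
  \<open>x'\<close>, at least its integral, makes all three integrals bounded. The resulting constant
  depends on \<open>Q\<close>, which is harmless.\<close>
lemma young_convolution:
  fixes \<kappa> F :: "'b::euclidean_space \<Rightarrow> real"
  assumes \<kappa>: "\<kappa> \<in> borel_measurable borel" "\<And>y. \<kappa> y \<ge> 0" "integrable lborel \<kappa>" "integrable lborel (\<lambda>y. \<kappa> y powr a)"
    and g: "\<gamma> \<ge> 1" "q \<ge> 1" and a: "a > 0" "1 / a = 1 + 1 / (\<gamma> * q) - 1 / q"
    and Q: "Q \<in> sets borel" "emeasure lborel Q = ennreal V" "V \<ge> 0"
  shows "\<exists>C>0. \<forall>F m B. F \<in> borel_measurable borel \<and> (\<forall>z. 0 \<le> F z \<and> F z \<le> B) \<and> m > 0 \<and>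
     (\<integral>\<^sup>+ z. ennreal (F z powr q) \<partial>lborel) \<le> ennreal m \<longrightarrow>
     (\<integral>\<^sup>+ z. ennreal (indicator Q z * corr \<kappa> F z powr (\<gamma> * q)) \<partial>lborel) \<le> ennreal (m powr \<gamma> * C)"
proof -
  define p where "p = \<gamma> * q"
  have p: "p \<ge> 1" "p \<ge> q" "p > 0" using g mult_mono[of 1 \<gamma> 1 q] mult_right_mono[of 1 \<gamma> q] by (auto simp: p_def)
  define A where "A = (LINT y|lborel. \<kappa> y powr a)"
  have A: "A \<ge> 0" by (simp add: A_def)
  define C where "C = (2 + A) powr p * (V + A + 1)"
  have C: "C > 0" using A Q by (simp add: C_def add_nonneg_pos)
  show ?thesis
  proof (intro exI[of _ C] conjI allI impI C)
    fix F :: "'b \<Rightarrow> real" and m B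
    assume asm: "F \<in> borel_measurable borel \<and> (\<forall>z. 0 \<le> F z \<and> F z \<le> B) \<and> m > 0 \<and> (\<integral>\<^sup>+ z. ennreal (F z powr q) \<partial>lborel) \<le> ennreal m"
    then have F: "F \<in> borel_measurable borel" "\<And>z. 0 \<le> F z" "\<And>z. F z \<le> B" and m: "m > 0"
      and Fm: "(\<integral>\<^sup>+ z. ennreal (F z powr q) \<partial>lborel) \<le> ennreal m" by auto
    note [measurable] = F(1) \<kappa>(1) Q(1)
    define f where "f z = F z / m powr (1/q)" for z
    have f0: "f z \<ge> 0" for z using F by (simp add: f_def)
    have fm [measurable]: "f \<in> borel_measurable borel" unfolding f_def[abs_def] by measurable
    have Ff: "F z = m powr (1/q) * f z" for z using m by (simp add: f_def)
    have fq: "f z powr q = F z powr q / m" for z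
      using F m g by (simp add: f_def powr_divide powr_powr)
    have fB: "f z \<le> B / m powr (1/q)" for z using F by (simp add: f_def divide_right_mono)
    have fint: "(\<integral>\<^sup>+ z. ennreal (f z powr q) \<partial>lborel) \<le> 1"
    proof -
      have "(\<integral>\<^sup>+ z. ennreal (f z powr q) \<partial>lborel) = (\<integral>\<^sup>+ z. ennreal (1/m) * ennreal (F z powr q) \<partial>lborel)"
        using m by (intro nn_integral_cong) (simp add: fq ennreal_mult[symmetric])
      also have "\<dots> = ennreal (1/m) * (\<integral>\<^sup>+ z. ennreal (F z powr q) \<partial>lborel)"
        by (rule nn_integral_cmult) measurable
      also have "\<dots> \<le> ennreal (1/m) * ennreal m" by (intro mult_left_mono Fm) auto
      also have "\<dots> = 1" using m by (simp add: ennreal_mult[symmetric])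
      finally show ?thesis .
    qed
    have fqi: "integrable lborel (\<lambda>z. f z powr q)"
      using fint by (intro integrableI_bounded) (auto intro: le_less_trans)
    have fq1: "(LINT z|lborel. f z powr q) \<le> 1"
      using fint unfolding nn_integral_eq_integral[OF fqi AE_I2[OF powr_ge_zero]] by (simp add: ennreal_le_1)
    define x where "x z = (LINT y|lborel. \<kappa> y powr a * f (z + y) powr q)" for z
    have xi: "integrable lborel (\<lambda>y. \<kappa> y powr a * f (z + y) powr q)" for z
      by (rule integrable_bounded_mult[OF \<kappa>(4), where B="(B / m powr (1/q)) powr q"])
         (use f0 fB g in \<open>auto intro!: powr_mono2\<close>)
    have x0: "x z \<ge> 0" for z by (simp add: x_def)
    have kfi: "integrable lborel (\<lambda>y. \<kappa> y * f (z + y))" for z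
      by (rule integrable_bounded_mult[OF \<kappa>(3), where B="B / m powr (1/q)"]) (use f0 fB in auto)
    have pt: "corr \<kappa> F z powr p \<le> m powr \<gamma> * (2 + A) powr p * (1 + x z)" for z
    proof -
      define x' where "x' = max 1 (x z)"
      have x': "x' \<ge> 1" "x' \<ge> x z" "x' \<le> 1 + x z" using x0[of z] by (auto simp: x'_def)
      have pw: "\<kappa> y * f (z + y) \<le> x' powr (1/p) * ((\<kappa> y powr a * f (z + y) powr q) / x' + \<kappa> y powr a + f (z + y) powr q)" for y
      proof (cases "\<kappa> y = 0 \<or> f (z + y) = 0")
        case False
        then have pos: "\<kappa> y > 0" "f (z + y) > 0" using \<kappa>(2)[of y] f0[of "z + y"] by (auto simp: less_le)
        let ?X = "(\<kappa> y powr a * f (z + y) powr q) / x'"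
        \<comment> \<open>The exponents of the kernel and of \<open>f\<close> in the threefold product add up to one.\<close>
        have "a * (1/p + (1 - 1/q)) = 1" using a by (simp add: p_def field_simps)
        then have ea: "a * (1/p) + a * (1 - 1/q) = 1" by (simp only: distrib_left)
        have eq: "q * (1/p) + q * (1/q - 1/p) = 1" using g by (simp add: right_diff_distrib)
        have "\<kappa> y * f (z + y) = \<kappa> y powr (a * (1/p) + a * (1 - 1/q)) * f (z + y) powr (q * (1/p) + q * (1/q - 1/p))"
          unfolding ea eq using pos by simp
        also have "\<dots> = x' powr (1/p) * (?X powr (1/p) * (\<kappa> y powr a) powr (1 - 1/q) * (f (z + y) powr q) powr (1/q - 1/p))"
          using pos x' by (simp add: powr_add powr_mult powr_divide powr_powr)
        also have "\<dots> \<le> x' powr (1/p) * (?X + \<kappa> y powr a + f (z + y) powr q)"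
          using p g x' frac_le[of 1 1 q p] by (intro mult_left_mono powr_mult3_le) auto
        finally show ?thesis .
      qed (use x' in auto)
      have "corr \<kappa> f z \<le> (LINT y|lborel. x' powr (1/p) * ((\<kappa> y powr a * f (z + y) powr q) / x' + \<kappa> y powr a + f (z + y) powr q))"
        unfolding corr_def
        by (intro integral_mono kfi pw integrable_mult_right Bochner_Integration.integrable_add Bochner_Integration.integrable_divide xi \<kappa>(4) lborel_integrable_shift[OF fqi])
      also have "\<dots> = x' powr (1/p) * (x z / x' + A + (LINT y|lborel. f (z + y) powr q))"
        using xi[of z] \<kappa>(4) lborel_integrable_shift[OF fqi, of z]
        by (subst integral_mult_right_zero, subst Bochner_Integration.integral_add) (auto simp: x_def A_def)
      also have "(LINT y|lborel. f (z + y) powr q) \<le> 1"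
        using fq1 lborel_integral_shift[of "\<lambda>z. f z powr q" z] by simp
      also have "x z / x' \<le> 1" using x' x0[of z] by (simp add: divide_le_eq_1)
      finally have "corr \<kappa> f z \<le> x' powr (1/p) * (2 + A)" by (simp add: mult_left_mono)
      moreover have "corr \<kappa> F z = m powr (1/q) * corr \<kappa> f z"
        unfolding corr_def integral_mult_right_zero[symmetric] Ff by (simp add: ac_simps)
      moreover have "corr \<kappa> f z \<ge> 0" unfolding corr_def using \<kappa>(2) f0 by simp
      ultimately have "corr \<kappa> F z powr p \<le> (m powr (1/q) * (x' powr (1/p) * (2 + A))) powr p"
        using p by (intro powr_mono2) (auto intro!: mult_left_mono)
      also have "\<dots> = m powr \<gamma> * (2 + A) powr p * x'"
        using p x' A g by (simp add: powr_mult powr_powr p_def)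
      also have "\<dots> \<le> m powr \<gamma> * (2 + A) powr p * (1 + x z)" using x' by (intro mult_left_mono) auto
      finally show ?thesis .
    qed
    have xnn: "(\<integral>\<^sup>+ z. ennreal (x z) \<partial>lborel) \<le> ennreal A"
    proof -
      have "(\<integral>\<^sup>+ z. ennreal (x z) \<partial>lborel) = (\<integral>\<^sup>+ z. \<integral>\<^sup>+ y. ennreal (\<kappa> y powr a * f (z + y) powr q) \<partial>lborel \<partial>lborel)"
        unfolding x_def by (intro nn_integral_cong nn_integral_eq_integral[OF xi, symmetric]) auto
      also have "\<dots> = (\<integral>\<^sup>+ y. ennreal (\<kappa> y powr a) \<partial>lborel) * (\<integral>\<^sup>+ z. ennreal (f z powr q) \<partial>lborel)"
        by (rule conv_power_nn_integral) auto
      also have "\<dots> \<le> ennreal A * 1"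
        unfolding A_def using fint nn_integral_eq_integral[OF \<kappa>(4)] by (intro mult_mono) auto
      finally show ?thesis by simp
    qed
    have [measurable]: "x \<in> borel_measurable borel" unfolding x_def[abs_def] by measurable
    have "(\<integral>\<^sup>+ z. ennreal (indicator Q z * corr \<kappa> F z powr (\<gamma> * q)) \<partial>lborel) \<le>
       (\<integral>\<^sup>+ z. ennreal (m powr \<gamma> * (2 + A) powr p) * (indicator Q z + ennreal (x z)) \<partial>lborel)"
    proof (rule nn_integral_mono)
      fix z
      show "ennreal (indicator Q z * corr \<kappa> F z powr (\<gamma> * q)) \<le> ennreal (m powr \<gamma> * (2 + A) powr p) * (indicator Q z + ennreal (x z))"
      proof (cases "z \<in> Q")
        case True
        have "ennreal (corr \<kappa> F z powr p) \<le> ennreal (m powr \<gamma> * (2 + A) powr p * (1 + x z))"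
          by (rule ennreal_leI[OF pt])
        also have "\<dots> = ennreal (m powr \<gamma> * (2 + A) powr p) * (1 + ennreal (x z))"
          using x0[of z] by (simp add: ennreal_mult)
        finally show ?thesis using True by (simp add: p_def)
      qed simp
    qed
    also have "\<dots> = ennreal (m powr \<gamma> * (2 + A) powr p) * (ennreal V + (\<integral>\<^sup>+ z. ennreal (x z) \<partial>lborel))"
    proof -
      have 1: "(\<lambda>z. indicator Q z + ennreal (x z)) \<in> borel_measurable lborel" by measurable
      have "(\<integral>\<^sup>+ z. indicator Q z + ennreal (x z) \<partial>lborel) = (\<integral>\<^sup>+ z. indicator Q z \<partial>lborel) + (\<integral>\<^sup>+ z. ennreal (x z) \<partial>lborel)"
        by (rule nn_integral_add) measurable
      then show ?thesis unfolding nn_integral_cmult[OF 1] using Q by simp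
    qed
    also have "\<dots> \<le> ennreal (m powr \<gamma> * (2 + A) powr p) * (ennreal V + ennreal A)"
      by (intro mult_left_mono add_left_mono xnn) auto
    also have "\<dots> = ennreal (m powr \<gamma> * (2 + A) powr p * (V + A))"
      using A Q by (simp add: ennreal_mult[symmetric] ennreal_plus[symmetric] del: ennreal_plus)
    also have "\<dots> \<le> ennreal (m powr \<gamma> * C)"
      unfolding C_def using A Q by (intro ennreal_leI) (simp add: mult.assoc mult_left_mono)
    finally show "(\<integral>\<^sup>+ z. ennreal (indicator Q z * corr \<kappa> F z powr (\<gamma> * q)) \<partial>lborel) \<le> ennreal (m powr \<gamma> * C)" .
  qed
qed

text \<open>Hoelder's inequality in the form of Young's inequality for numbers, with a weight \<zeta> that makes the
  contribution of the kernel at most half of \<tau>.\<close>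
lemma holder_small:
  fixes \<kappa> :: "'b::euclidean_space \<Rightarrow> real"
  assumes \<kappa>: "\<kappa> \<in> borel_measurable borel" "\<And>y. \<kappa> y \<ge> 0" "integrable lborel \<kappa>" "integrable lborel (\<lambda>y. \<kappa> y powr (q / (q - 1)))"
    and q: "q > 1" and \<tau>: "\<tau> > 0"
  shows "\<exists>m>0. \<forall>F B. F \<in> borel_measurable borel \<and> (\<forall>z. 0 \<le> F z \<and> F z \<le> B) \<and>
     (\<integral>\<^sup>+ z. ennreal (F z powr q) \<partial>lborel) \<le> ennreal m \<longrightarrow> (\<forall>z. corr \<kappa> F z \<le> \<tau>)"
proof -
  define q' where "q' = q / (q - 1)"
  have q': "q' > 1" "1 / q' + 1 / q = 1" using q by (auto simp: q'_def field_simps)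
  define A where "A = (LINT y|lborel. \<kappa> y powr q')"
  have A: "A \<ge> 0" by (simp add: A_def)
  define \<zeta> where "\<zeta> = (\<tau> / 2 / (A + 1)) powr (1 / q')"
  have \<zeta>: "\<zeta> > 0" using \<tau> A by (simp add: \<zeta>_def)
  have \<zeta>q: "\<zeta> powr q' * A \<le> \<tau> / 2"
  proof -
    have "\<zeta> powr q' = \<tau> / 2 / (A + 1)" using q' \<tau> A by (simp add: \<zeta>_def powr_powr)
    then have "\<zeta> powr q' * A = \<tau> / 2 * (A / (A + 1))" by simp
    also have "\<dots> \<le> \<tau> / 2 * 1" using \<tau> A by (intro mult_left_mono) (auto simp: divide_le_eq_1)
    finally show ?thesis by simp
  qed
  define m where "m = \<tau> / 2 * \<zeta> powr q"
  have m: "m > 0" using \<tau> \<zeta> by (simp add: m_def)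
  show ?thesis
  proof (intro exI[of _ m] conjI allI impI m)
    fix F :: "'b \<Rightarrow> real" and B z
    assume asm: "F \<in> borel_measurable borel \<and> (\<forall>z. 0 \<le> F z \<and> F z \<le> B) \<and> (\<integral>\<^sup>+ z. ennreal (F z powr q) \<partial>lborel) \<le> ennreal m"
    then have F: "F \<in> borel_measurable borel" "\<And>z. 0 \<le> F z" "\<And>z. F z \<le> B"
      and Fm: "(\<integral>\<^sup>+ z. ennreal (F z powr q) \<partial>lborel) \<le> ennreal m" by auto
    note [measurable] = F(1) \<kappa>(1)
    have Fi: "integrable lborel (\<lambda>z. F z powr q)"
      using Fm by (intro integrableI_bounded) (auto intro: le_less_trans)
    have F1: "(LINT z|lborel. F z powr q) \<le> m"
      using Fm m unfolding nn_integral_eq_integral[OF Fi AE_I2[OF powr_ge_zero]] by (simp add: ennreal_le_iff)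
    have \<kappa>i: "integrable lborel (\<lambda>y. \<kappa> y powr q')" using \<kappa>(4) by (simp add: q'_def)
    have "corr \<kappa> F z \<le> (LINT y|lborel. \<zeta> powr q' * \<kappa> y powr q' + \<zeta> powr (- q) * F (z + y) powr q)"
      unfolding corr_def
    proof (rule integral_mono)
      show "integrable lborel (\<lambda>y. \<kappa> y * F (z + y))"
        by (rule integrable_bounded_mult[OF \<kappa>(3), where B=B]) (use F in auto)
      show "integrable lborel (\<lambda>y. \<zeta> powr q' * \<kappa> y powr q' + \<zeta> powr (- q) * F (z + y) powr q)"
        using \<kappa>i lborel_integrable_shift[OF Fi, of z] by auto
      fix y
      have "\<kappa> y * F (z + y) = (\<zeta> * \<kappa> y) * (F (z + y) / \<zeta>)" using \<zeta> by simp
      also have "\<dots> \<le> (\<zeta> * \<kappa> y) powr q' / q' + (F (z + y) / \<zeta>) powr q / q"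
        using q' q \<zeta> \<kappa>(2) F(2) by (intro Youngs_inequality) auto
      also have "\<dots> \<le> (\<zeta> * \<kappa> y) powr q' + (F (z + y) / \<zeta>) powr q"
        using q q' divide_left_mono[of 1 q' "(\<zeta> * \<kappa> y) powr q'"] divide_left_mono[of 1 q "(F (z + y) / \<zeta>) powr q"]
        by (intro add_mono) auto
      also have "\<dots> = \<zeta> powr q' * \<kappa> y powr q' + \<zeta> powr (- q) * F (z + y) powr q"
        using \<zeta> \<kappa>(2) F(2) by (simp add: powr_mult powr_divide powr_minus field_simps)
      finally show "\<kappa> y * F (z + y) \<le> \<zeta> powr q' * \<kappa> y powr q' + \<zeta> powr (- q) * F (z + y) powr q" .
    qed
    also have "\<dots> = \<zeta> powr q' * A + \<zeta> powr (- q) * (LINT y|lborel. F (z + y) powr q)"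
      using \<kappa>i lborel_integrable_shift[OF Fi, of z] by (subst Bochner_Integration.integral_add) (auto simp: A_def)
    also have "(LINT y|lborel. F (z + y) powr q) = (LINT y|lborel. F y powr q)"
      using lborel_integral_shift[of "\<lambda>z. F z powr q" z] by simp
    also have "\<zeta> powr q' * A + \<zeta> powr (- q) * (LINT y|lborel. F y powr q) \<le> \<tau> / 2 + \<zeta> powr (- q) * m"
      using F1 \<zeta>q by (intro add_mono mult_left_mono) auto
    also have "\<zeta> powr (- q) * m = \<tau> / 2" using \<zeta> by (simp add: m_def powr_minus)
    finally show "corr \<kappa> F z \<le> \<tau>" by simp
  qed
qed

section \<open>Picard iteration for the corrector\<close>

lemma corr_mono:
  fixes \<kappa> F G :: "'b::euclidean_space \<Rightarrow> real"
  assumes \<kappa>: "integrable lborel \<kappa>" "\<And>y. \<kappa> y \<ge> 0"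
    and F: "F \<in> borel_measurable borel" "\<And>z. \<bar>F z\<bar> \<le> B" and G: "G \<in> borel_measurable borel" "\<And>z. \<bar>G z\<bar> \<le> B'"
    and le: "\<And>z. F z \<le> G z"
  shows "corr \<kappa> F z \<le> corr \<kappa> G z"
  unfolding corr_def
proof (rule integral_mono)
  note [measurable] = F(1) G(1)
  show "integrable lborel (\<lambda>y. \<kappa> y * F (z + y))" by (rule integrable_bounded_mult[OF \<kappa>(1) _ F(2)]) measurable
  show "integrable lborel (\<lambda>y. \<kappa> y * G (z + y))" by (rule integrable_bounded_mult[OF \<kappa>(1) _ G(2)]) measurable
qed (use le \<kappa>(2) in \<open>auto intro: mult_left_mono\<close>)

lemma corr_measurable:
  fixes \<kappa> F :: "'b::euclidean_space \<Rightarrow> real"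
  assumes [measurable]: "\<kappa> \<in> borel_measurable borel" "F \<in> borel_measurable borel"
  shows "corr \<kappa> F \<in> borel_measurable borel"
  unfolding corr_def[abs_def] by measurable

lemma corr_nonneg: "(\<And>y. \<kappa> y \<ge> 0) \<Longrightarrow> (\<And>y. F y \<ge> 0) \<Longrightarrow> corr \<kappa> F z \<ge> 0"
  unfolding corr_def by simp

lemma corr_le:
  fixes \<kappa> F :: "'b::euclidean_space \<Rightarrow> real"
  assumes \<kappa>: "integrable lborel \<kappa>" "\<And>y. \<kappa> y \<ge> 0"
    and F: "F \<in> borel_measurable borel" "\<And>z. 0 \<le> F z" "\<And>z. F z \<le> B"
  shows "corr \<kappa> F z \<le> B * (LINT y|lborel. \<kappa> y)"
proof -
  have B: "B \<ge> 0" using F(2,3)[of 0] by linarith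
  have "corr \<kappa> F z \<le> corr \<kappa> (\<lambda>_. B) z"
    by (rule corr_mono[OF \<kappa> F(1) _ _ _ F(3), where B=B and B'=B]) (use F B in \<open>auto simp: abs_of_nonneg\<close>)
  then show ?thesis by (simp add: corr_def mult.commute)
qed

text \<open>The Picard iterates, starting from zero, of the fixed point equation for the source of the corrector.\<close>
fun corr_iter :: "'b::euclidean_space set \<Rightarrow> real \<Rightarrow> real \<Rightarrow> ('b \<Rightarrow> real) \<Rightarrow> ('b \<Rightarrow> real) \<Rightarrow> nat \<Rightarrow> 'b \<Rightarrow> real" where
  "corr_iter Q K \<gamma> \<kappa> g 0 = (\<lambda>_. 0)"
| "corr_iter Q K \<gamma> \<kappa> g (Suc n) = (\<lambda>z. indicator Q z * (K * corr \<kappa> (corr_iter Q K \<gamma> \<kappa> g n) z powr \<gamma> + g z))"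

text \<open>If the norm of an iterate is at most \<open>m\<close>, then that of the next is at most a multiple of
  \<open>m powr \<gamma>\<close> plus the contribution of \<open>g\<close>. As
  \<open>\<gamma> > 1\<close>, the first term is at most \<open>m / 2\<close> for small
  \<open>m\<close>, so the ball of radius \<open>m\<close> is preserved.\<close>
lemma corr_iter_exists:
  fixes \<kappa> :: "'b::euclidean_space \<Rightarrow> real" and Q :: "'b set"
  assumes \<kappa>: "\<kappa> \<in> borel_measurable borel" "\<And>y. \<kappa> y \<ge> 0" "integrable lborel \<kappa>" "integrable lborel (\<lambda>y. \<kappa> y powr a)"
    and g: "\<gamma> > 1" "q \<ge> 1" and a: "a > 0" "1 / a = 1 + 1 / (\<gamma> * q) - 1 / q"
    and Q: "Q \<in> sets borel" "emeasure lborel Q = ennreal V" "V \<ge> 0" and K: "K \<ge> 0" and m0: "m0 > 0"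
  shows "\<exists>\<delta>>0. \<forall>g M. g \<in> borel_measurable borel \<and> (\<forall>z. 0 \<le> g z \<and> g z \<le> M) \<and>
     (\<integral>\<^sup>+ z. ennreal (indicator Q z * g z powr q) \<partial>lborel) \<le> ennreal \<delta> \<longrightarrow>
     (\<forall>n. corr_iter Q K \<gamma> \<kappa> g n \<in> borel_measurable borel \<and> (\<exists>B. \<forall>z. 0 \<le> corr_iter Q K \<gamma> \<kappa> g n z \<and> corr_iter Q K \<gamma> \<kappa> g n z \<le> B)
       \<and> (\<forall>z. z \<notin> Q \<longrightarrow> corr_iter Q K \<gamma> \<kappa> g n z = 0) \<and> (\<integral>\<^sup>+ z. ennreal (corr_iter Q K \<gamma> \<kappa> g n z powr q) \<partial>lborel) \<le> ennreal m0)"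
proof -
  obtain C where C: "C > 0" and young: "\<And>F m B. F \<in> borel_measurable borel \<Longrightarrow> (\<And>z. 0 \<le> F z \<and> F z \<le> B) \<Longrightarrow> m > 0 \<Longrightarrow>
     (\<integral>\<^sup>+ z. ennreal (F z powr q) \<partial>lborel) \<le> ennreal m \<Longrightarrow>
     (\<integral>\<^sup>+ z. ennreal (indicator Q z * corr \<kappa> F z powr (\<gamma> * q)) \<partial>lborel) \<le> ennreal (m powr \<gamma> * C)"
    using young_convolution[OF \<kappa> less_imp_le[OF g(1)] g(2) a Q] by blast
  define D where "D = 2 powr q * K powr q * C"
  have D: "D \<ge> 0" using C by (simp add: D_def)
  \<comment> \<open>This choice gives \<open>D * m powr (\<gamma> - 1) \<le> 1 / 2\<close>.\<close>
  define m where "m = min m0 ((1 / (2 * (D + 1))) powr (1 / (\<gamma> - 1)))"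
  have m: "m > 0" "m \<le> m0" using m0 D by (auto simp: m_def)
  have "m powr (\<gamma> - 1) \<le> ((1 / (2 * (D + 1))) powr (1 / (\<gamma> - 1))) powr (\<gamma> - 1)"
    using m g by (intro powr_mono2) (auto simp: m_def)
  also have "\<dots> = 1 / (2 * (D + 1))" using g D by (simp add: powr_powr)
  finally have "D * m powr (\<gamma> - 1) \<le> D * (1 / (2 * (D + 1)))" using D by (intro mult_left_mono) auto
  also have "\<dots> \<le> 1 / 2" using D by (simp add: field_simps)
  finally have Dm: "D * m powr (\<gamma> - 1) \<le> 1 / 2" .
  have Dm': "D * m powr \<gamma> \<le> m / 2"
  proof -
    have "m powr \<gamma> = m powr (\<gamma> - 1) * m" using m by (simp add: powr_diff)
    then have "D * m powr \<gamma> = (D * m powr (\<gamma> - 1)) * m" by simp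
    also have "\<dots> \<le> 1 / 2 * m" using Dm m by (intro mult_right_mono) auto
    finally show ?thesis by simp
  qed
  define \<delta> where "\<delta> = m / (2 * 2 powr q)"
  have \<delta>: "\<delta> > 0" using m by (simp add: \<delta>_def)
  show ?thesis
  proof (intro exI[of _ \<delta>] conjI[OF \<delta>] allI impI)
    fix g :: "'b \<Rightarrow> real" and M n
    assume asm: "g \<in> borel_measurable borel \<and> (\<forall>z. 0 \<le> g z \<and> g z \<le> M) \<and>
     (\<integral>\<^sup>+ z. ennreal (indicator Q z * g z powr q) \<partial>lborel) \<le> ennreal \<delta>"
    then have gb: "g \<in> borel_measurable borel" "\<And>z. 0 \<le> g z" "\<And>z. g z \<le> M"
      and g\<delta>: "(\<integral>\<^sup>+ z. ennreal (indicator Q z * g z powr q) \<partial>lborel) \<le> ennreal \<delta>" by auto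
    note [measurable] = gb(1) \<kappa>(1) Q(1)
    let ?F = "corr_iter Q K \<gamma> \<kappa> g"
    have "?F n \<in> borel_measurable borel \<and> (\<exists>B. \<forall>z. 0 \<le> ?F n z \<and> ?F n z \<le> B)
       \<and> (\<forall>z. z \<notin> Q \<longrightarrow> ?F n z = 0) \<and> (\<integral>\<^sup>+ z. ennreal (?F n z powr q) \<partial>lborel) \<le> ennreal m"
    proof (induction n)
      case 0
      show ?case using g by auto
    next
      case (Suc n)
      then obtain B where F [measurable]: "?F n \<in> borel_measurable borel" and B: "\<And>z. 0 \<le> ?F n z \<and> ?F n z \<le> B"
        and Fm: "(\<integral>\<^sup>+ z. ennreal (?F n z powr q) \<partial>lborel) \<le> ennreal m" by blast
      have [measurable]: "corr \<kappa> (?F n) \<in> borel_measurable borel" by (intro corr_measurable) auto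
      let ?c = "corr \<kappa> (?F n)"
      have c: "0 \<le> ?c z" "?c z \<le> B * (LINT y|lborel. \<kappa> y)" for z
        using B \<kappa> by (auto intro!: corr_nonneg corr_le)
      have 1: "?F (Suc n) \<in> borel_measurable borel" by simp
      have 2: "0 \<le> ?F (Suc n) z \<and> ?F (Suc n) z \<le> K * (B * (LINT y|lborel. \<kappa> y)) powr \<gamma> + M" for z
      proof -
        have "?c z powr \<gamma> \<le> (B * (LINT y|lborel. \<kappa> y)) powr \<gamma>" using c g by (intro powr_mono2) auto
        then have "K * ?c z powr \<gamma> + g z \<le> K * (B * (LINT y|lborel. \<kappa> y)) powr \<gamma> + M"
          using K gb by (intro add_mono mult_left_mono) auto
        moreover have "0 \<le> K * ?c z powr \<gamma> + g z" using K gb by simp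
        ultimately show ?thesis by (auto simp: indicator_def)
      qed
      have "(\<integral>\<^sup>+ z. ennreal (?F (Suc n) z powr q) \<partial>lborel) \<le>
        (\<integral>\<^sup>+ z. ennreal (2 powr q * K powr q) * ennreal (indicator Q z * ?c z powr (\<gamma> * q)) + ennreal (2 powr q) * ennreal (indicator Q z * g z powr q) \<partial>lborel)"
      proof (rule nn_integral_mono)
        fix z
        show "ennreal (?F (Suc n) z powr q) \<le> ennreal (2 powr q * K powr q) * ennreal (indicator Q z * ?c z powr (\<gamma> * q)) + ennreal (2 powr q) * ennreal (indicator Q z * g z powr q)"
        proof (cases "z \<in> Q")
          case True
          have "(K * ?c z powr \<gamma> + g z) powr q \<le> 2 powr q * ((K * ?c z powr \<gamma>) powr q + g z powr q)"
            using K gb g by (intro powr_split_half) auto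
          also have "(K * ?c z powr \<gamma>) powr q = K powr q * ?c z powr (\<gamma> * q)"
            using K by (simp add: powr_mult powr_powr)
          finally have "ennreal ((K * ?c z powr \<gamma> + g z) powr q) \<le> ennreal (2 powr q * K powr q * ?c z powr (\<gamma> * q) + 2 powr q * g z powr q)"
            by (intro ennreal_leI) (simp add: algebra_simps)
          then show ?thesis using True by (simp add: ennreal_mult)
        qed (use g in simp)
      qed
      also have "\<dots> = ennreal (2 powr q * K powr q) * (\<integral>\<^sup>+ z. ennreal (indicator Q z * ?c z powr (\<gamma> * q)) \<partial>lborel) +
          ennreal (2 powr q) * (\<integral>\<^sup>+ z. ennreal (indicator Q z * g z powr q) \<partial>lborel)"
      proof -
        have 1: "(\<lambda>z. ennreal (indicator Q z * ?c z powr (\<gamma> * q))) \<in> borel_measurable lborel"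
          "(\<lambda>z. ennreal (indicator Q z * g z powr q)) \<in> borel_measurable lborel" by measurable
        show ?thesis using 1 by (subst nn_integral_add) (auto simp: nn_integral_cmult)
      qed
      also have "\<dots> \<le> ennreal (2 powr q * K powr q) * ennreal (m powr \<gamma> * C) + ennreal (2 powr q) * ennreal \<delta>"
        by (intro add_mono mult_left_mono young[OF F B m(1) Fm] g\<delta>) auto
      also have "\<dots> = ennreal (D * m powr \<gamma> + 2 powr q * \<delta>)"
        using C \<delta> by (simp add: D_def ennreal_mult[symmetric] ennreal_plus[symmetric] ac_simps del: ennreal_plus)
      also have "\<dots> \<le> ennreal m"
        using Dm' by (intro ennreal_leI) (simp add: \<delta>_def)
      finally have 3: "(\<integral>\<^sup>+ z. ennreal (?F (Suc n) z powr q) \<partial>lborel) \<le> ennreal m" .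
      show ?case using 1 2 3 by (auto simp del: corr_iter.simps) (simp add: indicator_def)
    qed
    then show "?F n \<in> borel_measurable borel \<and> (\<exists>B. \<forall>z. 0 \<le> ?F n z \<and> ?F n z \<le> B)
       \<and> (\<forall>z. z \<notin> Q \<longrightarrow> ?F n z = 0) \<and> (\<integral>\<^sup>+ z. ennreal (?F n z powr q) \<partial>lborel) \<le> ennreal m0"
      using m by (auto intro: order_trans ennreal_leI)
  qed
qed

text \<open>The iteration is monotone and its first step goes upwards from zero.\<close>
lemma corr_iter_mono:
  fixes \<kappa> :: "'b::euclidean_space \<Rightarrow> real"
  assumes \<kappa>: "\<And>y. \<kappa> y \<ge> 0" "integrable lborel \<kappa>" and K: "K \<ge> 0" "\<gamma> > 0" and g: "\<And>z. g z \<ge> 0"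
    and F: "\<And>n. corr_iter Q K \<gamma> \<kappa> g n \<in> borel_measurable borel"
      "\<And>n. \<exists>B. \<forall>z. 0 \<le> corr_iter Q K \<gamma> \<kappa> g n z \<and> corr_iter Q K \<gamma> \<kappa> g n z \<le> B"
  shows "corr_iter Q K \<gamma> \<kappa> g n z \<le> corr_iter Q K \<gamma> \<kappa> g (Suc n) z"
proof (induction n arbitrary: z)
  case 0
  have "0 \<le> corr_iter Q K \<gamma> \<kappa> g (Suc 0) z" using F(2)[of "Suc 0"] by blast
  then show ?case by simp
next
  case (Suc n)
  let ?F = "corr_iter Q K \<gamma> \<kappa> g"
  obtain B where B: "\<And>z. 0 \<le> ?F n z" "\<And>z. ?F n z \<le> B" using F(2)[of n] by blast
  obtain B' where B': "\<And>z. 0 \<le> ?F (Suc n) z" "\<And>z. ?F (Suc n) z \<le> B'" using F(2)[of "Suc n"] by blast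
  have "corr \<kappa> (?F n) z \<le> corr \<kappa> (?F (Suc n)) z"
    by (rule corr_mono[OF \<kappa>(2,1) F(1) _ F(1) _ Suc, where B=B and B'=B'])
       (use B B' in \<open>auto simp: abs_of_nonneg simp del: corr_iter.simps\<close>)
  moreover have "corr \<kappa> (?F n) z \<ge> 0" using \<kappa>(1) B(1) by (rule corr_nonneg)
  ultimately have "corr \<kappa> (?F n) z powr \<gamma> \<le> corr \<kappa> (?F (Suc n)) z powr \<gamma>"
    using K by (intro powr_mono2) auto
  then have "indicator Q z * (K * corr \<kappa> (?F n) z powr \<gamma> + g z) \<le> indicator Q z * (K * corr \<kappa> (?F (Suc n)) z powr \<gamma> + g z)"
    using K by (intro mult_left_mono add_right_mono) auto
  then show ?case by (simp only: corr_iter.simps(2))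
qed

section \<open>Smooth correctors\<close>

lemma heat_const_pos: "heat_const TYPE('a::euclidean_space) > 0"
proof -
  have i: "integrable lborel (\<lambda>y::'a. exp (- (1/4) * (y \<bullet> y)))" by (rule integrable_gaussian) simp
  have "heat_const TYPE('a) \<noteq> 0"
  proof
    assume "heat_const TYPE('a) = 0"
    then have "AE y in (lborel::'a measure). exp (- (1/4) * (y \<bullet> y)) = 0"
      using integral_nonneg_eq_0_iff_AE[OF i] by (simp add: heat_const_def)
    then have "AE y in (lborel::'a measure). False" by simp
    then have "emeasure (lborel::'a measure) UNIV = 0"
      using AE_iff_measurable[of UNIV "lborel::'a measure" "\<lambda>_. False"] by simp
    then show False by simp
  qed
  moreover have "heat_const TYPE('a) \<ge> 0" by (simp add: heat_const_def)
  ultimately show ?thesis by simp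
qed

text \<open>A bounded sequence cannot make steps of fixed length forever.\<close>
lemma small_increment:
  fixes I :: "nat \<Rightarrow> real"
  assumes "\<And>n. I n \<le> M" "e > 0"
  shows "\<exists>n. I (Suc n) - I n < e"
proof (rule ccontr)
  assume "\<nexists>n. I (Suc n) - I n < e"
  then have "\<not> I (Suc n) - I n < e" for n by blast
  then have s: "I (Suc n) \<ge> I n + e" for n by (simp add: not_less algebra_simps)
  have "I n \<ge> I 0 + n * e" for n
  proof (induction n)
    case (Suc n) then show ?case using s[of n] by (simp add: algebra_simps)
  qed simp
  moreover obtain n :: nat where n: "(M - I 0) / e < n" using reals_Archimedean2 by blast
  have "M - I 0 < n * e" using n assms(2) by (simp add: divide_less_eq)
  ultimately have "M < I n" by (smt (verit))
  then show False using assms(1)[of n] by simp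
qed

lemma moll_local_integral_mono:
  fixes F G :: "'b::euclidean_space \<Rightarrow> real"
  assumes \<epsilon>: "\<epsilon> > 0" and i: "integrable lborel (\<lambda>y. moll \<epsilon> y * F y)" "integrable lborel (\<lambda>y. moll \<epsilon> y * G y)"
    and le: "\<And>y. norm y \<le> \<epsilon> \<Longrightarrow> F y \<le> G y"
  shows "(LINT y|lborel. moll \<epsilon> y * F y) \<le> (LINT y|lborel. moll \<epsilon> y * G y)"
proof (rule integral_mono[OF i])
  fix y
  show "moll \<epsilon> y * F y \<le> moll \<epsilon> y * G y"
  proof (cases "norm y \<le> \<epsilon>")
    case True then show ?thesis using le moll_nonneg[OF \<epsilon>] by (intro mult_left_mono) auto
  next
    case False then show ?thesis using vanishes_off_moll[OF \<epsilon>, where 'a='b] by (simp add: vanishes_off_def)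
  qed
qed

lemma corr_moll_vanishes:
  fixes F :: "'b::euclidean_space \<Rightarrow> real"
  assumes \<epsilon>: "\<epsilon> > 0" and F: "\<And>z. norm z > R \<Longrightarrow> F z = 0"
  shows "vanishes_off (R + \<epsilon>) (corr (mollD \<epsilon> es) F)"
  unfolding vanishes_off_def
proof (intro allI impI)
  fix z :: 'b assume z: "R + \<epsilon> < norm z"
  have "mollD \<epsilon> es y * F (z + y) = 0" for y
  proof (cases "norm y > \<epsilon>")
    case True then show ?thesis using mollD_basic(2)[OF \<epsilon>, of es] by (simp add: vanishes_off_def)
  next
    case False
    then have "norm (z + y) > R" using z norm_triangle_ineq4[of "z + y" y] by simp
    then show ?thesis using F by simp
  qed
  then show "corr (mollD \<epsilon> es) F z = 0" unfolding corr_def by (simp only: integral_zero)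
qed

text \<open>This is where \<open>q > q0\<close> is used. The condition says that the exponent \<open>a\<close> of
  Young's inequality is less than \<open>(N + 2) / (N + 1)\<close>, the limit of integrability for the
  gradient of the heat kernel. As \<open>\<gamma> > 2\<close>, it implies
  \<open>q > (N + 2) / 2\<close>, and the exponent dual to \<open>q\<close> is admissible for the heat
  kernel itself.\<close>
lemma subcritical_exponents:
  fixes \<gamma> q N :: real
  assumes g: "\<gamma> > 2" and N: "N \<ge> 1" and q: "q > (N + 2) * ((\<gamma> - 1) / \<gamma>)"
  defines "a \<equiv> 1 / (1 + 1 / (\<gamma> * q) - 1 / q)"
  shows "q > 1" "a > 0" "1 / a = 1 + 1 / (\<gamma> * q) - 1 / q" "(N + 1) / 2 * a - N / 2 < 1"
    "N / 2 * (q / (q - 1)) - N / 2 < 1"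
proof -
  have "(\<gamma> - 1) / \<gamma> > 1 / 2" using g by (simp add: field_simps)
  then have "(N + 2) * ((\<gamma> - 1) / \<gamma>) > (N + 2) * (1 / 2)" using N by (intro mult_strict_left_mono) auto
  then have q2: "q > (N + 2) / 2" using q by linarith
  then show q1: "q > 1" using N by simp
  have "(N + 2) * (\<gamma> - 1) < q * \<gamma>" using q g by (simp add: field_simps)
  then have "(\<gamma> - 1) / (\<gamma> * q) < 1 / (N + 2)" using N g q1 by (simp add: field_simps)
  moreover have "1 / q - 1 / (\<gamma> * q) = (\<gamma> - 1) / (\<gamma> * q)" using g q1 by (simp add: field_simps)
  ultimately have d: "1 + 1 / (\<gamma> * q) - 1 / q > (N + 1) / (N + 2)" using N by (simp add: field_simps)
  have p: "(N + 1) / (N + 2) > 0" using N by simp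
  show a0: "a > 0" using d p by (simp add: a_def)
  show "1 / a = 1 + 1 / (\<gamma> * q) - 1 / q" by (simp add: a_def)
  have "a < 1 / ((N + 1) / (N + 2))" unfolding a_def using d p by (intro divide_strict_left_mono mult_pos_pos) auto
  then have "(N + 1) * a < N + 2" using N by (simp add: field_simps)
  then show "(N + 1) / 2 * a - N / 2 < 1" by (simp add: field_simps)
  have "N / 2 * (q / (q - 1)) - N / 2 = N / (2 * (q - 1))" using q1 by (simp add: field_simps)
  also have "\<dots> < 1" using q1 q2 by (simp add: field_simps)
  finally show "N / 2 * (q / (q - 1)) - N / 2 < 1" .
qed

text \<open>The corrector is the heat potential of a mollified Picard iterate. The limit of the iteration would
  solve the fixed point equation exactly, but a single iterate is enough: the iterates increase and have
  bounded integrals, so the integral of some increment \<open>F (Suc n) - F n\<close> is as small as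
  desired. After mollification with a fixed radius the increment is even uniformly small. Mollification
  preserves the inequality between the potential and the source by Jensen's inequality, at the expense
  of the oscillation of \<open>g\<close>, which is controlled by uniform continuity. The slack \<sigma>
  pays for both errors.\<close>
lemma smooth_corrector:
  fixes Q :: "('a::euclidean_space \<times> real) set"
  assumes g: "\<gamma> > 2" and q: "q > (real DIM('a) + 2) * ((\<gamma> - 1) / \<gamma>)" and K: "K > 0" and \<tau>: "\<tau> > 0"
    and Q: "compact Q" "Q \<subseteq> cball 0 R" and R: "R > 0"
  shows "\<exists>\<delta>>0. \<forall>g. continuous_on Q g \<and> (\<forall>z\<in>Q. 0 \<le> g z) \<and>
     (\<integral>\<^sup>+ z. ennreal (indicator Q z * g z powr q) \<partial>lborel) \<le> ennreal \<delta> \<longrightarrow>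
     (\<forall>Q0 r \<sigma>. r > 0 \<and> \<sigma> > 0 \<and> (\<forall>z\<in>Q0. cball z r \<subseteq> Q) \<longrightarrow>
       (\<exists>\<psi> \<psi>t \<psi>1 \<psi>2. (\<forall>z. 0 \<le> \<psi> z \<and> \<psi> z \<le> \<tau>) \<and> continuous_on UNIV \<psi> \<and>
          (\<forall>z. has_line_deriv \<psi> (0, 1) (\<psi>t z) z) \<and>
          (\<forall>z. \<forall>b\<in>Basis. has_line_deriv \<psi> (b, 0) (\<psi>1 b z) z \<and> has_line_deriv (\<psi>1 b) (b, 0) (\<psi>2 b z) z) \<and>
          (\<forall>z\<in>Q0. - \<psi>t z - (\<Sum>b\<in>Basis. \<psi>2 b z) \<ge> K * norm (\<Sum>b\<in>(Basis::'a set). \<psi>1 b z *\<^sub>R b) powr \<gamma> + g z - \<sigma>)))"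
proof -
  define N where "N = real DIM('a)"
  have N: "N \<ge> 1" using DIM_positive[where 'a='a] unfolding N_def by linarith
  define a where "a = 1 / (1 + 1 / (\<gamma> * q) - 1 / q)"
  note ex = subcritical_exponents[OF g N q[folded N_def], folded a_def]
  \<comment> \<open>A point of \<open>Q\<close> and a point of the support of a mollified iterate differ by less than
    \<open>S\<close> in time, so the cut-off of the heat kernel has no effect.\<close>
  define S where "S = 2 * R + 2"
  have S: "S > 0" using R by (simp add: S_def)
  define c where "c = heat_const TYPE('a)"
  have c: "c > 0" by (simp add: c_def heat_const_pos)
  \<comment> \<open>The heat potential will be divided by \<open>c\<close>, because the kernel is not normalised.\<close>
  define K' where "K' = K * c powr (- \<gamma>)"
  have K': "K' > 0" using K c by (simp add: K'_def)
  let ?G = "heat S :: 'a \<times> real \<Rightarrow> real" and ?A = "heat_abs_grad S :: 'a \<times> real \<Rightarrow> real"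
  have Qb: "Q \<in> sets borel" using Q(1) by (simp add: borel_compact)
  obtain V where V: "emeasure lborel Q = ennreal V" "V \<ge> 0"
    using emeasure_compact_finite[OF Q(1)] by (cases "emeasure lborel Q") auto
  have G: "?G \<in> borel_measurable borel" "\<And>y. ?G y \<ge> 0" "integrable lborel ?G" "integrable lborel (\<lambda>y. ?G y powr (q / (q - 1)))"
    using heat_Lp(1)[OF S, of "q / (q - 1)", where 'a='a] ex heat_integrable(1)[OF S, where 'a='a]
    by (auto simp: heat_nonneg N_def)
  have A: "?A \<in> borel_measurable borel" "\<And>y. ?A y \<ge> 0" "integrable lborel ?A" "integrable lborel (\<lambda>y. ?A y powr a)"
    using heat_Lp(2)[OF S ex(2), where 'a='a] ex heat_integrable(2)[OF S, where 'a='a]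
    by (auto simp: heat_abs_grad_nonneg N_def add.commute)
  obtain m0 where m0: "m0 > 0" and hs: "\<And>F B. F \<in> borel_measurable borel \<Longrightarrow> (\<forall>z. 0 \<le> F z \<and> F z \<le> B) \<Longrightarrow>
     (\<integral>\<^sup>+ z. ennreal (F z powr q) \<partial>lborel) \<le> ennreal m0 \<Longrightarrow> (\<forall>z. corr ?G F z \<le> \<tau> * c)"
    using holder_small[OF G ex(1) mult_pos_pos[OF \<tau> c]] by blast
  have g1: "\<gamma> > 1" using g by simp
  let ?F = "\<lambda>g. corr_iter Q K' \<gamma> ?A g"
  obtain \<delta> where \<delta>: "\<delta> > 0" and it: "\<forall>g M. g \<in> borel_measurable borel \<and> (\<forall>z. 0 \<le> g z \<and> g z \<le> M) \<and>
     (\<integral>\<^sup>+ z. ennreal (indicator Q z * g z powr q) \<partial>lborel) \<le> ennreal \<delta> \<longrightarrow>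
     (\<forall>n. ?F g n \<in> borel_measurable borel \<and> (\<exists>B. \<forall>z. 0 \<le> ?F g n z \<and> ?F g n z \<le> B)
       \<and> (\<forall>z. z \<notin> Q \<longrightarrow> ?F g n z = 0) \<and> (\<integral>\<^sup>+ z. ennreal (?F g n z powr q) \<partial>lborel) \<le> ennreal m0)"
    using corr_iter_exists[OF A g1 less_imp_le[OF ex(1)] ex(2,3) Qb V less_imp_le[OF K'] m0] by (elim exE conjE) (rule that)
  show ?thesis
  proof (intro exI[of _ \<delta>] conjI[OF \<delta>] allI impI)
    fix g0 :: "'a \<times> real \<Rightarrow> real" and Q0 and r \<sigma> :: real
    assume asm1: "continuous_on Q g0 \<and> (\<forall>z\<in>Q. 0 \<le> g0 z) \<and> (\<integral>\<^sup>+ z. ennreal (indicator Q z * g0 z powr q) \<partial>lborel) \<le> ennreal \<delta>"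
      and asm2: "r > 0 \<and> \<sigma> > 0 \<and> (\<forall>z\<in>Q0. cball z r \<subseteq> Q)"
    define g where "g z = indicator Q z * g0 z" for z
    have gm: "g \<in> borel_measurable borel"
      using borel_measurable_continuous_on_indicator[OF Qb, of g0] asm1 by (simp add: g_def[abs_def])
    obtain M where M: "\<And>z. z \<in> Q \<Longrightarrow> \<bar>g0 z\<bar> \<le> M"
      using compact_imp_bounded[OF compact_continuous_image[of Q g0]] asm1 Q(1) by (auto simp: bounded_iff)
    have gM: "0 \<le> g z \<and> g z \<le> max M 0" for z
      using M[of z] asm1 by (auto simp: g_def indicator_def)
    have gi: "g \<in> borel_measurable borel \<and> (\<forall>z. 0 \<le> g z \<and> g z \<le> max M 0) \<and>
      (\<integral>\<^sup>+ z. ennreal (indicator Q z * g z powr q) \<partial>lborel) \<le> ennreal \<delta>"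
    proof -
      have e: "(\<integral>\<^sup>+ z. ennreal (indicator Q z * g z powr q) \<partial>lborel) = (\<integral>\<^sup>+ z. ennreal (indicator Q z * g0 z powr q) \<partial>lborel)"
        by (intro nn_integral_cong) (simp add: g_def indicator_def)
      show ?thesis unfolding e using gm gM asm1 by blast
    qed
    define F where "F = corr_iter Q K' \<gamma> ?A g"
    have itn: "\<forall>n. F n \<in> borel_measurable borel \<and> (\<exists>B. \<forall>z. 0 \<le> F n z \<and> F n z \<le> B)
       \<and> (\<forall>z. z \<notin> Q \<longrightarrow> F n z = 0) \<and> (\<integral>\<^sup>+ z. ennreal (F n z powr q) \<partial>lborel) \<le> ennreal m0"
      unfolding F_def by (rule it[rule_format, OF gi, THEN allI])
    have Fm [measurable]: "F n \<in> borel_measurable borel" for n using itn by blast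
    have FB: "\<exists>B. \<forall>z. 0 \<le> F n z \<and> F n z \<le> B" for n using itn by blast
    have F0: "F n z \<ge> 0" for n z using FB by blast
    have FQ: "z \<notin> Q \<Longrightarrow> F n z = 0" for n z using itn by blast
    have Fq: "(\<integral>\<^sup>+ z. ennreal (F n z powr q) \<partial>lborel) \<le> ennreal m0" for n using itn by blast
    have Fmono: "F n z \<le> F (Suc n) z" for n z
      unfolding F_def
      by (rule corr_iter_mono[OF A(2,3) less_imp_le[OF K']]) (use \<open>\<gamma> > 2\<close> gM Fm FB in \<open>auto simp: F_def simp del: corr_iter.simps\<close>)
    have Qi: "integrable lborel (indicator Q :: _ \<Rightarrow> real)"
      using V Qb by (intro integrable_real_indicator) (auto simp: V)
    have Fi: "integrable lborel (F n)" for n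
    proof -
      obtain B where B: "\<forall>z. 0 \<le> F n z \<and> F n z \<le> B" using FB by blast
      have "integrable lborel (\<lambda>z. indicator Q z * F n z)"
      proof (rule integrable_bounded_mult[OF Qi])
        show "\<bar>F n z\<bar> \<le> B" for z using B[rule_format, of z] by simp
      qed simp
      moreover have "indicator Q z * F n z = F n z" for z using FQ[of z n] by (cases "z \<in> Q") simp_all
      ultimately show ?thesis by simp
    qed
    define I where "I n = (LINT z|lborel. F n z)" for n
    have Fqi: "integrable lborel (\<lambda>z. F n z powr q)" for n
      using Fq[of n] by (intro integrableI_bounded) (auto intro: le_less_trans)
    have "I n \<le> V + m0" for n
    proof -
      have "(LINT z|lborel. F n z powr q) \<le> m0"
        using Fq[of n] m0 unfolding nn_integral_eq_integral[OF Fqi AE_I2[OF powr_ge_zero]] by (simp add: ennreal_le_iff)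
      moreover have "I n \<le> (LINT z|lborel. indicator Q z + F n z powr q)"
        unfolding I_def
      proof (rule integral_mono[OF Fi])
        show "integrable lborel (\<lambda>z. indicator Q z + F n z powr q)" using Qi Fqi by auto
        show "F n z \<le> indicator Q z + F n z powr q" for z
          using powr_le_one_add[of "F n z" 1 q] F0[of n z] FQ[of z n] ex(1) by (cases "z \<in> Q") auto
      qed
      moreover have "(LINT z|lborel. indicator Q z + F n z powr q) = V + (LINT z|lborel. F n z powr q)"
        using Qi Fqi V by (subst Bochner_Integration.integral_add) (auto simp: measure_def)
      ultimately show ?thesis by simp
    qed
    note Ibd = this
    have uc: "uniformly_continuous_on Q g0" using asm1 Q(1) by (intro compact_uniformly_continuous) auto
    have "\<sigma> / 2 > 0" using asm2 by simp
    with uc[unfolded uniformly_continuous_on_def, THEN spec[of _ "\<sigma> / 2"]]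
    have "\<exists>d>0. \<forall>x\<in>Q. \<forall>x'\<in>Q. dist x' x < d \<longrightarrow> dist (g0 x') (g0 x) < \<sigma> / 2" by (rule mp)
    then obtain d where d: "d > 0" and d0: "\<forall>x\<in>Q. \<forall>x'\<in>Q. dist x' x < d \<longrightarrow> dist (g0 x') (g0 x) < \<sigma> / 2"
      by (elim exE conjE) (rule that)
    \<comment> \<open>The radius of mollification: balls around points of \<open>Q0\<close> stay inside \<open>Q\<close>, and
      \<open>g0\<close> varies by less than \<open>\<sigma> / 2\<close> on them.\<close>
    define \<eta> where "\<eta> = min (min r 1) (d / 2)"
    have \<eta>: "\<eta> > 0" "\<eta> \<le> r" "\<eta> \<le> 1" "\<eta> < d" using asm2 d by (auto simp: \<eta>_def)
    obtain Bm where Bm: "\<And>y::'a \<times> real. \<bar>moll \<eta> y\<bar> \<le> Bm" using moll_bounded[OF \<eta>(1)] by blast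
    have Bm0: "Bm \<ge> 0" using Bm[of 0] by linarith
    \<comment> \<open>After multiplication by the bound \<open>Bm\<close> of the mollifier the increment is still less than
      \<open>\<sigma> / 2\<close>.\<close>
    obtain n where n: "I (Suc n) - I n < \<sigma> / 2 / (Bm + 1)"
      using small_increment[of I "V + m0" "\<sigma> / 2 / (Bm + 1)", OF Ibd] asm2 Bm0 by auto
    obtain B where B0: "\<forall>z. 0 \<le> F n z \<and> F n z \<le> B" using FB[of n] by blast
    have B: "\<bar>F n z\<bar> \<le> B" for z using B0[rule_format, of z] by simp
    let ?\<phi> = "\<lambda>es. corr (mollD \<eta> es) (F n)"
    have Fl: "integrable lborel (\<lambda>y. indicator (cball z \<rho>) y * F n y)" for z \<rho>
      using integrable_mult_indicator[of "cball z \<rho>" lborel "F n"] Fi[of n] by simp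
    have cont: "continuous_on UNIV (?\<phi> es)" for es
      unfolding continuous_on_eq_continuous_at[OF open_UNIV]
      by (intro ballI corr_moll_isCont[OF \<eta>(1) _ Fm Fl, of "\<eta> + 1"]) simp
    have FR: "norm z > R \<Longrightarrow> F n z = 0" for z using Q(2) by (intro FQ) auto
    have van: "vanishes_off (R + \<eta>) (?\<phi> es)" for es by (rule corr_moll_vanishes[OF \<eta>(1) FR])
    have ld: "has_line_deriv (?\<phi> es) e (- ?\<phi> (e # es) z) z" for es e z
      by (rule corr_moll_ld[OF \<eta>(1) _ Fm Fl, of "\<eta> + 1"]) simp
    let ?t = "(0::'a, 1::real)" and ?x = "\<lambda>b::'a. (b, 0::real)"
    define \<phi> where "\<phi> = ?\<phi> []"
    define \<phi>t where "\<phi>t z = - ?\<phi> [?t] z" for z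
    define \<phi>1 where "\<phi>1 b z = - ?\<phi> [?x b] z" for b z
    define \<phi>2 where "\<phi>2 b z = ?\<phi> [?x b, ?x b] z" for b z
    have cs: "continuous_on UNIV \<phi>" "continuous_on UNIV \<phi>t" "continuous_on UNIV (\<phi>1 b)" "continuous_on UNIV (\<phi>2 b)" for b
      using cont by (auto simp: \<phi>_def \<phi>t_def[abs_def] \<phi>1_def[abs_def] \<phi>2_def[abs_def] intro!: continuous_intros)
    have vs: "vanishes_off (R + \<eta>) \<phi>" "vanishes_off (R + \<eta>) \<phi>t" "vanishes_off (R + \<eta>) (\<phi>1 b)" "vanishes_off (R + \<eta>) (\<phi>2 b)" for b
      using van by (auto simp: \<phi>_def \<phi>t_def \<phi>1_def \<phi>2_def vanishes_off_def)
    have l1: "has_line_deriv \<phi> ?t (\<phi>t z) z" "has_line_deriv \<phi> (?x b) (\<phi>1 b z) z" for z b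
      using ld[of "[]"] by (auto simp: \<phi>_def \<phi>t_def \<phi>1_def)
    have l2: "has_line_deriv (\<phi>1 b) (?x b) (\<phi>2 b z) z" for b z
      using DERIV_minus[OF ld[of "[?x b]" "?x b" z, unfolded has_line_deriv_def]]
      by (simp add: has_line_deriv_def \<phi>1_def[abs_def] \<phi>2_def)
    have bd: "\<exists>B. \<forall>z. \<bar>f z\<bar> \<le> B" "f \<in> borel_measurable borel" if "continuous_on UNIV f" "vanishes_off (R + \<eta>) f" for f :: "'a \<times> real \<Rightarrow> real"
      using continuous_vanishes_off(2,3)[OF that] by (auto simp: bounded_iff)
    have pot: "has_line_deriv (corr ?G f) e (corr ?G f' z) z"
      if pt: "continuous_on UNIV f" "vanishes_off (R + \<eta>) f" "continuous_on UNIV f'" "vanishes_off (R + \<eta>) f'" "\<And>z. has_line_deriv f e (f' z) z" for f f' e z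
    proof -
      obtain B1 B2 where "\<And>z. \<bar>f z\<bar> \<le> B1" "\<And>z. \<bar>f' z\<bar> \<le> B2" using bd(1)[OF pt(1,2)] bd(1)[OF pt(3,4)] by blast
      from corr_ld_right[OF G(3) bd(2)[OF pt(1,2)] this(1) bd(2)[OF pt(3,4)] this(2) pt(5)] show ?thesis .
    qed
    define \<psi> where "\<psi> z = corr ?G \<phi> z / c" for z
    define \<psi>t where "\<psi>t z = corr ?G \<phi>t z / c" for z
    define \<psi>1 where "\<psi>1 b z = corr ?G (\<phi>1 b) z / c" for b z
    define \<psi>2 where "\<psi>2 b z = corr ?G (\<phi>2 b) z / c" for b z
    have div: "has_line_deriv (\<lambda>z. f z / c) e (D / c) z" if "has_line_deriv f e D z" for f e D and z :: "'a \<times> real"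
      using DERIV_cdivide[OF that[unfolded has_line_deriv_def], of c] by (simp add: has_line_deriv_def)
    have \<psi>t: "has_line_deriv \<psi> ?t (\<psi>t z) z" for z
      unfolding \<psi>_def[abs_def] \<psi>t_def by (intro div pot cs vs l1)
    have \<psi>1: "has_line_deriv \<psi> (?x b) (\<psi>1 b z) z" for b z
      unfolding \<psi>_def[abs_def] \<psi>1_def by (intro div pot cs vs l1)
    have \<psi>2: "has_line_deriv (\<psi>1 b) (?x b) (\<psi>2 b z) z" for b z
      unfolding \<psi>1_def[abs_def] \<psi>2_def by (intro div pot cs vs l2)
    have \<phi>0: "\<phi> z \<ge> 0" for z
      unfolding \<phi>_def mollD_Nil by (intro corr_nonneg moll_nonneg \<eta> F0)
    have sw: "corr \<kappa> \<phi> z = corr (moll \<eta>) (corr \<kappa> (F n)) z" if "integrable lborel \<kappa>" for \<kappa> z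
      unfolding \<phi>_def mollD_Nil by (rule corr_swap[OF that moll_basic(2)[OF \<eta>(1)] Fm B])
    have \<psi>b: "0 \<le> \<psi> z \<and> \<psi> z \<le> \<tau>" for z
    proof
      show "0 \<le> \<psi> z" unfolding \<psi>_def using c by (intro divide_nonneg_pos corr_nonneg G(2) \<phi>0)
      have le: "corr ?G (F n) y \<le> \<tau> * c" for y using hs[OF Fm _ Fq] FB[of n] by blast
      have "corr ?G \<phi> z \<le> \<tau> * c * (LINT y|lborel. moll \<eta> (y :: 'a \<times> real))"
        unfolding sw[OF G(3)]
        by (rule corr_le[OF moll_basic(2)[OF \<eta>(1)] moll_nonneg[OF \<eta>(1)] _ _ le])
           (auto intro!: corr_measurable corr_nonneg G F0)
      then show "\<psi> z \<le> \<tau>" using c moll_basic(5)[OF \<eta>(1), where 'a="'a \<times> real"] by (simp add: \<psi>_def divide_le_eq)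
    qed
    have \<psi>c: "continuous_on UNIV \<psi>"
    proof -
      obtain B1 where B1: "\<And>z. \<bar>\<phi> z\<bar> \<le> B1" using bd(1)[OF cs(1) vs(1)] by blast
      have \<phi>m [measurable]: "\<phi> \<in> borel_measurable borel" by (rule bd(2)[OF cs(1) vs(1)])
      have "isCont (corr ?G \<phi>) z" for z
        unfolding corr_def[abs_def]
      proof (rule cont_under_integral[OF G(3)])
        show "isCont (\<lambda>z. \<phi> (z + y)) z" for y
        proof (rule isCont_o2[where f="\<lambda>z. z + y"])
          show "isCont \<phi> (z + y)" using cs(1) continuous_on_eq_continuous_at[OF open_UNIV] by blast
        qed (intro continuous_intros)
        show "\<bar>\<phi> (z' + y)\<bar> \<le> B1" for z' y by (rule B1)
      qed measurable
      then show ?thesis unfolding \<psi>_def[abs_def] using c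
        by (intro continuous_intros) (auto simp: continuous_on_eq_continuous_at)
    qed
    have main: "- \<psi>t z - (\<Sum>b\<in>Basis. \<psi>2 b z) \<ge> K * norm (\<Sum>b\<in>(Basis::'a set). \<psi>1 b z *\<^sub>R b) powr \<gamma> + g0 z - \<sigma>" if z: "z \<in> Q0" for z
    proof -
      have zr: "cball z r \<subseteq> Q" using z asm2 by blast
      then have zQ: "z \<in> Q" using asm2 by (auto simp: subset_eq)
      have snd: "\<bar>snd z\<bar> \<le> R" using zQ Q(2) norm_snd_le[of "snd z" "fst z"] unfolding prod.collapse by auto
      have "corr ?G \<phi>t z + (\<Sum>b\<in>Basis. corr ?G (\<phi>2 b) z) = - c * \<phi> z"
        unfolding c_def
        by (rule heat_identity[OF cs(1,2) _ _ vs(1,2) _ _ l1(1) _ _ S, where ?\<phi>1.0=\<phi>1])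
          (use cs vs l1 l2 snd \<eta>(3) in \<open>auto simp: S_def\<close>)
      then have L: "- \<psi>t z - (\<Sum>b\<in>Basis. \<psi>2 b z) = \<phi> z"
        using c by (simp add: \<psi>t_def \<psi>2_def sum_divide_distrib[symmetric] field_simps)
      have f1: "corr ?G (\<phi>1 b) z = corr (heat_grad S b) \<phi> z" if "b \<in> Basis" for b
        by (rule heat_first[OF cs(1,2) _ _ vs(1,2) _ _ l1(1) _ _ S that, where ?\<phi>2.0=\<phi>2]) (use cs vs l1 l2 in auto)
      obtain B1 where B1: "\<And>z. \<bar>\<phi> z\<bar> \<le> B1" using bd(1)[OF cs(1) vs(1)] by blast
      have \<phi>m [measurable]: "\<phi> \<in> borel_measurable borel" by (rule bd(2)[OF cs(1) vs(1)])
      have iD: "integrable lborel (\<lambda>y. heat_grad S b y * \<phi> (z + y))" if "b \<in> Basis" for b :: 'a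
        by (rule integrable_bounded_mult[OF heat_integrable(3)[OF S that] _ B1]) measurable
      have "norm (\<Sum>b\<in>(Basis::'a set). \<psi>1 b z *\<^sub>R b) \<le> (\<Sum>b\<in>(Basis::'a set). \<bar>corr (heat_grad S b) \<phi> z\<bar> / c)"
        using c by (intro order_trans[OF norm_sum] sum_mono) (auto simp: \<psi>1_def f1)
      also have "\<dots> \<le> (\<Sum>b\<in>(Basis::'a set). (LINT y|lborel. \<bar>heat_grad S b y\<bar> * \<phi> (z + y)) / c)"
      proof (intro sum_mono divide_right_mono)
        fix b :: 'a
        have "\<bar>corr (heat_grad S b) \<phi> z\<bar> \<le> (LINT y|lborel. norm (heat_grad S b y * \<phi> (z + y)))"
          unfolding corr_def using integral_norm_bound[of lborel "\<lambda>y. heat_grad S b y * \<phi> (z + y)"] by simp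
        then show "\<bar>corr (heat_grad S b) \<phi> z\<bar> \<le> (LINT y|lborel. \<bar>heat_grad S b y\<bar> * \<phi> (z + y))"
          using \<phi>0 by (simp add: abs_mult)
      qed (use c in auto)
      also have "\<dots> = corr ?A \<phi> z / c"
      proof -
        have "integrable lborel (\<lambda>y. \<bar>heat_grad S b y\<bar> * \<phi> (z + y))" if "b \<in> Basis" for b :: 'a
          using integrable_abs[OF iD[OF that]] \<phi>0 by (simp add: abs_mult)
        then have "(\<Sum>b\<in>(Basis::'a set). (LINT y|lborel. \<bar>heat_grad S b y\<bar> * \<phi> (z + y))) = corr ?A \<phi> z"
          unfolding corr_def heat_abs_grad_def sum_distrib_right by (intro Bochner_Integration.integral_sum[symmetric])
        then show ?thesis by (simp add: sum_divide_distrib[symmetric])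
      qed
      finally have gr: "norm (\<Sum>b\<in>(Basis::'a set). \<psi>1 b z *\<^sub>R b) \<le> corr ?A \<phi> z / c" .
      have A\<phi>: "corr ?A \<phi> z \<ge> 0" by (intro corr_nonneg A \<phi>0)
      have "K * norm (\<Sum>b\<in>(Basis::'a set). \<psi>1 b z *\<^sub>R b) powr \<gamma> \<le> K * (corr ?A \<phi> z / c) powr \<gamma>"
        using gr K g \<open>\<gamma> > 2\<close> by (intro mult_left_mono powr_mono2) auto
      also have "\<dots> = K' * corr ?A \<phi> z powr \<gamma>"
        using c A\<phi> by (simp add: K'_def powr_divide powr_minus field_simps)
      finally have gr2: "K * norm (\<Sum>b\<in>(Basis::'a set). \<psi>1 b z *\<^sub>R b) powr \<gamma> \<le> K' * corr ?A \<phi> z powr \<gamma>" .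
      \<comment> \<open>It remains to bound \<phi> from below. By definition \<open>F (Suc n)\<close> is
        \<open>K' * H powr \<gamma> + g0\<close> on \<open>Q\<close>, and \<open>F n\<close> differs
        from it by a small increment only.\<close>
      define H where "H = corr ?A (F n)"
      have Hm [measurable]: "H \<in> borel_measurable borel" unfolding H_def by (intro corr_measurable A Fm)
      have H0: "H y \<ge> 0" for y unfolding H_def by (intro corr_nonneg A F0)
      have FleB: "F n y \<le> B" for y using B[of y] by linarith
      define BH where "BH = B * (LINT y|lborel. ?A y)"
      have BH: "H y \<le> BH" for y unfolding H_def BH_def by (rule corr_le[OF A(3,2) Fm F0 FleB])
      note mi = moll_basic(2)[OF \<eta>(1), where 'a="'a \<times> real"]
      have bm: "integrable lborel (\<lambda>y. moll \<eta> y * f y)" if "f \<in> borel_measurable borel" "\<And>y. \<bar>f y\<bar> \<le> b" for f :: "'a \<times> real \<Rightarrow> real" and b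
        by (rule integrable_bounded_mult[OF mi _ that(2)]) (use that(1) in simp)
      have iH: "integrable lborel (\<lambda>y. moll \<eta> y * H (z + y))"
      proof (rule bm[where b=BH])
        show "\<bar>H (z + y)\<bar> \<le> BH" for y using H0[of "z + y"] BH[of "z + y"] by simp
      qed measurable
      have iHg: "integrable lborel (\<lambda>y. moll \<eta> y * H (z + y) powr \<gamma>)"
      proof (rule bm[where b="BH powr \<gamma>"])
        show "\<bar>H (z + y) powr \<gamma>\<bar> \<le> BH powr \<gamma>" for y
          using H0[of "z + y"] BH[of "z + y"] \<open>\<gamma> > 2\<close> by (simp add: powr_mono2)
      qed measurable
      have "corr ?A \<phi> z powr \<gamma> \<le> (LINT y|lborel. moll \<eta> y * H (z + y) powr \<gamma>)"
        unfolding sw[OF A(3)] H_def[symmetric] corr_def[of "moll \<eta>"]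
        by (rule jensen_powr[OF _ mi moll_nonneg[OF \<eta>(1)] moll_basic(5)[OF \<eta>(1)] H0 iH iHg]) (use \<open>\<gamma> > 2\<close> in auto)
      then have J: "K' * corr ?A \<phi> z powr \<gamma> \<le> (LINT y|lborel. moll \<eta> y * (K' * H (z + y) powr \<gamma>))"
        using K' mult_left_mono[of "corr ?A \<phi> z powr \<gamma>" "(LINT y|lborel. moll \<eta> y * H (z + y) powr \<gamma>)" K']
        by (simp add: integral_mult_right_zero[symmetric] ac_simps del: integral_mult_right_zero integral_mult_left_zero)
      let ?dd = "\<lambda>y. F (Suc n) (z + y) - F n (z + y)"
      have ddi: "integrable lborel ?dd"
        by (intro Bochner_Integration.integrable_diff lborel_integrable_shift Fi)
      have iFn: "integrable lborel (\<lambda>y. moll \<eta> y * F n (z + y))" "integrable lborel (\<lambda>y. moll \<eta> y * ?dd y)"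
        using integrable_moll_mult[OF \<eta>(1) Fi, of n z] integrable_moll_mult[OF \<eta>(1) Fi, of "Suc n" z]
        by (auto simp: right_diff_distrib)
      have iS: "integrable lborel (\<lambda>y. moll \<eta> y * (F n (z + y) + ?dd y))"
        unfolding distrib_left by (intro Bochner_Integration.integrable_add iFn)
      have iL: "integrable lborel (\<lambda>y. moll \<eta> y * (K' * H (z + y) powr \<gamma> + (g0 z - \<sigma> / 2)))"
        using iHg mi integrable_mult_left[OF iHg, of K'] integrable_mult_left[OF mi, of "g0 z - \<sigma> / 2"]
        unfolding distrib_left by (intro Bochner_Integration.integrable_add) (auto simp: ac_simps)
      have "(LINT y|lborel. moll \<eta> y * (K' * H (z + y) powr \<gamma> + (g0 z - \<sigma> / 2))) \<le> (LINT y|lborel. moll \<eta> y * (F n (z + y) + ?dd y))"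
      proof (rule moll_local_integral_mono[OF \<eta>(1) iL iS])
        fix y :: "'a \<times> real" assume y: "norm y \<le> \<eta>"
        have "z + y \<in> cball z r" using y \<eta>(2) by (simp add: dist_norm)
        then have yQ: "z + y \<in> Q" using zr by blast
        have "dist (g0 (z + y)) (g0 z) < \<sigma> / 2" using y \<eta>(4) by (intro d0[rule_format, OF zQ yQ]) (simp add: dist_norm)
        then have "\<bar>g0 (z + y) - g0 z\<bar> < \<sigma> / 2" unfolding dist_real_def .
        then have "g0 z - \<sigma> / 2 \<le> g0 (z + y)" by linarith
        moreover have "F (Suc n) (z + y) = K' * H (z + y) powr \<gamma> + g0 (z + y)"
          using yQ by (simp add: F_def H_def g_def)
        ultimately show "K' * H (z + y) powr \<gamma> + (g0 z - \<sigma> / 2) \<le> F n (z + y) + ?dd y" by simp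
      qed
      also have "\<dots> = \<phi> z + (LINT y|lborel. moll \<eta> y * ?dd y)"
        unfolding distrib_left \<phi>_def mollD_Nil corr_def by (rule Bochner_Integration.integral_add[OF iFn])
      also have "(LINT y|lborel. moll \<eta> y * ?dd y) \<le> (LINT y|lborel. Bm * ?dd y)"
      proof (intro integral_mono iFn integrable_mult_right ddi mult_right_mono)
        show "moll \<eta> y \<le> Bm" for y :: "'a \<times> real" using Bm[of y] by linarith
        show "0 \<le> ?dd y" for y using Fmono[of n "z + y"] by simp
      qed
      also have "\<dots> = Bm * (I (Suc n) - I n)"
        unfolding I_def using lborel_integral_shift[of "F (Suc n)" z] lborel_integral_shift[of "F n" z]
          lborel_integrable_shift[OF Fi[of n], of z] lborel_integrable_shift[OF Fi[of "Suc n"], of z] Fm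
        by (simp add: Bochner_Integration.integral_diff)
      also have "\<dots> \<le> Bm * (\<sigma> / 2 / (Bm + 1))" using n Bm0 by (intro mult_left_mono) auto
      also have "\<dots> \<le> \<sigma> / 2" using Bm0 asm2 by (simp add: field_simps)
      finally have "(LINT y|lborel. moll \<eta> y * (K' * H (z + y) powr \<gamma> + (g0 z - \<sigma> / 2))) \<le> \<phi> z + \<sigma> / 2" by simp
      moreover have "(LINT y|lborel. moll \<eta> y * (K' * H (z + y) powr \<gamma> + (g0 z - \<sigma> / 2))) =
         (LINT y|lborel. moll \<eta> y * (K' * H (z + y) powr \<gamma>)) + (g0 z - \<sigma> / 2)"
        unfolding distrib_left using mi moll_basic(5)[OF \<eta>(1), where 'a="'a \<times> real"] integrable_mult_left[OF iHg, of K']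
        by (subst Bochner_Integration.integral_add) (auto simp: ac_simps)
      ultimately have "\<phi> z \<ge> K' * corr ?A \<phi> z powr \<gamma> + g0 z - \<sigma>" using J by linarith
      then show ?thesis using gr2 L by linarith
    qed
    show "\<exists>\<psi> \<psi>t \<psi>1 \<psi>2. (\<forall>z. 0 \<le> \<psi> z \<and> \<psi> z \<le> \<tau>) \<and> continuous_on UNIV \<psi> \<and>
          (\<forall>z. has_line_deriv \<psi> (0, 1) (\<psi>t z) z) \<and>
          (\<forall>z. \<forall>b\<in>Basis. has_line_deriv \<psi> (b, 0) (\<psi>1 b z) z \<and> has_line_deriv (\<psi>1 b) (b, 0) (\<psi>2 b z) z) \<and>
          (\<forall>z\<in>Q0. - \<psi>t z - (\<Sum>b\<in>Basis. \<psi>2 b z) \<ge> K * norm (\<Sum>b\<in>(Basis::'a set). \<psi>1 b z *\<^sub>R b) powr \<gamma> + g0 z - \<sigma>)"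
      using \<psi>b \<psi>c \<psi>t \<psi>1 \<psi>2 main by blast
  qed
qed

section \<open>The comparison argument\<close>

text \<open>If \<open>p\<close> exceeds the threshold
  \<open>(2 * b / (h * \<kappa>)) powr (1 / (\<gamma> - 1))\<close>, the superlinear term beats the
  linear one; otherwise the linear term is bounded by \<open>b\<close> times the threshold.\<close>
lemma drift_absorb:
  fixes h \<kappa> \<gamma> p b :: real
  assumes "h > 0" "\<kappa> > 0" "\<gamma> > 1" "p \<ge> 0" "b \<ge> 0"
  shows "h * (\<kappa> / 2) * p powr \<gamma> - p * b \<ge> - (b * (2 * b / (h * \<kappa>)) powr (1 / (\<gamma> - 1)))"
proof -
  define s where "s = (2 * b / (h * \<kappa>)) powr (1 / (\<gamma> - 1))"
  have s0: "s \<ge> 0" by (simp add: s_def)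
  show ?thesis
  proof (cases "p \<le> s")
    case True
    have "b * p \<le> b * s" using True assms by (intro mult_left_mono) auto
    moreover have "h * (\<kappa> / 2) * p powr \<gamma> \<ge> 0" using assms by simp
    ultimately show ?thesis by (simp add: s_def mult.commute)
  next
    case False
    then have p: "p > 0" using s0 by simp
    have "s powr (\<gamma> - 1) = 2 * b / (h * \<kappa>)" using assms by (simp add: s_def powr_powr)
    moreover have "s powr (\<gamma> - 1) \<le> p powr (\<gamma> - 1)" using False s0 assms by (intro powr_mono2) auto
    ultimately have "2 * b / (h * \<kappa>) \<le> p powr (\<gamma> - 1)" by simp
    then have "h * (\<kappa> / 2) * (2 * b / (h * \<kappa>)) * p \<le> h * (\<kappa> / 2) * p powr (\<gamma> - 1) * p"
      using assms by (intro mult_right_mono mult_left_mono) auto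
    moreover have "h * (\<kappa> / 2) * (2 * b / (h * \<kappa>)) = b" using assms by (simp add: field_simps)
    moreover have "p powr (\<gamma> - 1) * p = p powr \<gamma>" using p by (simp add: powr_diff)
    ultimately have "b * p \<le> h * (\<kappa> / 2) * p powr \<gamma>" by (simp add: mult.assoc)
    moreover have "b * s \<ge> 0" using assms s0 by simp
    ultimately show ?thesis unfolding s_def by (simp add: mult.commute)
  qed
qed

text \<open>Convexity with the weights \<open>1 + \<kappa>\<close>, \<open>\<kappa>\<close> and
  \<open>\<kappa>\<close>, which add up to \<open>1 + 3 * \<kappa>\<close>.\<close>
lemma weighted_convexity:
  fixes \<kappa> \<gamma> :: real and g p u w :: "'a::real_normed_vector"
  assumes \<kappa>: "\<kappa> > 0" and g: "\<gamma> \<ge> 1" and eq: "(1 + 3 * \<kappa>) *\<^sub>R g = p - u - w"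
  shows "(1 + 3 * \<kappa>) * norm g powr \<gamma> \<le>
     (1 + \<kappa>) powr (1 - \<gamma>) * norm p powr \<gamma> + \<kappa> powr (1 - \<gamma>) * norm u powr \<gamma> + \<kappa> powr (1 - \<gamma>) * norm w powr \<gamma>"
proof -
  define l where "l = 1 + 3 * \<kappa>"
  have l: "l > 0" using \<kappa> by (simp add: l_def)
  have "norm (l *\<^sub>R g) \<le> norm p + (norm u + norm w)"
    unfolding l_def eq using norm_triangle_ineq4[of "p - u" w] norm_triangle_ineq4[of p u] by simp
  then have "(l * norm g) powr \<gamma> \<le> (norm p + (norm u + norm w)) powr \<gamma>"
    using l g by (intro powr_mono2) auto
  also have "\<dots> \<le> ((1 + \<kappa>) / l) powr (1 - \<gamma>) * norm p powr \<gamma> + (2 * \<kappa> / l) powr (1 - \<gamma>) * (norm u + norm w) powr \<gamma>"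
  proof (intro powr_split2)
    have "(1 + \<kappa>) / l + 2 * \<kappa> / l = (1 + \<kappa> + 2 * \<kappa>) / l" by (simp only: add_divide_distrib)
    also have "1 + \<kappa> + 2 * \<kappa> = l" by (simp add: l_def)
    finally show "(1 + \<kappa>) / l + 2 * \<kappa> / l = 1" using l by simp
  qed (use \<kappa> l g in auto)
  also have "(norm u + norm w) powr \<gamma> \<le> (1/2) powr (1 - \<gamma>) * norm u powr \<gamma> + (1/2) powr (1 - \<gamma>) * norm w powr \<gamma>"
    using g by (intro powr_split2) auto
  finally have 1: "(l * norm g) powr \<gamma> \<le> ((1 + \<kappa>) / l) powr (1 - \<gamma>) * norm p powr \<gamma> +
     (2 * \<kappa> / l) powr (1 - \<gamma>) * ((1/2) powr (1 - \<gamma>) * norm u powr \<gamma> + (1/2) powr (1 - \<gamma>) * norm w powr \<gamma>)"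
    by (simp add: mult_left_mono)
  have 2: "(2 * \<kappa> / l) powr (1 - \<gamma>) * (1/2) powr (1 - \<gamma>) = (\<kappa> / l) powr (1 - \<gamma>)"
    using \<kappa> l by (simp add: powr_mult[symmetric])
  have 3: "l powr (1 - \<gamma>) * (x / l) powr (1 - \<gamma>) = x powr (1 - \<gamma>)" if "x > 0" for x
    using that l by (simp add: powr_mult[symmetric])
  have "(l * norm g) powr \<gamma> \<le> ((1 + \<kappa>) / l) powr (1 - \<gamma>) * norm p powr \<gamma> +
     (\<kappa> / l) powr (1 - \<gamma>) * norm u powr \<gamma> + (\<kappa> / l) powr (1 - \<gamma>) * norm w powr \<gamma>"
    using 1 unfolding 2[symmetric] by (simp only: distrib_left mult.assoc add.assoc)
  then have "l powr (1 - \<gamma>) * (l * norm g) powr \<gamma> \<le> l powr (1 - \<gamma>) * (((1 + \<kappa>) / l) powr (1 - \<gamma>) * norm p powr \<gamma> +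
     (\<kappa> / l) powr (1 - \<gamma>) * norm u powr \<gamma> + (\<kappa> / l) powr (1 - \<gamma>) * norm w powr \<gamma>)"
    by (intro mult_left_mono) auto
  also have "l powr (1 - \<gamma>) * (((1 + \<kappa>) / l) powr (1 - \<gamma>) * norm p powr \<gamma> +
     (\<kappa> / l) powr (1 - \<gamma>) * norm u powr \<gamma> + (\<kappa> / l) powr (1 - \<gamma>) * norm w powr \<gamma>) =
     (1 + \<kappa>) powr (1 - \<gamma>) * norm p powr \<gamma> + \<kappa> powr (1 - \<gamma>) * norm u powr \<gamma> + \<kappa> powr (1 - \<gamma>) * norm w powr \<gamma>"
    using 3[of "1 + \<kappa>"] 3[of \<kappa>] \<kappa> by (simp add: distrib_left mult.assoc[symmetric])
  also have "l powr (1 - \<gamma>) * (l * norm g) powr \<gamma> = l * norm g powr \<gamma>"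
    using l by (simp add: powr_mult mult.assoc[symmetric] powr_add[symmetric])
  finally show ?thesis by (simp add: l_def)
qed

lemma has_line_deriv_diff: "has_line_deriv f e D z \<Longrightarrow> has_line_deriv g e E z \<Longrightarrow> has_line_deriv (\<lambda>z. f z - g z) e (D - E) z"
  unfolding has_line_deriv_def by (rule DERIV_diff)

lemma has_line_deriv_cmult: "has_line_deriv f e D z \<Longrightarrow> has_line_deriv (\<lambda>z. c * f z) e (c * D) z"
  unfolding has_line_deriv_def by (rule DERIV_cmult)

lemma has_line_deriv_const: "has_line_deriv (\<lambda>z. c) e 0 z"
  unfolding has_line_deriv_def by simp

lemma one_sided_max:
  assumes "(f has_real_derivative D) (at 0)" "d > 0" "\<And>h. 0 < h \<Longrightarrow> h < d \<Longrightarrow> f h \<le> f (0::real)"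
  shows "D \<le> 0"
proof (rule ccontr)
  assume "\<not> D \<le> 0"
  then obtain d' where d': "d' > 0" "\<And>h. h > 0 \<Longrightarrow> h < d' \<Longrightarrow> f 0 < f (0 + h)"
    using DERIV_pos_inc_right[OF assms(1)] by auto
  define h where "h = min d d' / 2"
  have "0 < h" "h < d" "h < d'" using assms(2) d'(1) by (auto simp: h_def)
  then show False using assms(3)[of h] d'(2)[of h] by simp
qed

text \<open>If the second derivative were positive, the first derivative would be positive to the right of its zero,
  and the function would increase there.\<close>
lemma second_derivative_max:
  fixes f f' :: "real \<Rightarrow> real"
  assumes f: "\<And>h. \<bar>h\<bar> < d \<Longrightarrow> (f has_real_derivative f' h) (at h)" and f': "(f' has_real_derivative D) (at 0)"
    and d: "d > 0" and m: "\<And>h. \<bar>h\<bar> < d \<Longrightarrow> f h \<le> f 0"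
  shows "f' 0 = 0" "D \<le> 0"
proof -
  show z: "f' 0 = 0"
    by (rule DERIV_local_max[OF f d]) (use m d in auto)
  show "D \<le> 0"
  proof (rule ccontr)
    assume "\<not> D \<le> 0"
    then obtain d' where d': "d' > 0" "\<And>h. h > 0 \<Longrightarrow> h < d' \<Longrightarrow> f' 0 < f' (0 + h)"
      using DERIV_pos_inc_right[OF f'] by auto
    define h where "h = min d d' / 2"
    have h: "0 < h" "h < d" "h < d'" using d d'(1) by (auto simp: h_def)
    have "\<exists>z. 0 < z \<and> z < h \<and> f h - f 0 = (h - 0) * f' z"
      using h by (intro MVT2 f) auto
    then obtain z where z: "0 < z" "z < h" "f h - f 0 = h * f' z" by auto
    have "f' z > 0" using d'(2)[of z] z h \<open>f' 0 = 0\<close> by simp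
    then have "f h > f 0" using z(3) h(1) by (metis diff_gt_0_iff_gt mult_pos_pos)
    then show False using m[of h] h by simp
  qed
qed

lemma one_add_powr_le:
  fixes \<kappa> \<gamma> :: real
  assumes "0 < \<kappa>" "\<kappa> \<le> 1" "\<gamma> \<ge> 2"
  shows "(1 + \<kappa>) powr (1 - \<gamma>) \<le> 1 - \<kappa> / 2"
proof -
  have "(1 + \<kappa>) powr (1 - \<gamma>) \<le> (1 + \<kappa>) powr (-1)" using assms by (intro powr_mono) auto
  also have "\<dots> = 1 / (1 + \<kappa>)" using assms by (simp add: powr_minus_divide)
  also have "\<dots> \<le> 1 - \<kappa> / 2"
  proof -
    have "\<kappa> * \<kappa> \<le> \<kappa> * 1" using assms by (intro mult_left_mono) auto
    then show ?thesis using assms by (simp add: field_simps)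
  qed
  finally show ?thesis .
qed

text \<open>A smooth substitute for the distance to \<open>x0\<close>, which has bounded gradient and second
  derivatives at most \<open>1 / R\<close>.\<close>
definition smooth_dist :: "real \<Rightarrow> 'a::euclidean_space \<Rightarrow> 'a \<Rightarrow> real" where
  "smooth_dist R x0 x = sqrt (R\<^sup>2 + (x - x0) \<bullet> (x - x0))"

lemma smooth_dist_ge: assumes "R > 0" shows "smooth_dist R x0 x \<ge> R" "smooth_dist R x0 x \<ge> norm (x - x0)" "smooth_dist R x0 x > 0"
proof -
  show 1: "smooth_dist R x0 x \<ge> R" using assms unfolding smooth_dist_def by (intro real_le_rsqrt) auto
  show "smooth_dist R x0 x \<ge> norm (x - x0)" unfolding smooth_dist_def norm_eq_sqrt_inner by simp
  show "smooth_dist R x0 x > 0" using 1 assms by linarith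
qed

lemma smooth_dist_ld:
  assumes R: "R > 0" and b: "b \<in> Basis"
  shows "has_line_deriv (smooth_dist R x0) b (((x - x0) \<bullet> b) / smooth_dist R x0 x) x"
    "has_line_deriv (\<lambda>x. ((x - x0) \<bullet> b) / smooth_dist R x0 x) b (1 / smooth_dist R x0 x - ((x - x0) \<bullet> b)\<^sup>2 / smooth_dist R x0 x ^ 3) x"
proof -
  let ?S = "smooth_dist R x0 x"
  note S = smooth_dist_ge(3)[OF R, of x0 x]
  have ip: "(x + h *\<^sub>R b - x0) \<bullet> (x + h *\<^sub>R b - x0) = (x - x0) \<bullet> (x - x0) + 2 * h * ((x - x0) \<bullet> b) + h\<^sup>2" for h
    using b by (simp add: inner_diff_left inner_diff_right inner_add_left inner_add_right inner_commute algebra_simps power2_eq_square)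
  have pos: "R\<^sup>2 + (x - x0) \<bullet> (x - x0) > 0" using R by (intro add_pos_nonneg) auto
  show 1: "has_line_deriv (smooth_dist R x0) b (((x - x0) \<bullet> b) / ?S) x"
    unfolding has_line_deriv_def smooth_dist_def ip using pos
    by (auto intro!: derivative_eq_intros simp: field_simps)
  have 2: "((\<lambda>h. (x + h *\<^sub>R b - x0) \<bullet> b) has_real_derivative 1) (at 0)"
    using b by (auto intro!: derivative_eq_intros simp: inner_add_left inner_diff_left)
  have "((\<lambda>h. ((x + h *\<^sub>R b - x0) \<bullet> b) / smooth_dist R x0 (x + h *\<^sub>R b)) has_real_derivative
     (1 * smooth_dist R x0 (x + 0 *\<^sub>R b) - ((x + 0 *\<^sub>R b - x0) \<bullet> b) * (((x - x0) \<bullet> b) / ?S)) / (smooth_dist R x0 (x + 0 *\<^sub>R b) * smooth_dist R x0 (x + 0 *\<^sub>R b))) (at 0)"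
    using S by (intro DERIV_divide 2 1[unfolded has_line_deriv_def]) auto
  moreover have "(1 * ?S - ((x - x0) \<bullet> b) * (((x - x0) \<bullet> b) / ?S)) / (?S * ?S) = 1 / ?S - ((x - x0) \<bullet> b)\<^sup>2 / ?S ^ 3"
    using S by (simp add: field_simps power2_eq_square power3_eq_cube)
  ultimately show "has_line_deriv (\<lambda>x. ((x - x0) \<bullet> b) / smooth_dist R x0 x) b (1 / ?S - ((x - x0) \<bullet> b)\<^sup>2 / ?S ^ 3) x"
    by (simp add: has_line_deriv_def)
qed

text \<open>The maximum principle for the sheared solution \<open>U (\<Phi> z)\<close> against
  \<open>(1 + 3 * \<kappa>) * U\<close> plus barrier and corrector, all relative to
  \<open>U (x0, t0)\<close>. At a positive interior maximum of the difference \<open>w\<close>, the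
  first order conditions express the gradient of \<open>U\<close> at \<open>z\<close> through the
  gradient \<open>p\<close> at the sheared point, and \<open>weighted_convexity\<close> turns this into
  an inequality between the nonlinear terms. At the sheared point the inequality \<open>sub\<close> has
  the favourable sign; at \<open>z\<close> the defect of the same inequality is paid for by the
  corrector \<psi>. The surplus \<open>h * (\<kappa> / 2) * norm p powr \<gamma>\<close> absorbs the
  drift caused by the shear, and \<open>B\<close> exceeds all that is left, a contradiction. The maximum
  may lie on the initial face \<open>t = t0\<close>, for there the one-sided time derivative has the
  same sign.\<close>
theorem comparison:
  fixes U Ut f \<psi> \<psi>t :: "'a::euclidean_space \<times> real \<Rightarrow> real" and gU :: "'a \<times> real \<Rightarrow> 'a" and U2 \<psi>1 \<psi>2 :: "'a \<Rightarrow> 'a \<times> real \<Rightarrow> real"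
    and x0 e :: 'a and t0 tm T \<kappa> \<alpha> C h \<gamma> R A B \<rho> \<sigma> :: real
  assumes g: "\<gamma> > 2" and h: "h > 0" and C: "C \<ge> 0" and \<kappa>: "0 < \<kappa>" "\<kappa> \<le> 1" and T: "T > 0" and tm: "tm < t0" and R: "R > 0"
    and \<rho>: "\<rho> > 0"
    and hol: "\<And>x t x' t'. t \<ge> t0 \<Longrightarrow> t' \<ge> t0 \<Longrightarrow> \<bar>U (x, t) - U (x', t')\<bar> \<le> C * (norm (x - x') powr \<alpha> + \<bar>t - t'\<bar> powr (\<alpha> / 2))"
    and \<alpha>: "0 < \<alpha>"
    and Uc: "continuous_on {z. snd z \<ge> t0} U"
    and U1: "\<And>z \<xi> \<tau>. snd z > tm \<Longrightarrow> has_line_deriv U (\<xi>, \<tau>) (\<tau> * Ut z + gU z \<bullet> \<xi>) z"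
    and U2: "\<And>z b. snd z > tm \<Longrightarrow> b \<in> Basis \<Longrightarrow> has_line_deriv (\<lambda>z. gU z \<bullet> b) (b, 0) (U2 b z) z"
    and eq: "\<And>z. snd z > tm \<Longrightarrow> Ut z + (\<Sum>b\<in>Basis. U2 b z) = h * f z"
    and sub: "\<And>z. snd z > tm \<Longrightarrow> norm (gU z) powr \<gamma> \<le> f z"
    and \<psi>0: "\<And>z. \<psi> z \<ge> 0" and \<psi>c: "continuous_on UNIV \<psi>" and \<psi>t: "\<And>z. has_line_deriv \<psi> (0, 1) (\<psi>t z) z"
    and \<psi>1: "\<And>z b. b \<in> Basis \<Longrightarrow> has_line_deriv \<psi> (b, 0) (\<psi>1 b z) z" and \<psi>2: "\<And>z b. b \<in> Basis \<Longrightarrow> has_line_deriv (\<psi>1 b) (b, 0) (\<psi>2 b z) z"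
    and \<psi>: "\<And>x t. norm (x - x0) \<le> \<rho> \<Longrightarrow> t0 \<le> t \<Longrightarrow> t \<le> t0 + T \<Longrightarrow>
       - \<psi>t (x, t) - (\<Sum>b\<in>Basis. \<psi>2 b (x, t)) \<ge> h * \<kappa> powr (1 - \<gamma>) * norm (\<Sum>b\<in>(Basis::'a set). \<psi>1 b (x, t) *\<^sub>R b) powr \<gamma>
           + (1 + 3 * \<kappa>) * (h * (f (x, t) - norm (gU (x, t)) powr \<gamma>)) - \<sigma>"
    and A: "A \<ge> 0"
    and B: "B > real DIM('a) * (A / R) + h * \<kappa> powr (1 - \<gamma>) * A powr \<gamma> + (norm e / T) * (2 * (norm e / T) / (h * \<kappa>)) powr (1 / (\<gamma> - 1)) + \<sigma>"
    and B0: "B \<ge> 0"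
    and terminal: "\<And>x. 3 * \<kappa> * C * (norm (x - x0) powr \<alpha> + T powr (\<alpha> / 2)) \<le> A * smooth_dist R x0 x"
    and lateral: "C * norm e powr \<alpha> + 3 * \<kappa> * C * (\<rho> powr \<alpha> + T powr (\<alpha> / 2)) \<le> A * \<rho>"
  shows "U (x0 + e, t0) - U (x0, t0) \<le> A * R + B * T + \<psi> (x0, t0)"
proof -
  define l where "l = 1 + 3 * \<kappa>"
  define c0 where "c0 = U (x0, t0)"
  define \<Phi> where "\<Phi> z = (fst z + (1 - (snd z - t0) / T) *\<^sub>R e, snd z)" for z :: "'a \<times> real"
  define P where "P z = A * smooth_dist R x0 (fst z) + B * (t0 + T - snd z)" for z :: "'a \<times> real"
  define w where "w z = U (\<Phi> z) - c0 - l * (U z - c0) - P z - \<psi> z" for z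
  define M where "M = cball x0 \<rho> \<times> {t0..t0 + T}"
  have Mc: "compact M" unfolding M_def by (intro compact_Times) auto
  have Mne: "(x0, t0) \<in> M" using \<rho> T by (simp add: M_def)
  have cont: "continuous_on M w"
  proof -
    have "continuous_on M U" by (rule continuous_on_subset[OF Uc]) (auto simp: M_def)
    moreover have "continuous_on M (\<lambda>z. U (\<Phi> z))"
      by (rule continuous_on_compose2[OF Uc]) (use T in \<open>auto simp: M_def \<Phi>_def intro!: continuous_intros\<close>)
    moreover have "continuous_on M \<psi>" by (rule continuous_on_subset[OF \<psi>c]) auto
    moreover have "continuous_on M P" unfolding P_def smooth_dist_def by (intro continuous_intros)
    ultimately show ?thesis unfolding w_def by (intro continuous_intros)
  qed
  obtain zm where zm: "zm \<in> M" "\<And>z. z \<in> M \<Longrightarrow> w z \<le> w zm"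
    using continuous_attains_sup[OF Mc _ cont] Mne by blast
  obtain x t where xt: "zm = (x, t)" by (cases zm)
  have xM: "norm (x - x0) \<le> \<rho>" "t0 \<le> t" "t \<le> t0 + T"
    using zm(1) by (auto simp: xt M_def dist_norm norm_minus_commute)
  have l0: "l > 0" using \<kappa> by (simp add: l_def)
  have lU: "- (l - 1) * (U (x, t) - c0) \<le> 3 * \<kappa> * C * (norm (x - x0) powr \<alpha> + T powr (\<alpha> / 2))"
  proof -
    have "\<bar>U (x, t) - U (x0, t0)\<bar> \<le> C * (norm (x - x0) powr \<alpha> + \<bar>t - t0\<bar> powr (\<alpha> / 2))"
      using xM by (intro hol) auto
    also have "\<dots> \<le> C * (norm (x - x0) powr \<alpha> + T powr (\<alpha> / 2))"
      using xM C \<alpha> by (intro mult_left_mono add_left_mono powr_mono2) auto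
    finally have "- (U (x, t) - c0) \<le> C * (norm (x - x0) powr \<alpha> + T powr (\<alpha> / 2))"
      by (simp add: c0_def abs_le_iff)
    then have "3 * \<kappa> * (- (U (x, t) - c0)) \<le> 3 * \<kappa> * (C * (norm (x - x0) powr \<alpha> + T powr (\<alpha> / 2)))"
      using \<kappa> by (intro mult_left_mono) auto
    then show ?thesis by (simp add: l_def algebra_simps)
  qed
  have weq: "w (x, t) = (U (\<Phi> (x, t)) - U (x, t)) + (- (l - 1) * (U (x, t) - c0)) - P (x, t) - \<psi> (x, t)"
    by (simp add: w_def algebra_simps)
  have "w zm \<le> 0"
  proof (rule ccontr)
    assume "\<not> w zm \<le> 0"
    then have wpos: "w (x, t) > 0" by (simp add: xt)
    \<comment> \<open>At the final time the shear is the identity, and the Hoelder bound on \<open>U\<close> is dominated by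
      the barrier.\<close>
    have t1: "t < t0 + T"
    proof (rule ccontr)
      assume "\<not> t < t0 + T"
      then have tT: "t = t0 + T" using xM by simp
      then have "\<Phi> (x, t) = (x, t)" using T by (simp add: \<Phi>_def)
      then have "w (x, t) \<le> 3 * \<kappa> * C * (norm (x - x0) powr \<alpha> + T powr (\<alpha> / 2)) - A * smooth_dist R x0 x"
        using weq lU \<psi>0[of "(x, t)"] tT by (simp add: P_def)
      then show False using wpos terminal[of x] by simp
    qed
    \<comment> \<open>On the lateral boundary the radius \<rho> is so large that the barrier dominates the Hoelder bounds.\<close>
    have x1: "norm (x - x0) < \<rho>"
    proof (rule ccontr)
      assume "\<not> norm (x - x0) < \<rho>"
      then have n: "norm (x - x0) = \<rho>" using xM by simp
      have "\<bar>U (\<Phi> (x, t)) - U (x, t)\<bar> \<le> C * (norm ((1 - (t - t0) / T) *\<^sub>R e) powr \<alpha> + \<bar>t - t\<bar> powr (\<alpha> / 2))"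
        using hol[of t t "x + (1 - (t - t0) / T) *\<^sub>R e" x] xM by (simp add: \<Phi>_def)
      also have "\<dots> \<le> C * (norm e powr \<alpha>)"
      proof -
        have "0 \<le> (t - t0) / T" "(t - t0) / T \<le> 1" using xM T by (auto simp: divide_le_eq)
        then have "\<bar>1 - (t - t0) / T\<bar> * norm e \<le> 1 * norm e" by (intro mult_right_mono) auto
        then show ?thesis using C \<alpha> by (intro mult_left_mono) (auto intro!: powr_mono2)
      qed
      finally have "U (\<Phi> (x, t)) - U (x, t) \<le> C * norm e powr \<alpha>" by simp
      moreover have "P (x, t) \<ge> A * \<rho>"
      proof -
        have "A * \<rho> \<le> A * smooth_dist R x0 x" using smooth_dist_ge(2)[OF R, of x x0] n A by (intro mult_left_mono) auto
        moreover have "B * (t0 + T - t) \<ge> 0" using B0 xM by simp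
        ultimately show ?thesis by (simp add: P_def)
      qed
      ultimately have "w (x, t) \<le> 0" using weq lU \<psi>0[of "(x, t)"] lateral n by simp
      then show False using wpos by simp
    qed
    define y where "y = \<Phi> (x, t)"
    define z where "z = (x, t)"
    have zt: "snd z > tm" "snd y > tm" using xM tm by (auto simp: z_def y_def \<Phi>_def)
    define p where "p = gU y"
    define u where "u = (A / smooth_dist R x0 x) *\<^sub>R (x - x0)"
    define v where "v = (\<Sum>b\<in>(Basis::'a set). \<psi>1 b z *\<^sub>R b)"
    let ?S = "smooth_dist R x0 x"
    \<comment> \<open>First and second order conditions at the maximum in the direction \<open>b\<close>; \<open>u\<close> and
      \<open>v\<close> are the gradients of barrier and corrector.\<close>
    have dir: "(p - l *\<^sub>R gU z - u - v) \<bullet> b = 0 \<and>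
        U2 b y - l * U2 b z - A * (1 / ?S - ((x - x0) \<bullet> b)\<^sup>2 / ?S ^ 3) - \<psi>2 b z \<le> 0" if b: "b \<in> Basis" for b
    proof -
      let ?f = "\<lambda>h. w (z + h *\<^sub>R (b, 0))"
      let ?f' = "\<lambda>z. gU (\<Phi> z) \<bullet> b - l * (gU z \<bullet> b) - A * (((fst z - x0) \<bullet> b) / smooth_dist R x0 (fst z)) - \<psi>1 b z"
      have \<Phi>b: "\<Phi> (z' + h *\<^sub>R (b, 0)) = \<Phi> z' + h *\<^sub>R (b, 0)" for z' h by (simp add: \<Phi>_def)
      have ldw: "has_line_deriv w (b, 0) (?f' z') z'" if z': "snd z' > tm" for z'
      proof -
        have "has_line_deriv (\<lambda>z. U (\<Phi> z)) (b, 0) (gU (\<Phi> z') \<bullet> b) z'"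
          using U1[of "\<Phi> z'" b 0] z' by (simp add: has_line_deriv_def \<Phi>b del: scaleR_Pair) (simp add: \<Phi>_def)
        moreover have "has_line_deriv U (b, 0) (gU z' \<bullet> b) z'" using U1[of z' b 0] z' by simp
        moreover have "has_line_deriv P (b, 0) (A * (((fst z' - x0) \<bullet> b) / smooth_dist R x0 (fst z'))) z'"
          using smooth_dist_ld(1)[OF R b, of x0 "fst z'"] unfolding has_line_deriv_def P_def
          by (auto intro!: derivative_eq_intros)
        ultimately have "has_line_deriv w (b, 0) (gU (\<Phi> z') \<bullet> b - 0 - l * (gU z' \<bullet> b - 0) - A * (((fst z' - x0) \<bullet> b) / smooth_dist R x0 (fst z')) - \<psi>1 b z') z'"
          unfolding w_def by (intro has_line_deriv_diff has_line_deriv_cmult has_line_deriv_const \<psi>1[OF b])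
        then show ?thesis by simp
      qed
      have lds: "has_line_deriv ?f' (b, 0) (U2 b y - l * U2 b z - A * (1 / ?S - ((x - x0) \<bullet> b)\<^sup>2 / ?S ^ 3) - \<psi>2 b z) z"
      proof -
        have "has_line_deriv (\<lambda>z. gU (\<Phi> z) \<bullet> b) (b, 0) (U2 b y) z"
          using U2[OF zt(2) b] by (simp add: has_line_deriv_def \<Phi>b y_def z_def[symmetric] del: scaleR_Pair)
        moreover have "has_line_deriv (\<lambda>z. ((fst z - x0) \<bullet> b) / smooth_dist R x0 (fst z)) (b, 0) (1 / ?S - ((x - x0) \<bullet> b)\<^sup>2 / ?S ^ 3) z"
          using smooth_dist_ld(2)[OF R b, of x0 x] by (simp add: has_line_deriv_def z_def)
        ultimately show ?thesis
          by (intro has_line_deriv_diff has_line_deriv_cmult \<psi>2[OF b] U2[OF zt(1) b])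
      qed
      have d: "\<rho> - norm (x - x0) > 0" using x1 by simp
      have der: "(?f has_real_derivative ?f' (z + h *\<^sub>R (b, 0))) (at h)" for h
        by (rule has_line_deriv_along[OF ldw]) (use zt in simp)
      have max: "?f h \<le> ?f 0" if "\<bar>h\<bar> < \<rho> - norm (x - x0)" for h
      proof -
        have "norm (x + h *\<^sub>R b - x0) \<le> norm (x - x0) + norm (h *\<^sub>R b)"
          using norm_triangle_ineq[of "x - x0" "h *\<^sub>R b"] by (simp add: algebra_simps)
        then have "norm (x + h *\<^sub>R b - x0) \<le> \<rho>" using that b by simp
        then have "z + h *\<^sub>R (b, 0) \<in> M" using xM by (simp add: M_def z_def dist_norm norm_minus_commute)
        from zm(2)[OF this] show ?thesis by (simp add: xt z_def)
      qed
      note sd = second_derivative_max[OF der lds[unfolded has_line_deriv_def] d max]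
      have "?f' (z + 0 *\<^sub>R (b, 0)) = (p - l *\<^sub>R gU z - u - v) \<bullet> b"
      proof -
        have "v \<bullet> b = \<psi>1 b z" unfolding v_def by (rule inner_sum_left_Basis[OF b])
        moreover have "u \<bullet> b = A * (((fst z - x0) \<bullet> b) / smooth_dist R x0 (fst z))" by (simp add: u_def z_def)
        moreover have "z + 0 *\<^sub>R (b, 0) = z" by (simp add: zero_prod_def[symmetric])
        ultimately show ?thesis by (simp only: p_def y_def z_def[symmetric] inner_diff_left inner_scaleR_left)
      qed
      then show ?thesis using sd by simp
    qed
    have "p - l *\<^sub>R gU z - u - v = 0" by (rule euclidean_eqI) (use dir in simp)
    then have "p - u - v - l *\<^sub>R gU z = 0" by (simp add: algebra_simps)
    then have lg: "l *\<^sub>R gU z = p - u - v" by simp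
    have lap: "(\<Sum>b\<in>Basis. U2 b y) - l * (\<Sum>b\<in>Basis. U2 b z) - (\<Sum>b\<in>Basis. \<psi>2 b z) \<le> real DIM('a) * (A / R)"
    proof -
      have "U2 b y - l * U2 b z - \<psi>2 b z \<le> A / R" if b: "b \<in> Basis" for b
      proof -
        have "1 / ?S - ((x - x0) \<bullet> b)\<^sup>2 / ?S ^ 3 \<le> 1 / R"
        proof -
          have "1 / ?S \<le> 1 / R" using smooth_dist_ge(1)[OF R, of x0 x] R by (intro frac_le) auto
          moreover have "((x - x0) \<bullet> b)\<^sup>2 / ?S ^ 3 \<ge> 0" using smooth_dist_ge(3)[OF R, of x0 x] by simp
          ultimately show ?thesis by linarith
        qed
        then have "A * (1 / ?S - ((x - x0) \<bullet> b)\<^sup>2 / ?S ^ 3) \<le> A * (1 / R)" using A by (intro mult_left_mono)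
        then show ?thesis using dir[OF b] by simp
      qed
      then have "(\<Sum>b\<in>(Basis::'a set). U2 b y - l * U2 b z - \<psi>2 b z) \<le> real DIM('a) * (A / R)"
        by (rule sum_bounded_above)
      then show ?thesis by (simp add: sum_subtractf sum_distrib_left)
    qed
    \<comment> \<open>Moving forward in time is always possible, because \<open>t < t0 + T\<close>.\<close>
    have time: "Ut y - p \<bullet> e / T - l * Ut z + B - \<psi>t z \<le> 0"
    proof (rule one_sided_max)
      have "\<Phi> (z + h *\<^sub>R (0, 1)) = y + h *\<^sub>R (- (1 / T) *\<^sub>R e, 1)" for h
        by (simp add: \<Phi>_def y_def z_def algebra_simps add_divide_distrib diff_divide_distrib)
      moreover have "has_line_deriv U (- (1 / T) *\<^sub>R e, 1) (1 * Ut y + gU y \<bullet> (- (1 / T) *\<^sub>R e)) y" by (rule U1[OF zt(2)])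
      ultimately have "has_line_deriv (\<lambda>z. U (\<Phi> z)) (0, 1) (Ut y - p \<bullet> e / T) z"
        by (simp add: has_line_deriv_def p_def)
      moreover have "has_line_deriv U (0, 1) (Ut z) z" using U1[OF zt(1), of 0 1] by simp
      moreover have "has_line_deriv P (0, 1) (- B) z"
        unfolding has_line_deriv_def P_def by (auto intro!: derivative_eq_intros)
      ultimately have ld3: "has_line_deriv (\<lambda>z. U (\<Phi> z)) (0, 1) (Ut y - p \<bullet> e / T) z" "has_line_deriv U (0, 1) (Ut z) z" "has_line_deriv P (0, 1) (- B) z"
        by auto
      show "((\<lambda>h. w (z + h *\<^sub>R (0, 1))) has_real_derivative Ut y - p \<bullet> e / T - l * Ut z + B - \<psi>t z) (at 0)"
      proof -
        have "has_line_deriv w (0, 1) (Ut y - p \<bullet> e / T - 0 - l * (Ut z - 0) - - B - \<psi>t z) z"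
          unfolding w_def by (intro has_line_deriv_diff has_line_deriv_cmult has_line_deriv_const \<psi>t ld3)
        then show ?thesis by (simp add: has_line_deriv_def)
      qed
      show "t0 + T - t > 0" using t1 by simp
      fix h assume h: "0 < h" "h < t0 + T - t"
      then have "z + h *\<^sub>R (0, 1) \<in> M" using xM by (simp add: M_def z_def dist_norm norm_minus_commute)
      from zm(2)[OF this] show "w (z + h *\<^sub>R (0, 1)) \<le> w (z + 0 *\<^sub>R (0, 1))" by (simp add: xt z_def)
    qed
    have pe: "p \<bullet> e / T \<le> norm p * (norm e / T)"
      using norm_cauchy_schwarz[of p e] T by (simp add: divide_right_mono)
    have un: "norm u \<le> A"
    proof -
      have "norm u = A * (norm (x - x0) / ?S)" using A smooth_dist_ge(3)[OF R, of x0 x] by (simp add: u_def)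
      also have "\<dots> \<le> A * 1" using A smooth_dist_ge(2,3)[OF R, of x x0] smooth_dist_ge(3)[OF R, of x0 x] by (intro mult_left_mono) (auto simp: divide_le_eq smooth_dist_ge(2)[OF R])
      finally show ?thesis by simp
    qed
    have conv: "l * norm (gU z) powr \<gamma> \<le> (1 - \<kappa> / 2) * norm p powr \<gamma> + \<kappa> powr (1 - \<gamma>) * A powr \<gamma> + \<kappa> powr (1 - \<gamma>) * norm v powr \<gamma>"
    proof -
      have "l * norm (gU z) powr \<gamma> \<le> (1 + \<kappa>) powr (1 - \<gamma>) * norm p powr \<gamma> + \<kappa> powr (1 - \<gamma>) * norm u powr \<gamma> + \<kappa> powr (1 - \<gamma>) * norm v powr \<gamma>"
        unfolding l_def by (rule weighted_convexity[OF \<kappa>(1) _ lg[unfolded l_def]]) (use g in simp)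
      also have "\<dots> \<le> (1 - \<kappa> / 2) * norm p powr \<gamma> + \<kappa> powr (1 - \<gamma>) * A powr \<gamma> + \<kappa> powr (1 - \<gamma>) * norm v powr \<gamma>"
        using un g \<kappa> by (intro add_mono mult_right_mono mult_left_mono one_add_powr_le powr_mono2 order_refl) auto
      finally show ?thesis .
    qed
    have \<psi>z: "- \<psi>t z - (\<Sum>b\<in>Basis. \<psi>2 b z) \<ge> h * \<kappa> powr (1 - \<gamma>) * norm v powr \<gamma> + l * (h * (f z - norm (gU z) powr \<gamma>)) - \<sigma>"
      using \<psi>[OF xM] by (simp add: z_def l_def v_def)
    have "h * f y - l * (h * f z) - norm p * (norm e / T) + B - \<psi>t z - (\<Sum>b\<in>Basis. \<psi>2 b z) \<le> real DIM('a) * (A / R)"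
    proof -
      have "(Ut y + (\<Sum>b\<in>Basis. U2 b y)) - l * (Ut z + (\<Sum>b\<in>Basis. U2 b z)) - p \<bullet> e / T + B - \<psi>t z - (\<Sum>b\<in>Basis. \<psi>2 b z) \<le> real DIM('a) * (A / R)"
        using lap time by (simp add: algebra_simps)
      then show ?thesis unfolding eq[OF zt(1)] eq[OF zt(2)] using pe by linarith
    qed
    then have 1: "h * f y - l * (h * f z) - norm p * (norm e / T) + B + h * \<kappa> powr (1 - \<gamma>) * norm v powr \<gamma> + l * (h * (f z - norm (gU z) powr \<gamma>)) - \<sigma> \<le> real DIM('a) * (A / R)"
      using \<psi>z by linarith
    have 2: "h * norm p powr \<gamma> \<le> h * f y" using sub[OF zt(2)] h by (simp add: p_def)
    have 3: "h * (l * norm (gU z) powr \<gamma>) \<le> h * ((1 - \<kappa> / 2) * norm p powr \<gamma> + \<kappa> powr (1 - \<gamma>) * A powr \<gamma> + \<kappa> powr (1 - \<gamma>) * norm v powr \<gamma>)"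
      using conv h by (intro mult_left_mono) auto
    have 4: "h * (\<kappa> / 2) * norm p powr \<gamma> - norm p * (norm e / T) \<ge> - ((norm e / T) * (2 * (norm e / T) / (h * \<kappa>)) powr (1 / (\<gamma> - 1)))"
      using g h \<kappa> T by (intro drift_absorb) auto
    have 5: "l * (h * (f z - norm (gU z) powr \<gamma>)) = l * (h * f z) - h * (l * norm (gU z) powr \<gamma>)"
      by (simp add: algebra_simps)
    have 6: "h * ((1 - \<kappa> / 2) * norm p powr \<gamma> + \<kappa> powr (1 - \<gamma>) * A powr \<gamma> + \<kappa> powr (1 - \<gamma>) * norm v powr \<gamma>) =
       h * norm p powr \<gamma> - h * (\<kappa> / 2) * norm p powr \<gamma> + h * \<kappa> powr (1 - \<gamma>) * A powr \<gamma> + h * \<kappa> powr (1 - \<gamma>) * norm v powr \<gamma>"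
      by (simp add: algebra_simps)
    show False using 1 2 3 4 B unfolding 5 6 by linarith
  qed
  moreover have "w (x0, t0) \<le> w zm" by (rule zm(2)[OF Mne])
  moreover have "w (x0, t0) = U (x0 + e, t0) - U (x0, t0) - A * R - B * T - \<psi> (x0, t0)"
    using R by (simp add: w_def \<Phi>_def c0_def P_def smooth_dist_def)
  ultimately show ?thesis by simp
qed

section \<open>Mollified solutions\<close>

definition half :: "('a::euclidean_space \<times> real) set" where "half = UNIV \<times> {0<..}"

lemma half_iff: "z \<in> half \<longleftrightarrow> snd z > 0"
  by (cases z) (simp add: half_def)

lemma open_half: "open (half :: ('a::euclidean_space \<times> real) set)"
  unfolding half_def by (intro open_Times) auto

lemma cball_subset_half: "\<epsilon> < snd z \<Longrightarrow> cball z \<epsilon> \<subseteq> (half :: ('a::euclidean_space \<times> real) set)"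
proof
  fix y assume e: "\<epsilon> < snd z" and y: "y \<in> cball z \<epsilon>"
  have "dist (snd z) (snd y) \<le> dist z y" by (rule dist_snd_le)
  then have "\<bar>snd z - snd y\<bar> \<le> \<epsilon>" using y by (simp add: dist_real_def)
  then show "y \<in> half" using e unfolding half_iff by linarith
qed

lemma cball_subset_halfD:
  assumes "cball z \<epsilon> \<subseteq> (half :: ('a::euclidean_space \<times> real) set)" "\<epsilon> > 0" shows "\<epsilon> < snd z"
proof -
  have "(fst z, snd z - \<epsilon>) \<in> cball z \<epsilon>"
    using assms(2) by (cases z) (simp add: dist_Pair_Pair dist_real_def)
  then have "(fst z, snd z - \<epsilon>) \<in> half" using assms(1) by blast
  then show ?thesis by (simp add: half_iff)
qed

lemma mollD_mult_integrable:
  fixes F :: "'a::euclidean_space \<Rightarrow> real"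
  assumes \<epsilon>: "\<epsilon> > 0" and F: "F \<in> borel_measurable borel" and i: "integrable lborel (\<lambda>y. indicator (cball z \<epsilon>) y * F y)"
  shows "integrable lborel (\<lambda>y. mollD \<epsilon> es y * F (z + y))"
proof -
  obtain B where B: "\<And>y::'a. \<bar>mollD \<epsilon> es y\<bar> \<le> B" using mollD_bound[OF \<epsilon>, of es] by blast
  note [measurable] = mollD_basic(5)[OF \<epsilon>, of es]
  have "integrable lborel (\<lambda>y. indicator (cball z \<epsilon>) y * F y * mollD \<epsilon> es (y - z))"
    by (rule integrable_bounded_mult[OF i _ B]) measurable
  from lborel_integrable_shift[OF this, of z]
  have "integrable lborel (\<lambda>y. indicator (cball z \<epsilon>) (z + y) * F (z + y) * mollD \<epsilon> es y)" by simp
  moreover have "indicator (cball z \<epsilon>) (z + y) * F (z + y) * mollD \<epsilon> es y = mollD \<epsilon> es y * F (z + y)" for y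
  proof (cases "norm y > \<epsilon>")
    case True then show ?thesis using mollD_basic(2)[OF \<epsilon>, of es] by (simp add: vanishes_off_def)
  next
    case False then show ?thesis by (simp add: dist_norm)
  qed
  ultimately show ?thesis by simp
qed

lemma mollD_linear:
  fixes \<xi> :: "'a::euclidean_space"
  shows "mollD \<epsilon> [(\<xi>, \<tau>)] y = \<tau> * mollD \<epsilon> [(0, 1)] y + (\<Sum>b\<in>Basis. (\<xi> \<bullet> b) * mollD \<epsilon> [(b, 0)] y)"
proof -
  have lin: "linear (\<lambda>e. mollD \<epsilon> [e] y)" by (rule has_derivative_linear[OF mollD_deriv[of \<epsilon> "[]"]])
  have "(\<xi>, \<tau>) = \<tau> *\<^sub>R (0, 1) + (\<Sum>b\<in>Basis. (\<xi> \<bullet> b) *\<^sub>R (b, 0))"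
    by (rule prod_eqI) (simp_all add: fst_sum snd_sum euclidean_representation)
  then have "mollD \<epsilon> [(\<xi>, \<tau>)] y = mollD \<epsilon> [\<tau> *\<^sub>R (0, 1) + (\<Sum>b\<in>Basis. (\<xi> \<bullet> b) *\<^sub>R (b, 0))] y" by simp
  also have "\<dots> = \<tau> * mollD \<epsilon> [(0, 1)] y + (\<Sum>b\<in>Basis. (\<xi> \<bullet> b) * mollD \<epsilon> [(b, 0)] y)"
    using linear_add[OF lin] linear_scale[OF lin] linear_sum[OF lin, of "\<lambda>b. (\<xi> \<bullet> b) *\<^sub>R (b, 0)" Basis]
    by (simp del: scaleR_Pair)
  finally show ?thesis .
qed

text \<open>The equation in the form in which it is used: with Borel representatives \<open>Gb\<close> and
  \<open>D2\<close> of the first and second spatial derivatives along the basis, and with the weak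
  derivatives expressed through mollifications.\<close>
locale HJ_solution =
  fixes v vt :: "'a::euclidean_space \<times> real \<Rightarrow> real" and Gb D2 :: "'a \<Rightarrow> 'a \<times> real \<Rightarrow> real" and h \<gamma> q \<alpha> C :: real
  assumes h: "h > 0" and g: "\<gamma> > 2" and q: "q > (real DIM('a) + 2) * ((\<gamma> - 1) / \<gamma>)"
    and \<alpha>: "0 < \<alpha>" "\<alpha> < 1" and C: "C \<ge> 0"
    and loc: "loc_int half v" "loc_int half vt" "\<And>b. b \<in> Basis \<Longrightarrow> loc_int half (Gb b)" "\<And>b. b \<in> Basis \<Longrightarrow> loc_int half (D2 b)"
    and weak_t: "\<And>z \<epsilon>. 0 < \<epsilon> \<Longrightarrow> \<epsilon> < snd z \<Longrightarrow> corr (mollD \<epsilon> [(0, 1)]) v z = - corr (moll \<epsilon>) vt z"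
    and weak_x: "\<And>z \<epsilon> b. 0 < \<epsilon> \<Longrightarrow> \<epsilon> < snd z \<Longrightarrow> b \<in> Basis \<Longrightarrow> corr (mollD \<epsilon> [(b, 0)]) v z = - corr (moll \<epsilon>) (Gb b) z"
    and weak_xx: "\<And>z \<epsilon> b. 0 < \<epsilon> \<Longrightarrow> \<epsilon> < snd z \<Longrightarrow> b \<in> Basis \<Longrightarrow> corr (mollD \<epsilon> [(b, 0), (b, 0)]) v z = corr (moll \<epsilon>) (D2 b) z"
    and equation: "AE z in lborel. snd z > 0 \<longrightarrow> vt z + (\<Sum>b\<in>Basis. D2 b z) = h * norm (\<Sum>b\<in>(Basis::'a set). Gb b z *\<^sub>R b) powr \<gamma>"
    and Lq: "\<And>K. compact K \<Longrightarrow> K \<subseteq> half \<Longrightarrow> integrable lborel (\<lambda>z. indicator K z * norm (\<Sum>b\<in>(Basis::'a set). Gb b z *\<^sub>R b) powr (\<gamma> * q))"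
    and hol: "\<And>x t x' t'. t > 0 \<Longrightarrow> t' > 0 \<Longrightarrow> \<bar>v (x, t) - v (x', t')\<bar> \<le> C * (norm (x - x') powr \<alpha> + \<bar>t - t'\<bar> powr (\<alpha> / 2))"
begin

definition "G z = (\<Sum>b\<in>(Basis::'a set). Gb b z *\<^sub>R b)"
definition "f z = norm (G z) powr \<gamma>"
text \<open>The gradient of the mollified solution \<open>corr (moll \<epsilon>) v\<close>.\<close>
definition "gU \<epsilon> z = (\<Sum>b\<in>(Basis::'a set). corr (moll \<epsilon>) (Gb b) z *\<^sub>R b)"

lemma q1: "q > 1"
  using subcritical_exponents(1)[OF g _ q] DIM_positive[where 'a='a] by simp

lemma loc_measurable: "loc_int half F \<Longrightarrow> F \<in> borel_measurable borel"
  by (simp add: loc_int_def)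

lemma G_measurable [measurable]: "G \<in> borel_measurable borel"
  unfolding G_def[abs_def] by (intro borel_measurable_sum borel_measurable_scaleR loc_measurable loc) auto

lemma f_measurable [measurable]: "f \<in> borel_measurable borel"
  unfolding f_def[abs_def] by measurable

lemma loc_ball: "loc_int half F \<Longrightarrow> \<epsilon> < snd z \<Longrightarrow> integrable lborel (\<lambda>y. indicator (cball z \<epsilon>) y * F y)"
  by (intro loc_int_cut(1)[of half F "cball z \<epsilon>"] cball_subset_half) auto

lemma loc_int_f: "loc_int half f"
  unfolding loc_int_def
proof (intro conjI allI impI f_measurable)
  fix K assume K: "compact K \<and> K \<subseteq> (half :: ('a \<times> real) set)"
  have Kb [measurable]: "K \<in> sets borel" using K by (auto intro: borel_compact)
  have Ki: "integrable lborel (indicator K :: 'a \<times> real \<Rightarrow> real)"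
    using K emeasure_compact_finite[of K] by (intro integrable_real_indicator) auto
  have i: "integrable lborel (\<lambda>z. indicator K z + indicator K z * norm (G z) powr (\<gamma> * q))"
    using Ki Lq[of K] K by (auto simp: G_def)
  show "integrable lborel (\<lambda>y. indicator K y * f y)"
  proof (rule Bochner_Integration.integrable_bound[OF i])
    show "AE z in lborel. norm (indicator K z * f z) \<le> norm (indicator K z + indicator K z * norm (G z) powr (\<gamma> * q))"
    proof (rule AE_I2)
      fix z
      have "f z \<le> 1 + norm (G z) powr (\<gamma> * q)"
        unfolding f_def using g q1 mult_left_mono[of 1 q \<gamma>] by (intro powr_le_one_add) auto
      moreover have "f z \<ge> 0" by (simp add: f_def)
      ultimately show "norm (indicator K z * f z) \<le> norm (indicator K z + indicator K z * norm (G z) powr (\<gamma> * q))"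
        by (cases "z \<in> K") auto
    qed
  qed measurable
qed

lemma moll_integrable:
  assumes "loc_int half F" "0 < \<epsilon>" "\<epsilon> < snd z"
  shows "integrable lborel (\<lambda>y. mollD \<epsilon> es y * F (z + y))" "integrable lborel (\<lambda>y. moll \<epsilon> y * F (z + y))"
  using mollD_mult_integrable[OF assms(2) loc_measurable[OF assms(1)] loc_ball[OF assms(1,3)]]
  by (auto simp: mollD_Nil[symmetric])

lemma moll_continuous:
  assumes "loc_int half F" "0 < \<epsilon>" "\<epsilon> < snd z"
  shows "isCont (corr (moll \<epsilon>) F) z"
proof -
  define r where "r = (\<epsilon> + snd z) / 2"
  have r: "r > \<epsilon>" "r < snd z" using assms by (auto simp: r_def)
  show ?thesis
    using corr_moll_isCont[OF assms(2) r(1) loc_measurable[OF assms(1)] loc_ball[OF assms(1) r(2)], of "[]"]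
    by (simp add: mollD_Nil)
qed

lemma moll_solution_deriv:
  assumes "0 < \<epsilon>" "\<epsilon> < snd z"
  shows "has_line_deriv (corr (mollD \<epsilon> es) v) e (- corr (mollD \<epsilon> (e # es)) v z) z"
proof -
  define r where "r = (\<epsilon> + snd z) / 2"
  have r: "r > \<epsilon>" "r < snd z" using assms by (auto simp: r_def)
  show ?thesis
    by (rule corr_moll_ld[OF assms(1) r(1) loc_measurable[OF loc(1)] loc_ball[OF loc(1) r(2)]])
qed

lemma moll_line_deriv:
  assumes e: "0 < \<epsilon>" "\<epsilon> < snd z"
  shows "has_line_deriv (corr (moll \<epsilon>) v) (\<xi>, \<tau>) (\<tau> * corr (moll \<epsilon>) vt z + gU \<epsilon> z \<bullet> \<xi>) z"
proof -
  have i: "integrable lborel (\<lambda>y. mollD \<epsilon> es y * v (z + y))" for es by (rule moll_integrable(1)[OF loc(1) e])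
  have "corr (mollD \<epsilon> [(\<xi>, \<tau>)]) v z = (LINT y|lborel. \<tau> * (mollD \<epsilon> [(0, 1)] y * v (z + y)) + (\<Sum>b\<in>Basis. (\<xi> \<bullet> b) * (mollD \<epsilon> [(b, 0)] y * v (z + y))))"
    unfolding corr_def mollD_linear[of \<epsilon> \<xi> \<tau>] by (simp add: algebra_simps sum_distrib_left)
  also have "\<dots> = \<tau> * corr (mollD \<epsilon> [(0, 1)]) v z + (\<Sum>b\<in>Basis. (\<xi> \<bullet> b) * corr (mollD \<epsilon> [(b, 0)]) v z)"
    unfolding corr_def using i
    by (subst Bochner_Integration.integral_add) (auto simp: Bochner_Integration.integral_sum)
  also have "\<dots> = - (\<tau> * corr (moll \<epsilon>) vt z + gU \<epsilon> z \<bullet> \<xi>)"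
  proof -
    have "gU \<epsilon> z \<bullet> \<xi> = (\<Sum>b\<in>Basis. corr (moll \<epsilon>) (Gb b) z * (b \<bullet> \<xi>))"
      unfolding gU_def inner_sum_left inner_scaleR_left ..
    also have "\<dots> = - (\<Sum>b\<in>Basis. (\<xi> \<bullet> b) * corr (mollD \<epsilon> [(b, 0)]) v z)"
      unfolding sum_negf[symmetric] by (intro sum.cong refl) (simp add: weak_x[OF e] inner_commute)
    finally show ?thesis using weak_t[OF e] by simp
  qed
  finally have eq: "- corr (mollD \<epsilon> [(\<xi>, \<tau>)]) v z = \<tau> * corr (moll \<epsilon>) vt z + gU \<epsilon> z \<bullet> \<xi>" by simp
  show ?thesis
    using moll_solution_deriv[OF e, of "[]" "(\<xi>, \<tau>)"] unfolding eq mollD_Nil .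
qed

lemma gU_inner: "b \<in> Basis \<Longrightarrow> gU \<epsilon> z \<bullet> b = corr (moll \<epsilon>) (Gb b) z"
  unfolding gU_def by (rule inner_sum_left_Basis)

lemma moll_second_deriv:
  assumes e: "0 < \<epsilon>" "\<epsilon> < snd z" and b: "b \<in> Basis"
  shows "has_line_deriv (\<lambda>z. gU \<epsilon> z \<bullet> b) (b, 0) (corr (moll \<epsilon>) (D2 b) z) z"
proof -
  have "(\<lambda>k. gU \<epsilon> (z + k *\<^sub>R (b, 0)) \<bullet> b) = (\<lambda>k. - corr (mollD \<epsilon> [(b, 0)]) v (z + k *\<^sub>R (b, 0)))"
    using weak_x[OF e(1) _ b] e by (intro ext) (simp add: gU_inner[OF b])
  then show ?thesis
    using DERIV_minus[OF moll_solution_deriv[OF e, of "[(b, 0)]" "(b, 0)", unfolded has_line_deriv_def]] weak_xx[OF e b]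
    unfolding has_line_deriv_def by simp
qed

text \<open>Mollification is linear and respects equality almost everywhere.\<close>
lemma moll_equation:
  assumes e: "0 < \<epsilon>" "\<epsilon> < snd z"
  shows "corr (moll \<epsilon>) vt z + (\<Sum>b\<in>Basis. corr (moll \<epsilon>) (D2 b) z) = h * corr (moll \<epsilon>) f z"
proof -
  have b: "borel_measurable borel = borel_measurable (lborel :: ('a \<times> real) measure)" by simp
  have i: "integrable lborel (\<lambda>y. moll \<epsilon> y * F (z + y))" if "loc_int half F" for F
    by (rule moll_integrable(2)[OF that e])
  have m: "(\<lambda>z. vt z + (\<Sum>b\<in>Basis. D2 b z)) \<in> borel_measurable borel"
    by (intro borel_measurable_add borel_measurable_sum loc_measurable loc) auto
  have mm [measurable]: "moll \<epsilon> \<in> borel_measurable (borel :: ('a \<times> real) measure)" by (rule moll_basic(4)[OF e(1)])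
  have "corr (moll \<epsilon>) vt z + (\<Sum>b\<in>Basis. corr (moll \<epsilon>) (D2 b) z) = corr (moll \<epsilon>) (\<lambda>z. vt z + (\<Sum>b\<in>Basis. D2 b z)) z"
    unfolding corr_def distrib_left sum_distrib_left
    by (subst Bochner_Integration.integral_add)
       (auto intro!: i loc Bochner_Integration.integrable_sum Bochner_Integration.integral_sum[symmetric])
  also have "\<dots> = corr (moll \<epsilon>) (\<lambda>z. h * f z) z"
    unfolding corr_shift[OF mm m] corr_shift[OF mm borel_measurable_times[OF borel_measurable_const f_measurable]]
  proof (rule integral_cong_AE)
    show "(\<lambda>y. (vt y + (\<Sum>b\<in>Basis. D2 b y)) * moll \<epsilon> (y - z)) \<in> borel_measurable lborel" using m by measurable
    show "(\<lambda>y. h * f y * moll \<epsilon> (y - z)) \<in> borel_measurable lborel" by measurable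
    show "AE y in lborel. (vt y + (\<Sum>b\<in>Basis. D2 b y)) * moll \<epsilon> (y - z) = h * f y * moll \<epsilon> (y - z)"
      using equation
    proof eventually_elim
      case (elim y)
      show ?case
      proof (cases "y \<in> cball z \<epsilon>")
        case True
        then have "snd y > 0" using cball_subset_half[OF e(2)] half_iff by blast
        then show ?thesis using elim by (simp add: f_def G_def)
      next
        case False
        then have "norm (y - z) > \<epsilon>" by (simp add: dist_norm norm_minus_commute)
        then have "moll \<epsilon> (y - z) = 0" using vanishes_off_moll[OF e(1)] unfolding vanishes_off_def by blast
        then show ?thesis by simp
      qed
    qed
  qed
  also have "\<dots> = h * corr (moll \<epsilon>) f z" unfolding corr_def integral_mult_right_zero[symmetric] by (simp add: ac_simps)
  finally show ?thesis .
qed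

lemma vcorr_G:
  assumes e: "0 < \<epsilon>" "\<epsilon> < snd z"
  shows "vcorr (moll \<epsilon>) G z = gU \<epsilon> z"
proof -
  have i: "integrable lborel (\<lambda>y. (moll \<epsilon> y * Gb b (z + y)) *\<^sub>R b)" if "b \<in> Basis" for b
    using moll_integrable(2)[OF loc(3)[OF that] e] by simp
  have "vcorr (moll \<epsilon>) G z = (LINT y|lborel. (\<Sum>b\<in>(Basis::'a set). (moll \<epsilon> y * Gb b (z + y)) *\<^sub>R b))"
    by (simp add: vcorr_def G_def scaleR_sum_right)
  also have "\<dots> = (\<Sum>b\<in>(Basis::'a set). LINT y|lborel. (moll \<epsilon> y * Gb b (z + y)) *\<^sub>R b)"
    by (rule Bochner_Integration.integral_sum) (rule i)
  also have "\<dots> = gU \<epsilon> z"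
    unfolding gU_def corr_def
    by (intro sum.cong refl integral_scaleR_left) (use moll_integrable(2)[OF loc(3) e] in auto)
  finally show ?thesis .
qed

text \<open>Mollification at \<open>z\<close> sees only the ball around \<open>z\<close>; cutting the gradient off
  outside a compact set makes it globally integrable, so that the estimates for functions on the whole
  space apply.\<close>
lemma cut_G:
  assumes K: "compact K" "K \<subseteq> half" and e: "0 < \<epsilon>" "cball z \<epsilon> \<subseteq> K"
  defines "Gc \<equiv> \<lambda>z. indicator K z *\<^sub>R G z"
  shows "Gc \<in> borel_measurable borel" "integrable lborel (\<lambda>z. norm (Gc z) powr (\<gamma> * q))"
    "vcorr (moll \<epsilon>) Gc z = gU \<epsilon> z" "corr (moll \<epsilon>) (\<lambda>z. norm (Gc z) powr \<gamma>) z = corr (moll \<epsilon>) f z"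
proof -
  have [measurable]: "K \<in> sets borel" using K by (auto intro: borel_compact)
  show "Gc \<in> borel_measurable borel" unfolding Gc_def by measurable
  have "norm (Gc z) powr (\<gamma> * q) = indicator K z * norm (G z) powr (\<gamma> * q)" for z
    using g q1 by (simp add: Gc_def indicator_def)
  then show "integrable lborel (\<lambda>z. norm (Gc z) powr (\<gamma> * q))" using Lq[OF K] by (simp add: G_def)
  have sz: "\<epsilon> < snd z" using e K by (intro cball_subset_halfD) auto
  have "moll \<epsilon> y *\<^sub>R Gc (z + y) = moll \<epsilon> y *\<^sub>R G (z + y)" for y
  proof (cases "norm y > \<epsilon>")
    case True then show ?thesis using vanishes_off_moll[OF e(1)] unfolding vanishes_off_def by (metis scaleR_zero_left)
  next
    case False
    then have "z + y \<in> K" using e(2) by (auto simp: dist_norm subset_eq)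
    then show ?thesis by (simp add: Gc_def)
  qed
  then show "vcorr (moll \<epsilon>) Gc z = gU \<epsilon> z" unfolding vcorr_G[OF e(1) sz, symmetric] vcorr_def by (simp only:)
  show "corr (moll \<epsilon>) (\<lambda>z. norm (Gc z) powr \<gamma>) z = corr (moll \<epsilon>) f z"
  proof (rule corr_moll_cong[OF e(1)])
    fix y assume "y \<in> cball z \<epsilon>"
    then have "y \<in> K" using e(2) by blast
    then show "norm (Gc y) powr \<gamma> = f y" by (simp add: Gc_def f_def)
  qed
qed

lemma moll_gradient_le:
  assumes e: "0 < \<epsilon>" "\<epsilon> < snd z"
  shows "norm (gU \<epsilon> z) powr \<gamma> \<le> corr (moll \<epsilon>) f z"
proof -
  note c = cut_G[OF compact_cball cball_subset_half[OF e(2)] e(1) order_refl]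
  have p: "\<gamma> * q \<ge> 1" "1 \<le> \<gamma>" "\<gamma> \<le> \<gamma> * q" using g q1 mult_mono[of 1 \<gamma> 1 q] by auto
  show ?thesis
    using norm_vcorr_diff_powr[OF p(1) c(1,2) e(1) p(2,3), of z 0]
    by (simp only: diff_zero c(3) c(4)[unfolded corr_def] corr_def)
qed

lemma moll_error_locally_small:
  assumes Q: "compact Q" "Q \<subseteq> half" and e: "e > 0"
  shows "\<exists>\<delta>>0. \<forall>\<epsilon>. 0 < \<epsilon> \<and> \<epsilon> < \<delta> \<longrightarrow> (\<forall>z\<in>Q. \<epsilon> < snd z) \<and>
    (\<integral>\<^sup>+ z. ennreal (indicator Q z * (corr (moll \<epsilon>) f z - norm (gU \<epsilon> z) powr \<gamma>) powr q) \<partial>lborel) \<le> ennreal e"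
proof -
  obtain r K where r: "r > 0" and K: "compact K" "K \<subseteq> half" "\<And>z. z \<in> Q \<Longrightarrow> cball z r \<subseteq> K"
    using compact_nhd[OF Q(1) open_half Q(2)] by blast
  define Gc where "Gc z = indicator K z *\<^sub>R G z" for z
  have Kb [measurable]: "K \<in> sets borel" using K by (auto intro: borel_compact)
  have Gm: "Gc \<in> borel_measurable borel" unfolding Gc_def by measurable
  have "norm (Gc z) powr (\<gamma> * q) = indicator K z * norm (G z) powr (\<gamma> * q)" for z
    using g q1 by (simp add: Gc_def indicator_def)
  then have Gi: "integrable lborel (\<lambda>z. norm (Gc z) powr (\<gamma> * q))" using Lq[OF K(1,2)] by (simp add: G_def)
  have g1: "\<gamma> \<ge> 1" "q \<ge> 1" using g q1 by auto
  obtain \<delta> where \<delta>: "\<delta> > 0" "\<And>\<epsilon>. 0 < \<epsilon> \<Longrightarrow> \<epsilon> < \<delta> \<Longrightarrow>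
    (\<integral>\<^sup>+ z. ennreal ((corr (moll \<epsilon>) (\<lambda>z. norm (Gc z) powr \<gamma>) z - norm (vcorr (moll \<epsilon>) Gc z) powr \<gamma>) powr q) \<partial>lborel) \<le> ennreal e"
    using moll_error_small[OF g1 Gm Gi e] by blast
  show ?thesis
  proof (intro exI[of _ "min \<delta> r"] conjI allI impI)
    show "min \<delta> r > 0" using \<delta> r by simp
    fix \<epsilon> assume \<epsilon>: "0 < \<epsilon> \<and> \<epsilon> < min \<delta> r"
    have sub: "cball z \<epsilon> \<subseteq> K" if "z \<in> Q" for z
      using K(3)[OF that] \<epsilon> subset_cball[of \<epsilon> r z] by auto
    show "\<forall>z\<in>Q. \<epsilon> < snd z"
      using sub K(2) \<epsilon> by (meson cball_subset_halfD order_trans)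
    have "(\<integral>\<^sup>+ z. ennreal (indicator Q z * (corr (moll \<epsilon>) f z - norm (gU \<epsilon> z) powr \<gamma>) powr q) \<partial>lborel) \<le>
      (\<integral>\<^sup>+ z. ennreal ((corr (moll \<epsilon>) (\<lambda>z. norm (Gc z) powr \<gamma>) z - norm (vcorr (moll \<epsilon>) Gc z) powr \<gamma>) powr q) \<partial>lborel)"
    proof (rule nn_integral_mono)
      fix z
      show "ennreal (indicator Q z * (corr (moll \<epsilon>) f z - norm (gU \<epsilon> z) powr \<gamma>) powr q) \<le>
        ennreal ((corr (moll \<epsilon>) (\<lambda>z. norm (Gc z) powr \<gamma>) z - norm (vcorr (moll \<epsilon>) Gc z) powr \<gamma>) powr q)"
      proof (cases "z \<in> Q")
        case True
        have c: "vcorr (moll \<epsilon>) Gc z = gU \<epsilon> z" "corr (moll \<epsilon>) (\<lambda>z. norm (Gc z) powr \<gamma>) z = corr (moll \<epsilon>) f z"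
          using cut_G(3,4)[OF K(1,2) _ sub[OF True]] \<epsilon> by (simp_all add: Gc_def[abs_def])
        show ?thesis unfolding c using True by simp
      qed simp
    qed
    also have "\<dots> \<le> ennreal e" using \<epsilon> by (intro \<delta>(2)) auto
    finally show "(\<integral>\<^sup>+ z. ennreal (indicator Q z * (corr (moll \<epsilon>) f z - norm (gU \<epsilon> z) powr \<gamma>) powr q) \<partial>lborel) \<le> ennreal e" .
  qed
qed

lemma moll_diff_le:
  assumes e: "0 < \<epsilon>" "\<epsilon> < snd z" "\<epsilon> < snd z'"
    and le: "\<And>y. norm y \<le> \<epsilon> \<Longrightarrow> v (z + y) - v (z' + y) \<le> c"
  shows "corr (moll \<epsilon>) v z - corr (moll \<epsilon>) v z' \<le> c"
proof -
  note i = moll_integrable(2)[OF loc(1) e(1,2)] moll_integrable(2)[OF loc(1) e(1,3)]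
  have i2: "integrable lborel (\<lambda>y. moll \<epsilon> y * (v (z + y) - v (z' + y)))"
    unfolding right_diff_distrib by (intro Bochner_Integration.integrable_diff i)
  have i3: "integrable lborel (\<lambda>y::'a \<times> real. moll \<epsilon> y * c)" using moll_basic(2)[OF e(1)] by auto
  have "corr (moll \<epsilon>) v z - corr (moll \<epsilon>) v z' = (LINT y|lborel. moll \<epsilon> y * (v (z + y) - v (z' + y)))"
    unfolding corr_def Bochner_Integration.integral_diff[OF i, symmetric] right_diff_distrib ..
  also have "\<dots> \<le> (LINT y|lborel. moll \<epsilon> (y::'a \<times> real) * c)"
    by (rule moll_local_integral_mono[OF e(1) i2 i3 le])
  also have "\<dots> = c" using moll_basic(5)[OF e(1), where 'a="'a \<times> real"] by simp
  finally show ?thesis .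
qed

lemma snd_add_pos: "\<epsilon> < snd z \<Longrightarrow> norm y \<le> \<epsilon> \<Longrightarrow> 0 < snd (z + y)"
  using norm_snd_le[of "snd y" "fst y"] unfolding prod.collapse by simp

lemma hol_pair:
  assumes "snd z > 0" "snd z' > 0"
  shows "\<bar>v z - v z'\<bar> \<le> C * (norm (fst z - fst z') powr \<alpha> + \<bar>snd z - snd z'\<bar> powr (\<alpha> / 2))"
  using hol[OF assms, of "fst z" "fst z'"] by simp

lemma moll_holder:
  assumes e: "0 < \<epsilon>" "\<epsilon> < t" "\<epsilon> < t'"
  shows "\<bar>corr (moll \<epsilon>) v (x, t) - corr (moll \<epsilon>) v (x', t')\<bar> \<le> C * (norm (x - x') powr \<alpha> + \<bar>t - t'\<bar> powr (\<alpha> / 2))"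
proof -
  have *: "corr (moll \<epsilon>) v (x, t) - corr (moll \<epsilon>) v (x', t') \<le> C * (norm (x - x') powr \<alpha> + \<bar>t - t'\<bar> powr (\<alpha> / 2))"
    if e: "\<epsilon> < t" "\<epsilon> < t'" for x t x' t'
  proof (rule moll_diff_le)
    fix y :: "'a \<times> real" assume y: "norm y \<le> \<epsilon>"
    have "\<bar>v ((x, t) + y) - v ((x', t') + y)\<bar> \<le> C * (norm (x - x') powr \<alpha> + \<bar>t - t'\<bar> powr (\<alpha> / 2))"
      using hol_pair[OF snd_add_pos[OF _ y, of "(x, t)"] snd_add_pos[OF _ y, of "(x', t')"]] e by simp
    then show "v ((x, t) + y) - v ((x', t') + y) \<le> C * (norm (x - x') powr \<alpha> + \<bar>t - t'\<bar> powr (\<alpha> / 2))" by linarith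
  qed (use e assms in auto)
  show ?thesis
    using *[OF e(2,3), of x x'] *[OF e(3,2), of x' x] by (simp add: abs_le_iff norm_minus_commute abs_minus_commute)
qed

lemma moll_approx:
  assumes e: "0 < \<epsilon>" "\<epsilon> < snd z"
  shows "\<bar>corr (moll \<epsilon>) v z - v z\<bar> \<le> C * (\<epsilon> powr \<alpha> + \<epsilon> powr (\<alpha> / 2))"
proof -
  let ?c = "C * (\<epsilon> powr \<alpha> + \<epsilon> powr (\<alpha> / 2))"
  have b: "\<bar>v (z + y) - v z\<bar> \<le> ?c" if y: "norm y \<le> \<epsilon>" for y
  proof -
    have "\<bar>v (z + y) - v z\<bar> \<le> C * (norm (fst y) powr \<alpha> + \<bar>snd y\<bar> powr (\<alpha> / 2))"
      using hol_pair[OF snd_add_pos[OF e(2) y], of z] e by simp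
    also have "\<dots> \<le> ?c"
      using y norm_fst_le[of "fst y" "snd y"] norm_snd_le[of "snd y" "fst y"] C \<alpha> unfolding prod.collapse
      by (intro mult_left_mono add_mono powr_mono2) auto
    finally show ?thesis .
  qed
  note i = moll_integrable(2)[OF loc(1) e]
  have m: "integrable lborel (moll \<epsilon> :: 'a \<times> real \<Rightarrow> real)" "(LINT y|lborel. moll \<epsilon> (y::'a \<times> real)) = 1"
    using moll_basic(2,5)[OF e(1)] by auto
  have "corr (moll \<epsilon>) v z \<le> (LINT y|lborel. moll \<epsilon> (y::'a \<times> real) * (v z + ?c))"
    unfolding corr_def
  proof (rule moll_local_integral_mono[OF e(1) i])
    show "norm y \<le> \<epsilon> \<Longrightarrow> v (z + y) \<le> v z + ?c" for y using b[of y] by linarith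
  qed (use m in auto)
  moreover have "(LINT y|lborel. moll \<epsilon> (y::'a \<times> real) * (v z - ?c)) \<le> corr (moll \<epsilon>) v z"
    unfolding corr_def
  proof (rule moll_local_integral_mono[OF e(1) _ i])
    show "norm y \<le> \<epsilon> \<Longrightarrow> v z - ?c \<le> v (z + y)" for y using b[of y] by linarith
  qed (use m in auto)
  ultimately show ?thesis using m by (simp add: abs_le_iff)
qed

end

section \<open>Solutions on the half-space are constant\<close>

text \<open>By concavity \<open>d powr \<alpha>\<close> is at most \<open>R powr (\<alpha> - 1) * d\<close> when
  \<open>d\<close> is at least \<open>R\<close>; for smaller \<open>d\<close> monotonicity suffices.\<close>
lemma powr_le_linear:
  fixes d R S \<alpha> :: real
  assumes "0 < \<alpha>" "\<alpha> < 1" "R > 0" "0 \<le> d" "d \<le> S" "R \<le> S"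
  shows "d powr \<alpha> \<le> R powr (\<alpha> - 1) * S" "R powr \<alpha> \<le> R powr (\<alpha> - 1) * S"
proof -
  have R: "R powr \<alpha> = R powr (\<alpha> - 1) * R" using assms by (simp add: powr_diff)
  show 1: "R powr \<alpha> \<le> R powr (\<alpha> - 1) * S" unfolding R using assms by (intro mult_left_mono) auto
  show "d powr \<alpha> \<le> R powr (\<alpha> - 1) * S"
  proof (cases "d \<le> R")
    case True
    then have "d powr \<alpha> \<le> R powr \<alpha>" using assms by (intro powr_mono2) auto
    then show ?thesis using 1 by linarith
  next
    case False
    then have "d powr \<alpha> = d powr (\<alpha> - 1) * d" using assms by (simp add: powr_diff)
    also have "\<dots> \<le> R powr (\<alpha> - 1) * S"
      using False assms by (intro mult_mono powr_mono2') auto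
    finally show ?thesis .
  qed
qed

context HJ_solution begin

text \<open>All parameters of the comparison except \<kappa> and \<open>T\<close> are fixed here. Corrector and
  mollification contribute at most an arbitrary \<open>s > 0\<close>, so they are absent from the final
  estimate.\<close>
lemma shift_estimate:
  fixes x0 e :: 'a
  assumes t0: "t0 > 0" and T: "T > 0" and \<kappa>: "0 < \<kappa>" "\<kappa> \<le> 1"
  defines "R \<equiv> sqrt T"
  defines "A \<equiv> 6 * \<kappa> * C * R powr (\<alpha> - 1)"
  defines "B \<equiv> real DIM('a) * (A / R) + h * \<kappa> powr (1 - \<gamma>) * A powr \<gamma> + (norm e / T) * (2 * (norm e / T) / (h * \<kappa>)) powr (1 / (\<gamma> - 1)) + 2 / T\<^sup>2"
  shows "v (x0 + e, t0) - v (x0, t0) \<le> A * R + B * T"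
proof (rule field_le_epsilon)
  fix s :: real assume s: "s > 0"
  have R: "R > 0" using T by (simp add: R_def)
  have RT: "R powr \<alpha> = T powr (\<alpha> / 2)" using T by (simp add: R_def powr_half_sqrt[symmetric] powr_powr)
  \<comment> \<open>The lateral condition reduces to \<open>norm e powr \<alpha> + 3 * \<kappa> * R powr \<alpha> \<le> 3 *
    \<kappa> * R powr (\<alpha> - 1) * \<rho>\<close>, which holds with equality.\<close>
  define \<rho> where "\<rho> = R * (1 + norm e powr \<alpha> / (3 * \<kappa> * R powr \<alpha>))"
  have \<rho>R: "\<rho> \<ge> R" using R \<kappa> by (simp add: \<rho>_def mult_left_mono)
  then have \<rho>: "\<rho> > 0" using R by linarith
  \<comment> \<open>Half of the term \<open>2 / T\<^sup>2\<close> in \<open>B\<close>, which makes the inequality for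
    \<open>B\<close> strict.\<close>
  define \<sigma> where "\<sigma> = 1 / T\<^sup>2"
  have \<sigma>: "\<sigma> > 0" using T by (simp add: \<sigma>_def)
  define l where "l = 1 + 3 * \<kappa>"
  have l: "l > 0" using \<kappa> by (simp add: l_def)
  define Q0 where "Q0 = cball x0 \<rho> \<times> {t0..t0 + T}"
  define Q where "Q = cball x0 (\<rho> + 1) \<times> {t0 / 2..t0 + T + 1}"
  define r where "r = min 1 (t0 / 2)"
  have r: "r > 0" using t0 by (simp add: r_def)
  have Qc: "compact Q" unfolding Q_def by (intro compact_Times) auto
  have Qh: "Q \<subseteq> half" using t0 by (auto simp: Q_def half_def)
  have Q0r: "\<forall>z\<in>Q0. cball z r \<subseteq> Q"
  proof (intro ballI subsetI)
    fix z y assume z: "z \<in> Q0" and y: "y \<in> cball z r"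
    have d: "dist (fst z) (fst y) \<le> r" "dist (snd z) (snd y) \<le> r"
      using y dist_fst_le[of z y] dist_snd_le[of z y] by auto
    have "dist x0 (fst y) \<le> \<rho> + 1"
      using d(1) z dist_triangle[of x0 "fst y" "fst z"] by (auto simp: Q0_def r_def)
    have "\<bar>snd z - snd y\<bar> \<le> r" "r \<le> t0 / 2" "r \<le> 1" "t0 \<le> snd z" "snd z \<le> t0 + T"
      using d(2) z by (auto simp: Q0_def r_def dist_real_def)
    then have "t0 / 2 \<le> snd y" "snd y \<le> t0 + T + 1" by linarith+
    with \<open>dist x0 (fst y) \<le> \<rho> + 1\<close> show "y \<in> Q" by (cases y) (simp add: Q_def)
  qed
  obtain Rc where Rc: "Rc > 0" "Q \<subseteq> cball 0 Rc"
    using compact_imp_bounded[OF Qc] unfolding bounded_pos by (auto simp: subset_iff)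
  define K where "K = h * \<kappa> powr (1 - \<gamma>)"
  have K: "K > 0" using h \<kappa> by (simp add: K_def)
  have s2: "s / 2 > 0" using s by simp
  obtain \<delta>1 where \<delta>1: "\<delta>1 > 0" and corr: "\<forall>g. continuous_on Q g \<and> (\<forall>z\<in>Q. 0 \<le> g z) \<and>
     (\<integral>\<^sup>+ z. ennreal (indicator Q z * g z powr q) \<partial>lborel) \<le> ennreal \<delta>1 \<longrightarrow>
     (\<forall>Q0 r \<sigma>. r > 0 \<and> \<sigma> > 0 \<and> (\<forall>z\<in>Q0. cball z r \<subseteq> Q) \<longrightarrow>
       (\<exists>\<psi> \<psi>t \<psi>1 \<psi>2. (\<forall>z. 0 \<le> \<psi> z \<and> \<psi> z \<le> s / 2) \<and> continuous_on UNIV \<psi> \<and>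
          (\<forall>z. has_line_deriv \<psi> (0, 1) (\<psi>t z) z) \<and>
          (\<forall>z. \<forall>b\<in>Basis. has_line_deriv \<psi> (b, 0) (\<psi>1 b z) z \<and> has_line_deriv (\<psi>1 b) (b, 0) (\<psi>2 b z) z) \<and>
          (\<forall>z\<in>Q0. - \<psi>t z - (\<Sum>b\<in>Basis. \<psi>2 b z) \<ge> K * norm (\<Sum>b\<in>(Basis::'a set). \<psi>1 b z *\<^sub>R b) powr \<gamma> + g z - \<sigma>)))"
    using smooth_corrector[OF g q K s2 Qc Rc(2,1)] by (elim exE conjE) (rule that)
  define e' where "e' = \<delta>1 / (l * h) powr q"
  have e': "e' > 0" using \<delta>1 l h by (simp add: e'_def)
  obtain \<delta>2 where \<delta>2: "\<delta>2 > 0" and err: "\<forall>\<epsilon>. 0 < \<epsilon> \<and> \<epsilon> < \<delta>2 \<longrightarrow> (\<forall>z\<in>Q. \<epsilon> < snd z) \<and>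
    (\<integral>\<^sup>+ z. ennreal (indicator Q z * (corr (moll \<epsilon>) f z - norm (gU \<epsilon> z) powr \<gamma>) powr q) \<partial>lborel) \<le> ennreal e'"
    using moll_error_locally_small[OF Qc Qh e'] by (elim exE conjE) (rule that)
  have "((\<lambda>\<epsilon>. 2 * (C * (\<epsilon> powr \<alpha> + \<epsilon> powr (\<alpha> / 2)))) \<longlongrightarrow> 2 * (C * (0 + 0))) (at_right 0)"
    using \<alpha> by (intro tendsto_intros tendsto_zero_powrI[OF tendsto_ident_at tendsto_const]) (auto simp: eventually_at_right_field intro: exI[of _ 1])
  then have "\<forall>\<^sub>F \<epsilon> in at_right 0. 2 * (C * (\<epsilon> powr \<alpha> + \<epsilon> powr (\<alpha> / 2))) < s / 2"
    using s by (intro order_tendstoD(2)) auto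
  then obtain \<delta>3 where \<delta>3: "\<delta>3 > 0" "\<And>\<epsilon>. 0 < \<epsilon> \<Longrightarrow> \<epsilon> < \<delta>3 \<Longrightarrow> 2 * (C * (\<epsilon> powr \<alpha> + \<epsilon> powr (\<alpha> / 2))) < s / 2"
    unfolding eventually_at_right_field by auto
  \<comment> \<open>The corrector depends on the mollification radius through its source, but the thresholds
    \<open>\<delta>1\<close>, \<open>\<delta>2\<close> and \<open>\<delta>3\<close> do not.\<close>
  define \<epsilon> where "\<epsilon> = min (min \<delta>2 \<delta>3) (t0 / 2) / 2"
  have \<epsilon>: "0 < \<epsilon>" "\<epsilon> < \<delta>2" "\<epsilon> < \<delta>3" "\<epsilon> < t0 / 2" using \<delta>2 \<delta>3(1) t0 by (auto simp: \<epsilon>_def)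
  have errQ: "\<And>z. z \<in> Q \<Longrightarrow> \<epsilon> < snd z"
    and err': "(\<integral>\<^sup>+ z. ennreal (indicator Q z * (corr (moll \<epsilon>) f z - norm (gU \<epsilon> z) powr \<gamma>) powr q) \<partial>lborel) \<le> ennreal e'"
    using err \<epsilon>(1,2) by blast+
  define g0 where "g0 z = l * (h * (corr (moll \<epsilon>) f z - norm (gU \<epsilon> z) powr \<gamma>))" for z
  have sub': "0 \<le> corr (moll \<epsilon>) f z - norm (gU \<epsilon> z) powr \<gamma>" if "\<epsilon> < snd z" for z
    using moll_gradient_le[OF \<epsilon>(1) that] by simp
  have g0c: "continuous_on Q g0"
  proof -
    have f: "continuous_on Q (corr (moll \<epsilon>) f)"
      by (intro continuous_at_imp_continuous_on ballI moll_continuous[OF loc_int_f \<epsilon>(1)] errQ)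
    have "continuous_on Q (gU \<epsilon>)"
      unfolding gU_def
      by (intro continuous_intros continuous_at_imp_continuous_on ballI moll_continuous[OF loc(3) \<epsilon>(1)] errQ) auto
    then have "continuous_on Q (\<lambda>z. norm (gU \<epsilon> z) powr \<gamma>)"
      using g by (intro continuous_on_powr' continuous_on_norm continuous_on_const) auto
    then show ?thesis unfolding g0_def using f by (intro continuous_on_mult_left continuous_on_diff)
  qed
  have g0n: "\<forall>z\<in>Q. 0 \<le> g0 z" using sub' errQ l h by (simp add: g0_def)
  have g0q: "(\<integral>\<^sup>+ z. ennreal (indicator Q z * g0 z powr q) \<partial>lborel) \<le> ennreal \<delta>1"
  proof -
    let ?i = "\<lambda>z. ennreal (indicator Q z * (corr (moll \<epsilon>) f z - norm (gU \<epsilon> z) powr \<gamma>) powr q)"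
    have Qb: "Q \<in> sets borel" using Qc by (rule borel_compact)
    have meas: "?i \<in> borel_measurable lborel"
    proof -
      have "corr (moll \<epsilon>) F \<in> borel_measurable borel" if "F \<in> borel_measurable borel" for F :: "'a \<times> real \<Rightarrow> real"
        by (rule corr_measurable[OF moll_basic(4)[OF \<epsilon>(1)] that])
      then have "corr (moll \<epsilon>) f \<in> borel_measurable borel" "gU \<epsilon> \<in> borel_measurable borel"
        unfolding gU_def using loc(3) by (auto intro!: borel_measurable_sum borel_measurable_scaleR simp: loc_int_def)
      then show ?thesis using Qb by measurable
    qed
    have "(\<integral>\<^sup>+ z. ennreal (indicator Q z * g0 z powr q) \<partial>lborel) = (\<integral>\<^sup>+ z. ennreal ((l * h) powr q) * ?i z \<partial>lborel)"
    proof (intro nn_integral_cong)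
      fix z
      show "ennreal (indicator Q z * g0 z powr q) = ennreal ((l * h) powr q) * ?i z"
      proof (cases "z \<in> Q")
        case True
        have "g0 z powr q = (l * h) powr q * (corr (moll \<epsilon>) f z - norm (gU \<epsilon> z) powr \<gamma>) powr q"
          using sub'[OF errQ[OF True]] l h by (simp add: g0_def powr_mult mult.assoc[symmetric])
        then show ?thesis using True by (simp add: ennreal_mult)
      qed simp
    qed
    also have "\<dots> = ennreal ((l * h) powr q) * (\<integral>\<^sup>+ z. ?i z \<partial>lborel)" by (rule nn_integral_cmult[OF meas])
    also have "\<dots> \<le> ennreal ((l * h) powr q) * ennreal e'" by (intro mult_left_mono err') auto
    also have "\<dots> = ennreal \<delta>1" using l h \<delta>1 by (simp add: ennreal_mult[symmetric] e'_def)
    finally show ?thesis .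
  qed
  from corr[rule_format, OF conjI[OF g0c conjI[OF g0n g0q]], of r \<sigma> Q0, OF conjI[OF r conjI[OF \<sigma> Q0r]]]
  obtain \<psi> \<psi>t \<psi>1 \<psi>2 where \<psi>: "\<forall>z. 0 \<le> \<psi> z \<and> \<psi> z \<le> s / 2" "continuous_on UNIV \<psi>"
          "\<forall>z. has_line_deriv \<psi> (0, 1) (\<psi>t z) z"
          "\<forall>z. \<forall>b\<in>Basis. has_line_deriv \<psi> (b, 0) (\<psi>1 b z) z \<and> has_line_deriv (\<psi>1 b) (b, 0) (\<psi>2 b z) z"
          "\<forall>z\<in>Q0. - \<psi>t z - (\<Sum>b\<in>Basis. \<psi>2 b z) \<ge> K * norm (\<Sum>b\<in>(Basis::'a set). \<psi>1 b z *\<^sub>R b) powr \<gamma> + g0 z - \<sigma>"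
    by (elim exE conjE) (rule that)
  have A: "A \<ge> 0" using \<kappa> C by (simp add: A_def)
  have tz: "\<epsilon> < snd z" if "t0 / 2 < snd z" for z :: "'a \<times> real" using that \<epsilon> by linarith
  have "corr (moll \<epsilon>) v (x0 + e, t0) - corr (moll \<epsilon>) v (x0, t0) \<le> A * R + B * T + \<psi> (x0, t0)"
  proof (rule comparison[where tm="t0 / 2" and \<rho>=\<rho> and \<sigma>=\<sigma> and Ut="corr (moll \<epsilon>) vt" and f="corr (moll \<epsilon>) f"
        and gU="gU \<epsilon>" and ?U2.0="\<lambda>b. corr (moll \<epsilon>) (D2 b)" and \<psi>=\<psi> and \<psi>t=\<psi>t and ?\<psi>1.0=\<psi>1 and ?\<psi>2.0=\<psi>2 and C=C and \<alpha>=\<alpha>,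
        OF g h C \<kappa> T _ R \<rho>])
    show "t0 / 2 < t0" using t0 by simp
    show "\<bar>corr (moll \<epsilon>) v (x, t) - corr (moll \<epsilon>) v (x', t')\<bar> \<le> C * (norm (x - x') powr \<alpha> + \<bar>t - t'\<bar> powr (\<alpha> / 2))"
      if "t0 \<le> t" "t0 \<le> t'" for x t x' t'
      using that \<epsilon> t0 by (intro moll_holder) auto
    show "0 < \<alpha>" by (rule \<alpha>)
    show "continuous_on {z. t0 \<le> snd z} (corr (moll \<epsilon>) v)"
      using \<epsilon> t0 by (intro continuous_at_imp_continuous_on ballI moll_continuous[OF loc(1) \<epsilon>(1)]) auto
    show "has_line_deriv (corr (moll \<epsilon>) v) (\<xi>, \<tau>) (\<tau> * corr (moll \<epsilon>) vt z + gU \<epsilon> z \<bullet> \<xi>) z" if "t0 / 2 < snd z" for z \<xi> \<tau>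
      by (rule moll_line_deriv[OF \<epsilon>(1) tz[OF that]])
    show "has_line_deriv (\<lambda>z. gU \<epsilon> z \<bullet> b) (b, 0) (corr (moll \<epsilon>) (D2 b) z) z" if "t0 / 2 < snd z" "b \<in> Basis" for z b
      by (rule moll_second_deriv[OF \<epsilon>(1) tz[OF that(1)] that(2)])
    show "corr (moll \<epsilon>) vt z + (\<Sum>b\<in>Basis. corr (moll \<epsilon>) (D2 b) z) = h * corr (moll \<epsilon>) f z" if "t0 / 2 < snd z" for z
      by (rule moll_equation[OF \<epsilon>(1) tz[OF that]])
    show "norm (gU \<epsilon> z) powr \<gamma> \<le> corr (moll \<epsilon>) f z" if "t0 / 2 < snd z" for z
      by (rule moll_gradient_le[OF \<epsilon>(1) tz[OF that]])
    show "0 \<le> \<psi> z" for z using \<psi>(1)[rule_format, of z] by simp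
    show "continuous_on UNIV \<psi>" by (rule \<psi>(2))
    show "has_line_deriv \<psi> (0, 1) (\<psi>t z) z" for z by (rule \<psi>(3)[rule_format])
    show "has_line_deriv \<psi> (b, 0) (\<psi>1 b z) z" "has_line_deriv (\<psi>1 b) (b, 0) (\<psi>2 b z) z" if "b \<in> Basis" for z b
      using \<psi>(4)[rule_format, OF that, of z] by auto
    show "- \<psi>t (x, t) - (\<Sum>b\<in>Basis. \<psi>2 b (x, t)) \<ge> h * \<kappa> powr (1 - \<gamma>) * norm (\<Sum>b\<in>(Basis::'a set). \<psi>1 b (x, t) *\<^sub>R b) powr \<gamma>
           + (1 + 3 * \<kappa>) * (h * (corr (moll \<epsilon>) f (x, t) - norm (gU \<epsilon> (x, t)) powr \<gamma>)) - \<sigma>"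
      if "norm (x - x0) \<le> \<rho>" "t0 \<le> t" "t \<le> t0 + T" for x t
    proof -
      have "(x, t) \<in> Q0" using that by (simp add: Q0_def dist_norm norm_minus_commute)
      from \<psi>(5)[rule_format, OF this] show ?thesis by (simp only: K_def g0_def l_def)
    qed
    show "A \<ge> 0" by (rule A)
    show "real DIM('a) * (A / R) + h * \<kappa> powr (1 - \<gamma>) * A powr \<gamma> + (norm e / T) * (2 * (norm e / T) / (h * \<kappa>)) powr (1 / (\<gamma> - 1)) + \<sigma> < B"
      using T by (simp add: B_def \<sigma>_def divide_strict_right_mono)
    show "0 \<le> B" unfolding B_def using A R h T by (intro add_nonneg_nonneg mult_nonneg_nonneg) auto
    show "3 * \<kappa> * C * (norm (x - x0) powr \<alpha> + T powr (\<alpha> / 2)) \<le> A * smooth_dist R x0 x" for x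
    proof -
      have "norm (x - x0) powr \<alpha> \<le> R powr (\<alpha> - 1) * smooth_dist R x0 x" "T powr (\<alpha> / 2) \<le> R powr (\<alpha> - 1) * smooth_dist R x0 x"
        using powr_le_linear[OF \<alpha> R norm_ge_zero smooth_dist_ge(2)[OF R, where x=x and ?x0.0=x0] smooth_dist_ge(1)[OF R, where x=x and ?x0.0=x0]] RT
        by auto
      then have "3 * \<kappa> * C * (norm (x - x0) powr \<alpha> + T powr (\<alpha> / 2)) \<le> 3 * \<kappa> * C * (R powr (\<alpha> - 1) * smooth_dist R x0 x + R powr (\<alpha> - 1) * smooth_dist R x0 x)"
        using \<kappa> C by (intro mult_left_mono add_mono) auto
      then show ?thesis by (simp add: A_def)
    qed
    show "C * norm e powr \<alpha> + 3 * \<kappa> * C * (\<rho> powr \<alpha> + T powr (\<alpha> / 2)) \<le> A * \<rho>"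
    proof -
      have 1: "\<rho> powr \<alpha> \<le> R powr (\<alpha> - 1) * \<rho>" using powr_le_linear(1)[OF \<alpha> R _ order_refl \<rho>R] \<rho> by simp
      have "R powr (\<alpha> - 1) * \<rho> = R powr \<alpha> * (1 + norm e powr \<alpha> / (3 * \<kappa> * R powr \<alpha>))"
        using R by (simp add: \<rho>_def powr_diff)
      moreover have "3 * \<kappa> * (P * (1 + n / (3 * \<kappa> * P))) = 3 * \<kappa> * P + n" if "P > 0" for P n :: real
        using that \<kappa> by (simp add: field_simps)
      ultimately have 2: "3 * \<kappa> * (R powr (\<alpha> - 1) * \<rho>) = 3 * \<kappa> * T powr (\<alpha> / 2) + norm e powr \<alpha>"
        using R by (simp add: RT[symmetric])
      have "C * norm e powr \<alpha> + 3 * \<kappa> * C * (\<rho> powr \<alpha> + T powr (\<alpha> / 2)) \<le> C * norm e powr \<alpha> + 3 * \<kappa> * C * (R powr (\<alpha> - 1) * \<rho> + T powr (\<alpha> / 2))"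
        using 1 \<kappa> C by (intro add_left_mono mult_left_mono) auto
      also have "\<dots> = C * (norm e powr \<alpha> + 3 * \<kappa> * T powr (\<alpha> / 2)) + C * (3 * \<kappa> * (R powr (\<alpha> - 1) * \<rho>))"
        by (simp add: algebra_simps)
      also have "norm e powr \<alpha> + 3 * \<kappa> * T powr (\<alpha> / 2) = 3 * \<kappa> * (R powr (\<alpha> - 1) * \<rho>)" using 2 by simp
      also have "C * (3 * \<kappa> * (R powr (\<alpha> - 1) * \<rho>)) + C * (3 * \<kappa> * (R powr (\<alpha> - 1) * \<rho>)) = A * \<rho>"
        by (simp add: A_def)
      finally show ?thesis .
    qed
  qed
  moreover have "\<psi> (x0, t0) \<le> s / 2" using \<psi>(1) by blast
  moreover have "\<bar>corr (moll \<epsilon>) v (x0 + e, t0) - v (x0 + e, t0)\<bar> \<le> C * (\<epsilon> powr \<alpha> + \<epsilon> powr (\<alpha> / 2))"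
    "\<bar>corr (moll \<epsilon>) v (x0, t0) - v (x0, t0)\<bar> \<le> C * (\<epsilon> powr \<alpha> + \<epsilon> powr (\<alpha> / 2))"
    using \<epsilon> t0 by (auto intro!: moll_approx)
  moreover have "2 * (C * (\<epsilon> powr \<alpha> + \<epsilon> powr (\<alpha> / 2))) < s / 2" by (rule \<delta>3(2)[OF \<epsilon>(1,3)])
  ultimately show "v (x0 + e, t0) - v (x0, t0) \<le> A * R + B * T + s" by linarith
qed

text \<open>Set \<open>\<kappa> = T powr (- \<theta>)\<close>. The five terms of the estimate are powers of
  \<open>T\<close> with the exponents \<open>\<alpha> / 2 - \<theta>\<close> (twice),
  \<open>1 - \<gamma> * (1 - \<alpha>) / 2 - \<theta>\<close>,
  \<open>(\<theta> - 1) / (\<gamma> - 1)\<close> and \<open>- 1\<close>. All of them are negative for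
  \<theta> between the maximum of \<open>\<alpha> / 2\<close> and
  \<open>1 - \<gamma> * (1 - \<alpha>) / 2\<close>, which is less than \<open>1\<close>, and
  \<open>1\<close>.\<close>
lemma solution_shift_le:
  fixes x0 e :: 'a
  assumes t0: "t0 > 0"
  shows "v (x0 + e, t0) \<le> v (x0, t0)"
proof -
  define \<theta> where "\<theta> = (1 + max (\<alpha> / 2) (1 - \<gamma> * (1 - \<alpha>) / 2)) / 2"
  have "max (\<alpha> / 2) (1 - \<gamma> * (1 - \<alpha>) / 2) < 1" using \<alpha> g by auto
  then have \<theta>: "\<theta> < 1" "\<alpha> / 2 < \<theta>" "1 - \<gamma> * (1 - \<alpha>) / 2 < \<theta>" by (auto simp: \<theta>_def)
  have \<theta>0: "\<theta> > 0" using \<theta>(2) \<alpha> by simp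
  define N where "N = real DIM('a)"
  define D where "D = norm e * (2 * norm e / h) powr (1 / (\<gamma> - 1))"
  define EE where "EE T = 6 * C * T powr (\<alpha> / 2 - \<theta>) + N * (6 * C) * T powr (\<alpha> / 2 - \<theta>)
     + h * (6 * C) powr \<gamma> * T powr (1 - \<gamma> * (1 - \<alpha>) / 2 - \<theta>) + D * T powr ((\<theta> - 1) / (\<gamma> - 1)) + 2 * T powr (- 1)" for T
  have bound: "v (x0 + e, t0) - v (x0, t0) \<le> EE T" if T1: "T \<ge> 1" for T
  proof -
    define \<kappa> where "\<kappa> = T powr (- \<theta>)"
    have T: "T > 0" using T1 by simp
    have \<kappa>: "0 < \<kappa>" "\<kappa> \<le> 1" using T1 \<theta>0 by (auto simp: \<kappa>_def powr_le1 powr_minus_divide divide_le_eq_1 ge_one_powr_ge_zero)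
    have sq: "sqrt T = T powr (1/2)" using T by (simp add: powr_half_sqrt)
    define A where "A = 6 * \<kappa> * C * sqrt T powr (\<alpha> - 1)"
    have A: "A = 6 * C * T powr ((\<alpha> - 1) / 2 - \<theta>)"
      using T by (simp add: A_def \<kappa>_def sq powr_powr powr_add[symmetric] mult_ac)
    have 1: "A * sqrt T = 6 * C * T powr (\<alpha> / 2 - \<theta>)"
    proof -
      have "A * sqrt T = 6 * C * (T powr ((\<alpha> - 1) / 2 - \<theta>) * T powr (1 / 2))" unfolding A sq by (simp only: mult.assoc)
      also have "T powr ((\<alpha> - 1) / 2 - \<theta>) * T powr (1 / 2) = T powr (((\<alpha> - 1) / 2 - \<theta>) + 1 / 2)" by (simp only: powr_add)
      also have "((\<alpha> - 1) / 2 - \<theta>) + 1 / 2 = \<alpha> / 2 - \<theta>" by (simp add: field_simps)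
      finally show ?thesis .
    qed
    have 2: "N * (A / sqrt T) * T = N * (6 * C) * T powr (\<alpha> / 2 - \<theta>)"
    proof -
      have "a / b * (b * b) = a * b" if "b > 0" for a b :: real using that by simp
      from this[of "sqrt T" A] have "A / sqrt T * (sqrt T * sqrt T) = A * sqrt T" using T by (simp only: real_sqrt_gt_0_iff)
      moreover have "sqrt T * sqrt T = T" using T by simp
      ultimately have "A / sqrt T * T = A * sqrt T" by (simp only:)
      then have "N * (A / sqrt T) * T = N * (A * sqrt T)" by (simp only: mult.assoc)
      then show ?thesis unfolding 1 by simp
    qed
    have 3: "h * \<kappa> powr (1 - \<gamma>) * A powr \<gamma> * T = h * (6 * C) powr \<gamma> * T powr (1 - \<gamma> * (1 - \<alpha>) / 2 - \<theta>)"
    proof -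
      have "\<kappa> powr (1 - \<gamma>) * A powr \<gamma> * T = (6 * C) powr \<gamma> * (T powr (- \<theta> * (1 - \<gamma>)) * T powr (((\<alpha> - 1) / 2 - \<theta>) * \<gamma>) * T powr 1)"
        unfolding A \<kappa>_def using T C by (simp add: powr_mult powr_powr mult_ac)
      also have "T powr (- \<theta> * (1 - \<gamma>)) * T powr (((\<alpha> - 1) / 2 - \<theta>) * \<gamma>) * T powr 1 = T powr (- \<theta> * (1 - \<gamma>) + ((\<alpha> - 1) / 2 - \<theta>) * \<gamma> + 1)"
        by (simp only: powr_add)
      also have "- \<theta> * (1 - \<gamma>) + ((\<alpha> - 1) / 2 - \<theta>) * \<gamma> + 1 = 1 - \<gamma> * (1 - \<alpha>) / 2 - \<theta>" by (simp add: field_simps)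
      finally show ?thesis by (simp only: mult.assoc)
    qed
    have 4: "(norm e / T) * (2 * (norm e / T) / (h * \<kappa>)) powr (1 / (\<gamma> - 1)) * T = D * T powr ((\<theta> - 1) / (\<gamma> - 1))"
    proof -
      have pe: "(\<theta> - 1) * (1 / (\<gamma> - 1)) = (\<theta> - 1) / (\<gamma> - 1)" by simp
      have "2 * (norm e / T) / (h * \<kappa>) = (2 * norm e / h) * (T powr (- 1) * T powr \<theta>)"
        using T h by (simp add: \<kappa>_def powr_minus field_simps)
      also have "T powr (- 1) * T powr \<theta> = T powr (- 1 + \<theta>)" by (simp only: powr_add)
      also have "- 1 + \<theta> = \<theta> - 1" by simp
      finally have "(2 * (norm e / T) / (h * \<kappa>)) powr (1 / (\<gamma> - 1)) = (2 * norm e / h) powr (1 / (\<gamma> - 1)) * T powr ((\<theta> - 1) / (\<gamma> - 1))"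
        using h by (simp only:) (simp add: powr_mult powr_powr mult.assoc pe del: times_divide_eq_left times_divide_eq_right)
      then show ?thesis using T by (simp add: D_def)
    qed
    have 5: "2 / T\<^sup>2 * T = 2 * T powr (- 1)" using T by (simp add: powr_minus power2_eq_square field_simps)
    have "v (x0 + e, t0) - v (x0, t0) \<le> A * sqrt T + (N * (A / sqrt T) + h * \<kappa> powr (1 - \<gamma>) * A powr \<gamma> + (norm e / T) * (2 * (norm e / T) / (h * \<kappa>)) powr (1 / (\<gamma> - 1)) + 2 / T\<^sup>2) * T"
      unfolding A_def N_def by (rule shift_estimate[OF t0 T \<kappa>])
    also have "\<dots> = EE T"
      unfolding distrib_right 1 2 3 4 5 EE_def by simp
    finally show ?thesis .
  qed
  have "(EE \<longlongrightarrow> 6 * C * 0 + N * (6 * C) * 0 + h * (6 * C) powr \<gamma> * 0 + D * 0 + 2 * 0) at_top"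
    unfolding EE_def
    by (intro tendsto_add tendsto_mult tendsto_const tendsto_neg_powr filterlim_ident)
       (use \<theta> g in \<open>auto simp: divide_neg_pos\<close>)
  then have lim: "(EE \<longlongrightarrow> 0) at_top" by simp
  have "v (x0 + e, t0) - v (x0, t0) \<le> 0"
    by (rule tendsto_lowerbound[OF lim]) (auto intro: eventually_mono[OF eventually_ge_at_top[of 1]] bound)
  then show ?thesis by simp
qed

lemma space_independent:
  assumes "t > 0" shows "v (x, t) = v (x', t)"
  using solution_shift_le[OF assms, of x "x' - x"] solution_shift_le[OF assms, of x' "x - x'"] by simp

lemma moll_x_independent:
  assumes e: "0 < \<epsilon>" "\<epsilon> < snd z" shows "corr (moll \<epsilon>) v (z + (a, 0)) = corr (moll \<epsilon>) v z"
proof -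
  have eq: "v (z + (a, 0) + y) = v (z + y)" if "norm y \<le> \<epsilon>" for y
  proof -
    have "snd (z + y) > 0" by (rule snd_add_pos[OF e(2) that])
    then have "v (fst (z + (a, 0) + y), snd (z + y)) = v (fst (z + y), snd (z + y))" by (rule space_independent)
    moreover have "snd (z + (a, 0) + y) = snd (z + y)" by simp
    ultimately show ?thesis by (metis prod.collapse)
  qed
  have "corr (moll \<epsilon>) v (z + (a, 0)) - corr (moll \<epsilon>) v z \<le> 0"
    by (rule moll_diff_le[OF e(1)]) (use e eq in auto)
  moreover have "corr (moll \<epsilon>) v z - corr (moll \<epsilon>) v (z + (a, 0)) \<le> 0"
    by (rule moll_diff_le[OF e(1)]) (use e eq in auto)
  ultimately show ?thesis by simp
qed

lemma gradient_zero:
  assumes e: "0 < \<epsilon>" "\<epsilon> < snd z" and b: "b \<in> Basis" shows "gU \<epsilon> z \<bullet> b = 0"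
proof -
  have "has_line_deriv (corr (moll \<epsilon>) v) (b, 0) (gU \<epsilon> z \<bullet> b) z" using moll_line_deriv[OF e, of b 0] by simp
  then have "((\<lambda>k. corr (moll \<epsilon>) v z) has_real_derivative (gU \<epsilon> z \<bullet> b)) (at 0)"
    unfolding has_line_deriv_def using moll_x_independent[OF e] by simp
  then show ?thesis by (rule DERIV_unique) simp
qed

text \<open>The mollified gradient vanishes for every radius, hence so do the gradient almost everywhere and the
  nonlinear term. The equation leaves the time derivative only.\<close>
lemma time_derivative_zero:
  assumes e: "0 < \<epsilon>" "\<epsilon> < snd z" shows "corr (moll \<epsilon>) vt z = 0"
proof -
  have D2: "corr (moll \<epsilon>) (D2 b) z = 0" if b: "b \<in> Basis" for b
  proof -
    have "((\<lambda>k. gU \<epsilon> (z + k *\<^sub>R (b, 0)) \<bullet> b) has_real_derivative corr (moll \<epsilon>) (D2 b) z) (at 0)"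
      using moll_second_deriv[OF e b] by (simp add: has_line_deriv_def)
    moreover have "gU \<epsilon> (z + k *\<^sub>R (b, 0)) \<bullet> b = 0" for k using e by (intro gradient_zero b) auto
    ultimately have "((\<lambda>k. 0) has_real_derivative corr (moll \<epsilon>) (D2 b) z) (at 0)" by simp
    then show ?thesis by (rule DERIV_unique) simp
  qed
  have Gb: "AE z in lborel. z \<in> half \<longrightarrow> Gb b z = 0" if b: "b \<in> Basis" for b
  proof (rule ae_zero_of_moll_zero[OF open_half loc(3)[OF b]])
    fix z \<epsilon> assume e: "0 < \<epsilon>" "cball z \<epsilon> \<subseteq> (half :: ('a \<times> real) set)"
    show "corr (moll \<epsilon>) (Gb b) z = 0"
      using gradient_zero[OF e(1) cball_subset_halfD[OF e(2,1)] b] gU_inner[OF b] by simp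
  qed
  have "AE z in lborel. \<forall>b\<in>Basis. z \<in> half \<longrightarrow> Gb b z = 0"
    using Gb by (subst AE_ball_countable) (auto simp: countable_finite)
  then have ae: "AE y in lborel. f y * moll \<epsilon> (y - z) = 0"
  proof eventually_elim
    case (elim y)
    show ?case
    proof (cases "y \<in> cball z \<epsilon>")
      case True
      then have "y \<in> half" using cball_subset_half[OF e(2)] by blast
      then have "G y = 0" using elim by (simp add: G_def)
      then show ?thesis by (simp add: f_def)
    next
      case False
      then have "norm (y - z) > \<epsilon>" by (simp add: dist_norm norm_minus_commute)
      then have "moll \<epsilon> (y - z) = 0" using vanishes_off_moll[OF e(1)] unfolding vanishes_off_def by blast
      then show ?thesis by simp
    qed
  qed
  have "corr (moll \<epsilon>) f z = 0"
    unfolding corr_shift[OF moll_basic(4)[OF e(1)] f_measurable] by (rule integral_eq_zero_AE[OF ae])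
  then show ?thesis using moll_equation[OF e] D2 by simp
qed

text \<open>The mollified solutions are constant in time, and they converge to \<open>v\<close>.\<close>
lemma constant_in_time:
  assumes st: "0 < s" "s < t" shows "v (x, t) = v (x, s)"
proof -
  have U: "corr (moll \<epsilon>) v (x, t) = corr (moll \<epsilon>) v (x, s)" if e: "0 < \<epsilon>" "\<epsilon> < s" for \<epsilon>
  proof -
    have D: "((\<lambda>k. corr (moll \<epsilon>) v ((x, s) + k *\<^sub>R (0, 1))) has_real_derivative 0) (at k)" if "0 \<le> k" for k
    proof (rule has_line_deriv_along)
      have "\<epsilon> < snd ((x, s) + k *\<^sub>R (0, 1))" using e that by simp
      from moll_line_deriv[OF e(1) this, of 0 1] time_derivative_zero[OF e(1) this]
      show "has_line_deriv (corr (moll \<epsilon>) v) (0, 1) 0 ((x, s) + k *\<^sub>R (0, 1))" by simp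
    qed
    have "\<exists>k. 0 < k \<and> k < t - s \<and> corr (moll \<epsilon>) v ((x, s) + (t - s) *\<^sub>R (0, 1)) - corr (moll \<epsilon>) v ((x, s) + 0 *\<^sub>R (0, 1)) = (t - s - 0) * 0"
      using st by (intro MVT2 D) auto
    then show ?thesis by auto
  qed
  have "\<bar>v (x, t) - v (x, s)\<bar> \<le> 2 * (C * (\<epsilon> powr \<alpha> + \<epsilon> powr (\<alpha> / 2)))" if e: "0 < \<epsilon>" "\<epsilon> < s" for \<epsilon>
  proof -
    have "\<epsilon> < snd (x, t)" "\<epsilon> < snd (x, s)" using e st by auto
    from moll_approx[OF e(1) this(1)] moll_approx[OF e(1) this(2)] U[OF e] show ?thesis by linarith
  qed
  then have ev: "\<forall>\<^sub>F \<epsilon> in at_right 0. \<bar>v (x, t) - v (x, s)\<bar> \<le> 2 * (C * (\<epsilon> powr \<alpha> + \<epsilon> powr (\<alpha> / 2)))"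
    unfolding eventually_at_right_field using st by auto
  have "((\<lambda>\<epsilon>. 2 * (C * (\<epsilon> powr \<alpha> + \<epsilon> powr (\<alpha> / 2)))) \<longlongrightarrow> 2 * (C * (0 + 0))) (at_right 0)"
    using \<alpha> by (intro tendsto_intros tendsto_zero_powrI[OF tendsto_ident_at tendsto_const]) (auto simp: eventually_at_right_field intro: exI[of _ 1])
  from tendsto_lowerbound[OF this ev] show ?thesis by simp
qed

theorem solution_constant:
  assumes "t > 0" "s > 0" shows "v (x, t) = v (y, s)"
proof -
  have "v (x, t) = v (x, s)"
    using constant_in_time[OF assms(2), of t x] constant_in_time[OF assms(1), of s x]
      assms by (metis linorder_neqE_linordered_idom)
  then show ?thesis using space_independent[OF assms(2), of x y] by simp
qed

end

section \<open>Sobolev solutions\<close>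

lemma borel_rep_subset:
  assumes "borel_rep X w w'" "Y \<subseteq> X" shows "borel_rep Y w w'"
  using assms unfolding borel_rep_def loc_int_def by (auto elim!: eventually_mono)

text \<open>The Sobolev condition provides a weak derivative in \<open>L^q\<close> on each smaller domain, a priori
  different for each of them. By uniqueness it agrees with the given global one.\<close>
lemma Lq_of_weak_deriv:
  fixes X :: "'a::euclidean_space set"
  assumes X: "open X" and q: "q > 0" and v: "borel_rep X v v'" and w: "has_weak_deriv X es v w" "borel_rep X w w'"
    and Y: "\<And>Y. open Y \<Longrightarrow> compact (closure Y) \<Longrightarrow> closure Y \<subseteq> X \<Longrightarrow> \<exists>u\<in>Lq q Y. has_weak_deriv Y es v u"
    and K: "compact K" "K \<subseteq> X"
  shows "integrable lborel (\<lambda>z. indicator K z * \<bar>w' z\<bar> powr q)"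
proof -
  obtain r K' where r: "r > 0" and K': "compact K'" "K' \<subseteq> X" "\<And>z. z \<in> K \<Longrightarrow> cball z r \<subseteq> K'"
    using compact_nhd[OF K(1) X K(2)] by blast
  define Y where "Y = interior K'"
  have Yo: "open Y" by (simp add: Y_def)
  have YK: "closure Y \<subseteq> K'"
    unfolding Y_def using K'(1) by (intro closure_minimal interior_subset compact_imp_closed)
  have Yc: "compact (closure Y)"
    using YK K'(1) by (meson bounded_subset closed_closure compact_eq_bounded_closed)
  have YX: "closure Y \<subseteq> X" "Y \<subseteq> X" using YK K'(2) closure_subset[of Y] by auto
  have KY: "K \<subseteq> Y"
  proof
    fix z assume "z \<in> K"
    then have "ball z r \<subseteq> K'" using K'(3)[of z] ball_subset_cball[of z r] by blast
    then show "z \<in> Y" unfolding Y_def using r by (intro interiorI[of "ball z r"]) auto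
  qed
  obtain u where u: "u \<in> Lq q Y" "has_weak_deriv Y es v u" using Y[OF Yo Yc YX(1)] by blast
  have "locally_integrable Y u" using u(2) by (simp add: has_weak_deriv_def)
  then obtain u' where u': "borel_rep Y u u'" using borel_rep_exists[OF Yo] by blast
  note vY = borel_rep_subset[OF v YX(2)] and wY = borel_rep_subset[OF w(2) YX(2)]
  have lw: "loc_int Y w'" and lu: "loc_int Y u'" using wY u' by (auto simp: borel_rep_def)
  have m [measurable]: "w' \<in> borel_measurable borel" "u' \<in> borel_measurable borel" using lw lu by (auto simp: loc_int_def)
  have "loc_int Y (\<lambda>z. w' z - u' z)"
    using lw lu unfolding loc_int_def by (auto simp: right_diff_distrib)
  then have ae: "AE z in lborel. z \<in> Y \<longrightarrow> w' z - u' z = 0"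
  proof (rule ae_zero_of_moll_zero[OF Yo])
    fix z \<epsilon> assume e: "0 < \<epsilon>" "cball z \<epsilon> \<subseteq> Y"
    have "(- 1) ^ length es * corr (moll \<epsilon>) w' z = corr (mollD \<epsilon> es) v' z"
      by (rule weak_deriv_corr[OF X w(1) v w(2) e(1), symmetric]) (use e YX in blast)
    also have "\<dots> = (- 1) ^ length es * corr (moll \<epsilon>) u' z"
      by (rule weak_deriv_corr[OF Yo u(2) vY u' e])
    finally have eq: "corr (moll \<epsilon>) w' z = corr (moll \<epsilon>) u' z" by simp
    have i: "integrable lborel (\<lambda>y. moll \<epsilon> y * w' (z + y))" "integrable lborel (\<lambda>y. moll \<epsilon> y * u' (z + y))"
      using mollD_mult_integrable[OF e(1) m(1) loc_int_cut(1)[OF lw _ e(2)], of "[]"]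
        mollD_mult_integrable[OF e(1) m(2) loc_int_cut(1)[OF lu _ e(2)], of "[]"] by (auto simp: mollD_Nil)
    show "corr (moll \<epsilon>) (\<lambda>z. w' z - u' z) z = 0"
      unfolding corr_def right_diff_distrib Bochner_Integration.integral_diff[OF i] using eq by (simp add: corr_def)
  qed
  have Yb [measurable]: "Y \<in> sets borel" "K \<in> sets borel" using Yo K by (auto intro: borel_compact)
  have aeu: "AE z in lebesgue. z \<in> Y \<longrightarrow> \<bar>u z\<bar> powr q = \<bar>u' z\<bar> powr q"
    using u' unfolding borel_rep_def by (auto elim!: eventually_mono)
  have um: "(\<lambda>z. \<bar>u' z\<bar> powr q) \<in> borel_measurable borel" by measurable
  have "integrable (lebesgue_on Y) (\<lambda>z. \<bar>u z\<bar> powr q)" using u(1) by (simp add: Lq_def)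
  then have i: "integrable lborel (\<lambda>z. indicator Y z * \<bar>u' z\<bar> powr q)"
    using integral_lebesgue_on_eq(2)[OF Yb(1) aeu um AE_eq_measurable[OF aeu Yb(1) um]] by simp
  show ?thesis
  proof (rule Bochner_Integration.integrable_bound[OF i])
    show "AE z in lborel. norm (indicator K z * \<bar>w' z\<bar> powr q) \<le> norm (indicator Y z * \<bar>u' z\<bar> powr q)"
      using ae by eventually_elim (use KY in \<open>auto simp: indicator_def\<close>)
  qed measurable
qed

lemma Lq_sum:
  fixes w :: "'i \<Rightarrow> 'a::euclidean_space \<Rightarrow> real"
  assumes q: "q \<ge> 1" and "finite I" and K: "K \<in> sets borel"
    and w: "\<And>i. i \<in> I \<Longrightarrow> w i \<in> borel_measurable borel" "\<And>i. i \<in> I \<Longrightarrow> integrable lborel (\<lambda>z. indicator K z * \<bar>w i z\<bar> powr q)"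
  shows "integrable lborel (\<lambda>z. indicator K z * \<bar>\<Sum>i\<in>I. w i z\<bar> powr q)"
  using assms(2) w
proof (induction I rule: finite_induct)
  case empty
  then show ?case using q by simp
next
  case (insert i I)
  have [measurable]: "w j \<in> borel_measurable borel" if "j \<in> insert i I" for j using insert.prems(1)[OF that] .
  have m: "(\<lambda>z. \<Sum>j\<in>I. w j z) \<in> borel_measurable borel" "w i \<in> borel_measurable borel"
    using insert.prems(1) by (auto intro!: borel_measurable_sum)
  note [measurable] = m K
  have IH: "integrable lborel (\<lambda>z. indicator K z * \<bar>\<Sum>i\<in>I. w i z\<bar> powr q)"
    by (rule insert.IH) (use insert.prems in auto)
  have b: "integrable lborel (\<lambda>z. 2 powr q * (indicator K z * \<bar>w i z\<bar> powr q) + 2 powr q * (indicator K z * \<bar>\<Sum>i\<in>I. w i z\<bar> powr q))"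
    using IH insert.prems(2)[of i] by auto
  show ?case
  proof (rule Bochner_Integration.integrable_bound[OF b])
    show "(\<lambda>z. indicator K z * \<bar>\<Sum>j\<in>insert i I. w j z\<bar> powr q) \<in> borel_measurable lborel"
      unfolding sum.insert[OF insert.hyps] by measurable
    show "AE z in lborel. norm (indicator K z * \<bar>\<Sum>j\<in>insert i I. w j z\<bar> powr q) \<le>
       norm (2 powr q * (indicator K z * \<bar>w i z\<bar> powr q) + 2 powr q * (indicator K z * \<bar>\<Sum>i\<in>I. w i z\<bar> powr q))"
    proof (rule AE_I2)
      fix z
      have "\<bar>w i z + (\<Sum>j\<in>I. w j z)\<bar> powr q \<le> (\<bar>w i z\<bar> + \<bar>\<Sum>j\<in>I. w j z\<bar>) powr q"
        using q by (intro powr_mono2) auto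
      also have "\<dots> \<le> 2 powr q * (\<bar>w i z\<bar> powr q + \<bar>\<Sum>j\<in>I. w j z\<bar> powr q)"
        using q by (intro powr_split_half) auto
      finally show "norm (indicator K z * \<bar>\<Sum>j\<in>insert i I. w j z\<bar> powr q) \<le>
       norm (2 powr q * (indicator K z * \<bar>w i z\<bar> powr q) + 2 powr q * (indicator K z * \<bar>\<Sum>i\<in>I. w i z\<bar> powr q))"
        unfolding sum.insert[OF insert.hyps] by (cases "z \<in> K") (auto simp: distrib_left)
    qed
  qed
qed

lemma corr_cmult: "corr \<kappa> (\<lambda>z. c * F z) z = c * corr \<kappa> F z"
  unfolding corr_def integral_mult_right_zero[symmetric] by (simp only: mult.left_commute)

lemma loc_int_cmult: "loc_int X F \<Longrightarrow> loc_int X (\<lambda>z. c * F z)"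
  unfolding loc_int_def by (auto simp: mult.left_commute[of _ c])

lemma Basis_vec_axis: "(Basis :: (real^'n) set) = range (\<lambda>i. axis i 1)"
  by (auto simp: Basis_vec_def)

lemma sum_Basis_vec: "(\<Sum>b\<in>(Basis :: (real^'n) set). x \<bullet> b) = (\<Sum>i\<in>UNIV. x $ i)"
proof -
  have "inj (\<lambda>i::'n. axis i (1::real))" by (auto simp: inj_def axis_eq_axis)
  then show ?thesis unfolding Basis_vec_axis by (subst sum.reindex) (auto simp: inner_axis)
qed

lemma half_spacetime_half: "half_spacetime = (half :: ((real^'n) \<times> real) set)"
  by (simp add: half_spacetime_def half_def)

theorem theorem4p1:
  fixes v :: "(real^'n) \<times> real \<Rightarrow> real"
    and \<gamma> q h \<alpha> :: real
  assumes "\<gamma> > 2"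
    and "q > (real CARD('n) + 2) * ((\<gamma> - 1) / \<gamma>)"
    and "h \<noteq> 0"
    and "v \<in> W21_loc q half_spacetime"
    and "continuous_on half_spacetime v"
    and "strong_HJ_solution half_spacetime h \<gamma> v"
    and "0 < \<alpha>" and "\<alpha> < 1"
    and "(SUP (z, z') \<in> {(z, z'). z \<in> half_spacetime \<and> z' \<in> half_spacetime \<and> z \<noteq> z'}.
            ereal (holder_quotient \<alpha> v z z')) < \<infinity>"
  shows "v constant_on half_spacetime"
proof -
  let ?H = "half :: ((real^'n) \<times> real) set"
  note oH = open_half[where 'a="real^'n"]
  have q': "q > (real DIM(real^'n) + 2) * ((\<gamma> - 1) / \<gamma>)" using assms(2) by simp
  have q1: "q > 1" by (rule subcritical_exponents(1)[OF assms(1) _ q']) (simp add: Suc_le_eq)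
  obtain vt :: "(real^'n) \<times> real \<Rightarrow> real" and Dv D2 :: "(real^'n) \<times> real \<Rightarrow> real^'n"
    where vt: "has_weak_deriv ?H [t_dir] v vt" and Dv: "\<And>i. has_weak_deriv ?H [x_dir i] v (\<lambda>z. Dv z $ i)"
      and D2: "\<And>i. has_weak_deriv ?H [x_dir i, x_dir i] v (\<lambda>z. D2 z $ i)"
      and ae: "AE z in lebesgue_on ?H. - vt z - (\<Sum>i\<in>UNIV. D2 z $ i) + h * norm (Dv z) powr \<gamma> = 0"
    using assms(6) unfolding strong_HJ_solution_def half_spacetime_half by blast
  have DvB: "has_weak_deriv ?H [(b, 0)] v (\<lambda>z. Dv z \<bullet> b)" and D2B: "has_weak_deriv ?H [(b, 0), (b, 0)] v (\<lambda>z. D2 z \<bullet> b)"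
    if b: "b \<in> Basis" for b
    using b Dv D2 by (auto simp: Basis_vec_axis x_dir_def inner_axis)
  \<comment> \<open>The values of \<open>v\<close> off the half-space are arbitrary and may even fail to be measurable.\<close>
  define v' where "v' z = indicator ?H z * v z" for z
  have cv: "continuous_on ?H v" using assms(5) by (simp add: half_spacetime_half)
  have v'm: "v' \<in> borel_measurable borel"
    using borel_measurable_continuous_on_indicator[OF borel_open[OF oH] cv] by (simp add: v'_def[abs_def])
  have rv: "borel_rep ?H v v'"
    unfolding borel_rep_def loc_int_def
  proof (intro conjI allI impI v'm)
    fix K assume K: "compact K \<and> K \<subseteq> ?H"
    have "integrable lborel (\<lambda>x. indicator K x *\<^sub>R v x)"
      using K cv by (intro borel_integrable_compact) (auto intro: continuous_on_subset)
    moreover have "indicator K x *\<^sub>R v x = indicator K x * v' x" for x using K by (auto simp: v'_def indicator_def)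
    ultimately show "integrable lborel (\<lambda>x. indicator K x * v' x)" by (simp only:)
  qed (auto simp: v'_def)
  have li: "locally_integrable X w" if "has_weak_deriv X es u w" for X :: "((real^'n) \<times> real) set" and es u w
    using that by (simp add: has_weak_deriv_def)
  obtain wt where wt: "borel_rep ?H vt wt" "\<And>z. z \<notin> ?H \<Longrightarrow> wt z = 0" using borel_rep_exists[OF oH li[OF vt]] by blast
  define wG where "wG b = (SOME w. borel_rep ?H (\<lambda>z. Dv z \<bullet> b) w \<and> (\<forall>z. z \<notin> ?H \<longrightarrow> w z = 0))" for b
  define wD where "wD b = (SOME w. borel_rep ?H (\<lambda>z. D2 z \<bullet> b) w \<and> (\<forall>z. z \<notin> ?H \<longrightarrow> w z = 0))" for b
  have wG: "borel_rep ?H (\<lambda>z. Dv z \<bullet> b) (wG b)" if "b \<in> Basis" for b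
    using someI_ex[OF borel_rep_exists[OF oH li[OF DvB[OF that]]]] unfolding wG_def by blast
  have wD: "borel_rep ?H (\<lambda>z. D2 z \<bullet> b) (wD b)" if "b \<in> Basis" for b
    using someI_ex[OF borel_rep_exists[OF oH li[OF D2B[OF that]]]] unfolding wD_def by blast
  have lrep: "loc_int X w'" if "borel_rep X w w'" for X :: "((real^'n) \<times> real) set" and w w' using that by (simp add: borel_rep_def)
  have eqL: "AE z in lebesgue. snd z > 0 \<longrightarrow> wt z + (\<Sum>b\<in>Basis. wD b z) = h * norm (\<Sum>b\<in>(Basis::(real^'n) set). wG b z *\<^sub>R b) powr \<gamma>"
  proof -
    have 1: "AE z in lebesgue. z \<in> ?H \<longrightarrow> - vt z - (\<Sum>i\<in>UNIV. D2 z $ i) + h * norm (Dv z) powr \<gamma> = 0"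
      using ae by (subst (asm) AE_restrict_space_iff) (auto simp: oH)
    have 2: "AE z in lebesgue. \<forall>b\<in>(Basis::(real^'n) set). z \<in> ?H \<longrightarrow> Dv z \<bullet> b = wG b z"
      using wG by (subst AE_ball_countable) (auto simp: countable_finite borel_rep_def)
    have 3: "AE z in lebesgue. \<forall>b\<in>(Basis::(real^'n) set). z \<in> ?H \<longrightarrow> D2 z \<bullet> b = wD b z"
      using wD by (subst AE_ball_countable) (auto simp: countable_finite borel_rep_def)
    have 4: "AE z in lebesgue. z \<in> ?H \<longrightarrow> vt z = wt z" using wt by (simp add: borel_rep_def)
    from 1 2 3 4 show ?thesis
    proof eventually_elim
      case (elim z)
      show ?case
      proof
        assume "0 < snd z"
        then have z: "z \<in> ?H" by (simp add: half_iff)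
        have "(\<Sum>b\<in>(Basis::(real^'n) set). wG b z *\<^sub>R b) = (\<Sum>b\<in>Basis. (Dv z \<bullet> b) *\<^sub>R b)"
          using elim(2) z by (intro sum.cong) auto
        also have "\<dots> = Dv z" by (rule euclidean_representation)
        finally have G: "(\<Sum>b\<in>(Basis::(real^'n) set). wG b z *\<^sub>R b) = Dv z" .
        have "(\<Sum>b\<in>(Basis::(real^'n) set). wD b z) = (\<Sum>b\<in>Basis. D2 z \<bullet> b)"
          using elim(3) z by (intro sum.cong) auto
        also have "\<dots> = (\<Sum>i\<in>UNIV. D2 z $ i)" by (rule sum_Basis_vec)
        finally have L: "(\<Sum>b\<in>(Basis::(real^'n) set). wD b z) = (\<Sum>i\<in>UNIV. D2 z $ i)" .
        show "wt z + (\<Sum>b\<in>Basis. wD b z) = h * norm (\<Sum>b\<in>(Basis::(real^'n) set). wG b z *\<^sub>R b) powr \<gamma>"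
          unfolding G L using elim(1,4) z by simp
      qed
    qed
  qed
  then have eq: "AE z in lborel. snd z > 0 \<longrightarrow> wt z + (\<Sum>b\<in>Basis. wD b z) = h * norm (\<Sum>b\<in>(Basis::(real^'n) set). wG b z *\<^sub>R b) powr \<gamma>"
    by (simp only: AE_completion_iff)
  have W: "\<exists>w\<in>Lq q Y. has_weak_deriv Y (replicate r t_dir @ map x_dir \<beta>) v w"
    if "open Y" "compact (closure Y)" "closure Y \<subseteq> ?H" "length \<beta> + 2 * r \<le> 2" for Y r and \<beta> :: "'n list"
    using assms(4) that unfolding W21_loc_def W21_def half_spacetime_half by blast
  have meas: "wt \<in> borel_measurable borel" "\<And>b. b \<in> Basis \<Longrightarrow> wG b \<in> borel_measurable borel" "\<And>b. b \<in> Basis \<Longrightarrow> wD b \<in> borel_measurable borel"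
    using lrep[OF wt(1)] lrep[OF wG] lrep[OF wD] by (auto simp: loc_int_def)
  \<comment> \<open>Here the Sobolev regularity is used: by the equation the power \<open>\<gamma>\<close> of the gradient
    is a combination of the time derivative and the Laplacian, both of which lie in \<open>L^q\<close>
    locally.\<close>
  have Lq: "integrable lborel (\<lambda>z. indicator K z * norm (\<Sum>b\<in>(Basis::(real^'n) set). wG b z *\<^sub>R b) powr (\<gamma> * q))"
    if K: "compact K" "K \<subseteq> ?H" for K
  proof -
    have Kb: "K \<in> sets borel" using K by (auto intro: borel_compact)
    have it: "integrable lborel (\<lambda>z. indicator K z * \<bar>wt z\<bar> powr q)"
      by (rule Lq_of_weak_deriv[OF oH _ rv vt wt(1) _ K]) (use q1 W[of _ "[]" 1] in auto)
    have iD: "integrable lborel (\<lambda>z. indicator K z * \<bar>wD b z\<bar> powr q)" if b: "b \<in> Basis" for b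
    proof -
      obtain i where i: "b = axis i 1" using b by (auto simp: Basis_vec_axis)
      show ?thesis
        by (rule Lq_of_weak_deriv[OF oH _ rv D2B[OF b] wD[OF b] _ K]) (use q1 W[of _ "[i, i]" 0] i in \<open>auto simp: x_dir_def\<close>)
    qed
    define ww where "ww c = (case c of None \<Rightarrow> wt | Some b \<Rightarrow> wD b)" for c :: "(real^'n) option"
    let ?I = "insert None (Some ` (Basis :: (real^'n) set))"
    have "integrable lborel (\<lambda>z. indicator K z * \<bar>\<Sum>c\<in>?I. ww c z\<bar> powr q)"
      by (rule Lq_sum) (use q1 Kb it iD meas in \<open>auto simp: ww_def\<close>)
    moreover have "(\<Sum>c\<in>?I. ww c z) = wt z + (\<Sum>b\<in>Basis. wD b z)" for z
      by (subst sum.insert) (auto simp: ww_def sum.reindex)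
    ultimately have i: "integrable lborel (\<lambda>z. (1 / \<bar>h\<bar> powr q) * (indicator K z * \<bar>wt z + (\<Sum>b\<in>Basis. wD b z)\<bar> powr q))"
      by (intro integrable_mult_right) simp
    have Gm: "(\<lambda>z. \<Sum>b\<in>(Basis::(real^'n) set). wG b z *\<^sub>R b) \<in> borel_measurable borel"
      using meas(2) by (intro borel_measurable_sum borel_measurable_scaleR) auto
    show ?thesis
    proof (rule integrable_cong_AE_imp[OF i])
      show "(\<lambda>z. indicator K z * norm (\<Sum>b\<in>(Basis::(real^'n) set). wG b z *\<^sub>R b) powr (\<gamma> * q)) \<in> borel_measurable lborel"
        using Gm Kb by measurable
      show "AE z in lborel. (1 / \<bar>h\<bar> powr q) * (indicator K z * \<bar>wt z + (\<Sum>b\<in>Basis. wD b z)\<bar> powr q) =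
         indicator K z * norm (\<Sum>b\<in>(Basis::(real^'n) set). wG b z *\<^sub>R b) powr (\<gamma> * q)"
        using eq
      proof eventually_elim
        case (elim z)
        show ?case
        proof (cases "z \<in> K")
          case True
          then have "snd z > 0" using K(2) half_iff by blast
          then have "wt z + (\<Sum>b\<in>Basis. wD b z) = h * norm (\<Sum>b\<in>(Basis::(real^'n) set). wG b z *\<^sub>R b) powr \<gamma>" using elim by simp
          then have "\<bar>wt z + (\<Sum>b\<in>Basis. wD b z)\<bar> powr q = \<bar>h\<bar> powr q * norm (\<Sum>b\<in>(Basis::(real^'n) set). wG b z *\<^sub>R b) powr (\<gamma> * q)"
            by (simp add: abs_mult powr_mult powr_powr)
          then show ?thesis using True assms(3) by simp
        qed simp
      qed
    qed
  qed
  obtain C0 where C0: "(SUP (z, z') \<in> {(z, z'). z \<in> ?H \<and> z' \<in> ?H \<and> z \<noteq> z'}. ereal (holder_quotient \<alpha> v z z')) < ereal C0"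
    using ereal_dense2[OF assms(9)[unfolded half_spacetime_half]] by blast
  define C where "C = max C0 0"
  have C: "C \<ge> 0" by (simp add: C_def)
  have hol: "\<bar>v (x, t) - v (x', t')\<bar> \<le> C * (norm (x - x') powr \<alpha> + \<bar>t - t'\<bar> powr (\<alpha> / 2))" if t: "t > 0" "t' > 0" for x x' t t'
  proof (cases "(x, t) = (x', t')")
    case True then show ?thesis using C by simp
  next
    case False
    let ?d = "norm (x - x') powr \<alpha> + \<bar>t - t'\<bar> powr (\<alpha> / 2)"
    have d: "?d > 0"
    proof (cases "x = x'")
      case True
      then have "\<bar>t - t'\<bar> powr (\<alpha> / 2) > 0" using False by simp
      then show ?thesis by (simp add: add_nonneg_pos)
    next
      case F: False
      then have "norm (x - x') powr \<alpha> > 0" by simp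
      then show ?thesis by (simp add: add_pos_nonneg)
    qed
    have "((x, t), (x', t')) \<in> {(z, z'). z \<in> ?H \<and> z' \<in> ?H \<and> z \<noteq> z'}" using t False by (simp add: half_iff)
    from SUP_upper[OF this, of "\<lambda>(z, z'). ereal (holder_quotient \<alpha> v z z')"]
    have "ereal (holder_quotient \<alpha> v (x, t) (x', t')) \<le> (SUP (z, z') \<in> {(z, z'). z \<in> ?H \<and> z' \<in> ?H \<and> z \<noteq> z'}. ereal (holder_quotient \<alpha> v z z'))"
      by (simp only: prod.case)
    then have "ereal (holder_quotient \<alpha> v (x, t) (x', t')) < ereal C0" using C0 by (rule le_less_trans)
    then have "\<bar>v (x, t) - v (x', t')\<bar> / ?d \<le> C" by (simp add: holder_quotient_def C_def)
    then show ?thesis using d by (simp add: divide_le_eq)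
  qed
  \<comment> \<open>If \<open>h\<close> is negative, \<open>- v\<close> solves the equation with \<open>- h\<close> in place
    of \<open>h\<close>.\<close>
  define s where "s = sgn h"
  have s: "\<bar>s\<bar> = 1" "s * h = \<bar>h\<bar>" "s \<noteq> 0" using assms(3) by (auto simp: s_def sgn_if)
  have norm_s: "norm (\<Sum>b\<in>(Basis::(real^'n) set). (s * wG b z) *\<^sub>R b) = norm (\<Sum>b\<in>(Basis::(real^'n) set). wG b z *\<^sub>R b)" for z
  proof -
    have "(\<Sum>b\<in>(Basis::(real^'n) set). (s * wG b z) *\<^sub>R b) = s *\<^sub>R (\<Sum>b\<in>(Basis::(real^'n) set). wG b z *\<^sub>R b)"
      by (simp add: scaleR_sum_right)
    then show ?thesis using s(1) by simp
  qed
  note wc = weak_deriv_corr[OF oH _ rv]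
  interpret HJ_solution "\<lambda>z. s * v' z" "\<lambda>z. s * wt z" "\<lambda>b z. s * wG b z" "\<lambda>b z. s * wD b z" "\<bar>h\<bar>" \<gamma> q \<alpha> C
  proof
    show "0 < \<bar>h\<bar>" using assms(3) by simp
    show "2 < \<gamma>" "(real DIM(real^'n) + 2) * ((\<gamma> - 1) / \<gamma>) < q" "0 < \<alpha>" "\<alpha> < 1" "0 \<le> C" using assms q' C by auto
    show "loc_int half (\<lambda>z. s * v' z)" "loc_int half (\<lambda>z. s * wt z)"
      by (intro loc_int_cmult lrep[OF rv] lrep[OF wt(1)])+
    show "loc_int half (\<lambda>z. s * wG b z)" "loc_int half (\<lambda>z. s * wD b z)" if "b \<in> Basis" for b
      by (intro loc_int_cmult lrep[OF wG[OF that]] lrep[OF wD[OF that]])+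
    show "corr (mollD \<epsilon> [(0, 1)]) (\<lambda>z. s * v' z) z = - corr (moll \<epsilon>) (\<lambda>z. s * wt z) z" if "0 < \<epsilon>" "\<epsilon> < snd z" for z \<epsilon>
      using wc[OF vt wt(1) that(1) cball_subset_half[OF that(2)]] by (simp add: corr_cmult t_dir_def)
    show "corr (mollD \<epsilon> [(b, 0)]) (\<lambda>z. s * v' z) z = - corr (moll \<epsilon>) (\<lambda>z. s * wG b z) z"
      "corr (mollD \<epsilon> [(b, 0), (b, 0)]) (\<lambda>z. s * v' z) z = corr (moll \<epsilon>) (\<lambda>z. s * wD b z) z"
      if "0 < \<epsilon>" "\<epsilon> < snd z" "b \<in> Basis" for z \<epsilon> b
      using wc[OF DvB[OF that(3)] wG[OF that(3)] that(1) cball_subset_half[OF that(2)]]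
        wc[OF D2B[OF that(3)] wD[OF that(3)] that(1) cball_subset_half[OF that(2)]] by (simp_all add: corr_cmult)
    show "AE z in lborel. 0 < snd z \<longrightarrow> s * wt z + (\<Sum>b\<in>Basis. s * wD b z) = \<bar>h\<bar> * norm (\<Sum>b\<in>(Basis::(real^'n) set). (s * wG b z) *\<^sub>R b) powr \<gamma>"
      using eq
    proof eventually_elim
      case (elim z)
      show ?case
      proof
        assume "0 < snd z"
        with elim have "s * (wt z + (\<Sum>b\<in>Basis. wD b z)) = s * (h * norm (\<Sum>b\<in>(Basis::(real^'n) set). wG b z *\<^sub>R b) powr \<gamma>)" by simp
        then show "s * wt z + (\<Sum>b\<in>Basis. s * wD b z) = \<bar>h\<bar> * norm (\<Sum>b\<in>(Basis::(real^'n) set). (s * wG b z) *\<^sub>R b) powr \<gamma>"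
          unfolding norm_s s(2)[symmetric] by (simp only: distrib_left sum_distrib_left mult.assoc)
      qed
    qed
    show "integrable lborel (\<lambda>z. indicator K z * norm (\<Sum>b\<in>(Basis::(real^'n) set). (s * wG b z) *\<^sub>R b) powr (\<gamma> * q))"
      if "compact K" "K \<subseteq> half" for K
      unfolding norm_s by (rule Lq[OF that])
    show "\<bar>s * v' (x, t) - s * v' (x', t')\<bar> \<le> C * (norm (x - x') powr \<alpha> + \<bar>t - t'\<bar> powr (\<alpha> / 2))" if "t > 0" "t' > 0" for x t x' t'
      using hol[OF that, of x x'] that s(1) by (simp add: v'_def half_iff right_diff_distrib[symmetric] abs_mult)
  qed
  show ?thesis
    unfolding constant_on_def half_spacetime_half
  proof (intro exI[of _ "v (0, 1)"] ballI)
    fix z assume "z \<in> ?H"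
    then have z: "snd z > 0" by (simp add: half_iff)
    have "s * v' (fst z, snd z) = s * v' (0, 1)" by (rule solution_constant[OF z]) simp
    then show "v z = v (0, 1)" using z s(3) by (simp add: v'_def half_iff)
  qed
qed

end
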